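(* In the setting and under the standing assumptions of the context, let $\bar P=(\bar P_{i'}^{ij})\in\mathbb R^{m_u}\otimes(\mathbb R^{m_s})^{\otimes2}$ be positive, and let $\{\mu_k\}_{k=1}^{N_\mu}=\{\gamma_k\}_{k=0}^{m_s}\cup\{\gamma_{k_1}+\gamma_{k_2}\}_{k_1,k_2=0}^{m_s}$. Assume that $K=(K_{j,k}^{il})$ ($i,j,l\in I$, $1\le k\le N_\mu$) satisfies $$\left\|\tfrac{\partial}{\partial\xi_i}x_j(t,\eta,\alpha)-\tfrac{\partial}{\partial\xi_i}x_j(t,\zeta,\alpha)\right\|\le\sum_{k=1}^{N_\mu}e^{\mu_kt}K_{j,k}^{il}|\eta_l-\zeta_l|$$ for all $t\ge0$, $\alpha\in\mathcal B^{1,1}_{\rho,P,\bar P}$, $\eta,\zeta\in B_s(\rho)$, $i,j\in I$. Define $$\tilde P_{j'}^{il}:=\sum_{0\le k_1,k_2\le m_s}(\lambda_{j'}-\gamma_{k_1}-\gamma_{k_2})^{-1}S_{j'}^{nm}G_{m,k_1}^lG_{n,k_2}^i+\sum_{1\le k\le N_\mu}(\lambda_{j'}-\mu_k)^{-1}H_{j'}^nK_{n,k}^{il}.$$ Then for all $\alpha\in\mathcal B^{1,1}_{\rho,P,\bar P}$ we have $\mathrm{Lip}(\partial_i\Psi[\alpha])_{j'}^l\le\tilde P_{j'}^{il}$. If $\tilde P_{j'}^{il}\le\bar P_{j'}^{il}$ for all $i,l\in I$, $j'\in I'$, then $\Psi:\mathcal B^{1,1}_{\rho,P,\bar P}\to\mathcal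 B^{1,1}_{\rho,P,\bar P}$ is well defined.
   Context: Setting. $X$ is a Banach space with norm $|\cdot|$; $\dot{\mathrm x}=\tilde\Lambda\mathrm x+\tilde{\mathcal N}(\mathrm x)$ with $\tilde\Lambda$ a densely defined linear operator on $X$ with bounded inverse, $\tilde{\mathcal N}\in C^2_{\mathrm{loc}}(X,X)$, and $\tilde h\in X$ a hyperbolic equilibrium. Put $\Lambda=\tilde\Lambda$, $L=D\tilde{\mathcal N}(\tilde h)$, $\hat{\mathcal N}(\mathrm x)=\tilde{\mathcal N}(\tilde h+\mathrm x)-\tilde{\mathcal N}(\tilde h)-D\tilde{\mathcal N}(\tilde h)\mathrm x$. The change of variables $\mathrm x\to\mathrm x+\tilde h$ gives $\dot{\mathrm x}=\Lambda\mathrm x+L\mathrm x+\hat{\mathcal N}(\mathrm x)$, with $\hat{\mathcal N}(0)=0$, $D\hat{\mathcal N}(0)=0$. Indices: $I=\{1,\dots,m_s\}$, $I'=\{1',\dots,m_u'\}$, $\mathbf I=I\cup I'$. Unprimed letters range over $I$, primed over $I'$, bold over $\mathbf I$. Repeated unprimed (primed) indices in a product are summed over $I$ ($I'$). $X=X_s\times X_u$ is the splitting into stable and unstable eigenspaces of $\Lambda$, with $X_s=\prod_{i\in I}X_i$, $X_u=\prod_{i'\in I'}X_{i'}$, all closed subspaces; $\pi_{\mathbf i},\pi_s,\pi_u$ are the projections, $\mathrm x_{\mathbf i}=\pi_{\mathbf i}\mathrm x$, etc., and $\|\pi_{\mathbf i}\|\le p_{\mathbf i}<\infty$. $\Lambda$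 maps each $X_{\mathbf i}$ into itself (restriction $\Lambda_{\mathbf i}$; $\Lambda_s,\Lambda_u$ are the restrictions to $X_s,X_u$), and there are $\lambda_i<0<\lambda_{i'}$ with $|e^{\Lambda_it}\mathrm x_i|\le e^{\lambda_it}|\mathrm x_i|$ for $t\ge0$ and $|e^{\Lambda_{i'}t}\mathrm x_{i'}|\le e^{\lambda_{i'}t}|\mathrm x_{i'}|$ for $t\le0$. $L_{\mathbf i}^{\mathbf j}=\pi_{\mathbf i}L|_{X_{\mathbf j}}$, $L_s^s=\pi_sL|_{X_s}$, $L_s^u=\pi_sL|_{X_u}$, $L_u^u=\pi_uL|_{X_u}$. There are constants $C_s,C_u$, $\lambda_s<0<\lambda_u$ with $|e^{(\Lambda_s+L_s^s)t}\mathrm x_s|\le C_se^{\lambda_st}|\mathrm x_s|$ for $t\ge0$ and $|e^{(\Lambda_u+L_u^u)t}\mathrm x_u|\le C_ue^{\lambda_ut}|\mathrm x_u|$ for $t\le0$. $\mathcal N(\mathrm x)=L\mathrm x+\hat{\mathcal N}(\mathrm x)$, $\mathcal N_{\mathbf i}=\pi_{\mathbf i}\mathcal N$, $\mathcal N_s=\pi_s\mathcal N$, $\mathcal N_u=\pi_u\mathcal N$ (similarly for $\hat{\mathcal N}$), viewed as functions of $(\mathrm x_s,\mathrm x_u)$; $\mathcal N_{\mathbf j}^{\mathbf i}=\partial\mathcal N_{\mathbf j}/\partial\mathrm x_{\mathbf i}$, $\mathcal N_{\mathbf j}^{\mathbf i\mathbf k}=\partial^2\mathcal N_{\mathbf j}/\partial\mathrm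 x_{\mathbf i}\partial\mathrm x_{\mathbf k}$. Charts. Fix positive $\rho\in\mathbb R^{m_s}$ and $P=(P_{i'}^i)$. $B_s(\rho)=\{\mathrm x_s\in X_s:|\mathrm x_i|\le\rho_i,\ i\in I\}$. For $\alpha:B_s(\rho)\to X_u$, $\mathrm{Lip}(\alpha)_{i'}^i=\sup|\alpha_{i'}(\xi+\zeta_i)-\alpha_{i'}(\xi)|/|\zeta_i|$ over $\xi,\xi+\zeta_i\in B_s(\rho)$, $0\ne\zeta_i\in X_i$; $\mathrm{Lip}(\partial_i\alpha)_{i'}^j$ is defined in the same way for $\partial_i\alpha=\partial\alpha/\partial\mathrm x_i$. $\mathcal B^{0,1}_{\rho,P}$ is the set of Lipschitz $\alpha:B_s(\rho)\to X_u$ with $\alpha(0)=0$, $\mathrm{Lip}(\alpha)_{i'}^i\le P_{i'}^i$; $\mathcal B^{1,1}_{\rho,P,\bar P}$ is the set of continuously differentiable $\alpha$ with Lipschitz derivative, $\alpha(0)=0$, $\mathrm{Lip}(\alpha)_{i'}^i\le P_{i'}^i$, $\mathrm{Lip}(\partial_i\alpha)_{i'}^j\le\bar P_{i'}^{ij}$. Let $r_{i'}=P_{i'}^i\rho_i$ and $B_u(r_u)=\{\mathrm x_u:|\mathrm x_{i'}|\le r_{i'}\}$. Nonnegative constants are fixed with $\|\mathcal N_{\mathbf j}^{\mathbf i}\|\le C_{\mathbf j}^{\mathbf i}$, $\|\mathcal N_{\mathbf j}^{\mathbf i\mathbf k}\|\le C_{\mathbf j}^{\mathbf i\mathbf k}$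 on $B_s(\rho)\times B_u(r_u)$. Put $H_{\mathbf j}^i=C_{\mathbf j}^i+C_{\mathbf j}^{i'}P_{i'}^i$, $S_{\mathbf j}^{nm}=(C_{\mathbf j}^{nm}+C_{\mathbf j}^{nm'}P_{m'}^m)+C_{\mathbf j}^{n'}\bar P_{n'}^{nm}+(C_{\mathbf j}^{n'm}+C_{\mathbf j}^{n'm'}P_{m'}^m)P_{n'}^n$, and $\hat{\mathcal H}=\sup_{\alpha\in\mathcal B^{0,1}_{\rho,P}}\sup_{\mathrm x_s\in B_s(\rho)}\|\tfrac{\partial}{\partial\mathrm x_s}(L_s^u\alpha(\mathrm x_s)+\hat{\mathcal N}_s(\mathrm x_s,\alpha(\mathrm x_s)))\|$ (for nondifferentiable $\alpha$ the inner supremum is read as the Lipschitz constant on $B_s(\rho)$). For $\alpha\in\mathcal B^{0,1}_{\rho,P}$ and $\xi\in B_s(\rho)$, $x(t,\xi,\alpha)$ is the solution of $\dot{\mathrm x}_s=\Lambda_s\mathrm x_s+\mathcal N_s(\mathrm x_s,\alpha(\mathrm x_s))$ with $x(0,\xi,\alpha)=\xi$, and $x_j=\pi_jx$. Rates and tensor $G$. $\gamma_0=\lambda_s+C_s\hat{\mathcal H}$, $\gamma_k=\lambda_k+H_k^k$ (no sum) for $1\le k\le m_s$; assume $\gamma_0>\gamma_1>\dots>\gamma_{m_s}$ and $\gamma_0<0$. For tensors $G=(G_{i,k}^n)$, $i,n\in I$, $0\le k\le m_s$, and $j\in I$ define: $[\mathcal Q_j(G)]_{i,k}^n=0$ if $k=j$;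 $G_{i,k}^n+G_{i,j}^n$ if $k=j-1$ and $G_{i,j}^n>0$, or $k=j+1$ and $G_{i,j}^n<0$; $G_{i,k}^n$ otherwise. And $[\mathcal T_j(G)]_k^n=\sum_{i\ne j}(\gamma_k-\gamma_j)^{-1}H_j^iG_{i,k}^n$ if $k\ne j$, $[\mathcal T_j(G)]_j^n=\delta_j^n-\sum_{i\ne j}\sum_{0\le m\le m_s,m\ne j}(\gamma_m-\gamma_j)^{-1}H_j^iG_{i,m}^n$. Bootstrap algorithm: start with $G_{j,0}^n=p_jC_s$, $G_{j,k}^n=0$ for $k\ne0$; repeat $N_{\mathrm{bootstrap}}$ times: for $j=1,\dots,m_s$ in order, replace $G_{j,k}^n$ by $[\mathcal T_j(\mathcal Q_j(G))]_k^n$ for all $k,n$. $G$ is the output of this algorithm with some $N_{\mathrm{bootstrap}}\ge1$. Assume $\rho_j\ge\sum_{n\in I,\,0\le k\le m_s}e^{\gamma_kt}G_{j,k}^n\rho_n$ for all $t\ge0$, $j\in I$. Then all solutions $x(t,\xi,\alpha)$ stay in $B_s(\rho)$ and $|x_j(t,\xi,\alpha)-x_j(t,\zeta,\alpha)|\le\sum_{n,k}e^{\gamma_kt}G_{j,k}^n|\xi_n-\zeta_n|$ for all $t\ge0$. Lyapunov–Perron operator: $\Psi[\alpha](\xi)=-\int_0^\infty e^{-\Lambda_ut}\mathcal N_u(x(t,\xi,\alpha),\alpha(x(t,\xi,\alpha)))\,dt$. Assume $\Psi$ maps $\mathcal B^{0,1}_{\rho,P}$ into itself. *)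

theory Defs
  imports "HOL-Analysis.Analysis"
begin

section \<open>Unbounded operators, semigroups and operator norms on subspaces\<close>

text \<open>An unbounded operator is a function \<open>A\<close> together with a domain \<open>D\<close>; values of \<open>A\<close> outside
  \<open>D\<close> are irrelevant. Semigroups live on a closed subspace \<open>Y\<close> of the ambient space, and only their
  values at times \<open>t \<ge> 0\<close> and points of \<open>Y\<close> matter.\<close>

definition linear_on_dom :: "'a::real_vector set \<Rightarrow> ('a \<Rightarrow> 'a) \<Rightarrow> bool" where
  "linear_on_dom D A \<longleftrightarrow> subspace D \<and>
     (\<forall>x\<in>D. \<forall>y\<in>D. A (x + y) = A x + A y) \<and> (\<forall>c. \<forall>x\<in>D. A (c *\<^sub>R x) = c *\<^sub>R A x)"

definition has_bounded_inverse :: "'a::real_normed_vector set \<Rightarrow> ('a \<Rightarrow> 'b::real_normed_vector) \<Rightarrow> bool" where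
  "has_bounded_inverse D A \<longleftrightarrow> bij_betw A D UNIV \<and> (\<exists>B. \<forall>x\<in>D. norm x \<le> B * norm (A x))"

text \<open>No spectrum on the imaginary axis: for every real \<open>\<omega>\<close> the operator \<open>A - \<i> \<omega>\<close> on the
  complexification has a bounded inverse, written in real and imaginary parts of \<open>x + \<i> y\<close>.\<close>

definition hyperbolic_operator :: "'a::real_normed_vector set \<Rightarrow> ('a \<Rightarrow> 'a) \<Rightarrow> bool" where
  "hyperbolic_operator D A \<longleftrightarrow>
     (\<forall>\<omega>::real. has_bounded_inverse (D \<times> D) (\<lambda>(x, y). (A x + \<omega> *\<^sub>R y, A y - \<omega> *\<^sub>R x)))"

definition C0_semigroup_on :: "'a::real_normed_vector set \<Rightarrow> (real \<Rightarrow> 'a \<Rightarrow> 'a) \<Rightarrow> bool" where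
  "C0_semigroup_on Y T \<longleftrightarrow>
     (\<forall>t\<ge>0. (\<forall>x\<in>Y. T t x \<in> Y) \<and> (\<forall>x\<in>Y. \<forall>y\<in>Y. T t (x + y) = T t x + T t y) \<and>
            (\<forall>c. \<forall>x\<in>Y. T t (c *\<^sub>R x) = c *\<^sub>R T t x) \<and> (\<exists>B. \<forall>x\<in>Y. norm (T t x) \<le> B * norm x)) \<and>
     (\<forall>x\<in>Y. T 0 x = x) \<and>
     (\<forall>s\<ge>0. \<forall>t\<ge>0. \<forall>x\<in>Y. T (s + t) x = T s (T t x)) \<and>
     (\<forall>x\<in>Y. continuous_on {0..} (\<lambda>t. T t x))"

definition generates :: "'a::real_normed_vector set \<Rightarrow> 'a set \<Rightarrow> ('a \<Rightarrow> 'a) \<Rightarrow> (real \<Rightarrow> 'a \<Rightarrow> 'a) \<Rightarrow> bool" where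
  "generates Y D A T \<longleftrightarrow> D \<subseteq> Y \<and> C0_semigroup_on Y T \<and>
     (\<forall>x\<in>Y. \<forall>y. ((\<lambda>h. (T h x - x) /\<^sub>R h) \<longlongrightarrow> y) (at_right 0) \<longleftrightarrow> x \<in> D \<and> A x = y)"

definition generator_on :: "'a::real_normed_vector set \<Rightarrow> 'a set \<Rightarrow> ('a \<Rightarrow> 'a) \<Rightarrow> bool" where
  "generator_on Y D A \<longleftrightarrow> (\<exists>T. generates Y D A T)"

text \<open>\<open>op_exp Y D A t\<close> is \<open>e\<^bsup>A t\<^esup>\<close> on \<open>Y\<close> for \<open>t \<ge> 0\<close>; a semigroup is determined by its generator.
  For an operator \<open>A\<close> generating backwards in time, \<open>e\<^bsup>A t\<^esup>\<close> with \<open>t \<le> 0\<close> is rendered as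
  \<open>op_exp Y D (- A) (- t)\<close>.\<close>

definition op_exp :: "'a::real_normed_vector set \<Rightarrow> 'a set \<Rightarrow> ('a \<Rightarrow> 'a) \<Rightarrow> real \<Rightarrow> 'a \<Rightarrow> 'a" where
  "op_exp Y D A = (SOME T. generates Y D A T)"

text \<open>Suprema of nonnegative quantities are taken in \<open>ereal\<close>, so that they are meaningful when
  infinite. Since \<open>0 / 0 = 0\<close>, the norm of an operator on the zero space is \<open>0\<close>.\<close>

definition op_norm_on :: "'a::real_normed_vector set \<Rightarrow> ('a \<Rightarrow> 'b::real_normed_vector) \<Rightarrow> ereal" where
  "op_norm_on Y f = (SUP v\<in>Y. ereal (norm (f v) / norm v))"

definition bilin_norm_on ::
  "'a::real_normed_vector set \<Rightarrow> 'a set \<Rightarrow> ('a \<Rightarrow> 'a \<Rightarrow> 'b::real_normed_vector) \<Rightarrow> ereal" where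
  "bilin_norm_on Y Z f = (SUP v\<in>Y. SUP w\<in>Z. ereal (norm (f v w) / (norm v * norm w)))"

definition lip_const :: "'a::real_normed_vector set \<Rightarrow> ('a \<Rightarrow> 'b::real_normed_vector) \<Rightarrow> ereal" where
  "lip_const S f = (SUP x\<in>S. SUP y\<in>S. ereal (norm (f x - f y) / norm (x - y)))"

definition Fderiv :: "('a::real_normed_vector \<Rightarrow> 'b::real_normed_vector) \<Rightarrow> 'a \<Rightarrow> 'a \<Rightarrow>\<^sub>L 'b" where
  "Fderiv f x = Blinfun (frechet_derivative f (at x))"

definition C2_map :: "('a::real_normed_vector \<Rightarrow> 'b::real_normed_vector) \<Rightarrow> bool" where
  "C2_map f \<longleftrightarrow> (\<forall>x. f differentiable (at x)) \<and> (\<forall>x. Fderiv f differentiable (at x)) \<and>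
     continuous_on UNIV (Fderiv (Fderiv f))"


section \<open>Data\<close>

text \<open>Indices: \<open>St i\<close> with \<open>1 \<le> i \<le> m\<^sub>s\<close> are the unprimed ones, \<open>Ust i\<close> with \<open>1 \<le> i \<le> m\<^sub>u\<close> the primed
  ones. The lower index of a tensor comes first, e.g. \<open>P\<^bsub>i'\<^esub>\<^bsup>i\<^esup>\<close> is \<open>Pt M i' i\<close>,
  \<open>C\<^bsub>j\<^esub>\<^bsup>i k\<^esup>\<close> is \<open>Cbd2 M j i k\<close> and \<open>G\<^bsub>i,k\<^esub>\<^bsup>n\<^esup>\<close> is \<open>G i k n\<close>.\<close>

datatype ix = St nat | Ust nat

record (overloaded) ('a::banach) lp_data =
  dom_Lam :: "'a set"
  Lam     :: "'a \<Rightarrow> 'a"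
  Ntilde  :: "'a \<Rightarrow> 'a"
  htilde  :: 'a
  mS      :: nat
  mU      :: nat
  proj    :: "ix \<Rightarrow> 'a \<Rightarrow>\<^sub>L 'a"
  pbd     :: "ix \<Rightarrow> real"           \<comment> \<open>\<open>p\<^sub>i\<close>\<close>
  rate    :: "ix \<Rightarrow> real"           \<comment> \<open>\<open>\<lambda>\<^sub>i\<close>\<close>
  Cs      :: real
  Cu      :: real
  lam_s   :: real
  lam_u   :: real
  rho     :: "nat \<Rightarrow> real"
  Pt      :: "nat \<Rightarrow> nat \<Rightarrow> real"
  Cbd1    :: "ix \<Rightarrow> ix \<Rightarrow> real"
  Cbd2    :: "ix \<Rightarrow> ix \<Rightarrow> ix \<Rightarrow> real"

definition IS :: "'a::banach lp_data \<Rightarrow> nat set" where "IS M = {1..mS M}"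
definition IU :: "'a::banach lp_data \<Rightarrow> nat set" where "IU M = {1..mU M}"
definition IX :: "'a::banach lp_data \<Rightarrow> ix set" where "IX M = St ` IS M \<union> Ust ` IU M"

definition pi_s :: "'a::banach lp_data \<Rightarrow> 'a \<Rightarrow>\<^sub>L 'a" where "pi_s M = (\<Sum>i\<in>IS M. proj M (St i))"
definition pi_u :: "'a::banach lp_data \<Rightarrow> 'a \<Rightarrow>\<^sub>L 'a" where "pi_u M = (\<Sum>i\<in>IU M. proj M (Ust i))"

definition Xi :: "'a::banach lp_data \<Rightarrow> ix \<Rightarrow> 'a set" where "Xi M i = range (blinfun_apply (proj M i))"
definition Xs :: "'a::banach lp_data \<Rightarrow> 'a set" where "Xs M = range (blinfun_apply (pi_s M))"
definition Xu :: "'a::banach lp_data \<Rightarrow> 'a set" where "Xu M = range (blinfun_apply (pi_u M))"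

text \<open>The pair \<open>(x\<^sub>s, x\<^sub>u)\<close> is identified with \<open>x\<^sub>s + x\<^sub>u\<close>.\<close>

definition Lop :: "'a::banach lp_data \<Rightarrow> 'a \<Rightarrow>\<^sub>L 'a" where
  "Lop M = Fderiv (Ntilde M) (htilde M)"

definition Nhat :: "'a::banach lp_data \<Rightarrow> 'a \<Rightarrow> 'a" where
  "Nhat M x = Ntilde M (htilde M + x) - Ntilde M (htilde M) - Lop M x"

definition Nfull :: "'a::banach lp_data \<Rightarrow> 'a \<Rightarrow> 'a" where
  "Nfull M x = Lop M x + Nhat M x"

definition Bs :: "'a::banach lp_data \<Rightarrow> 'a set" where
  "Bs M = {x \<in> Xs M. \<forall>i\<in>IS M. norm (proj M (St i) x) \<le> rho M i}"

definition r_u :: "'a::banach lp_data \<Rightarrow> nat \<Rightarrow> real" where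
  "r_u M i' = (\<Sum>i\<in>IS M. Pt M i' i * rho M i)"

definition Bu :: "'a::banach lp_data \<Rightarrow> 'a set" where
  "Bu M = {x \<in> Xu M. \<forall>i'\<in>IU M. norm (proj M (Ust i') x) \<le> r_u M i'}"


section \<open>Charts\<close>

text \<open>Charts are functions on the whole space of which only the restriction to \<open>Bs M\<close> matters.
  Likewise the derivative below is relative to \<open>Bs M\<close>: it is determined only on \<open>Xs M\<close>, and its
  restriction to \<open>Xi M (St i)\<close> is the partial derivative with respect to \<open>x\<^sub>i\<close>.\<close>

definition Lip :: "'a::banach lp_data \<Rightarrow> ('a \<Rightarrow> 'a) \<Rightarrow> nat \<Rightarrow> nat \<Rightarrow> ereal" where
  "Lip M \<alpha> i' i =
     (SUP (\<xi>, \<zeta>) \<in> {(\<xi>, \<zeta>). \<xi> \<in> Bs M \<and> \<zeta> \<in> Xi M (St i) \<and> \<zeta> \<noteq> 0 \<and> \<xi> + \<zeta> \<in> Bs M}.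
        ereal (norm (proj M (Ust i') (\<alpha> (\<xi> + \<zeta>)) - proj M (Ust i') (\<alpha> \<xi>)) / norm \<zeta>))"

definition DBs :: "'a::banach lp_data \<Rightarrow> ('a \<Rightarrow> 'a) \<Rightarrow> 'a \<Rightarrow> 'a \<Rightarrow> 'a" where
  "DBs M f \<xi> = frechet_derivative f (at \<xi> within Bs M)"

text \<open>\<open>LipD M \<alpha> i' i l\<close> is \<open>Lip(\<partial>\<^sub>i \<alpha>)\<^bsub>i'\<^esub>\<^bsup>l\<^esup>\<close>.\<close>

definition LipD :: "'a::banach lp_data \<Rightarrow> ('a \<Rightarrow> 'a) \<Rightarrow> nat \<Rightarrow> nat \<Rightarrow> nat \<Rightarrow> ereal" where
  "LipD M \<alpha> i' i l =
     (SUP (\<xi>, \<zeta>) \<in> {(\<xi>, \<zeta>). \<xi> \<in> Bs M \<and> \<zeta> \<in> Xi M (St l) \<and> \<zeta> \<noteq> 0 \<and> \<xi> + \<zeta> \<in> Bs M}.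
        op_norm_on (Xi M (St i))
          (\<lambda>v. proj M (Ust i') (DBs M \<alpha> (\<xi> + \<zeta>) v) - proj M (Ust i') (DBs M \<alpha> \<xi> v)) / ereal (norm \<zeta>))"

definition B01 :: "'a::banach lp_data \<Rightarrow> ('a \<Rightarrow> 'a) set" where
  "B01 M = {\<alpha>. \<alpha> ` Bs M \<subseteq> Xu M \<and> (\<exists>L. L-lipschitz_on (Bs M) \<alpha>) \<and> \<alpha> 0 = 0 \<and>
              (\<forall>i'\<in>IU M. \<forall>i\<in>IS M. Lip M \<alpha> i' i \<le> ereal (Pt M i' i))}"

definition B11 :: "'a::banach lp_data \<Rightarrow> (nat \<Rightarrow> nat \<Rightarrow> nat \<Rightarrow> real) \<Rightarrow> ('a \<Rightarrow> 'a) set" where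
  "B11 M Pbar = {\<alpha>. \<alpha> ` Bs M \<subseteq> Xu M \<and> (\<forall>\<xi>\<in>Bs M. \<alpha> differentiable (at \<xi> within Bs M)) \<and>
     (\<exists>L\<ge>0. \<forall>\<xi>\<in>Bs M. \<forall>\<eta>\<in>Bs M.
        op_norm_on (Xs M) (\<lambda>v. DBs M \<alpha> \<xi> v - DBs M \<alpha> \<eta> v) \<le> ereal (L * norm (\<xi> - \<eta>))) \<and>
     \<alpha> 0 = 0 \<and>
     (\<forall>i'\<in>IU M. \<forall>i\<in>IS M. Lip M \<alpha> i' i \<le> ereal (Pt M i' i)) \<and>
     (\<forall>i'\<in>IU M. \<forall>i\<in>IS M. \<forall>j\<in>IS M. LipD M \<alpha> i' i j \<le> ereal (Pbar i' i j))}"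


section \<open>Constants\<close>

definition Hc :: "'a::banach lp_data \<Rightarrow> ix \<Rightarrow> nat \<Rightarrow> real" where
  "Hc M j i = Cbd1 M j (St i) + (\<Sum>i'\<in>IU M. Cbd1 M j (Ust i') * Pt M i' i)"

definition Sc :: "'a::banach lp_data \<Rightarrow> (nat \<Rightarrow> nat \<Rightarrow> nat \<Rightarrow> real) \<Rightarrow> ix \<Rightarrow> nat \<Rightarrow> nat \<Rightarrow> real" where
  "Sc M Pbar j n m =
     (Cbd2 M j (St n) (St m) + (\<Sum>m'\<in>IU M. Cbd2 M j (St n) (Ust m') * Pt M m' m))
     + (\<Sum>n'\<in>IU M. Cbd1 M j (Ust n') * Pbar n' n m)
     + (\<Sum>n'\<in>IU M. (Cbd2 M j (Ust n') (St m) + (\<Sum>m'\<in>IU M. Cbd2 M j (Ust n') (Ust m') * Pt M m' m))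
                   * Pt M n' n)"

text \<open>On the convex set \<open>Bs M\<close> the supremum of the norm of the derivative of a differentiable map
  is its Lipschitz constant, so one formula serves for all \<open>\<alpha>\<close>. The bounds \<open>Cbd1\<close> make the
  supremum finite.\<close>

definition Hhat :: "'a::banach lp_data \<Rightarrow> real" where
  "Hhat M = real_of_ereal (SUP \<alpha>\<in>B01 M.
     lip_const (Bs M) (\<lambda>x. pi_s M (Lop M (\<alpha> x)) + pi_s M (Nhat M (x + \<alpha> x))))"

definition gam :: "'a::banach lp_data \<Rightarrow> nat \<Rightarrow> real" where
  "gam M k = (if k = 0 then lam_s M + Cs M * Hhat M else rate M (St k) + Hc M (St k) k)"

definition Qop :: "nat \<Rightarrow> (nat \<Rightarrow> nat \<Rightarrow> nat \<Rightarrow> real) \<Rightarrow> nat \<Rightarrow> nat \<Rightarrow> nat \<Rightarrow> real" where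
  "Qop j G i k n =
     (if k = j then 0
      else if (k + 1 = j \<and> G i j n > 0) \<or> (k = j + 1 \<and> G i j n < 0) then G i k n + G i j n
      else G i k n)"

definition Tow :: "'a::banach lp_data \<Rightarrow> nat \<Rightarrow> (nat \<Rightarrow> nat \<Rightarrow> nat \<Rightarrow> real) \<Rightarrow> nat \<Rightarrow> nat \<Rightarrow> real" where
  "Tow M j G k n =
     (if k \<noteq> j then \<Sum>i\<in>IS M - {j}. inverse (gam M k - gam M j) * Hc M (St j) i * G i k n
      else (if n = j then 1 else 0)
           - (\<Sum>i\<in>IS M - {j}. \<Sum>m\<in>{0..mS M} - {j}.
                inverse (gam M m - gam M j) * Hc M (St j) i * G i m n))"

definition G_init :: "'a::banach lp_data \<Rightarrow> nat \<Rightarrow> nat \<Rightarrow> nat \<Rightarrow> real" where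
  "G_init M j k n = (if k = 0 then pbd M (St j) * Cs M else 0)"

definition G_sweep :: "'a::banach lp_data \<Rightarrow> (nat \<Rightarrow> nat \<Rightarrow> nat \<Rightarrow> real) \<Rightarrow> nat \<Rightarrow> nat \<Rightarrow> nat \<Rightarrow> real" where
  "G_sweep M G = fold (\<lambda>j G. G(j := Tow M j (Qop j G))) [1..<Suc (mS M)] G"

definition G_boot :: "'a::banach lp_data \<Rightarrow> nat \<Rightarrow> nat \<Rightarrow> nat \<Rightarrow> nat \<Rightarrow> real" where
  "G_boot M N = (G_sweep M ^^ N) (G_init M)"


section \<open>Flow on a chart and the Lyapunov--Perron operator\<close>

text \<open>Initial data need not lie in the domain of \<open>\<Lambda>\<close>, hence solutions are mild solutions; since
  \<open>\<alpha>\<close> is only defined on \<open>Bs M\<close>, they are required to stay there.\<close>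

definition mild_solution :: "'a::banach lp_data \<Rightarrow> ('a \<Rightarrow> 'a) \<Rightarrow> 'a \<Rightarrow> (real \<Rightarrow> 'a) \<Rightarrow> bool" where
  "mild_solution M \<alpha> \<xi> x \<longleftrightarrow> continuous_on {0..} x \<and>
     (\<forall>t\<ge>0. x t \<in> Bs M \<and>
        ((\<lambda>\<tau>. op_exp (Xs M) (dom_Lam M \<inter> Xs M) (Lam M) (t - \<tau>) (pi_s M (Nfull M (x \<tau> + \<alpha> (x \<tau>)))))
          has_integral (x t - op_exp (Xs M) (dom_Lam M \<inter> Xs M) (Lam M) t \<xi>)) {0..t})"

definition flow :: "'a::banach lp_data \<Rightarrow> real \<Rightarrow> 'a \<Rightarrow> ('a \<Rightarrow> 'a) \<Rightarrow> 'a" where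
  "flow M t \<xi> \<alpha> = (SOME x. mild_solution M \<alpha> \<xi> x) t"

definition LP_integrand :: "'a::banach lp_data \<Rightarrow> ('a \<Rightarrow> 'a) \<Rightarrow> 'a \<Rightarrow> real \<Rightarrow> 'a" where
  "LP_integrand M \<alpha> \<xi> t = op_exp (Xu M) (dom_Lam M \<inter> Xu M) (\<lambda>x. - Lam M x) t
     (pi_u M (Nfull M (flow M t \<xi> \<alpha> + \<alpha> (flow M t \<xi> \<alpha>))))"

definition Psi :: "'a::banach lp_data \<Rightarrow> ('a \<Rightarrow> 'a) \<Rightarrow> 'a \<Rightarrow> 'a" where
  "Psi M \<alpha> \<xi> = - integral {0..} (LP_integrand M \<alpha> \<xi>)"

definition Psi_well_defined :: "'a::banach lp_data \<Rightarrow> ('a \<Rightarrow> 'a) \<Rightarrow> bool" where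
  "Psi_well_defined M \<alpha> \<longleftrightarrow>
     (\<forall>\<xi>\<in>Bs M. (\<exists>x. mild_solution M \<alpha> \<xi> x \<and>
                   (\<forall>y. mild_solution M \<alpha> \<xi> y \<longrightarrow> (\<forall>t\<ge>0. y t = x t))) \<and>
                LP_integrand M \<alpha> \<xi> integrable_on {0..})"


section \<open>Standing assumptions\<close>

locale lyapunov_perron_setting =
  fixes M :: "'a::banach lp_data" and Nboot :: nat
  assumes Lam_linear: "linear_on_dom (dom_Lam M) (Lam M)"
    and Lam_dense: "closure (dom_Lam M) = UNIV"
    and Lam_inverse: "has_bounded_inverse (dom_Lam M) (Lam M)"
    and Ntilde_C2: "C2_map (Ntilde M)"
    and equilibrium: "htilde M \<in> dom_Lam M" "Lam M (htilde M) + Ntilde M (htilde M) = 0"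
    and hyperbolic: "hyperbolic_operator (dom_Lam M) (\<lambda>x. Lam M x + Lop M x)"
    \<comment> \<open>the splitting\<close>
    and proj_orth: "\<And>i j x. i \<in> IX M \<Longrightarrow> j \<in> IX M \<Longrightarrow>
          proj M i (proj M j x) = (if i = j then proj M j x else 0)"
    and proj_sum: "\<And>x. (\<Sum>i\<in>IX M. proj M i x) = x"
    and proj_bound: "\<And>i. i \<in> IX M \<Longrightarrow> norm (proj M i) \<le> pbd M i"
    and Lam_invariant: "\<And>i x. i \<in> IX M \<Longrightarrow> x \<in> dom_Lam M \<inter> Xi M i \<Longrightarrow> Lam M x \<in> Xi M i"
    \<comment> \<open>semigroups and rates\<close>
    and rate_sign: "\<And>i. i \<in> IS M \<Longrightarrow> rate M (St i) < 0" "\<And>i'. i' \<in> IU M \<Longrightarrow> 0 < rate M (Ust i')"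
    and gen_s: "generator_on (Xs M) (dom_Lam M \<inter> Xs M) (Lam M)"
    and gen_u: "generator_on (Xu M) (dom_Lam M \<inter> Xu M) (\<lambda>x. - Lam M x)"
    and gen_i: "\<And>i. i \<in> IS M \<Longrightarrow>
          generator_on (Xi M (St i)) (dom_Lam M \<inter> Xi M (St i)) (Lam M)"
    and gen_i': "\<And>i'. i' \<in> IU M \<Longrightarrow>
          generator_on (Xi M (Ust i')) (dom_Lam M \<inter> Xi M (Ust i')) (\<lambda>x. - Lam M x)"
    and exp_i: "\<And>i t x. i \<in> IS M \<Longrightarrow> 0 \<le> t \<Longrightarrow> x \<in> Xi M (St i) \<Longrightarrow>
          norm (op_exp (Xi M (St i)) (dom_Lam M \<inter> Xi M (St i)) (Lam M) t x)
            \<le> exp (rate M (St i) * t) * norm x"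
    and exp_i': "\<And>i' t x. i' \<in> IU M \<Longrightarrow> t \<le> 0 \<Longrightarrow> x \<in> Xi M (Ust i') \<Longrightarrow>
          norm (op_exp (Xi M (Ust i')) (dom_Lam M \<inter> Xi M (Ust i')) (\<lambda>x. - Lam M x) (- t) x)
            \<le> exp (rate M (Ust i') * t) * norm x"
    and lam_sign: "lam_s M < 0" "0 < lam_u M"
    and gen_Ls: "generator_on (Xs M) (dom_Lam M \<inter> Xs M) (\<lambda>x. Lam M x + pi_s M (Lop M x))"
    and gen_Lu: "generator_on (Xu M) (dom_Lam M \<inter> Xu M) (\<lambda>x. - (Lam M x + pi_u M (Lop M x)))"
    and exp_Ls: "\<And>t x. 0 \<le> t \<Longrightarrow> x \<in> Xs M \<Longrightarrow>
          norm (op_exp (Xs M) (dom_Lam M \<inter> Xs M) (\<lambda>x. Lam M x + pi_s M (Lop M x)) t x)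
            \<le> Cs M * exp (lam_s M * t) * norm x"
    and exp_Lu: "\<And>t x. t \<le> 0 \<Longrightarrow> x \<in> Xu M \<Longrightarrow>
          norm (op_exp (Xu M) (dom_Lam M \<inter> Xu M) (\<lambda>x. - (Lam M x + pi_u M (Lop M x))) (- t) x)
            \<le> Cu M * exp (lam_u M * t) * norm x"
    \<comment> \<open>charts and bounds on the nonlinearity\<close>
    and rho_pos: "\<And>i. i \<in> IS M \<Longrightarrow> 0 < rho M i"
    and P_pos: "\<And>i' i. i' \<in> IU M \<Longrightarrow> i \<in> IS M \<Longrightarrow> 0 < Pt M i' i"
    and Cbd1_nonneg: "\<And>j i. j \<in> IX M \<Longrightarrow> i \<in> IX M \<Longrightarrow> 0 \<le> Cbd1 M j i"
    and Cbd2_nonneg: "\<And>j i k. j \<in> IX M \<Longrightarrow> i \<in> IX M \<Longrightarrow> k \<in> IX M \<Longrightarrow> 0 \<le> Cbd2 M j i k"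
    and DN_bound: "\<And>j i x y. j \<in> IX M \<Longrightarrow> i \<in> IX M \<Longrightarrow> x \<in> Bs M \<Longrightarrow> y \<in> Bu M \<Longrightarrow>
          op_norm_on (Xi M i) (\<lambda>v. proj M j (Fderiv (Nfull M) (x + y) v)) \<le> ereal (Cbd1 M j i)"
    and D2N_bound: "\<And>j i k x y. j \<in> IX M \<Longrightarrow> i \<in> IX M \<Longrightarrow> k \<in> IX M \<Longrightarrow> x \<in> Bs M \<Longrightarrow> y \<in> Bu M \<Longrightarrow>
          bilin_norm_on (Xi M i) (Xi M k) (\<lambda>v w. proj M j (Fderiv (Fderiv (Nfull M)) (x + y) v w))
            \<le> ereal (Cbd2 M j i k)"
    \<comment> \<open>rates, bootstrap tensor, Lyapunov--Perron operator\<close>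
    and gam_decreasing: "\<And>k. k < mS M \<Longrightarrow> gam M (Suc k) < gam M k"
    and gam0_neg: "gam M 0 < 0"
    and Nboot_pos: "1 \<le> Nboot"
    and rho_invariant: "\<And>j t. j \<in> IS M \<Longrightarrow> 0 \<le> t \<Longrightarrow>
          (\<Sum>n\<in>IS M. \<Sum>k=0..mS M. exp (gam M k * t) * G_boot M Nboot j k n * rho M n) \<le> rho M j"
    and Psi_B01: "\<And>\<alpha>. \<alpha> \<in> B01 M \<Longrightarrow> Psi M \<alpha> \<in> B01 M"

text \<open>\<open>K j k i l\<close> is \<open>K\<^bsub>j,k\<^esub>\<^bsup>i l\<^esup>\<close>, and \<open>Ptilde \<dots> j' i l\<close> is the new bound on
  \<open>Lip(\<partial>\<^sub>i \<Psi>[\<alpha>])\<^bsub>j'\<^esub>\<^bsup>l\<^esup>\<close>.\<close>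

definition Ptilde :: "'a::banach lp_data \<Rightarrow> nat \<Rightarrow> (nat \<Rightarrow> nat \<Rightarrow> nat \<Rightarrow> real) \<Rightarrow> nat \<Rightarrow> (nat \<Rightarrow> real)
    \<Rightarrow> (nat \<Rightarrow> nat \<Rightarrow> nat \<Rightarrow> nat \<Rightarrow> real) \<Rightarrow> nat \<Rightarrow> nat \<Rightarrow> nat \<Rightarrow> real" where
  "Ptilde M Nboot Pbar Nmu \<mu> K j' i l =
     (\<Sum>k1=0..mS M. \<Sum>k2=0..mS M. \<Sum>n\<in>IS M. \<Sum>m\<in>IS M.
        inverse (rate M (Ust j') - gam M k1 - gam M k2) * Sc M Pbar (Ust j') n m
          * G_boot M Nboot m k1 l * G_boot M Nboot n k2 i)
     + (\<Sum>k=1..Nmu. \<Sum>n\<in>IS M. inverse (rate M (Ust j') - \<mu> k) * Hc M (Ust j') n * K n k i l)"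

end

theory Submission
  imports Defs
begin

text \<open>Composing the chart \<open>\<alpha>\<close> with the radial retraction onto the box \<open>Bs M\<close> gives a globally Lipschitz
  equation, solved by Picard iteration. Each component of the difference of two solutions in the box
  satisfies a scalar Gronwall inequality driven by the other components; inserting exponential bounds
  for these, starting from the bound with rate \<open>\<gamma>\<^sub>0\<close>, is one step of the bootstrap algorithm. Since the
  resulting bounds leave the box invariant, solutions starting in \<open>s *\<^sub>R \<xi>\<close> with \<open>s < 1\<close> stay in its
  interior, and letting \<open>s\<close> tend to \<open>1\<close> all solutions stay in the box, where they solve the original
  equation. The variational equation gives the derivative of the flow; its Lipschitz bound \<open>K\<close> makes the
  first-order Taylor remainder quadratic uniformly in time, so that \<open>\<Psi>\<close> may be differentiated under the
  integral sign. The Lipschitz bounds \<open>S\<close> and \<open>K\<close> of the two factors of \<open>DF(x(t)) \<partial>\<^sub>ix(t)\<close>, together with their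
  norm bounds \<open>H\<close> and \<open>G\<close>, give after integration against \<open>e\<^bsup>-\<lambda>t\<^esup>\<close> the constants \<open>Ptilde\<close>.\<close>

text \<open>Solutions are mild and a generator supplies right derivatives only, so two semigroups,
  or two forms of the equation, are compared by differentiating expressions like
  \<open>T (t - s) (S s x)\<close> in \<open>s\<close> from the right. Growth estimates are given
  for the block semigroups of \<open>Lam\<close> and for the semigroup of \<open>Lam\<close> plus
  the linearisation, but none for the semigroup of \<open>Lam\<close> on all of \<open>Xs M\<close>.
  Its local boundedness is derived from the perturbed semigroup; only then can it be identified with
  the sum of the blocks. Both estimates feed the bootstrap: the blocks give the coupled
  componentwise inequalities, and the same difference of solutions, rewritten as a mild solution for
  the perturbed semigroup, gives the rate \<open>gam M 0\<close>. Derivatives are relative to a box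
  with faces and determine values on \<open>Xs M\<close> only, so directional bounds are reached as
  limits from scaled points. Entries of \<open>G\<close> may be negative; only their exponential
  sums are known to be nonnegative. The flow is estimated twice: Gronwall constants growing in time
  give differentiability at fixed times, the bounds from \<open>G\<close> and \<open>K\<close> are
  uniform in time and allow integration.\<close>

section \<open>Right derivatives and scalar comparison\<close>

lemma interval_continuous_induction:
  fixes K :: "real set"
  assumes "closed K" "a \<in> K"
    and step: "\<And>c. a \<le> c \<Longrightarrow> c < b \<Longrightarrow> {a..c} \<subseteq> K \<Longrightarrow> \<exists>d>c. {c..d} \<subseteq> K"
  shows "{a..b} \<subseteq> K"
proof (cases "a \<le> b")
  case True
  define S where "S = {t \<in> {a..b}. {a..t} \<subseteq> K}"
  have aS: "a \<in> S" using True assms(2) by (auto simp: S_def)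
  have bdd: "bdd_above S" by (rule bdd_aboveI[of _ b]) (auto simp: S_def)
  define c where "c = Sup S"
  have ac: "a \<le> c" unfolding c_def by (rule cSup_upper[OF aS bdd])
  have cb: "c \<le> b" unfolding c_def using aS by (intro cSup_least) (auto simp: S_def)
  have below: "s \<in> K" if s: "a \<le> s" "s < c" for s
  proof -
    obtain t where "t \<in> S" "s < t"
      using s(2) unfolding c_def by (subst (asm) less_cSup_iff[OF _ bdd]) (use aS in auto)
    then show ?thesis using s by (auto simp: S_def)
  qed
  have cK: "c \<in> K"
  proof (cases "a = c")
    case False
    then have "c \<in> closure {a..<c}"
      using ac by (simp add: closure_atLeastLessThan)
    also have "closure {a..<c} \<subseteq> K"
      by (rule closure_minimal) (use below assms(1) in auto)
    finally show ?thesis .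
  qed (use assms in simp)
  have acK: "{a..c} \<subseteq> K"
    using below cK by force
  have "c = b"
  proof (rule ccontr)
    assume "c \<noteq> b"
    then obtain d where d: "d > c" "{c..d} \<subseteq> K" using step[OF ac _ acK] cb by auto
    define e where "e = min d b"
    have "e > c" "e \<le> b" using d \<open>c \<noteq> b\<close> cb by (auto simp: e_def)
    moreover have "{a..e} \<subseteq> K"
    proof
      fix s assume "s \<in> {a..e}"
      then show "s \<in> K" using acK d by (cases "s \<le> c") (auto simp: e_def)
    qed
    ultimately have "e \<in> S" using ac by (auto simp: S_def)
    then have "e \<le> c" unfolding c_def by (rule cSup_upper[OF _ bdd])
    with \<open>e > c\<close> show False by simp
  qed
  with acK show ?thesis by simp
qed simp

text \<open>With right derivatives only, the mean value theorem is replaced by continuity induction: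
  for each slope \<open>e > 0\<close> the inequality
  \<open>norm (w t - w a) \<le> e * (t - a)\<close> is closed in \<open>t\<close> and can be
  continued a little to the right. Then \<open>e\<close> tends to 0.\<close>

lemma right_derivative_zero_constant:
  fixes w :: "real \<Rightarrow> 'b::real_normed_vector"
  assumes ab: "a \<le> b" and cont: "continuous_on {a..b} w"
    and der: "\<And>s. a \<le> s \<Longrightarrow> s < b \<Longrightarrow> ((\<lambda>h. (w (s + h) - w s) /\<^sub>R h) \<longlongrightarrow> 0) (at_right 0)"
  shows "w b = w a"
proof -
  have "norm (w b - w a) \<le> e * (b - a)" if e: "e > 0" for e
  proof -
    define K where "K = {t \<in> {a..b}. norm (w t - w a) \<le> e * (t - a)}"
    have "{a..b} \<subseteq> K"
    proof (rule interval_continuous_induction)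
      show "closed K" unfolding K_def
        by (intro continuous_on_closed_Collect_le continuous_intros cont)
      show "a \<in> K" using ab by (auto simp: K_def)
      fix c assume c: "a \<le> c" "c < b" "{a..c} \<subseteq> K"
      have cK: "norm (w c - w a) \<le> e * (c - a)" using c by (auto simp: K_def)
      have "eventually (\<lambda>h. norm ((w (c + h) - w c) /\<^sub>R h) < e) (at_right 0)"
        using tendstoD[OF der[OF c(1,2)] e] by (simp add: dist_norm)
      then obtain \<delta> where \<delta>: "\<delta> > 0" "\<And>h. 0 < h \<Longrightarrow> h < \<delta> \<Longrightarrow> norm ((w (c + h) - w c) /\<^sub>R h) < e"
        unfolding eventually_at_right_field by auto
      define d where "d = min (c + \<delta> / 2) b"
      have "d > c" using \<delta> c by (auto simp: d_def)
      moreover have "{c..d} \<subseteq> K"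
      proof
        fix t assume t: "t \<in> {c..d}"
        have "norm (w t - w c) \<le> e * (t - c)"
        proof (cases "t = c")
          case False
          define h where "h = t - c"
          have h: "0 < h" "h < \<delta>" using t False \<delta> by (auto simp: h_def d_def)
          have "norm (w t - w c) < e * h"
            using \<delta>(2)[OF h] h by (simp add: divide_simps mult.commute) (simp add: h_def)
          then show ?thesis by (simp add: h_def)
        qed simp
        moreover have "norm (w t - w a) \<le> norm (w t - w c) + norm (w c - w a)"
          using norm_triangle_ineq[of "w t - w c" "w c - w a"] by simp
        ultimately have "norm (w t - w a) \<le> e * (t - a)"
          using cK by (simp add: algebra_simps)
        then show "t \<in> K" using t c by (auto simp: K_def d_def)
      qed
      ultimately show "\<exists>d>c. {c..d} \<subseteq> K" by blast
    qed
    then show ?thesis using ab by (auto simp: K_def)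
  qed
  then have le: "norm (w b - w a) \<le> e" if "e > 0" for e
  proof (cases "a = b")
    case False
    then have "norm (w b - w a) \<le> (e / (b - a)) * (b - a)"
      using that ab \<open>\<And>e. 0 < e \<Longrightarrow> norm (w b - w a) \<le> e * (b - a)\<close>[of "e / (b - a)"] by auto
    then show ?thesis using False by simp
  qed (use that in simp)
  have "norm (w b - w a) \<le> 0" by (rule field_le_epsilon) (use le in simp)
  then show ?thesis by simp
qed

lemma vector_derivative_imp_right:
  fixes w :: "real \<Rightarrow> 'b::real_normed_vector"
  assumes "(w has_vector_derivative d) (at s within {a..b})" "a \<le> s" "s < b"
  shows "((\<lambda>h. (w (s + h) - w s) /\<^sub>R h) \<longlongrightarrow> d) (at_right 0)"
proof -
  have "(w has_vector_derivative d) (at s within {s..b})"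
    by (rule has_vector_derivative_within_subset[OF assms(1)]) (use assms in auto)
  then have "((\<lambda>y. (1 / norm (y - s)) *\<^sub>R (w y - (w s + (y - s) *\<^sub>R d))) \<longlongrightarrow> 0) (at_right s)"
    unfolding has_vector_derivative_def has_derivative_within
    using assms(3) by (simp add: at_within_Icc_at_right)
  moreover have "eventually (\<lambda>y. (1 / norm (y - s)) *\<^sub>R (w y - (w s + (y - s) *\<^sub>R d))
      = (w y - w s) /\<^sub>R (y - s) - d) (at_right s)"
    using eventually_at_right_less
  proof eventually_elim
    case (elim y)
    then have "y - s \<noteq> 0" "norm (y - s) = y - s" by auto
    then show ?case
      by (simp add: divide_inverse scaleR_diff_right scaleR_add_right del: right_minus_eq)
  qed
  ultimately have "((\<lambda>y. (w y - w s) /\<^sub>R (y - s) - d) \<longlongrightarrow> 0) (at_right s)"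
    by (rule Lim_transform_eventually)
  then have "((\<lambda>y. (w y - w s) /\<^sub>R (y - s)) \<longlongrightarrow> d) (at_right s)"
    by (rule LIM_zero_cancel)
  then show ?thesis
    unfolding filterlim_at_right_to_0[of _ _ s] by (simp add: add.commute)
qed

text \<open>Subtracting the primitive of \<open>g\<close> leaves a function with vanishing right
  derivative. This is the fundamental theorem behind all variation-of-constants formulas
  below.\<close>

lemma has_integral_right_derivative:
  fixes w :: "real \<Rightarrow> 'b::banach"
  assumes ab: "a \<le> b" and cont: "continuous_on {a..b} w" "continuous_on {a..b} g"
    and der: "\<And>s. a \<le> s \<Longrightarrow> s < b \<Longrightarrow> ((\<lambda>h. (w (s + h) - w s) /\<^sub>R h) \<longlongrightarrow> g s) (at_right 0)"
  shows "(g has_integral (w b - w a)) {a..b}"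
proof -
  define I where "I t = integral {a..t} g" for t
  have I': "(I has_vector_derivative g s) (at s within {a..b})" if "s \<in> {a..b}" for s
    unfolding I_def using integral_has_vector_derivative[OF cont(2) that] .
  have "w b - I b = w a - I a"
  proof (rule right_derivative_zero_constant[where w = "\<lambda>t. w t - I t", OF ab])
    show "continuous_on {a..b} (\<lambda>t. w t - I t)"
      by (intro continuous_intros cont continuous_on_vector_derivative[where f' = g]) (use I' in auto)
    fix s assume s: "a \<le> s" "s < b"
    have "((\<lambda>h. (w (s + h) - w s) /\<^sub>R h - (I (s + h) - I s) /\<^sub>R h) \<longlongrightarrow> g s - g s) (at_right 0)"
      by (intro tendsto_diff der s vector_derivative_imp_right[of _ _ _ a b] I') (use s in auto)
    then show "((\<lambda>h. (w (s + h) - I (s + h) - (w s - I s)) /\<^sub>R h) \<longlongrightarrow> 0) (at_right 0)"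
      by (simp add: algebra_simps)
  qed
  then have "integral {a..b} g = w b - w a" by (simp add: I_def algebra_simps)
  then show ?thesis
    using integrable_continuous_real[OF cont(2)] by (metis integrable_integral)
qed

text \<open>The right-hand side of \<open>le\<close> is \<open>exp (l * t) * V t\<close>, and it is
  \<open>V\<close>, which is differentiable, that is compared with \<open>g\<close>. The sign of
  \<open>h\<close> is what lets \<open>u\<close> be replaced by its bound. Neither \<open>u\<close>
  nor the forcing is assumed nonnegative. The rate \<open>l + h\<close> of \<open>g\<close> is the
  origin of the form of the rates \<open>gam\<close>.\<close>

lemma gronwall_comparison:
  fixes u g \<phi> :: "real \<Rightarrow> real"
  assumes cont: "continuous_on {0..b} u" "continuous_on {0..b} \<phi>" and h: "0 \<le> h"
    and le: "\<And>t. 0 \<le> t \<Longrightarrow> t \<le> b \<Longrightarrow>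
      u t \<le> exp (l * t) * a + integral {0..t} (\<lambda>s. exp (l * (t - s)) * (h * u s + \<phi> s))"
    and g: "\<And>t. 0 \<le> t \<Longrightarrow> t \<le> b \<Longrightarrow> (g has_real_derivative (l + h) * g t + \<phi> t) (at t)" "a \<le> g 0"
    and t: "0 \<le> t" "t \<le> b"
  shows "u t \<le> g t"
proof -
  define p where "p s = exp (- l * s) * (h * u s + \<phi> s)" for s
  define V where "V t = a + integral {0..t} p" for t
  have contp: "continuous_on {0..b} p" unfolding p_def by (intro continuous_intros cont)
  have V': "(V has_real_derivative p s) (at s within {0..b})" if "s \<in> {0..b}" for s
    unfolding V_def has_real_derivative_iff_has_vector_derivative
    using integral_has_vector_derivative[OF contp that] by (auto intro!: derivative_eq_intros)
  have uV: "u s \<le> exp (l * s) * V s" if "0 \<le> s" "s \<le> b" for s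
  proof -
    have "integral {0..s} (\<lambda>r. exp (l * (s - r)) * (h * u r + \<phi> r)) = integral {0..s} (\<lambda>r. exp (l * s) * p r)"
      by (rule Henstock_Kurzweil_Integration.integral_cong) (simp add: p_def exp_add[symmetric] algebra_simps)
    then show ?thesis using le[OF that] by (simp add: V_def algebra_simps)
  qed
  \<comment> \<open>The factors \<open>exp (- h * s)\<close> and \<open>exp (- l * s)\<close> are
    integrating factors: \<open>g\<close> and the forcing cancel from the derivative, leaving only
    the gap between \<open>u\<close> and its bound.\<close>
  define D where "D s = exp (- h * s) * (V s - exp (- l * s) * g s)" for s
  define D' where "D' s = exp (- h * s) * (- h * (V s - exp (- l * s) * u s))" for s
  have D': "(D has_real_derivative D' s) (at s within {0..b})" if s: "s \<in> {0..b}" for s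
  proof -
    have gs: "(g has_real_derivative (l + h) * g s + \<phi> s) (at s within {0..b})"
      by (rule has_field_derivative_at_within[OF g(1)]) (use s in auto)
    have "(D has_real_derivative
        (- h * exp (- h * s)) * (V s - exp (- l * s) * g s)
        + exp (- h * s) * (p s - (- l * exp (- l * s) * g s + exp (- l * s) * ((l + h) * g s + \<phi> s))))
      (at s within {0..b})"
      unfolding D_def
      by (auto intro!: derivative_eq_intros V'[OF s] gs)
    moreover have "(- h * exp (- h * s)) * (V s - exp (- l * s) * g s)
        + exp (- h * s) * (p s - (- l * exp (- l * s) * g s + exp (- l * s) * ((l + h) * g s + \<phi> s))) = D' s"
      by (simp add: D'_def p_def algebra_simps)
    ultimately show ?thesis by simp
  qed
  have D'le: "D' s \<le> 0" if "s \<in> {0..b}" for s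
  proof -
    have "exp (- l * s) * u s \<le> exp (- l * s) * (exp (l * s) * V s)"
      by (rule mult_left_mono[OF uV]) (use that in auto)
    also have "\<dots> = V s" by (simp add: mult.assoc[symmetric] exp_add[symmetric])
    finally show ?thesis using h by (simp add: D'_def zero_le_mult_iff mult_le_0_iff)
  qed
  have "D t \<le> D 0"
  proof (cases "t = 0")
    case False
    show ?thesis
    proof (rule DERIV_nonpos_imp_decreasing_open[of 0 t])
      show "0 \<le> t" using t by simp
      fix x assume x: "0 < x" "x < t"
      have "(D has_real_derivative D' x) (at x)"
        using D'[of x] x t by (simp add: at_within_Icc_at)
      then show "\<exists>y. (D has_real_derivative y) (at x) \<and> y \<le> 0" using D'le[of x] x t by auto
    next
      have "continuous_on {0..b} D"
        by (rule DERIV_continuous_on) (rule D')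
      then show "continuous_on {0..t} D" by (rule continuous_on_subset) (use t in auto)
    qed
  qed simp
  also have "D 0 \<le> 0" using g(2) by (simp add: D_def V_def)
  finally have "V t \<le> exp (- l * t) * g t" by (simp add: D_def mult_le_0_iff)
  then have "exp (l * t) * V t \<le> exp (l * t) * (exp (- l * t) * g t)" by simp
  also have "\<dots> = g t" by (simp add: mult.assoc[symmetric] exp_add[symmetric])
  finally show ?thesis using uV[OF t] by simp
qed

section \<open>Integrals over the half-line\<close>

text \<open>Continuity gives integrability on compact intervals; on the half-line the Cauchy
  criterion over large boxes is inherited from \<open>g\<close>, because the integral of
  \<open>f\<close> between two endpoints is at most that of \<open>g\<close>.\<close>

lemma integrable_on_Ici_dominated:
  fixes f :: "real \<Rightarrow> 'b::banach"
  assumes cont: "continuous_on {0..} f" and g: "(g has_integral I) {0..}"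
    and le: "\<And>t. 0 \<le> t \<Longrightarrow> norm (f t) \<le> g t"
  shows "f integrable_on {0..}" "norm (integral {0..} f) \<le> I"
proof -
  let ?f = "\<lambda>x. if x \<in> {0..} then f x else 0" and ?g = "\<lambda>x. if x \<in> {0..} then g x else 0"
  have gi: "g integrable_on {0..}" using g by blast
  have gI: "?g integrable_on cbox a b" for a b by (rule integrable_altD(1)[OF gi])
  \<comment> \<open>Boxes containing a ball around 0 have a left endpoint \<open>a \<le> 0\<close>,
    which then drops out: only integrals over \<open>{0..b}\<close> have to be compared.\<close>
  have int0: "integral (cbox a b) (\<lambda>x. if x \<in> {0..} then F x else 0) = integral {0..b} F" if "a \<le> 0"
    for a b :: real and F :: "real \<Rightarrow> 'c::banach"
  proof -
    have "integral (cbox a b) (\<lambda>x. if x \<in> {0..} then F x else 0) = integral ({0..} \<inter> cbox a b) F"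
      by (rule Henstock_Kurzweil_Integration.integral_restrict_Int)
    also have "{0..} \<inter> cbox a b = {0..b}" using that by auto
    finally show ?thesis .
  qed
  have fI: "f integrable_on {a..b}" if "0 \<le> a" for a b
    by (intro integrable_continuous_real continuous_on_subset[OF cont]) (use that in auto)
  have gI': "g integrable_on {a..b}" if "0 \<le> a" for a b
  proof -
    have "g integrable_on ({0..} \<inter> cbox a b)"
      using gI[of a b] by (subst (asm) integrable_restrict_Int) auto
    also have "{0..} \<inter> cbox a b = {a..b}" using that by auto
    finally show ?thesis .
  qed
  have diff: "norm (integral {0..b} f - integral {0..d} f) \<le> norm (integral {0..b} g - integral {0..d} g)"
    if bd: "0 \<le> d" "d \<le> b" for b d
  proof -
    have "integral {0..b} f - integral {0..d} f = integral {d..b} f"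
      using Henstock_Kurzweil_Integration.integral_combine[OF bd fI[of 0 b]] by (simp add: algebra_simps)
    moreover have "integral {0..b} g - integral {0..d} g = integral {d..b} g"
      using Henstock_Kurzweil_Integration.integral_combine[OF bd gI'[of 0 b]] by (simp add: algebra_simps)
    moreover have "norm (integral {d..b} f) \<le> integral {d..b} g"
      by (rule Henstock_Kurzweil_Integration.integral_norm_bound_integral) (use fI gI' bd le in auto)
    ultimately show ?thesis by simp
  qed
  show f: "f integrable_on {0..}"
  proof (subst integrable_alt, intro conjI allI impI)
    fix a b :: real
    have "f integrable_on ({0..} \<inter> cbox a b)"
    proof -
      have "{0..} \<inter> cbox a b = {max 0 a..b}" by auto
      then show ?thesis using fI[of "max 0 a" b] by simp
    qed
    then show "?f integrable_on cbox a b" by (subst integrable_restrict_Int) auto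
  next
    fix e :: real assume "e > 0"
    obtain B where B0: "B > 0" and B: "\<forall>a b c d. ball 0 B \<subseteq> cbox a b \<and> ball 0 B \<subseteq> cbox c d \<longrightarrow>
        norm (integral (cbox a b) ?g - integral (cbox c d) ?g) < e"
      using integrable_altD(2)[OF gi \<open>e > 0\<close>] by (elim exE conjE) (rule that)
    have "norm (integral (cbox a b) ?f - integral (cbox c d) ?f) < e"
      if "ball 0 B \<subseteq> cbox a b" "ball 0 B \<subseteq> cbox c d" for a b c d
    proof -
      have "0 \<in> ball (0::real) B" using B0 by simp
      then have s: "a \<le> 0" "c \<le> 0" "0 \<le> b" "0 \<le> d" using that by (auto dest!: subsetD)
      have "norm (integral {0..b} g - integral {0..d} g) < e"
        using B[rule_format, OF conjI, OF that] s by (simp only: int0)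
      moreover have "norm (integral {0..b} f - integral {0..d} f) \<le> norm (integral {0..b} g - integral {0..d} g)"
        using diff[of d b] diff[of b d] s by (cases "d \<le> b") (auto simp: norm_minus_commute)
      ultimately show ?thesis using s by (simp only: int0)
    qed
    then show "\<exists>B>0. \<forall>a b c d. ball 0 B \<subseteq> cbox a b \<and> ball 0 B \<subseteq> cbox c d \<longrightarrow>
        norm (integral (cbox a b) ?f - integral (cbox c d) ?f) < e"
      using B0 by (intro exI[of _ B] conjI allI impI) auto
  qed
  have "norm (integral {0..} f) \<le> integral {0..} g"
    by (rule Henstock_Kurzweil_Integration.integral_norm_bound_integral) (use f gi le in auto)
  then show "norm (integral {0..} f) \<le> I" using g by (simp add: integral_unique)
qed

lemma has_integral_exp_sum:
  fixes a b :: "'i \<Rightarrow> real"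
  assumes "finite S" "\<And>k. k \<in> S \<Longrightarrow> b k < 0"
  shows "((\<lambda>t. \<Sum>k\<in>S. exp (b k * t) * a k) has_integral (\<Sum>k\<in>S. inverse (- b k) * a k)) {0..}"
proof (rule has_integral_sum[OF assms(1)])
  fix k assume "k \<in> S"
  then have "((\<lambda>t. exp (- (- b k) * t)) has_integral exp (- (- b k) * 0) / (- b k)) {0..}"
    by (intro has_integral_exp_minus_to_infinity) (use assms in auto)
  from has_integral_mult_left[OF this, of "a k"]
  show "((\<lambda>t. exp (b k * t) * a k) has_integral inverse (- b k) * a k) {0..}"
    by (simp add: field_simps)
qed

section \<open>Mean value bound and symmetry of the second derivative\<close>

text \<open>Only the derivative in the one direction \<open>y - x\<close> is bounded, not its
  operator norm; this is what makes sharp coordinatewise constants possible. The proof restricts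
  \<open>f\<close> to the segment.\<close>

lemma mean_value_bound:
  fixes f :: "'a::real_normed_vector \<Rightarrow> 'b::real_normed_vector"
  assumes S: "convex S" "x \<in> S" "y \<in> S"
    and der: "\<And>z. z \<in> S \<Longrightarrow> (f has_derivative f' z) (at z within S)"
    and B: "\<And>z. z \<in> S \<Longrightarrow> norm (f' z (y - x)) \<le> B"
  shows "norm (f y - f x) \<le> B"
proof -
  define p where "p t = x + t *\<^sub>R (y - x)" for t :: real
  have pS: "p t \<in> S" if "t \<in> {0..1}" for t
  proof -
    have "p t = (1 - t) *\<^sub>R x + t *\<^sub>R y" by (simp add: p_def algebra_simps)
    then show ?thesis using S that by (auto simp: convex_alt)
  qed
  have "norm (f (p 1) - f (p 0)) \<le> B * norm (1 - 0 :: real)"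
  proof (rule differentiable_bound[where S = "{0..1}" and f = "\<lambda>t. f (p t)" and f' = "\<lambda>t h. f' (p t) (h *\<^sub>R (y - x))"])
    fix t :: real assume t: "t \<in> {0..1}"
    have 1: "(p has_derivative (\<lambda>h. h *\<^sub>R (y - x))) (at t within {0..1})"
      unfolding p_def by (auto intro!: derivative_eq_intros)
    have 2: "(f has_derivative f' (p t)) (at (p t) within p ` {0..1})"
      by (rule has_derivative_subset[OF der[OF pS[OF t]]]) (use pS in auto)
    show "((\<lambda>t. f (p t)) has_derivative (\<lambda>h. f' (p t) (h *\<^sub>R (y - x)))) (at t within {0..1})"
      using diff_chain_within[OF 1 2] by (simp add: o_def)
    show "onorm (\<lambda>h. f' (p t) (h *\<^sub>R (y - x))) \<le> B"
    proof (rule onorm_le)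
      fix h :: real
      have "linear (f' (p t))" using der[OF pS[OF t]] by (rule has_derivative_linear)
      then have "norm (f' (p t) (h *\<^sub>R (y - x))) = norm h * norm (f' (p t) (y - x))"
        by (simp add: linear_scale)
      then show "norm (f' (p t) (h *\<^sub>R (y - x))) \<le> B * norm h"
        using mult_left_mono[OF B[OF pS[OF t]], of "norm h"] by (simp add: mult.commute)
    qed
  qed auto
  then show ?thesis by (simp add: p_def)
qed

text \<open>The second difference of \<open>f\<close> at \<open>x\<close> is symmetric in
  \<open>v\<close> and \<open>w\<close>, and the mean value bound along \<open>v\<close> shows that
  it equals \<open>(h * h) *\<^sub>R f'' w v\<close> up to a smaller error. Differentiability of
  \<open>f'\<close> at the single point \<open>x\<close> suffices for this.\<close>

lemma symmetric_second_derivative: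
  fixes f :: "'a::real_normed_vector \<Rightarrow> 'b::real_normed_vector"
  assumes f': "\<And>x. (f has_derivative blinfun_apply (f' x)) (at x)"
    and f'': "(f' has_derivative blinfun_apply f'') (at x)"
  shows "f'' v w = f'' w v"
proof -
  define \<Delta> where "\<Delta> h v w = f (x + h *\<^sub>R v + h *\<^sub>R w) - f (x + h *\<^sub>R v) - f (x + h *\<^sub>R w) + f x" for h v w
  have approx: "\<exists>\<delta>>0. \<forall>h. 0 < h \<longrightarrow> h < \<delta> \<longrightarrow> norm (\<Delta> h v w - (h * h) *\<^sub>R f'' w v) \<le> e * (h * h)"
    if e: "e > 0" for e v w
  proof -
    \<comment> \<open>\<open>h * m\<close> bounds both displacements from \<open>x\<close> that
      occur, and \<open>m\<close> bounds \<open>norm v\<close>. Two approximation errors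
      \<open>e' * (h * m)\<close>, applied to \<open>v\<close> and multiplied by the length
      \<open>h\<close>, then add up to \<open>e * (h * h)\<close>.\<close>
    define m where "m = norm v + norm w + 1"
    have m: "m > 0" by (simp add: m_def add_nonneg_pos)
    define e' where "e' = e / (2 * m * m)"
    have e': "e' > 0" using e m by (simp add: e'_def)
    obtain d where d: "d > 0" "\<And>y. norm (y - x) < d \<Longrightarrow> norm (f' y - f' x - f'' (y - x)) \<le> e' * norm (y - x)"
      using f''[unfolded has_derivative_at_alt] e' by blast
    define \<delta> where "\<delta> = d / m"
    have "norm (\<Delta> h v w - (h * h) *\<^sub>R f'' w v) \<le> e * (h * h)" if h: "0 < h" "h < \<delta>" for h
    proof -
      have hm: "h * m < d" using h m by (simp add: \<delta>_def field_simps)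
      define g where "g t = f (x + t *\<^sub>R v + h *\<^sub>R w) - f (x + t *\<^sub>R v) - (t * h) *\<^sub>R f'' w v" for t
      define g' where "g' t r = r *\<^sub>R (f' (x + t *\<^sub>R v + h *\<^sub>R w) v - f' (x + t *\<^sub>R v) v - h *\<^sub>R f'' w v)" for t r :: real
      have "norm (g h - g 0) \<le> e * (h * h)"
      proof (rule mean_value_bound[of "{0..h}" 0 h g g'])
        fix t assume t: "t \<in> {0..h}"
        have c: "((\<lambda>t. f (x + t *\<^sub>R v + z)) has_derivative (\<lambda>r. f' (x + t *\<^sub>R v + z) (r *\<^sub>R v))) (at t within {0..h})" for z
          by (rule has_derivative_compose[of "\<lambda>t. x + t *\<^sub>R v + z" _ _ _ f, OF _ f'])
            (auto intro!: derivative_eq_intros)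
        have c1: "((\<lambda>t. f (x + t *\<^sub>R v)) has_derivative (\<lambda>r. r *\<^sub>R f' (x + t *\<^sub>R v) v)) (at t within {0..h})"
          using c[of 0] by (simp add: blinfun.scaleR_right)
        have c2: "((\<lambda>t. f (x + t *\<^sub>R v + h *\<^sub>R w)) has_derivative (\<lambda>r. r *\<^sub>R f' (x + t *\<^sub>R v + h *\<^sub>R w) v)) (at t within {0..h})"
          using c[of "h *\<^sub>R w"] by (simp add: blinfun.scaleR_right)
        show "(g has_derivative g' t) (at t within {0..h})"
          unfolding g_def g'_def
          by (rule derivative_eq_intros c1 c2 refl)+ (simp add: algebra_simps)
        have tn: "norm (t *\<^sub>R v + h *\<^sub>R w) \<le> h * m" "norm (t *\<^sub>R v) \<le> h * m"
        proof -
          have "norm (t *\<^sub>R v + h *\<^sub>R w) \<le> t * norm v + h * norm w"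
            using norm_triangle_ineq[of "t *\<^sub>R v" "h *\<^sub>R w"] t h by simp
          moreover have "t * norm v \<le> h * norm v" using t by (intro mult_right_mono) auto
          ultimately show "norm (t *\<^sub>R v + h *\<^sub>R w) \<le> h * m" using h by (simp add: m_def algebra_simps)
          have "0 \<le> h * norm w" using h by simp
          moreover have "h * m = h * norm v + h * norm w + h" by (simp add: m_def algebra_simps)
          moreover have "norm (t *\<^sub>R v) = t * norm v" using t by simp
          ultimately show "norm (t *\<^sub>R v) \<le> h * m" using \<open>t * norm v \<le> h * norm v\<close> h by linarith
        qed
        have 1: "norm (f' (x + (t *\<^sub>R v + h *\<^sub>R w)) - f' x - f'' (t *\<^sub>R v + h *\<^sub>R w)) \<le> e' * (h * m)"
          using d(2)[of "x + (t *\<^sub>R v + h *\<^sub>R w)"] tn(1) hm e'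
          by (smt (verit, ccfv_SIG) add_diff_cancel_left' mult_left_mono)
        have 2: "norm (f' (x + t *\<^sub>R v) - f' x - f'' (t *\<^sub>R v)) \<le> e' * (h * m)"
          using d(2)[of "x + t *\<^sub>R v"] tn(2) hm e'
          by (smt (verit, ccfv_SIG) add_diff_cancel_left' mult_left_mono)
        define q where "q = f' (x + t *\<^sub>R v + h *\<^sub>R w) - f' (x + t *\<^sub>R v) - h *\<^sub>R f'' w"
        have "q = (f' (x + (t *\<^sub>R v + h *\<^sub>R w)) - f' x - f'' (t *\<^sub>R v + h *\<^sub>R w)) - (f' (x + t *\<^sub>R v) - f' x - f'' (t *\<^sub>R v))"
          by (simp add: q_def blinfun.add_right blinfun.scaleR_right algebra_simps)
        then have q: "norm q \<le> 2 * (e' * (h * m))"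
          using 1 2 norm_triangle_ineq4 by (smt (verit))
        have qv: "norm (q v) \<le> 2 * (e' * (h * m)) * m"
        proof -
          have "norm (q v) \<le> norm q * norm v" by (rule norm_blinfun)
          also have "\<dots> \<le> 2 * (e' * (h * m)) * m"
            by (intro mult_mono q) (use e' h m in \<open>auto simp: m_def\<close>)
          finally show ?thesis .
        qed
        have "g' t (h - 0) = h *\<^sub>R q v"
          by (simp add: g'_def q_def blinfun.diff_left blinfun.scaleR_left)
        then have "norm (g' t (h - 0)) = h * norm (q v)" using h by simp
        also have "\<dots> \<le> h * (2 * (e' * (h * m)) * m)" using qv h by (intro mult_left_mono) auto
        also have "\<dots> = e * (h * h)" using m by (simp add: e'_def field_simps)
        finally show "norm (g' t (h - 0)) \<le> e * (h * h)" .
      qed (use h in auto)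
      moreover have "g h - g 0 = \<Delta> h v w - (h * h) *\<^sub>R f'' w v"
        by (simp add: g_def \<Delta>_def algebra_simps)
      ultimately show ?thesis by simp
    qed
    moreover have "\<delta> > 0" using d m by (simp add: \<delta>_def)
    ultimately show ?thesis by blast
  qed
  have le: "norm (f'' v w - f'' w v) \<le> 0 + e" if e: "e > 0" for e
  proof -
    obtain d1 where d1: "d1 > 0" "\<And>h. 0 < h \<Longrightarrow> h < d1 \<Longrightarrow> norm (\<Delta> h v w - (h * h) *\<^sub>R f'' w v) \<le> (e / 2) * (h * h)"
      using approx[of "e / 2" v w] e by auto
    obtain d2 where d2: "d2 > 0" "\<And>h. 0 < h \<Longrightarrow> h < d2 \<Longrightarrow> norm (\<Delta> h w v - (h * h) *\<^sub>R f'' v w) \<le> (e / 2) * (h * h)"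
      using approx[of "e / 2" w v] e by auto
    define h where "h = min d1 d2 / 2"
    have h: "0 < h" "h < d1" "h < d2" using d1 d2 by (auto simp: h_def)
    have sym: "\<Delta> h v w = \<Delta> h w v" by (simp add: \<Delta>_def algebra_simps)
    have "norm ((\<Delta> h v w - (h * h) *\<^sub>R f'' w v) - (\<Delta> h w v - (h * h) *\<^sub>R f'' v w)) \<le> e * (h * h)"
      using norm_triangle_ineq4[of "\<Delta> h v w - (h * h) *\<^sub>R f'' w v" "\<Delta> h w v - (h * h) *\<^sub>R f'' v w"]
        d1(2)[OF h(1,2)] d2(2)[OF h(1,3)] by (simp add: field_simps)
    also have "(\<Delta> h v w - (h * h) *\<^sub>R f'' w v) - (\<Delta> h w v - (h * h) *\<^sub>R f'' v w) = (h * h) *\<^sub>R (f'' v w - f'' w v)"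
      by (simp add: sym algebra_simps)
    finally have "(h * h) * norm (f'' v w - f'' w v) \<le> (h * h) * e"
      by (simp only: norm_scaleR) (simp add: mult.commute)
    then show ?thesis using h by simp
  qed
  have "norm (f'' v w - f'' w v) \<le> 0" by (rule field_le_epsilon) (rule le)
  then show ?thesis by simp
qed

text \<open>Strong continuity together with a bound uniform on \<open>J\<close> gives joint
  continuity: vary the vector first, using the uniform bound, then the time with the limit vector
  fixed.\<close>

lemma tendsto_orbit:
  fixes T :: "real \<Rightarrow> 'a::real_normed_vector \<Rightarrow> 'a"
  assumes add: "\<And>s x y. s \<in> J \<Longrightarrow> x \<in> Y \<Longrightarrow> y \<in> Y \<Longrightarrow> norm (T s x - T s y) \<le> B * norm (x - y)"
    and cont: "\<And>x. x \<in> Y \<Longrightarrow> continuous_on J (\<lambda>s. T s x)"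
    and f: "(f \<longlongrightarrow> f0) F" "eventually (\<lambda>s. f s \<in> J) F" "f0 \<in> J"
    and g: "(g \<longlongrightarrow> g0) F" "eventually (\<lambda>s. g s \<in> Y) F" "g0 \<in> Y"
  shows "((\<lambda>s. T (f s) (g s)) \<longlongrightarrow> T f0 g0) F"
proof -
  have 1: "((\<lambda>s. T (f s) g0) \<longlongrightarrow> T f0 g0) F"
    by (rule continuous_on_tendsto_compose[OF cont f(1,3)]) (use f g in auto)
  have 2: "((\<lambda>s. T (f s) (g s) - T (f s) g0) \<longlongrightarrow> 0) F"
  proof (rule Lim_null_comparison)
    show "eventually (\<lambda>s. norm (T (f s) (g s) - T (f s) g0) \<le> B * norm (g s - g0)) F"
      using f(2) g(2) by eventually_elim (use add g(3) in blast)
    show "((\<lambda>s. B * norm (g s - g0)) \<longlongrightarrow> 0) F"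
      by (intro tendsto_mult_right_zero tendsto_norm_zero) (use g(1) in \<open>simp add: LIM_zero\<close>)
  qed
  from tendsto_add[OF 2 1] show ?thesis by simp
qed

lemma continuous_on_orbit:
  fixes T :: "real \<Rightarrow> 'a::real_normed_vector \<Rightarrow> 'a"
  assumes "\<And>s x y. s \<in> J \<Longrightarrow> x \<in> Y \<Longrightarrow> y \<in> Y \<Longrightarrow> norm (T s x - T s y) \<le> B * norm (x - y)"
    and "\<And>x. x \<in> Y \<Longrightarrow> continuous_on J (\<lambda>s. T s x)"
    and "continuous_on S f" "f ` S \<subseteq> J" "continuous_on S g" "g ` S \<subseteq> Y"
  shows "continuous_on S (\<lambda>s. T (f s) (g s))"
  unfolding continuous_on_def
proof
  fix s assume "s \<in> S"
  show "((\<lambda>s. T (f s) (g s)) \<longlongrightarrow> T (f s) (g s)) (at s within S)"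
    by (rule tendsto_orbit[OF assms(1,2)])
      (use assms(3-) \<open>s \<in> S\<close> in \<open>auto simp: continuous_on_def eventually_at_filter image_subset_iff\<close>)
qed

section \<open>Semigroups and their generators\<close>

lemma generatesD:
  assumes "generates Y D A T"
  shows "D \<subseteq> Y" "\<And>t x. 0 \<le> t \<Longrightarrow> x \<in> Y \<Longrightarrow> T t x \<in> Y"
    and "\<And>t x y. 0 \<le> t \<Longrightarrow> x \<in> Y \<Longrightarrow> y \<in> Y \<Longrightarrow> T t (x + y) = T t x + T t y"
    and "\<And>t c x. 0 \<le> t \<Longrightarrow> x \<in> Y \<Longrightarrow> T t (c *\<^sub>R x) = c *\<^sub>R T t x"
    and "\<And>t. 0 \<le> t \<Longrightarrow> \<exists>B. \<forall>x\<in>Y. norm (T t x) \<le> B * norm x"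
    and "\<And>x. x \<in> Y \<Longrightarrow> T 0 x = x"
    and "\<And>s t x. 0 \<le> s \<Longrightarrow> 0 \<le> t \<Longrightarrow> x \<in> Y \<Longrightarrow> T (s + t) x = T s (T t x)"
    and "\<And>x. x \<in> Y \<Longrightarrow> continuous_on {0..} (\<lambda>t. T t x)"
    and "\<And>x. x \<in> D \<Longrightarrow> ((\<lambda>h. (T h x - x) /\<^sub>R h) \<longlongrightarrow> A x) (at_right 0)"
    and "\<And>x y. x \<in> Y \<Longrightarrow> ((\<lambda>h. (T h x - x) /\<^sub>R h) \<longlongrightarrow> y) (at_right 0) \<Longrightarrow> x \<in> D"
  using assms unfolding generates_def C0_semigroup_on_def by blast+

text \<open>The semigroup is specified on \<open>Y\<close> only. Composing with a bounded projection
  onto \<open>Y\<close> makes every \<open>T t\<close> a bounded linear map of the whole space, so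
  that ambient facts on linearity, limits and integrals apply.\<close>

locale projected_semigroup =
  fixes Y D :: "'a::banach set" and A :: "'a \<Rightarrow> 'a" and T :: "real \<Rightarrow> 'a \<Rightarrow> 'a" and \<pi> :: "'a \<Rightarrow> 'a"
  assumes gen: "generates Y D A T"
    and bl: "bounded_linear \<pi>" and range: "range \<pi> = Y" and idem: "\<And>y. y \<in> Y \<Longrightarrow> \<pi> y = y"
begin

lemmas DY = generatesD(1)[OF gen]
  and inY = generatesD(2)[OF gen]
  and at0 = generatesD(6)[OF gen]
  and semi = generatesD(7)[OF gen]
  and cont = generatesD(8)[OF gen]
  and deriv0 = generatesD(9)[OF gen]
  and domI = generatesD(10)[OF gen]

lemma piY: "\<pi> x \<in> Y" using range by auto

lemma subspace_Y: "subspace Y"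
  unfolding range[symmetric] by (rule linear_subspace_image) (auto intro: bounded_linear.linear bl)

lemma bounded_linear_T: "0 \<le> t \<Longrightarrow> bounded_linear (\<lambda>x. T t (\<pi> x))"
proof -
  assume t: "0 \<le> t"
  obtain B where B: "\<And>x. x \<in> Y \<Longrightarrow> norm (T t x) \<le> B * norm x" using generatesD(5)[OF gen t] by blast
  obtain K where K: "\<And>x. norm (\<pi> x) \<le> norm x * K" "0 \<le> K" using bounded_linear.nonneg_bounded[OF bl] by blast
  show ?thesis
  proof (rule bounded_linear_intro[of _ "\<bar>B\<bar> * K"])
    show "T t (\<pi> (x + y)) = T t (\<pi> x) + T t (\<pi> y)" for x y
      by (simp add: linear_add[OF bounded_linear.linear[OF bl]] generatesD(3)[OF gen t piY piY])
    show "T t (\<pi> (c *\<^sub>R x)) = c *\<^sub>R T t (\<pi> x)" for c x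
      by (simp add: linear_scale[OF bounded_linear.linear[OF bl]] generatesD(4)[OF gen t piY])
    fix x
    have "norm (T t (\<pi> x)) \<le> \<bar>B\<bar> * norm (\<pi> x)"
      using B[OF piY[of x]] by (meson abs_ge_self mult_right_mono norm_ge_zero order_trans)
    also have "\<dots> \<le> \<bar>B\<bar> * (norm x * K)" by (intro mult_left_mono K) auto
    finally show "norm (T t (\<pi> x)) \<le> norm x * (\<bar>B\<bar> * K)" by (simp add: algebra_simps)
  qed
qed

lemma T_diff: "0 \<le> t \<Longrightarrow> x \<in> Y \<Longrightarrow> y \<in> Y \<Longrightarrow> T t (x - y) = T t x - T t y"
  using linear_diff[OF bounded_linear.linear[OF bounded_linear_T], of t x y]
  by (simp add: idem subspace_diff[OF subspace_Y])

lemma T_scale: "0 \<le> t \<Longrightarrow> x \<in> Y \<Longrightarrow> T t (c *\<^sub>R x) = c *\<^sub>R T t x"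
  by (rule generatesD(4)[OF gen])

lemma T_zero: "0 \<le> t \<Longrightarrow> T t 0 = 0"
  using T_scale[of t 0 0] subspace_0[OF subspace_Y] by simp

lemma T_lipschitz:
  assumes "\<And>x. x \<in> Y \<Longrightarrow> norm (T t x) \<le> B * norm x" "0 \<le> t" "x \<in> Y" "y \<in> Y"
  shows "norm (T t x - T t y) \<le> B * norm (x - y)"
  using assms(1)[of "x - y"] assms(2-) by (simp add: T_diff subspace_diff[OF subspace_Y])

text \<open>\<open>T s\<close> commutes with \<open>T h\<close>, so it maps the difference quotients
  at \<open>x\<close> to those at \<open>T s x\<close>. The projection in the limit lets the
  continuity of the extended map be used without first locating \<open>A x\<close> in
  \<open>Y\<close>.\<close>

lemma orbit_dom:
  assumes x: "x \<in> D" and s: "0 \<le> s"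
  shows "T s x \<in> D"
proof -
  have xY: "x \<in> Y" using x DY by blast
  have "((\<lambda>h. T s (\<pi> ((T h x - x) /\<^sub>R h))) \<longlongrightarrow> T s (\<pi> (A x))) (at_right 0)"
    by (rule bounded_linear.tendsto[OF bounded_linear_T[OF s] deriv0[OF x]])
  moreover have "eventually (\<lambda>h. T s (\<pi> ((T h x - x) /\<^sub>R h)) = (T h (T s x) - T s x) /\<^sub>R h) (at_right 0)"
    using eventually_at_right_less
  proof eventually_elim
    case (elim h)
    have "T h x \<in> Y" using elim xY inY by simp
    moreover have "T s (T h x) = T h (T s x)"
      using semi[of s h x] semi[of h s x] elim s xY by (simp add: add.commute)
    ultimately show ?case
      using xY s by (simp add: idem subspace_diff[OF subspace_Y] subspace_mul[OF subspace_Y] T_scale T_diff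
          flip: divide_inverse)
  qed
  ultimately have "((\<lambda>h. (T h (T s x) - T s x) /\<^sub>R h) \<longlongrightarrow> T s (\<pi> (A x))) (at_right 0)"
    by (rule Lim_transform_eventually)
  then show ?thesis by (rule domI[OF inY[OF s xY]])
qed

text \<open>The averages of the orbit of \<open>y\<close> over \<open>{0..h}\<close> lie in the
  domain and tend to \<open>y\<close> as \<open>h\<close> tends to 0.\<close>

lemma dense:
  assumes y: "y \<in> Y"
  shows "y \<in> closure D"
proof -
  define I where "I t = integral {0..t} (\<lambda>s. T s y)" for t
  have cy: "continuous_on {0..b} (\<lambda>s. T s y)" for b
    by (rule continuous_on_subset[OF cont[OF y]]) auto
  have I': "((\<lambda>k. (I (s + k) - I s) /\<^sub>R k) \<longlongrightarrow> T s y) (at_right 0)" if "0 \<le> s" for s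
    using integral_has_vector_derivative[OF cy, of s "s + 1"] that
    by (intro vector_derivative_imp_right[where a = 0 and b = "s + 1"]) (auto simp: I_def)
  have I0: "I 0 = 0" by (simp add: I_def)
  have IY: "I t \<in> Y" if "0 \<le> t" for t
  proof -
    have "\<pi> (I t) = integral {0..t} (\<lambda>s. \<pi> (T s y))"
      unfolding I_def
      by (rule Henstock_Kurzweil_Integration.integral_linear[OF integrable_continuous_real[OF cy] bl, unfolded o_def, symmetric])
    also have "\<dots> = I t" unfolding I_def
      by (rule Henstock_Kurzweil_Integration.integral_cong) (simp add: idem inY y)
    finally show ?thesis using piY[of "I t"] by simp
  qed
  have ID: "I h \<in> D" if h: "0 < h" for h
  proof (rule domI[OF IY])
    have eq: "T k (I h) = I (h + k) - I k" if k: "0 < k" for k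
    proof -
      have "T k (\<pi> (I h)) = integral {0..h} (\<lambda>s. T k (\<pi> (T s y)))"
        unfolding I_def using bounded_linear_T[of k] k
        by (intro Henstock_Kurzweil_Integration.integral_linear[OF integrable_continuous_real[OF cy], unfolded o_def, symmetric]) auto
      also have "\<dots> = integral {0..h} (\<lambda>s. T (s + k) y)"
        by (rule Henstock_Kurzweil_Integration.integral_cong) (use k in \<open>simp add: idem inY y semi[symmetric] add.commute\<close>)
      also have "\<dots> = integral {k..h + k} (\<lambda>s. T s y)"
        using integral_shift_Icc_real[of 0 h "\<lambda>s. T s y" k] by (simp add: o_def add.commute)
      also have "\<dots> = I (h + k) - I k"
        unfolding I_def
        using Henstock_Kurzweil_Integration.integral_combine[of 0 k "h + k" "\<lambda>s. T s y"] k h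
          integrable_continuous_real[OF cy, of "h + k"] by (simp add: algebra_simps)
      finally show ?thesis using IY h by (simp add: idem)
    qed
    \<comment> \<open>By the shift identity the difference quotient of the semigroup at
      \<open>I h\<close> is the quotient of the primitive at \<open>h\<close> minus its quotient at
      \<open>0\<close>.\<close>
    have "((\<lambda>k. (I (h + k) - I h) /\<^sub>R k - (I (0 + k) - I 0) /\<^sub>R k) \<longlongrightarrow> T h y - T 0 y) (at_right 0)"
      by (intro tendsto_diff I') (use h in auto)
    moreover have "eventually (\<lambda>k. (I (h + k) - I h) /\<^sub>R k - (I (0 + k) - I 0) /\<^sub>R k = (T k (I h) - I h) /\<^sub>R k) (at_right 0)"
      using eventually_at_right_less by eventually_elim (simp add: eq I0 algebra_simps)
    ultimately show "((\<lambda>k. (T k (I h) - I h) /\<^sub>R k) \<longlongrightarrow> T h y - T 0 y) (at_right 0)"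
      by (rule Lim_transform_eventually)
  qed (use h in simp)
  have mul: "c *\<^sub>R x \<in> D" if "x \<in> D" for c x
  proof (rule domI)
    have xY: "x \<in> Y" using that DY by blast
    then show "c *\<^sub>R x \<in> Y" by (rule subspace_mul[OF subspace_Y])
    have "((\<lambda>h. c *\<^sub>R ((T h x - x) /\<^sub>R h)) \<longlongrightarrow> c *\<^sub>R A x) (at_right 0)"
      by (intro tendsto_scaleR tendsto_const deriv0 that)
    moreover have "eventually (\<lambda>h. c *\<^sub>R ((T h x - x) /\<^sub>R h) = (T h (c *\<^sub>R x) - c *\<^sub>R x) /\<^sub>R h) (at_right 0)"
      using eventually_at_right_less by eventually_elim (simp add: T_scale xY algebra_simps)
    ultimately show "((\<lambda>h. (T h (c *\<^sub>R x) - c *\<^sub>R x) /\<^sub>R h) \<longlongrightarrow> c *\<^sub>R A x) (at_right 0)"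
      by (rule Lim_transform_eventually)
  qed
  have "((\<lambda>k. (I (0 + k) - I 0) /\<^sub>R k) \<longlongrightarrow> y) (at_right 0)"
    using I'[of 0] at0[OF y] by simp
  then have lim: "((\<lambda>k. I k /\<^sub>R k) \<longlongrightarrow> y) (at_right 0)" by (simp add: I_def)
  show ?thesis
  proof (rule Lim_in_closed_set[OF closed_closure _ _ lim])
    show "eventually (\<lambda>k. I k /\<^sub>R k \<in> closure D) (at_right 0)"
      using eventually_at_right_less
      by eventually_elim (use ID mul closure_subset in blast)
  qed simp
qed

text \<open>\<open>P\<close> is meaningful on \<open>Y\<close> only; composing with the projection
  allows closedness to be stated in the ambient space.\<close>

lemma dense_induct:
  assumes "closed {x. P (\<pi> x)}" "\<And>x. x \<in> D \<Longrightarrow> P x" "y \<in> Y"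
  shows "P y"
proof -
  have "closure D \<subseteq> {x. P (\<pi> x)}"
    by (rule closure_minimal[OF _ assms(1)]) (use assms(2) DY idem in auto)
  then show ?thesis using dense[OF assms(3)] assms(3) idem by auto
qed

end

text \<open>Duhamel's formula: \<open>T (t - s) (S s x)\<close> runs from \<open>T t x\<close> to
  \<open>S t x\<close> as \<open>s\<close> runs over \<open>{0..t}\<close>, and its right derivative
  is the integrand. With \<open>Z = Y\<close> it compares a generator with a perturbation, with
  \<open>G = 0\<close> a semigroup with its restriction to a smaller space.\<close>

lemma semigroup_variation:
  assumes T: "projected_semigroup Y D A T \<pi>" and S: "projected_semigroup Z D' A' S \<pi>'"
    and sub: "Z \<subseteq> Y" "D' \<subseteq> D"
    and bound: "\<And>s x. 0 \<le> s \<Longrightarrow> s \<le> t \<Longrightarrow> x \<in> Y \<Longrightarrow> norm (T s x) \<le> B * norm x"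
    and t: "0 \<le> t" and x: "x \<in> D'"
    and AA: "\<And>y. y \<in> D' \<Longrightarrow> A' y - A y = G y"
    and G: "continuous_on Z G" "G ` Z \<subseteq> Y"
  shows "((\<lambda>s. T (t - s) (G (S s x))) has_integral (S t x - T t x)) {0..t}"
proof -
  interpret T: projected_semigroup Y D A T \<pi> by fact
  interpret S: projected_semigroup Z D' A' S \<pi>' by fact
  have xZ: "x \<in> Z" using x S.DY by blast
  have SZ: "S s x \<in> Z" if "0 \<le> s" for s using S.inY that xZ by blast
  have Scont: "continuous_on {0..t} (\<lambda>s. S s x)" by (rule continuous_on_subset[OF S.cont[OF xZ]]) auto
  have lip: "norm (T s x - T s y) \<le> B * norm (x - y)" if "s \<in> {0..t}" "x \<in> Y" "y \<in> Y" for s x y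
    by (rule T.T_lipschitz) (use bound that in auto)
  have Tcont: "continuous_on {0..t} (\<lambda>s. T s y)" if "y \<in> Y" for y
    by (rule continuous_on_subset[OF T.cont[OF that]]) auto
  define w where "w s = T (t - s) (S s x)" for s
  have "((\<lambda>s. T (t - s) (G (S s x))) has_integral (w t - w 0)) {0..t}"
  proof (rule has_integral_right_derivative[OF t])
    show "continuous_on {0..t} w" unfolding w_def
      by (rule continuous_on_orbit[OF lip Tcont]) (use Scont SZ sub in \<open>auto intro!: continuous_intros\<close>)
    show "continuous_on {0..t} (\<lambda>s. T (t - s) (G (S s x)))"
      by (rule continuous_on_orbit[OF lip Tcont])
        (use SZ sub G in \<open>auto intro!: continuous_intros continuous_on_compose2[OF G(1) Scont]\<close>)
    fix s assume s: "0 \<le> s" "s < t"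
    let ?y = "S s x"
    have yD': "?y \<in> D'" by (rule S.orbit_dom[OF x s(1)])
    have yY: "?y \<in> Y" "?y \<in> Z" using SZ s sub by auto
    have "((\<lambda>h. (S h ?y - ?y) /\<^sub>R h - (T h ?y - ?y) /\<^sub>R h) \<longlongrightarrow> A' ?y - A ?y) (at_right 0)"
      by (intro tendsto_diff S.deriv0 T.deriv0) (use yD' sub in auto)
    then have q: "((\<lambda>h. (S h ?y - T h ?y) /\<^sub>R h) \<longlongrightarrow> G ?y) (at_right 0)"
      by (simp add: AA[OF yD', symmetric] algebra_simps)
    have small: "eventually (\<lambda>h. 0 < h \<and> h < t - s) (at_right (0::real))"
      using eventually_at_right_less eventually_at_right_real[of 0 "t - s"] s
      by (auto elim: eventually_elim2)
    \<comment> \<open>The increment over \<open>{s..s + h}\<close> is \<open>T (t - s - h)\<close>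
      applied to \<open>S h ?y - T h ?y\<close>. Hence both semigroups are differentiated at time 0
      from the right only, and the moving outer time is handled by joint continuity.\<close>
    have "((\<lambda>h. T (t - s - h) ((S h ?y - T h ?y) /\<^sub>R h)) \<longlongrightarrow> T (t - s) (G ?y)) (at_right 0)"
    proof (rule tendsto_orbit[OF lip Tcont _ _ _ q])
      show "((\<lambda>h. t - s - h) \<longlongrightarrow> t - s) (at_right 0)" by (auto intro!: tendsto_eq_intros)
      show "eventually (\<lambda>h. t - s - h \<in> {0..t}) (at_right 0)"
        using small by eventually_elim (use s in auto)
      show "eventually (\<lambda>h. (S h ?y - T h ?y) /\<^sub>R h \<in> Y) (at_right 0)"
        using small by eventually_elim
          (intro subspace_mul[OF T.subspace_Y] subspace_diff[OF T.subspace_Y] T.inY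
            subsetD[OF sub(1) S.inY] yY, auto)
      show "G ?y \<in> Y" using G yY by auto
    qed (use s in auto)
    moreover have "eventually (\<lambda>h. T (t - s - h) ((S h ?y - T h ?y) /\<^sub>R h) = (w (s + h) - w s) /\<^sub>R h) (at_right 0)"
      using small
    proof eventually_elim
      case (elim h)
      have 1: "S h ?y = S (s + h) x" using S.semi[of h s x] elim s xZ by (simp add: add.commute)
      have 2: "T (t - s - h) (T h ?y) = T (t - s) ?y" using T.semi[of "t - s - h" h ?y] elim yY by simp
      have 4: "T (t - (s + h)) z = T (t - s - h) z" for z by (simp add: diff_diff_add)
      have 3: "S h ?y \<in> Y" "T h ?y \<in> Y" using S.inY T.inY yY elim sub by auto
      show ?case
        using elim 3 by (simp add: T.T_scale T.T_diff subspace_diff[OF T.subspace_Y] w_def 4 2 1)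
    qed
    ultimately show "((\<lambda>h. (w (s + h) - w s) /\<^sub>R h) \<longlongrightarrow> T (t - s) (G (S s x))) (at_right 0)"
      by (rule Lim_transform_eventually)
  qed
  moreover have "w t = S t x" "w 0 = T t x"
    using T.at0 SZ[OF t] sub S.at0[OF xZ] by (auto simp: w_def)
  ultimately show ?thesis by simp
qed

text \<open>Two semigroups whose generators agree on the smaller domain differ by a Duhamel integral
  with zero integrand; density extends the equality to \<open>Z\<close>. Taking \<open>Z = Y\<close>
  would be the uniqueness of the semigroup of a generator.\<close>

lemma semigroup_restrict:
  assumes T: "projected_semigroup Y D A T \<pi>" and S: "projected_semigroup Z D' A' S \<pi>'"
    and sub: "Z \<subseteq> Y" "D' \<subseteq> D" and AA: "\<And>y. y \<in> D' \<Longrightarrow> A' y = A y"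
    and bound: "\<And>s x. 0 \<le> s \<Longrightarrow> s \<le> t \<Longrightarrow> x \<in> Y \<Longrightarrow> norm (T s x) \<le> B * norm x"
    and t: "0 \<le> t" and x: "x \<in> Z"
  shows "S t x = T t x"
proof -
  interpret T: projected_semigroup Y D A T \<pi> by fact
  interpret S: projected_semigroup Z D' A' S \<pi>' by fact
  show ?thesis
  proof (rule S.dense_induct[where P = "\<lambda>x. S t x = T t x", OF _ _ x])
    have "T t (\<pi>' x) = T t (\<pi> (\<pi>' x))" for x using T.idem sub S.piY by (metis subsetD)
    then have "closed {x. S t (\<pi>' x) = T t (\<pi> (\<pi>' x))}"
      by (intro closed_Collect_eq linear_continuous_on S.bounded_linear_T[OF t]
          bounded_linear_compose[OF T.bounded_linear_T[OF t] S.bl])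
    then show "closed {x. S t (\<pi>' x) = T t (\<pi>' x)}"
      using \<open>\<And>x. T t (\<pi>' x) = T t (\<pi> (\<pi>' x))\<close> by simp
  next
    fix x assume "x \<in> D'"
    have "((\<lambda>s. T (t - s) ((\<lambda>_. 0) (S s x))) has_integral (S t x - T t x)) {0..t}"
      by (rule semigroup_variation[OF T S sub bound t \<open>x \<in> D'\<close>, where G = "\<lambda>_. 0"])
        (use AA subspace_0[OF T.subspace_Y] in auto)
    moreover have "((\<lambda>s. T (t - s) 0) has_integral 0) {0..t}"
      by (rule has_integral_is_0) (simp add: T.T_zero)
    ultimately have "S t x - T t x = 0" using has_integral_unique by blast
    then show "S t x = T t x" by simp
  qed
qed

text \<open>The known bound on the perturbed semigroup \<open>S\<close> gives the local boundedness of \<open>T\<close> by a Gronwall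
  argument, which saves an appeal to the uniform boundedness principle.\<close>

lemma perturbed_semigroup_bound:
  assumes T: "projected_semigroup Y D A T \<pi>" and S: "projected_semigroup Y D A' S \<pi>"
    and SB: "\<And>t x. 0 \<le> t \<Longrightarrow> x \<in> Y \<Longrightarrow> norm (S t x) \<le> C * norm x" and C: "0 \<le> C"
    and AA: "\<And>y. y \<in> D \<Longrightarrow> A y - A' y = G y"
    and G: "bounded_linear G" "G ` Y \<subseteq> Y" "\<And>x. norm (G x) \<le> K * norm x" "0 \<le> K"
    and t: "0 \<le> t" and x: "x \<in> Y"
  shows "norm (T t x) \<le> C * exp (C * K * t) * norm x"
    and "norm (T t x - S t x) \<le> t * (C * K * (C * exp (C * K * t))) * norm x"
proof -
  interpret T: projected_semigroup Y D A T \<pi> by fact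
  interpret S: projected_semigroup Y D A' S \<pi> by fact
  \<comment> \<open>The roles are chosen so that the outer semigroup is \<open>S\<close>, whose
    bound is known, and the unknown growth of \<open>T\<close> appears only inside the integral,
    where Gronwall applies.\<close>
  have var: "((\<lambda>s. S (t - s) (G (T s x))) has_integral (T t x - S t x)) {0..t}" if "x \<in> D" "0 \<le> t" for x t
    by (rule semigroup_variation[OF S T _ _ _ that(2,1) AA])
      (use SB G(2) in \<open>auto intro: linear_continuous_on[OF G(1)]\<close>)
  have SG: "norm (S (t - s) (G (T s x))) \<le> C * K * norm (T s x)" if "0 \<le> s" "s \<le> t" "x \<in> Y" for s t x
  proof -
    have "T s x \<in> Y" by (rule T.inY) (use that in auto)
    then have "norm (S (t - s) (G (T s x))) \<le> C * norm (G (T s x))"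
      by (intro SB) (use that G(2) in auto)
    also have "\<dots> \<le> C * (K * norm (T s x))" by (intro mult_left_mono G C)
    finally show ?thesis by (simp add: mult.assoc)
  qed
  have cT: "continuous_on {0..t} (\<lambda>s. norm (T s x))" if "x \<in> Y" for x t
    by (intro continuous_intros continuous_on_subset[OF T.cont[OF that]]) auto
  \<comment> \<open>Duhamel's formula is available on the domain only; the resulting inequality is
    closed and passes to \<open>Y\<close> by density in \<open>Y1\<close>.\<close>
  have D1: "norm (T t x) \<le> C * exp (C * K * t) * norm x" if xD: "x \<in> D" and t: "0 \<le> t" for x t
  proof -
    have xY: "x \<in> Y" using xD T.DY by blast
    have "norm (T t x) \<le> (C * norm x) * exp (C * K * t)"
    proof (rule gronwall_comparison[where u = "\<lambda>s. norm (T s x)" and \<phi> = "\<lambda>_. 0" and b = t and l = 0 and h = "C * K"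
          and a = "C * norm x" and g = "\<lambda>s. (C * norm x) * exp (C * K * s)"])
      fix s assume s: "0 \<le> s" "s \<le> t"
      have "norm (T s x) \<le> norm (S s x) + norm (T s x - S s x)"
        using norm_triangle_ineq[of "S s x" "T s x - S s x"] by simp
      also have "norm (S s x) \<le> C * norm x" by (rule SB[OF s(1) xY])
      also have "norm (T s x - S s x) \<le> integral {0..s} (\<lambda>r. C * K * norm (T r x))"
        unfolding integral_unique[OF var[OF xD s(1)], symmetric]
        by (rule Henstock_Kurzweil_Integration.integral_norm_bound_integral)
          (use has_integral_integrable[OF var[OF xD s(1)]] SG xY in
            \<open>auto intro!: integrable_continuous_real[of _ _ "\<lambda>r. C * K * norm (T r x)"] continuous_intros cT\<close>)
      finally show "norm (T s x) \<le> exp (0 * s) * (C * norm x)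
          + integral {0..s} (\<lambda>r. exp (0 * (s - r)) * (C * K * norm (T r x) + 0))"
        by simp
    qed (use cT[OF xY] G(4) C t in \<open>auto intro!: derivative_eq_intros\<close>)
    then show ?thesis by (simp add: mult_ac)
  qed
  have cl: "closed {x. norm (f (\<pi> x)) \<le> c * norm (\<pi> x)}" if "bounded_linear (\<lambda>x. f (\<pi> x))" for f and c :: real
    by (intro closed_Collect_le continuous_intros linear_continuous_on that T.bl)
  have Y1: "norm (T t x) \<le> C * exp (C * K * t) * norm x" if "x \<in> Y" "0 \<le> t" for x t
    by (rule T.dense_induct[OF cl D1 that(1)]) (use T.bounded_linear_T that in auto)
  show "norm (T t x) \<le> C * exp (C * K * t) * norm x" by (rule Y1[OF x t])
  show "norm (T t x - S t x) \<le> t * (C * K * (C * exp (C * K * t))) * norm x"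
  proof (rule T.dense_induct[where P = "\<lambda>x. norm (T t x - S t x) \<le> t * (C * K * (C * exp (C * K * t))) * norm x",
        OF cl _ x])
    show "bounded_linear (\<lambda>x. T t (\<pi> x) - S t (\<pi> x))"
      by (intro bounded_linear_sub T.bounded_linear_T S.bounded_linear_T t)
    fix x assume xD: "x \<in> D"
    then have xY: "x \<in> Y" using T.DY by blast
    have "norm (T t x - S t x) \<le> integral {0..t} (\<lambda>r. C * K * (C * exp (C * K * t) * norm x))"
      unfolding integral_unique[OF var[OF xD t], symmetric]
    proof (rule Henstock_Kurzweil_Integration.integral_norm_bound_integral)
      show "(\<lambda>s. S (t - s) (G (T s x))) integrable_on {0..t}" using var[OF xD t] by blast
      fix s assume s: "s \<in> {0..t}"
      have "norm (T s x) \<le> C * exp (C * K * s) * norm x" by (rule Y1) (use s xY in auto)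
      also have "\<dots> \<le> C * exp (C * K * t) * norm x"
        using s C G(4) by (intro mult_right_mono mult_left_mono) (auto intro!: mult_left_mono)
      finally have "C * K * norm (T s x) \<le> C * K * (C * exp (C * K * t) * norm x)"
        by (intro mult_left_mono) (use C G(4) in auto)
      then show "norm (S (t - s) (G (T s x))) \<le> C * K * (C * exp (C * K * t) * norm x)"
        using SG[of s t x] s xY by auto
    qed auto
    then show "norm (T t x - S t x) \<le> t * (C * K * (C * exp (C * K * t))) * norm x"
      using t by (simp add: mult_ac)
  qed
qed

text \<open>Outside the domain neither semigroup need be differentiable at 0, but their difference
  is: its quotients are uniformly bounded operators for small \<open>h\<close>, so the limit known
  on the domain extends by density. This is used along mild solutions, which may leave the
  domain.\<close>

lemma perturbed_semigroup_derivative: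
  assumes T: "projected_semigroup Y D A T \<pi>" and S: "projected_semigroup Y D A' S \<pi>"
    and SB: "\<And>t x. 0 \<le> t \<Longrightarrow> x \<in> Y \<Longrightarrow> norm (S t x) \<le> C * norm x" and C: "0 \<le> C"
    and AA: "\<And>y. y \<in> D \<Longrightarrow> A y - A' y = G y"
    and G: "bounded_linear G" "G ` Y \<subseteq> Y" "\<And>x. norm (G x) \<le> K * norm x" "0 \<le> K"
    and y: "y \<in> Y"
  shows "((\<lambda>h. (T h y - S h y) /\<^sub>R h) \<longlongrightarrow> G y) (at_right 0)"
proof (rule tendstoI)
  interpret T: projected_semigroup Y D A T \<pi> by fact
  interpret S: projected_semigroup Y D A' S \<pi> by fact
  fix e :: real assume e: "e > 0"
  define K' where "K' = C * K * (C * exp (C * K * 1))"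
  have K': "K' \<ge> 0" using C G(4) by (simp add: K'_def)
  \<comment> \<open>Replacing \<open>y\<close> by a domain point within \<open>\<delta>\<close>
    costs a factor \<open>K'\<close> in the quotient and \<open>K\<close> in the limit, together at
    most \<open>e / 2\<close>.\<close>
  define \<delta> where "\<delta> = e / (2 * (K' + K + 1))"
  have \<delta>: "\<delta> > 0" using e K' G(4) by (simp add: \<delta>_def)
  obtain x where x: "x \<in> D" "dist x y < \<delta>"
    using T.dense[OF y] \<delta> unfolding closure_approachable by blast
  have xY: "x \<in> Y" using x T.DY by blast
  have "((\<lambda>h. (T h x - x) /\<^sub>R h - (S h x - x) /\<^sub>R h) \<longlongrightarrow> A x - A' x) (at_right 0)"
    by (intro tendsto_diff T.deriv0 S.deriv0 x)
  then have "((\<lambda>h. (T h x - S h x) /\<^sub>R h) \<longlongrightarrow> G x) (at_right 0)"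
    by (simp add: AA[OF x(1), symmetric] algebra_simps)
  then have "eventually (\<lambda>h. dist ((T h x - S h x) /\<^sub>R h) (G x) < e / 2) (at_right 0)"
    using e by (intro tendstoD) auto
  moreover have "eventually (\<lambda>h. h < 1) (at_right (0::real))"
    using eventually_at_right_real[of 0 1] by (auto elim: eventually_mono)
  ultimately show "eventually (\<lambda>h. dist ((T h y - S h y) /\<^sub>R h) (G y) < e) (at_right 0)"
    using eventually_at_right_less
  proof eventually_elim
    case (elim h)
    have d: "y - x \<in> Y" by (rule subspace_diff[OF T.subspace_Y y xY])
    have "norm (T h (y - x) - S h (y - x)) \<le> h * (C * K * (C * exp (C * K * h))) * norm (y - x)"
      by (rule perturbed_semigroup_bound(2)[OF T S SB C AA G]) (use elim d in auto)
    also have "\<dots> \<le> h * K' * norm (y - x)"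
      using elim C G(4) unfolding K'_def
      by (intro mult_right_mono mult_left_mono) (auto intro!: mult_left_le mult_nonneg_nonneg)
    finally have "norm ((T h (y - x) - S h (y - x)) /\<^sub>R h) \<le> K' * norm (y - x)"
      using elim by (simp add: inverse_eq_divide pos_divide_le_eq mult_ac flip: divide_inverse_commute)
    moreover have "(T h (y - x) - S h (y - x)) /\<^sub>R h = (T h y - S h y) /\<^sub>R h - (T h x - S h x) /\<^sub>R h"
      using elim by (simp add: T.T_diff S.T_diff xY y algebra_simps)
    moreover have "norm (G x - G y) \<le> K * norm (y - x)"
      using G(3)[of "x - y"] by (simp add: linear_diff[OF bounded_linear.linear[OF G(1)]] norm_minus_commute)
    moreover have "dist ((T h y - S h y) /\<^sub>R h) (G y) \<le> norm ((T h y - S h y) /\<^sub>R h - (T h x - S h x) /\<^sub>R h)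
        + dist ((T h x - S h x) /\<^sub>R h) (G x) + norm (G x - G y)"
      unfolding dist_norm by (rule order_trans[OF _ add_right_mono[OF norm_triangle_ineq]],
        rule order_trans[OF _ norm_triangle_ineq]) simp
    ultimately have "dist ((T h y - S h y) /\<^sub>R h) (G y) < (K' + K) * norm (y - x) + e / 2"
      using elim by (simp add: distrib_right)
    also have "(K' + K) * norm (y - x) \<le> (K' + K + 1) * \<delta>"
      using x(2) K' G(4) by (intro mult_mono) (auto simp: dist_norm norm_minus_commute)
    also have "(K' + K + 1) * \<delta> = e / 2" using K' G(4) by (simp add: \<delta>_def field_simps)
    finally show ?case by simp
  qed
qed

section \<open>Mild solutions\<close>

definition mild_conv :: "(real \<Rightarrow> 'a::banach \<Rightarrow> 'a) \<Rightarrow> (real \<Rightarrow> 'a) \<Rightarrow> real \<Rightarrow> 'a" where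
  "mild_conv E g t = integral {0..t} (\<lambda>s. E (t - s) (g s))"

text \<open>A semigroup on a complemented closed subspace, extended to the whole space by composing with
  the projection \<open>E 0\<close>.\<close>

locale bounded_semigroup =
  fixes E :: "real \<Rightarrow> 'a::banach \<Rightarrow> 'a" and C :: real
  assumes bl: "\<And>t. 0 \<le> t \<Longrightarrow> bounded_linear (E t)"
    and bound: "\<And>t x. 0 \<le> t \<Longrightarrow> norm (E t x) \<le> C * norm x"
    and C_nonneg: "0 \<le> C"
    and semi: "\<And>s t x. 0 \<le> s \<Longrightarrow> 0 \<le> t \<Longrightarrow> E (s + t) x = E s (E t x)"
    and cont: "\<And>x. continuous_on {0..} (\<lambda>t. E t x)"
begin

lemma add: "0 \<le> t \<Longrightarrow> E t (x + y) = E t x + E t y"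
  and diff: "0 \<le> t \<Longrightarrow> E t (x - y) = E t x - E t y"
  and scale: "0 \<le> t \<Longrightarrow> E t (c *\<^sub>R x) = c *\<^sub>R E t x"
  and zero: "0 \<le> t \<Longrightarrow> E t 0 = 0"
  using bl[THEN bounded_linear.linear] by (auto intro: linear_add linear_diff linear_scale linear_0)

lemma lipschitz: "0 \<le> t \<Longrightarrow> norm (E t x - E t y) \<le> C * norm (x - y)"
  by (simp add: diff[symmetric] bound)

lemma cont_orbit:
  assumes "continuous_on S f" "f ` S \<subseteq> {0..}" "continuous_on S g"
  shows "continuous_on S (\<lambda>s. E (f s) (g s))"
  by (rule continuous_on_orbit[where J = "{0..}" and Y = UNIV and B = C])
    (use assms lipschitz cont in auto)

lemma integrable:
  assumes "continuous_on {a..b} g" "b \<le> t"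
  shows "(\<lambda>s. E (t - s) (g s)) integrable_on {a..b}"
  by (intro integrable_continuous_real cont_orbit continuous_intros assms) (use assms in auto)

lemma conv_has_integral:
  assumes "continuous_on {0..t} g"
  shows "((\<lambda>s. E (t - s) (g s)) has_integral mild_conv E g t) {0..t}"
  unfolding mild_conv_def using integrable[OF assms] by (simp add: integrable_integral)

lemma norm_conv_le:
  assumes "continuous_on {0..t} g" "\<And>s. 0 \<le> s \<Longrightarrow> s \<le> t \<Longrightarrow> norm (E (t - s) (g s)) \<le> \<phi> s"
    "\<phi> integrable_on {0..t}"
  shows "norm (mild_conv E g t) \<le> integral {0..t} \<phi>"
  unfolding mild_conv_def
  by (rule Henstock_Kurzweil_Integration.integral_norm_bound_integral) (use assms integrable in auto)

lemma conv_diff: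
  assumes "continuous_on {0..t} f" "continuous_on {0..t} g"
  shows "mild_conv E (\<lambda>s. f s - g s) t = mild_conv E f t - mild_conv E g t"
proof -
  have "mild_conv E (\<lambda>s. f s - g s) t = integral {0..t} (\<lambda>s. E (t - s) (f s) - E (t - s) (g s))"
    unfolding mild_conv_def by (rule Henstock_Kurzweil_Integration.integral_cong) (simp add: diff)
  also have "\<dots> = mild_conv E f t - mild_conv E g t"
    unfolding mild_conv_def
    by (rule Henstock_Kurzweil_Integration.integral_diff) (use integrable assms in auto)
  finally show ?thesis .
qed

lemma conv_cong:
  assumes "\<And>s. 0 \<le> s \<Longrightarrow> s \<le> t \<Longrightarrow> f s = g s"
  shows "mild_conv E f t = mild_conv E g t"
  unfolding mild_conv_def by (rule Henstock_Kurzweil_Integration.integral_cong) (use assms in auto)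

lemma conv_zero [simp]: "mild_conv E g 0 = 0"
  by (simp add: mild_conv_def)

text \<open>Moves the dependence on \<open>t\<close> from the interval of integration into the
  integrand, so that continuity in \<open>t\<close> follows from that of integrals with a
  parameter.\<close>

lemma conv_rescale:
  assumes t: "0 \<le> t"
  shows "mild_conv E g t = t *\<^sub>R integral (cbox 0 1) (\<lambda>\<theta>. E (t - t * \<theta>) (g (t * \<theta>)))"
proof (cases "t = 0")
  case False
  then have t: "t > 0" using t by simp
  define f where "f s = E (t - s) (g s)" for s
  have "integral (cbox 0 1) (\<lambda>\<theta>. f (t * \<theta>)) = integral {0..t} f /\<^sub>R t"
    using integral_stretch_real[of t 0 t f] t by (simp add: inverse_eq_divide)
  then show ?thesis using t unfolding mild_conv_def f_def by simp
qed simp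

lemma conv_continuous:
  assumes g: "continuous_on {0..b} g"
  shows "continuous_on {0..b} (mild_conv E g)"
proof -
  have "continuous_on ({0..b} \<times> cbox 0 1) (\<lambda>(t, \<theta>). E (t - t * \<theta>) (g (t * \<theta>)))"
    unfolding split_beta
  proof (rule cont_orbit)
    show "continuous_on ({0..b} \<times> cbox 0 1) (\<lambda>x. g (fst x * snd x))"
    proof (rule continuous_on_compose2[OF g])
      show "(\<lambda>x. fst x * snd x) ` ({0..b} \<times> cbox 0 1) \<subseteq> {0..b}"
        by (auto intro: order_trans[OF mult_left_le])
    qed (intro continuous_intros)
  qed (auto intro!: continuous_intros mult_left_le)
  then have "continuous_on {0..b} (\<lambda>t. t *\<^sub>R integral (cbox 0 1) (\<lambda>\<theta>. E (t - t * \<theta>) (g (t * \<theta>))))"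
    by (intro continuous_on_scaleR continuous_on_id integral_continuous_on_param)
  then show ?thesis by (rule continuous_on_eq) (simp add: conv_rescale)
qed

lemma conv_continuous_Ici:
  assumes "continuous_on {0..} g"
  shows "continuous_on {0..} (mild_conv E g)"
proof -
  have "continuous_on {0..<b} (mild_conv E g)" for b
    by (rule continuous_on_subset[OF conv_continuous[of b]], rule continuous_on_subset[OF assms]) auto
  then have "isCont (\<lambda>x. mild_conv E g (max 0 x)) t" for t
  proof -
    have "continuous_on {..<\<bar>t\<bar> + 1} (\<lambda>x. mild_conv E g (max 0 x))"
      by (rule continuous_on_compose2[OF \<open>\<And>b. continuous_on {0..<b} (mild_conv E g)\<close>[of "\<bar>t\<bar> + 1"]])
        (auto intro!: continuous_intros)
    then show ?thesis by (rule continuous_on_interior) (simp add: interior_open)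
  qed
  then have "continuous_on {0..} (\<lambda>x. mild_conv E g (max 0 x))"
    by (simp add: continuous_at_imp_continuous_on)
  then show ?thesis by (rule continuous_on_eq) simp
qed

lemma mild_step:
  assumes g: "continuous_on {0..t + h} g" and t: "0 \<le> t" "0 \<le> h"
  shows "E (t + h) \<xi> + mild_conv E g (t + h) =
    E h (E t \<xi> + mild_conv E g t) + integral {0..h} (\<lambda>s. E (h - s) (g (t + s)))"
proof -
  have "mild_conv E g (t + h) = integral {0..t} (\<lambda>s. E (t + h - s) (g s)) + integral {t..t + h} (\<lambda>s. E (t + h - s) (g s))"
    unfolding mild_conv_def
    by (rule Henstock_Kurzweil_Integration.integral_combine[symmetric]) (use t g integrable in auto)
  also have "integral {0..t} (\<lambda>s. E (t + h - s) (g s)) = integral {0..t} (\<lambda>s. E h (E (t - s) (g s)))"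
    by (rule Henstock_Kurzweil_Integration.integral_cong) (use t in \<open>simp add: semi[symmetric] algebra_simps\<close>)
  also have "\<dots> = E h (mild_conv E g t)"
    unfolding mild_conv_def
    by (rule Henstock_Kurzweil_Integration.integral_linear[OF integrable bl, unfolded o_def])
      (use t in \<open>auto intro: continuous_on_subset[OF g]\<close>)
  also have "integral {t..t + h} (\<lambda>s. E (t + h - s) (g s)) = integral {0..h} (\<lambda>s. E (h - s) (g (t + s)))"
    using integral_shift_Icc_real[of 0 h "\<lambda>s. E (t + h - s) (g s)" t]
    by (simp add: o_def add.commute algebra_simps)
  finally show ?thesis using t by (simp add: add semi[symmetric] add.commute)
qed

text \<open>The constant forcing \<open>k\<close> is enlarged to \<open>k * exp (C * l * t)\<close>,
  which makes the comparison function explicit. The bound is crude in time but enough for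
  uniqueness, continuous dependence and differentiability at a fixed time.\<close>

lemma mild_gronwall:
  assumes cont: "continuous_on {0..b} w" "continuous_on {0..b} q"
    and w: "\<And>t. 0 \<le> t \<Longrightarrow> t \<le> b \<Longrightarrow> w t = E t \<xi> + mild_conv E q t"
    and q: "\<And>t. 0 \<le> t \<Longrightarrow> t \<le> b \<Longrightarrow> norm (q t) \<le> l * norm (w t) + k"
    and nonneg: "0 \<le> l" "0 \<le> k" and t: "0 \<le> t" "t \<le> b"
  shows "norm (w t) \<le> (C * norm \<xi> + C * k * t) * exp (C * l * t)"
proof (rule gronwall_comparison[where u = "\<lambda>t. norm (w t)" and \<phi> = "\<lambda>t. C * k * exp (C * l * t)" and l = 0
      and h = "C * l" and a = "C * norm \<xi>" and g = "\<lambda>t. (C * norm \<xi> + C * k * t) * exp (C * l * t)" and b = b])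
  fix s assume s: "0 \<le> s" "s \<le> b"
  have sub: "continuous_on {0..s} w" "continuous_on {0..s} q"
    using cont s by (auto intro: continuous_on_subset)
  have "norm (w s) \<le> norm (E s \<xi>) + norm (mild_conv E q s)"
    unfolding w[OF s] by (rule norm_triangle_ineq)
  also have "norm (E s \<xi>) \<le> C * norm \<xi>" by (rule bound[OF s(1)])
  also have "norm (mild_conv E q s) \<le> integral {0..s} (\<lambda>r. C * l * norm (w r) + C * k * exp (C * l * r))"
  proof (rule norm_conv_le[OF sub(2)])
    fix r assume r: "0 \<le> r" "r \<le> s"
    have "norm (E (s - r) (q r)) \<le> C * norm (q r)" using r by (intro bound) auto
    also have "\<dots> \<le> C * (l * norm (w r) + k * exp (C * l * r))"
    proof (rule mult_left_mono[OF _ C_nonneg])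
      have "k * 1 \<le> k * exp (C * l * r)" using nonneg C_nonneg r by (intro mult_left_mono) auto
      then show "norm (q r) \<le> l * norm (w r) + k * exp (C * l * r)" using q[of r] r s by auto
    qed
    finally show "norm (E (s - r) (q r)) \<le> C * l * norm (w r) + C * k * exp (C * l * r)"
      by (simp add: algebra_simps)
  qed (intro integrable_continuous_real continuous_intros sub)
  finally show "norm (w s) \<le> exp (0 * s) * (C * norm \<xi>)
      + integral {0..s} (\<lambda>r. exp (0 * (s - r)) * (C * l * norm (w r) + C * k * exp (C * l * r)))"
    by simp
qed (use t nonneg C_nonneg in \<open>auto intro!: continuous_intros cont derivative_eq_intros simp: algebra_simps\<close>)

text \<open>Contraction in the bounded continuous functions for the weighted unknown
  \<open>exp (- \<omega> * t) *\<^sub>R x t\<close>, which covers the whole half-line at once.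
  \<open>F0\<close> and the Lipschitz bound give linear growth of \<open>F\<close>, so the iteration
  stays in this space.\<close>

lemma mild_solution_exists:
  assumes F: "\<And>x. continuous_on {0..} x \<Longrightarrow> continuous_on {0..} (\<lambda>t. F t (x t))"
    and F0: "\<And>t. 0 \<le> t \<Longrightarrow> F t 0 = 0"
    and lip: "\<And>t x y. 0 \<le> t \<Longrightarrow> norm (F t x - F t y) \<le> l * norm (x - y)" and l: "0 \<le> l"
  shows "\<exists>x. continuous_on {0..} x \<and> (\<forall>t\<ge>0. x t = E t \<xi> + mild_conv E (\<lambda>s. F s (x s)) t)"
proof -
  \<comment> \<open>Integrating the weight produces \<open>1 / \<omega>\<close>, so the contraction
    constant is \<open>C * l / \<omega> \<le> 1 / 2\<close>; the summand 1 keeps the weight positive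
    when \<open>C * l = 0\<close>.\<close>
  define \<omega> where "\<omega> = 2 * C * l + 1"
  have \<omega>: "\<omega> > 0" "C * l / \<omega> \<le> 1 / 2"
  proof -
    have "0 \<le> C * l" using C_nonneg l by simp
    then show "\<omega> > 0" "C * l / \<omega> \<le> 1 / 2" by (auto simp: \<omega>_def mult.assoc divide_simps)
  qed
  define G where "G y s = F s (exp (\<omega> * s) *\<^sub>R apply_bcontfun y s)" for y :: "real \<Rightarrow>\<^sub>C 'a" and s
  define H where "H y t = exp (- \<omega> * t) *\<^sub>R (E t \<xi> + mild_conv E (G y) t)" for y t
  have Gcont: "continuous_on {0..} (G y)" for y unfolding G_def by (intro F continuous_intros) auto
  have Gcont': "continuous_on {0..b} (G y)" for y b by (rule continuous_on_subset[OF Gcont]) auto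
  have Hcont: "continuous_on {0..} (H y)" for y
    unfolding H_def by (intro continuous_intros cont conv_continuous_Ici Gcont)
  have expint: "((\<lambda>s. exp (\<omega> * s)) has_integral (exp (\<omega> * t) - 1) / \<omega>) {0..t}" if "0 \<le> t" for t
  proof -
    have "((\<lambda>s. exp (\<omega> * s)) has_integral (exp (\<omega> * t) / \<omega> - exp (\<omega> * 0) / \<omega>)) {0..t}"
      by (rule fundamental_theorem_of_calculus[OF that])
        (use \<omega> in \<open>auto intro!: derivative_eq_intros simp: has_real_derivative_iff_has_vector_derivative[symmetric]\<close>)
    then show ?thesis by (simp add: diff_divide_distrib)
  qed
  have convle: "exp (- \<omega> * t) * norm (mild_conv E g t) \<le> d / 2"
    if t: "0 \<le> t" and g: "continuous_on {0..t} g" and d: "\<And>s. 0 \<le> s \<Longrightarrow> norm (g s) \<le> l * (exp (\<omega> * s) * d)" "0 \<le> d"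
    for t g d
  proof -
    have "norm (mild_conv E g t) \<le> integral {0..t} (\<lambda>s. exp (\<omega> * s) * (C * l * d))"
    proof (rule norm_conv_le[OF g])
      fix s assume s: "0 \<le> s" "s \<le> t"
      have "norm (E (t - s) (g s)) \<le> C * norm (g s)" using s by (intro bound) auto
      also have "\<dots> \<le> C * (l * (exp (\<omega> * s) * d))" by (intro mult_left_mono d C_nonneg s)
      finally show "norm (E (t - s) (g s)) \<le> exp (\<omega> * s) * (C * l * d)" by (simp add: mult_ac)
    qed (intro integrable_continuous_real continuous_intros)
    also have "\<dots> = (exp (\<omega> * t) - 1) / \<omega> * (C * l * d)"
      by (rule integral_unique[OF has_integral_mult_left[OF expint[OF t]]])
    also have "\<dots> = (exp (\<omega> * t) - 1) * (C * l / \<omega> * d)" by simp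
    also have "\<dots> \<le> (exp (\<omega> * t) - 1) * (1 / 2 * d)"
      using \<omega> t d by (intro mult_left_mono mult_right_mono) auto
    also have "\<dots> \<le> exp (\<omega> * t) * (1 / 2 * d)" using d by (intro mult_right_mono) auto
    finally have "exp (- \<omega> * t) * norm (mild_conv E g t) \<le> exp (- \<omega> * t) * (exp (\<omega> * t) * (1 / 2 * d))"
      by (intro mult_left_mono) auto
    also have "\<dots> = d / 2" by (simp add: mult.assoc[symmetric] exp_add[symmetric])
    finally show ?thesis .
  qed
  have G0: "norm (G y s) \<le> l * (exp (\<omega> * s) * norm y)" if "0 \<le> s" for y s
  proof -
    have "norm (G y s) \<le> l * norm (exp (\<omega> * s) *\<^sub>R apply_bcontfun y s)"
      using lip[OF that, of "exp (\<omega> * s) *\<^sub>R apply_bcontfun y s" 0] F0[OF that] by (simp add: G_def)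
    also have "\<dots> \<le> l * (exp (\<omega> * s) * norm y)"
      using l norm_bounded[of y s] by (intro mult_left_mono) auto
    finally show ?thesis .
  qed
  have Gd: "norm (G y s - G z s) \<le> l * (exp (\<omega> * s) * dist y z)" if "0 \<le> s" for y z s
  proof -
    have "norm (G y s - G z s) \<le> l * norm (exp (\<omega> * s) *\<^sub>R (apply_bcontfun y s - apply_bcontfun z s))"
      using lip[OF that] by (simp add: G_def scaleR_diff_right)
    also have "\<dots> \<le> l * (exp (\<omega> * s) * dist y z)"
      using l dist_bounded[of y s z] by (intro mult_left_mono) (auto simp: dist_norm)
    finally show ?thesis .
  qed
  \<comment> \<open>Elements of the function space live on the whole real line;
    \<open>max 0 t\<close> continues the iterate by its value at time 0.\<close>
  have Hb: "(\<lambda>t. H y (max 0 t)) \<in> bcontfun" for y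
  proof (rule bcontfun_normI)
    show "continuous_on UNIV (\<lambda>t. H y (max 0 t))"
      by (rule continuous_on_compose2[OF Hcont]) (auto intro!: continuous_intros)
    fix t :: real
    have t: "0 \<le> max 0 t" by simp
    have "norm (H y (max 0 t)) \<le> exp (- \<omega> * max 0 t) * (norm (E (max 0 t) \<xi>) + norm (mild_conv E (G y) (max 0 t)))"
      unfolding H_def using norm_triangle_ineq by (simp add: mult_left_mono)
    also have "\<dots> \<le> 1 * (C * norm \<xi>) + norm y / 2"
      unfolding distrib_left using \<omega> bound[OF t] C_nonneg
      by (intro add_mono mult_mono convle Gcont' G0) (auto intro!: mult_nonneg_nonneg)
    finally show "norm (H y (max 0 t)) \<le> 1 * (C * norm \<xi>) + norm y / 2" .
  qed
  define \<Phi> where "\<Phi> y = Bcontfun (\<lambda>t. H y (max 0 t))" for y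
  have \<Phi>: "apply_bcontfun (\<Phi> y) t = H y (max 0 t)" for y t
    using Bcontfun_inverse[OF Hb] by (simp add: \<Phi>_def)
  have "\<exists>!y. \<Phi> y = y"
  proof (rule banach_fix_type[of "1 / 2"])
    show "\<forall>y z. dist (\<Phi> y) (\<Phi> z) \<le> 1 / 2 * dist y z"
    proof (intro allI dist_bound)
      fix y z and t :: real
      let ?t = "max 0 t"
      have "dist (apply_bcontfun (\<Phi> y) t) (apply_bcontfun (\<Phi> z) t)
          = exp (- \<omega> * ?t) * norm (mild_conv E (\<lambda>s. G y s - G z s) ?t)"
        unfolding \<Phi> H_def dist_norm by (simp add: scaleR_diff_right[symmetric] conv_diff Gcont')
      also have "\<dots> \<le> dist y z / 2"
        by (rule convle) (auto intro!: continuous_intros Gcont' Gd)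
      finally show "dist (apply_bcontfun (\<Phi> y) t) (apply_bcontfun (\<Phi> z) t) \<le> 1 / 2 * dist y z" by simp
    qed
  qed auto
  then obtain y where y: "\<Phi> y = y" by blast
  define x where "x t = exp (\<omega> * t) *\<^sub>R apply_bcontfun y t" for t
  have "x t = E t \<xi> + mild_conv E (\<lambda>s. F s (x s)) t" if "0 \<le> t" for t
  proof -
    have "x t = exp (\<omega> * t) *\<^sub>R H y t" using \<Phi>[of y t] that by (simp add: x_def y)
    also have "\<dots> = E t \<xi> + mild_conv E (G y) t"
      by (simp add: H_def exp_add[symmetric])
    also have "mild_conv E (G y) t = mild_conv E (\<lambda>s. F s (x s)) t"
      by (simp add: G_def[abs_def] x_def)
    finally show ?thesis .
  qed
  moreover have "continuous_on {0..} x" unfolding x_def by (intro continuous_intros) auto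
  ultimately show ?thesis by blast
qed

end

lemma (in projected_semigroup) bounded_semigroup:
  assumes "\<And>t x. 0 \<le> t \<Longrightarrow> x \<in> Y \<Longrightarrow> norm (T t x) \<le> C * norm x" "0 \<le> C"
    "\<And>x. norm (\<pi> x) \<le> K * norm x" "0 \<le> K"
  shows "bounded_semigroup (\<lambda>t x. T t (\<pi> x)) (C * K)"
proof (rule bounded_semigroup.intro)
  show "bounded_linear (\<lambda>x. T t (\<pi> x))" if "0 \<le> t" for t by (rule bounded_linear_T[OF that])
next
  fix t :: real and x assume t: "0 \<le> t"
  have "norm (T t (\<pi> x)) \<le> C * norm (\<pi> x)" by (rule assms(1)[OF t piY])
  also have "\<dots> \<le> C * (K * norm x)" by (intro mult_left_mono assms)
  finally show "norm (T t (\<pi> x)) \<le> C * K * norm x" by (simp add: mult.assoc)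
next
  show "T (s + t) (\<pi> x) = T s (\<pi> (T t (\<pi> x)))" if "0 \<le> s" "0 \<le> t" for s t x
    by (simp add: idem inY piY that semi)
  show "continuous_on {0..} (\<lambda>t. T t (\<pi> x))" for x by (rule cont[OF piY])
qed (use assms in simp)

text \<open>Formally the generator of \<open>S\<close> is that of \<open>E\<close> plus
  \<open>B\<close>, so \<open>B (x s)\<close> moves from the forcing into the semigroup. Since
  \<open>x s\<close> need not lie in the domain, only the difference of the two semigroups is
  differentiated, which is what \<open>deriv\<close> supplies, and \<open>S (t - s) (x s)\<close> is
  differentiated from the right.\<close>

lemma mild_perturb:
  assumes E: "bounded_semigroup E C" and S: "bounded_semigroup S C'"
    and ES: "E 0 = S 0" and B: "bounded_linear B"
    and deriv: "\<And>y. E 0 y = y \<Longrightarrow> ((\<lambda>h. (E h y - S h y) /\<^sub>R h) \<longlongrightarrow> - B y) (at_right 0)"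
    and cont: "continuous_on {0..b} x" "continuous_on {0..b} g"
    and inv: "\<And>t. 0 \<le> t \<Longrightarrow> t \<le> b \<Longrightarrow> E 0 (x t) = x t" "\<And>t. 0 \<le> t \<Longrightarrow> t \<le> b \<Longrightarrow> E 0 (g t) = g t"
    and x: "\<And>t. 0 \<le> t \<Longrightarrow> t \<le> b \<Longrightarrow> x t = E t \<xi> + mild_conv E g t"
    and t: "0 \<le> t" "t \<le> b"
  shows "x t = S t \<xi> + mild_conv S (\<lambda>s. g s - B (x s)) t"
proof -
  interpret E: bounded_semigroup E C by fact
  interpret S: bounded_semigroup S C' by fact
  define w where "w s = S (t - s) (x s)" for s
  have contt: "continuous_on {0..t} x" "continuous_on {0..t} g"
    using cont t by (auto intro: continuous_on_subset)
  have contBx: "continuous_on {0..t} (\<lambda>s. B (x s))"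
    by (rule continuous_on_compose2[OF linear_continuous_on[OF B] contt(1)]) auto
  have "((\<lambda>s. S (t - s) (g s - B (x s))) has_integral (w t - w 0)) {0..t}"
  proof (rule has_integral_right_derivative[OF t(1)])
    show "continuous_on {0..t} w" unfolding w_def
      by (rule S.cont_orbit) (use contt in \<open>auto intro!: continuous_intros\<close>)
    show "continuous_on {0..t} (\<lambda>s. S (t - s) (g s - B (x s)))"
      by (rule S.cont_orbit) (use contt contBx in \<open>auto intro!: continuous_intros\<close>)
    fix s assume s: "0 \<le> s" "s < t"
    have small: "eventually (\<lambda>h. 0 < h \<and> h < t - s) (at_right (0::real))"
      using eventually_at_right_less eventually_at_right_real[of 0 "t - s"] s
      by (auto elim: eventually_elim2)
    define J where "J h = integral {0..h} (\<lambda>r. E (h - r) (g (s + r)))" for h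
    have xh: "x (s + h) = E h (x s) + J h" if "0 \<le> h" "h \<le> t - s" for h
    proof -
      have "x (s + h) = E (s + h) \<xi> + mild_conv E g (s + h)" using x[of "s + h"] that s t by simp
      also have "\<dots> = E h (E s \<xi> + mild_conv E g s) + J h"
        unfolding J_def by (rule E.mild_step) (use that s in \<open>auto intro: continuous_on_subset[OF contt(2)]\<close>)
      finally show ?thesis using x[of s] s t by simp
    qed
    \<comment> \<open>An average of \<open>E (h - r) (g (s + r))\<close> over \<open>{0..h}\<close>:
      joint continuity at \<open>(0, 0)\<close> gives the limit \<open>E 0 (g s)\<close>, which is
      \<open>g s\<close> by \<open>inv\<close>.\<close>
    have J: "((\<lambda>h. J h /\<^sub>R h) \<longlongrightarrow> g s) (at_right 0)"
    proof (rule tendstoI)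
      fix e :: real assume e: "e > 0"
      have "continuous_on ({0..} \<times> {0..t - s}) (\<lambda>p. E (fst p) (g (s + snd p)))"
        by (rule E.cont_orbit)
          (use s in \<open>auto intro!: continuous_intros continuous_on_compose2[OF contt(2)]\<close>)
      moreover have "(0::real, 0::real) \<in> {0..} \<times> {0..t - s}" using s by simp
      ultimately obtain d where d: "d > 0" "\<And>p. p \<in> {0..} \<times> {0..t - s} \<Longrightarrow> dist p (0, 0) < d \<Longrightarrow>
          dist (E (fst p) (g (s + snd p))) (E 0 (g (s + 0))) < e / 2"
        unfolding continuous_on_iff using half_gt_zero[OF e] by (metis fst_conv snd_conv)
      have "eventually (\<lambda>h. h < d / 2) (at_right (0::real))"
        using eventually_at_right_real[of 0 "d / 2"] d by (auto elim: eventually_mono)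
      with small show "eventually (\<lambda>h. dist (J h /\<^sub>R h) (g s) < e) (at_right 0)"
      proof eventually_elim
        case (elim h)
        have c: "continuous_on {0..h} (\<lambda>r. E (h - r) (g (s + r)))"
          by (rule E.cont_orbit)
            (use s elim in \<open>auto intro!: continuous_intros continuous_on_compose2[OF contt(2)]\<close>)
        have "norm (integral {0..h} (\<lambda>r. E (h - r) (g (s + r)) - g s)) \<le> e / 2 * (h - 0)"
        proof (rule integral_bound)
          fix r assume r: "r \<in> {0..h}"
          have "dist (h - r, r) (0, 0) \<le> \<bar>h - r\<bar> + \<bar>r\<bar>"
            using sqrt_sum_squares_le_sum_abs by (simp add: dist_prod_def dist_real_def)
          also have "\<dots> < d" using r elim by auto
          finally have "dist (E (h - r) (g (s + r))) (E 0 (g (s + 0))) < e / 2"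
            using d(2)[of "(h - r, r)"] r elim by auto
          then show "norm (E (h - r) (g (s + r)) - g s) \<le> e / 2"
            using inv(2)[of s] s t by (simp add: dist_norm)
        qed (use elim in \<open>auto intro!: continuous_intros c\<close>)
        moreover have "integral {0..h} (\<lambda>r. E (h - r) (g (s + r)) - g s) = J h - h *\<^sub>R g s"
          unfolding J_def using elim
          by (subst Henstock_Kurzweil_Integration.integral_diff) (auto intro!: integrable_continuous_real c)
        ultimately have "norm (J h - h *\<^sub>R g s) \<le> e / 2 * h" by simp
        moreover have "J h /\<^sub>R h - g s = (J h - h *\<^sub>R g s) /\<^sub>R h" using elim by (simp add: algebra_simps)
        then have "dist (J h /\<^sub>R h) (g s) = inverse h * norm (J h - h *\<^sub>R g s)"
          using elim by (simp add: dist_norm)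
        moreover have "inverse h * (e / 2 * h) = e / 2" using elim by simp
        moreover have "inverse h * norm (J h - h *\<^sub>R g s) \<le> inverse h * (e / 2 * h)"
          by (rule mult_left_mono) (use elim \<open>norm (J h - h *\<^sub>R g s) \<le> e / 2 * h\<close> in auto)
        ultimately have "dist (J h /\<^sub>R h) (g s) \<le> e / 2" by linarith
        then show ?case using e by simp
      qed
    qed
    have "((\<lambda>h. (E h (x s) - S h (x s)) /\<^sub>R h + J h /\<^sub>R h) \<longlongrightarrow> - B (x s) + g s) (at_right 0)"
      by (intro tendsto_add deriv J inv(1)) (use s t in auto)
    then have q: "((\<lambda>h. (E h (x s) - S h (x s)) /\<^sub>R h + J h /\<^sub>R h) \<longlongrightarrow> g s - B (x s)) (at_right 0)"
      by simp
    have "((\<lambda>h. S (t - s - h) ((E h (x s) - S h (x s)) /\<^sub>R h + J h /\<^sub>R h)) \<longlongrightarrow> S (t - s) (g s - B (x s))) (at_right 0)"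
    proof (rule tendsto_orbit[where J = "{0..}" and Y = UNIV and B = C', OF _ _ _ _ _ q])
      show "((\<lambda>h. t - s - h) \<longlongrightarrow> t - s) (at_right 0)" by (auto intro!: tendsto_eq_intros)
      show "eventually (\<lambda>h. t - s - h \<in> {0..}) (at_right 0)"
        using small by eventually_elim auto
    qed (use s S.lipschitz S.cont in auto)
    moreover have "eventually (\<lambda>h. S (t - s - h) ((E h (x s) - S h (x s)) /\<^sub>R h + J h /\<^sub>R h)
        = (w (s + h) - w s) /\<^sub>R h) (at_right 0)"
      using small
    proof eventually_elim
      case (elim h)
      have "S (t - s) (x s) = S (t - s - h) (S h (x s))" using S.semi[of "t - s - h" h "x s"] elim by simp
      then have "(w (s + h) - w s) /\<^sub>R h = (S (t - s - h) (E h (x s) + J h) - S (t - s - h) (S h (x s))) /\<^sub>R h"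
        unfolding w_def using xh[of h] elim by (simp add: diff_diff_add)
      also have "\<dots> = S (t - s - h) ((E h (x s) + J h - S h (x s)) /\<^sub>R h)"
        using elim by (simp add: S.diff S.scale)
      also have "(E h (x s) + J h - S h (x s)) /\<^sub>R h = (E h (x s) - S h (x s)) /\<^sub>R h + J h /\<^sub>R h"
        by (simp add: algebra_simps)
      finally show ?case by simp
    qed
    ultimately show "((\<lambda>h. (w (s + h) - w s) /\<^sub>R h) \<longlongrightarrow> S (t - s) (g s - B (x s))) (at_right 0)"
      by (rule Lim_transform_eventually)
  qed
  then have "mild_conv S (\<lambda>s. g s - B (x s)) t = w t - w 0"
    unfolding mild_conv_def by (rule integral_unique)
  moreover have "w t = x t" using inv(1)[of t] t ES by (simp add: w_def)
  moreover have "w 0 = S t \<xi>"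
  proof -
    have "w 0 = S t (S 0 \<xi>)" using x[of 0] t ES by (simp add: w_def)
    also have "\<dots> = S t \<xi>" using S.semi[of t 0 \<xi>] t by simp
    finally show ?thesis .
  qed
  ultimately show ?thesis by simp
qed

section \<open>The bootstrap estimate\<close>

definition exp_combination :: "'a::banach lp_data \<Rightarrow> (nat \<Rightarrow> nat \<Rightarrow> nat \<Rightarrow> real) \<Rightarrow> nat \<Rightarrow> nat \<Rightarrow> real \<Rightarrow> real" where
  "exp_combination M G j n t = (\<Sum>k=0..mS M. exp (gam M k * t) * G j k n)"

text \<open>The differential inequalities satisfied by the components \<open>u j\<close> of the difference of two
  solutions, in integrated form.\<close>

definition comparison_system :: "'a::banach lp_data \<Rightarrow> real \<Rightarrow> (nat \<Rightarrow> real \<Rightarrow> real) \<Rightarrow> (nat \<Rightarrow> real) \<Rightarrow> bool" where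
  "comparison_system M b u d \<longleftrightarrow>
     (\<forall>j\<in>IS M. continuous_on {0..b} (u j) \<and> 0 \<le> d j \<and> (\<forall>t\<in>{0..b}.
        u j t \<le> exp (rate M (St j) * t) * d j
          + integral {0..t} (\<lambda>s. exp (rate M (St j) * (t - s)) * (\<Sum>i\<in>IS M. Hc M (St j) i * u i s)) \<and>
        u j t \<le> pbd M (St j) * Cs M * exp (gam M 0 * t) * (\<Sum>n\<in>IS M. d n)))"

context lyapunov_perron_setting
begin

lemma finite_index [simp]: "finite (IS M)" "finite (IU M)" "finite (IX M)"
  by (auto simp: IS_def IU_def IX_def)

lemma index_in_IX [simp]: "St i \<in> IX M \<longleftrightarrow> i \<in> IS M" "Ust i \<in> IX M \<longleftrightarrow> i \<in> IU M"
  by (auto simp: IX_def)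

lemma sum_IX: "(\<Sum>i\<in>IX M. f i) = (\<Sum>i\<in>IS M. f (St i)) + (\<Sum>i\<in>IU M. f (Ust i))"
proof -
  have "(\<Sum>i\<in>IX M. f i) = (\<Sum>i\<in>St ` IS M. f i) + (\<Sum>i\<in>Ust ` IU M. f i)"
    unfolding IX_def by (rule sum.union_disjoint) auto
  then show ?thesis by (simp add: sum.reindex inj_on_def)
qed

lemma Hc_nonneg: "j \<in> IX M \<Longrightarrow> i \<in> IS M \<Longrightarrow> 0 \<le> Hc M j i"
  unfolding Hc_def by (intro add_nonneg_nonneg sum_nonneg mult_nonneg_nonneg Cbd1_nonneg less_imp_le[OF P_pos]) auto

lemma gam_strict: "k < l \<Longrightarrow> l \<le> mS M \<Longrightarrow> gam M l < gam M k"
proof (induction l)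
  case (Suc l)
  show ?case
  proof (cases "k = l")
    case False
    then have "gam M l < gam M k" using Suc by simp
    moreover have "gam M (Suc l) < gam M l" using Suc gam_decreasing by simp
    ultimately show ?thesis by simp
  qed (use Suc gam_decreasing in simp)
qed simp

lemma gam_neg: "k \<le> mS M \<Longrightarrow> gam M k < 0"
  using gam_strict[of 0 k] gam0_neg by (cases "k = 0") auto

lemma gam_eq: "j \<in> IS M \<Longrightarrow> gam M j = rate M (St j) + Hc M (St j) j"
  by (auto simp: gam_def IS_def)

text \<open>\<open>Tow\<close> divides by \<open>gam M k - gam M j\<close>, so the rate
  \<open>gam M j\<close> has to disappear from the bounds of the other components first. As the
  rates decrease in \<open>k\<close>, a positive coefficient may be moved to the slower rate
  \<open>j - 1\<close> and a negative one to the faster rate \<open>j + 1\<close>; both only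
  increase the sum.\<close>

lemma Qop_bound:
  assumes j: "j \<in> IS M" and t: "0 \<le> t"
  shows "exp_combination M G i n t \<le> (\<Sum>k\<in>{0..mS M} - {j}. exp (gam M k * t) * Qop j G i k n)"
proof -
  let ?e = "\<lambda>k. exp (gam M k * t)" and ?K = "{0..mS M} - {j}"
  define d where "d k = (if (k + 1 = j \<and> G i j n > 0) \<or> (k = j + 1 \<and> G i j n < 0) then G i j n else 0)" for k
  have jm: "1 \<le> j" "j \<le> mS M" using j by (auto simp: IS_def)
  have Q: "Qop j G i k n = G i k n + d k" if "k \<noteq> j" for k using that by (simp add: Qop_def d_def)
  have "(\<Sum>k\<in>?K. ?e k * Qop j G i k n) = (\<Sum>k\<in>?K. ?e k * G i k n) + (\<Sum>k\<in>?K. ?e k * d k)"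
    by (simp add: Q sum.distrib[symmetric] distrib_left)
  moreover have "exp_combination M G i n t = ?e j * G i j n + (\<Sum>k\<in>?K. ?e k * G i k n)"
    unfolding exp_combination_def by (rule sum.remove) (use jm in auto)
  moreover have "?e j * G i j n \<le> (\<Sum>k\<in>?K. ?e k * d k)"
  proof -
    consider "G i j n > 0" | "G i j n = 0" | "G i j n < 0" by linarith
    then show ?thesis
    proof cases
      case 1
      have "(\<Sum>k\<in>?K. ?e k * d k) = (\<Sum>k\<in>{j - 1}. ?e k * d k)"
        by (rule sum.mono_neutral_right) (use jm 1 in \<open>auto simp: d_def\<close>)
      also have "\<dots> = ?e (j - 1) * G i j n" using 1 jm by (simp add: d_def)
      finally have "(\<Sum>k\<in>?K. ?e k * d k) = ?e (j - 1) * G i j n" .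
      moreover have "gam M j \<le> gam M (j - 1)" using gam_strict[of "j - 1" j] jm by simp
      ultimately show ?thesis using 1 t by (simp add: mult_right_mono)
    next
      case 2
      then show ?thesis by (simp add: d_def)
    next
      case 3
      show ?thesis
      \<comment> \<open>At the fastest rate there is no neighbour \<open>j + 1\<close>; the negative
        term is simply dropped, which is still an upper bound.\<close>
      proof (cases "j = mS M")
        case True
        have "d k = 0" if "k \<in> ?K" for k using that True 3 by (auto simp: d_def)
        then show ?thesis using 3 by (simp add: mult_le_0_iff)
      next
        case False
        have "(\<Sum>k\<in>?K. ?e k * d k) = (\<Sum>k\<in>{j + 1}. ?e k * d k)"
          by (rule sum.mono_neutral_right) (use jm 3 False in \<open>auto simp: d_def\<close>)
        also have "\<dots> = ?e (j + 1) * G i j n" using 3 jm by (simp add: d_def)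
        finally have "(\<Sum>k\<in>?K. ?e k * d k) = ?e (j + 1) * G i j n" .
        moreover have "gam M (j + 1) \<le> gam M j" using gam_strict[of j "j + 1"] jm False by simp
        ultimately show ?thesis using 3 t by (simp add: mult_right_mono)
      qed
    qed
  qed
  ultimately show ?thesis by simp
qed

text \<open>\<open>Tow\<close> lists the coefficients of the explicit solution of a scalar linear
  equation with rate \<open>gam M j\<close> and exponential forcing. For \<open>k \<noteq> j\<close>
  they are the particular solution, whence the divisors \<open>gam M k - gam M j\<close>; the
  coefficient at \<open>j\<close> corrects the initial value to the Kronecker delta.\<close>

lemma Tow_ode:
  fixes Q :: "nat \<Rightarrow> nat \<Rightarrow> nat \<Rightarrow> real"
  assumes j: "j \<in> IS M"
  defines "g \<equiv> \<lambda>n t. \<Sum>k=0..mS M. exp (gam M k * t) * Tow M j Q k n"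
  shows "(g n has_real_derivative gam M j * g n t
      + (\<Sum>i\<in>IS M - {j}. Hc M (St j) i * (\<Sum>k\<in>{0..mS M} - {j}. exp (gam M k * t) * Q i k n))) (at t)"
    and "g n 0 = (if n = j then 1 else 0)"
proof -
  let ?K = "{0..mS M} - {j}" and ?I = "IS M - {j}"
  have jm: "1 \<le> j" "j \<le> mS M" using j by (auto simp: IS_def)
  have ne: "gam M k - gam M j \<noteq> 0" if "k \<in> ?K" for k
    using gam_strict[of k j] gam_strict[of j k] that jm by (cases "k < j") auto
  have rem: "(\<Sum>k=0..mS M. f k) = f j + (\<Sum>k\<in>?K. f k)" for f :: "nat \<Rightarrow> real"
    by (rule sum.remove) (use jm in auto)
  have "(g n has_real_derivative (\<Sum>k=0..mS M. gam M k * exp (gam M k * t) * Tow M j Q k n)) (at t)"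
    unfolding g_def by (auto intro!: derivative_eq_intros sum.cong simp: mult_ac)
  moreover have "(\<Sum>k=0..mS M. gam M k * exp (gam M k * t) * Tow M j Q k n) - gam M j * g n t
      = (\<Sum>k=0..mS M. (gam M k - gam M j) * exp (gam M k * t) * Tow M j Q k n)"
    by (simp add: g_def sum_distrib_left sum_subtractf[symmetric] algebra_simps)
  moreover have "\<dots> = (\<Sum>k\<in>?K. (gam M k - gam M j) * exp (gam M k * t) * Tow M j Q k n)"
    by (subst rem) simp
  moreover have "\<dots> = (\<Sum>k\<in>?K. \<Sum>i\<in>?I. Hc M (St j) i * (exp (gam M k * t) * Q i k n))"
  proof (rule sum.cong[OF refl])
    fix k assume k: "k \<in> ?K"
    have "(gam M k - gam M j) * exp (gam M k * t) * Tow M j Q k n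
        = (\<Sum>i\<in>?I. (gam M k - gam M j) * exp (gam M k * t) * (inverse (gam M k - gam M j) * Hc M (St j) i * Q i k n))"
      using k by (simp add: Tow_def sum_distrib_left)
    also have "\<dots> = (\<Sum>i\<in>?I. Hc M (St j) i * (exp (gam M k * t) * Q i k n))"
      by (rule sum.cong[OF refl]) (use ne[OF k] in \<open>simp add: field_simps\<close>)
    finally show "(gam M k - gam M j) * exp (gam M k * t) * Tow M j Q k n
        = (\<Sum>i\<in>?I. Hc M (St j) i * (exp (gam M k * t) * Q i k n))" .
  qed
  moreover have "\<dots> = (\<Sum>i\<in>?I. Hc M (St j) i * (\<Sum>k\<in>?K. exp (gam M k * t) * Q i k n))"
    by (subst sum.swap) (simp add: sum_distrib_left)
  ultimately show "(g n has_real_derivative gam M j * g n t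
      + (\<Sum>i\<in>?I. Hc M (St j) i * (\<Sum>k\<in>?K. exp (gam M k * t) * Q i k n))) (at t)"
    by (smt (verit))
  have "g n 0 = Tow M j Q j n + (\<Sum>k\<in>?K. Tow M j Q k n)"
    unfolding g_def by (subst rem) simp
  also have "(\<Sum>k\<in>?K. Tow M j Q k n) = (\<Sum>k\<in>?K. \<Sum>i\<in>?I. inverse (gam M k - gam M j) * Hc M (St j) i * Q i k n)"
    by (rule sum.cong) (auto simp: Tow_def)
  also have "\<dots> = (\<Sum>i\<in>?I. \<Sum>k\<in>?K. inverse (gam M k - gam M j) * Hc M (St j) i * Q i k n)"
    by (rule sum.swap)
  finally show "g n 0 = (if n = j then 1 else 0)" by (simp add: Tow_def)
qed

text \<open>The invariant of the bootstrap, quantified over all solutions of the comparison system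
  and hence independent of the chart and the initial points. Nonnegativity of the exponential sums
  is carried along because it does not follow from the signs of the entries of \<open>G\<close> and
  is needed when the bounds are multiplied.\<close>

definition valid_bound :: "(nat \<Rightarrow> nat \<Rightarrow> nat \<Rightarrow> real) \<Rightarrow> bool" where
  "valid_bound G \<longleftrightarrow> (\<forall>i\<in>IS M. \<forall>n\<in>IS M. \<forall>t\<ge>0. 0 \<le> exp_combination M G i n t) \<and>
     (\<forall>b u d. comparison_system M b u d \<longrightarrow>
        (\<forall>i\<in>IS M. \<forall>t\<in>{0..b}. u i t \<le> (\<Sum>n\<in>IS M. exp_combination M G i n t * d n)))"

text \<open>The other components, bounded without the rate \<open>gam M j\<close>, become the
  forcing of component \<open>j\<close>, while the self-coupling \<open>Hc M (St j) j\<close> is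
  absorbed into the rate and produces \<open>gam M j\<close>. Only row \<open>j\<close> is replaced
  and the other rows remain valid, so updating in place within a sweep is sound.\<close>

lemma valid_bound_step:
  assumes G: "valid_bound G" and j: "j \<in> IS M"
  shows "valid_bound (G(j := Tow M j (Qop j G)))"
proof -
  let ?I = "IS M - {j}"
  define Q where "Q = Qop j G"
  define q where "q i n t = (\<Sum>k\<in>{0..mS M} - {j}. exp (gam M k * t) * Q i k n)" for i n t
  define g where "g n t = (\<Sum>k=0..mS M. exp (gam M k * t) * Tow M j Q k n)" for n t
  define \<phi> where "\<phi> n t = (\<Sum>i\<in>?I. Hc M (St j) i * q i n t)" for n t
  have Gq: "exp_combination M G i n t \<le> q i n t" if "0 \<le> t" for i n t
    unfolding q_def Q_def by (rule Qop_bound[OF j that])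
  have g': "(g n has_real_derivative (rate M (St j) + Hc M (St j) j) * g n t + \<phi> n t) (at t)" for n t
    using Tow_ode(1)[OF j, where Q = Q and n = n and t = t] gam_eq[OF j] by (simp add: g_def[abs_def] \<phi>_def q_def)
  have g0: "g n 0 = (if n = j then 1 else 0)" for n
    using Tow_ode(2)[OF j, where Q = Q and n = n] by (simp add: g_def)
  have H: "0 \<le> Hc M (St j) i" if "i \<in> IS M" for i using Hc_nonneg that j by simp
  have q_nonneg: "0 \<le> q i n t" if "i \<in> IS M" "n \<in> IS M" "0 \<le> t" for i n t
  proof -
    have "0 \<le> exp_combination M G i n t" using G that unfolding valid_bound_def by blast
    then show ?thesis using Gq[OF that(3)] by (rule order_trans)
  qed
  have \<phi>_nonneg: "0 \<le> \<phi> n t" if "n \<in> IS M" "0 \<le> t" for n t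
    unfolding \<phi>_def by (intro sum_nonneg mult_nonneg_nonneg H q_nonneg) (use that in auto)
  have \<phi>cont: "continuous_on S (\<phi> n)" for S n
    unfolding \<phi>_def q_def by (intro continuous_intros)
  have comb: "exp_combination M (G(j := Tow M j (Qop j G))) i n t = (if i = j then g n t else exp_combination M G i n t)" for i n t
    by (simp add: exp_combination_def g_def Q_def)
  \<comment> \<open>The forcing is nonnegative, so the zero function satisfies the integral
    inequality with initial value 0 and the comparison puts it below \<open>g n\<close>.\<close>
  have g_nonneg: "0 \<le> g n t" if n: "n \<in> IS M" and t: "0 \<le> t" for n t
  proof (rule gronwall_comparison[where u = "\<lambda>_. 0" and \<phi> = "\<phi> n" and b = t and l = "rate M (St j)"
        and h = "Hc M (St j) j" and a = 0 and g = "g n"])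
    fix s assume s: "0 \<le> s" "s \<le> t"
    have "0 \<le> integral {0..s} (\<lambda>r. exp (rate M (St j) * (s - r)) * \<phi> n r)"
      by (rule Henstock_Kurzweil_Integration.integral_nonneg)
        (use n in \<open>auto intro!: integrable_continuous_real continuous_intros \<phi>cont mult_nonneg_nonneg \<phi>_nonneg\<close>)
    then show "0 \<le> exp (rate M (St j) * s) * 0 + integral {0..s} (\<lambda>r. exp (rate M (St j) * (s - r)) * (Hc M (St j) j * 0 + \<phi> n r))"
      by simp
  qed (use H j t g' g0 \<phi>cont in auto)
  have "u j t \<le> (\<Sum>n\<in>IS M. g n t * d n)" if u: "comparison_system M b u d" and t: "0 \<le> t" "t \<le> b" for b u d t
  proof (rule gronwall_comparison[where u = "u j" and \<phi> = "\<lambda>t. \<Sum>n\<in>IS M. \<phi> n t * d n" and b = b and l = "rate M (St j)"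
        and h = "Hc M (St j) j" and a = "d j" and g = "\<lambda>t. \<Sum>n\<in>IS M. g n t * d n"])
    show "continuous_on {0..b} (u j)" using u j unfolding comparison_system_def by blast
    show "continuous_on {0..b} (\<lambda>t. \<Sum>n\<in>IS M. \<phi> n t * d n)" by (intro continuous_intros \<phi>cont)
    show "((\<lambda>t. \<Sum>n\<in>IS M. g n t * d n) has_real_derivative
        (rate M (St j) + Hc M (St j) j) * (\<Sum>n\<in>IS M. g n s * d n) + (\<Sum>n\<in>IS M. \<phi> n s * d n)) (at s)" for s
    proof -
      have "((\<lambda>t. \<Sum>n\<in>IS M. g n t * d n) has_real_derivative
          (\<Sum>n\<in>IS M. ((rate M (St j) + Hc M (St j) j) * g n s + \<phi> n s) * d n)) (at s)"
        by (auto intro!: derivative_eq_intros g')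
      also have "(\<Sum>n\<in>IS M. ((rate M (St j) + Hc M (St j) j) * g n s + \<phi> n s) * d n)
          = (rate M (St j) + Hc M (St j) j) * (\<Sum>n\<in>IS M. g n s * d n) + (\<Sum>n\<in>IS M. \<phi> n s * d n)"
        by (simp add: sum_distrib_left sum.distrib[symmetric] algebra_simps)
      finally show ?thesis .
    qed
    have "(\<Sum>n\<in>IS M. g n 0 * d n) = (\<Sum>n\<in>IS M. if n = j then d n else 0)"
      by (rule sum.cong) (auto simp: g0)
    also have "\<dots> = d j" using j by simp
    finally show "d j \<le> (\<Sum>n\<in>IS M. g n 0 * d n)" by simp
    fix s assume s: "0 \<le> s" "s \<le> b"
    have cont: "continuous_on {0..s} (u i)" if "i \<in> IS M" for i
      using u that s unfolding comparison_system_def by (auto intro: continuous_on_subset)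
    have "u j s \<le> exp (rate M (St j) * s) * d j
          + integral {0..s} (\<lambda>r. exp (rate M (St j) * (s - r)) * (\<Sum>i\<in>IS M. Hc M (St j) i * u i r))"
      using u j s unfolding comparison_system_def by auto
    also have "integral {0..s} (\<lambda>r. exp (rate M (St j) * (s - r)) * (\<Sum>i\<in>IS M. Hc M (St j) i * u i r))
        \<le> integral {0..s} (\<lambda>r. exp (rate M (St j) * (s - r)) * (Hc M (St j) j * u j r + (\<Sum>n\<in>IS M. \<phi> n r * d n)))"
    proof (rule Henstock_Kurzweil_Integration.integral_le)
      fix r assume r: "r \<in> {0..s}"
      have ui: "u i r \<le> (\<Sum>n\<in>IS M. q i n r * d n)" if i: "i \<in> IS M" for i
      proof -
        have "u i r \<le> (\<Sum>n\<in>IS M. exp_combination M G i n r * d n)"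
          using G u i r s unfolding valid_bound_def by auto
        also have "\<dots> \<le> (\<Sum>n\<in>IS M. q i n r * d n)"
          using u r unfolding comparison_system_def by (intro sum_mono mult_right_mono Gq) auto
        finally show ?thesis .
      qed
      have "(\<Sum>i\<in>IS M. Hc M (St j) i * u i r) = Hc M (St j) j * u j r + (\<Sum>i\<in>?I. Hc M (St j) i * u i r)"
        by (rule sum.remove) (use j in auto)
      also have "(\<Sum>i\<in>?I. Hc M (St j) i * u i r) \<le> (\<Sum>i\<in>?I. Hc M (St j) i * (\<Sum>n\<in>IS M. q i n r * d n))"
        by (intro sum_mono mult_left_mono ui H) auto
      also have "\<dots> = (\<Sum>i\<in>?I. \<Sum>n\<in>IS M. Hc M (St j) i * q i n r * d n)"
        by (simp add: sum_distrib_left mult.assoc)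
      also have "\<dots> = (\<Sum>n\<in>IS M. \<phi> n r * d n)"
        by (subst sum.swap) (simp add: \<phi>_def sum_distrib_right)
      finally show "exp (rate M (St j) * (s - r)) * (\<Sum>i\<in>IS M. Hc M (St j) i * u i r)
          \<le> exp (rate M (St j) * (s - r)) * (Hc M (St j) j * u j r + (\<Sum>n\<in>IS M. \<phi> n r * d n))"
        by simp
    qed (use cont j \<phi>cont in \<open>auto intro!: integrable_continuous_real continuous_intros\<close>)
    finally show "u j s \<le> exp (rate M (St j) * s) * d j
        + integral {0..s} (\<lambda>r. exp (rate M (St j) * (s - r)) * (Hc M (St j) j * u j r + (\<Sum>n\<in>IS M. \<phi> n r * d n)))"
      by simp
  qed (use H j t in auto)
  then have uj: "\<forall>t\<in>{0..b}. u j t \<le> (\<Sum>n\<in>IS M. g n t * d n)" if "comparison_system M b u d" for b u d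
    using that by auto
  have "u i t \<le> (\<Sum>n\<in>IS M. (if i = j then g n t else exp_combination M G i n t) * d n)"
    if "comparison_system M b u d" "i \<in> IS M" "t \<in> {0..b}" for b u d i t
    using uj[OF that(1)] that G unfolding valid_bound_def by (cases "i = j") simp_all
  then show ?thesis
    using G g_nonneg unfolding valid_bound_def comb by auto
qed

lemma valid_bound_init:
  assumes "0 \<le> Cs M"
  shows "valid_bound (G_init M)"
proof -
  have eq: "exp_combination M (G_init M) i n t = pbd M (St i) * Cs M * exp (gam M 0 * t)" for i n t
  proof -
    have "exp_combination M (G_init M) i n t = (\<Sum>k=0..mS M. if k = 0 then exp (gam M 0 * t) * (pbd M (St i) * Cs M) else 0)"
      unfolding exp_combination_def by (rule sum.cong) (auto simp: G_init_def)
    then show ?thesis by simp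
  qed
  have "0 \<le> pbd M (St i)" if "i \<in> IS M" for i
    using proj_bound[of "St i"] that norm_ge_zero[of "proj M (St i)"] by (simp del: norm_ge_zero)
  then show ?thesis
    using assms unfolding valid_bound_def eq comparison_system_def by (auto simp: sum_distrib_left)
qed

lemma valid_bound_boot:
  assumes "0 \<le> Cs M"
  shows "valid_bound (G_boot M N)"
proof -
  have fold: "valid_bound (fold (\<lambda>j G. G(j := Tow M j (Qop j G))) js G)"
    if "valid_bound G" "set js \<subseteq> IS M" for js G
    using that by (induction js arbitrary: G) (auto intro: valid_bound_step)
  have "valid_bound ((G_sweep M ^^ n) (G_init M))" for n
  proof (induction n)
    case (Suc n)
    have "set [1..<Suc (mS M)] \<subseteq> IS M" by (auto simp: IS_def)
    then show ?case using fold[OF Suc] by (simp add: G_sweep_def)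
  qed (use valid_bound_init assms in simp)
  then show ?thesis by (simp add: G_boot_def)
qed

end

section \<open>Operator norms and Frechet derivatives\<close>

lemma op_norm_onD:
  assumes "op_norm_on Y f \<le> ereal c" "v \<in> Y" "f 0 = 0"
  shows "norm (f v) \<le> c * norm v"
proof (cases "v = 0")
  case False
  have "norm (f v) / norm v \<le> c"
    using assms unfolding op_norm_on_def SUP_le_iff ereal_less_eq by blast
  then show ?thesis using False by (simp add: pos_divide_le_eq)
qed (simp add: assms)

text \<open>The quotient at \<open>v = 0\<close> is \<open>0 / 0 = 0\<close>, hence a nonnegative
  constant is required. For this reason the sign of \<open>Ptilde\<close> has to be settled
  separately at the end.\<close>

lemma op_norm_onI:
  assumes "\<And>v. v \<in> Y \<Longrightarrow> norm (f v) \<le> c * norm v" "0 \<le> c"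
  shows "op_norm_on Y f \<le> ereal c"
  unfolding op_norm_on_def SUP_le_iff ereal_less_eq
proof
  fix v assume "v \<in> Y"
  then show "norm (f v) / norm v \<le> c"
    using assms(1)[of v] assms(2) by (cases "v = 0") (auto simp: pos_divide_le_eq)
qed

lemma has_derivative_Fderiv:
  assumes "f differentiable (at x)"
  shows "(f has_derivative blinfun_apply (Fderiv f x)) (at x)"
proof -
  have "(f has_derivative frechet_derivative f (at x)) (at x)"
    using assms by (simp add: frechet_derivative_works)
  moreover then have "bounded_linear (frechet_derivative f (at x))"
    by (rule has_derivative_bounded_linear)
  ultimately show ?thesis by (simp add: Fderiv_def bounded_linear_Blinfun_apply)
qed

lemma Fderiv_eq:
  assumes "(f has_derivative blinfun_apply D) (at x)"
  shows "Fderiv f x = D"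
  using frechet_derivative_at[OF assms] by (metis Fderiv_def blinfun_apply_inverse)

context lyapunov_perron_setting
begin

section \<open>Coordinates\<close>

abbreviation ps :: "nat \<Rightarrow> 'a \<Rightarrow> 'a" where "ps i \<equiv> blinfun_apply (proj M (St i))"
abbreviation pu :: "nat \<Rightarrow> 'a \<Rightarrow> 'a" where "pu i \<equiv> blinfun_apply (proj M (Ust i))"

lemma pi_s_apply: "pi_s M x = (\<Sum>i\<in>IS M. ps i x)"
  and pi_u_apply: "pi_u M x = (\<Sum>i\<in>IU M. pu i x)"
  by (simp_all add: pi_s_def pi_u_def blinfun.sum_left)

lemma proj_proj:
  assumes "i \<in> IX M" "j \<in> IX M"
  shows "proj M i (proj M j x) = (if i = j then proj M i x else 0)"
  using proj_orth[OF assms, of x] by auto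

lemma proj_pi [simp]:
  "i \<in> IS M \<Longrightarrow> ps i (pi_s M x) = ps i x" "i \<in> IU M \<Longrightarrow> pu i (pi_u M x) = pu i x"
  "i \<in> IU M \<Longrightarrow> pu i (pi_s M x) = 0" "i \<in> IS M \<Longrightarrow> ps i (pi_u M x) = 0"
  by (simp_all add: pi_s_apply pi_u_apply blinfun.sum_right proj_proj if_distrib sum.delta cong: if_cong)

lemma pi_idem [simp]: "pi_s M (pi_s M x) = pi_s M x" "pi_u M (pi_u M x) = pi_u M x"
  "pi_s M (pi_u M x) = 0" "pi_u M (pi_s M x) = 0"
  by (simp_all add: pi_s_apply[of "pi_s M x"] pi_u_apply[of "pi_u M x"] pi_s_apply[of "pi_u M x"] pi_u_apply[of "pi_s M x"])
    (simp_all add: pi_s_apply pi_u_apply)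

lemma mem_Xs: "x \<in> Xs M \<longleftrightarrow> pi_s M x = x"
  unfolding Xs_def by (metis pi_idem(1) rangeE rangeI)
lemma mem_Xu: "x \<in> Xu M \<longleftrightarrow> pi_u M x = x"
  unfolding Xu_def by (metis pi_idem(2) rangeE rangeI)
lemma mem_Xi: "i \<in> IX M \<Longrightarrow> x \<in> Xi M i \<longleftrightarrow> proj M i x = x"
  unfolding Xi_def by (metis (mono_tags, lifting) proj_orth rangeE rangeI)

lemma Xs_coords: "x \<in> Xs M \<Longrightarrow> x = (\<Sum>i\<in>IS M. ps i x)"
  by (simp add: mem_Xs pi_s_apply)
lemma Xu_coords: "x \<in> Xu M \<Longrightarrow> x = (\<Sum>i\<in>IU M. pu i x)"
  by (simp add: mem_Xu pi_u_apply)

lemma pu_Xs: "x \<in> Xs M \<Longrightarrow> i \<in> IU M \<Longrightarrow> pu i x = 0"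
  by (metis mem_Xs proj_pi(3))
lemma ps_Xu: "x \<in> Xu M \<Longrightarrow> i \<in> IS M \<Longrightarrow> ps i x = 0"
  by (metis mem_Xu proj_pi(4))

lemma subspace_X: "subspace (Xs M)" "subspace (Xu M)" "subspace (Xi M i)"
  unfolding Xs_def Xu_def Xi_def
  by (auto intro!: linear_subspace_image bounded_linear.linear blinfun.bounded_linear_right)

lemma proj_in_Xi: "proj M i x \<in> Xi M i" by (simp add: Xi_def)
lemma pi_in [simp]: "pi_s M x \<in> Xs M" "pi_u M x \<in> Xu M" by (simp_all add: Xs_def Xu_def)

lemma Xi_sub: "i \<in> IS M \<Longrightarrow> Xi M (St i) \<subseteq> Xs M" "i \<in> IU M \<Longrightarrow> Xi M (Ust i) \<subseteq> Xu M"
proof -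
  show "Xi M (St i) \<subseteq> Xs M" if i: "i \<in> IS M"
  proof
    fix x assume "x \<in> Xi M (St i)"
    then have x: "ps i x = x" using i by (simp add: mem_Xi)
    have "pi_s M x = (\<Sum>k\<in>IS M. ps k (ps i x))" by (simp add: pi_s_apply x)
    also have "\<dots> = ps i x" using i by (simp add: proj_proj if_distrib sum.delta cong: if_cong)
    finally show "x \<in> Xs M" by (simp add: mem_Xs x)
  qed
  show "Xi M (Ust i) \<subseteq> Xu M" if i: "i \<in> IU M"
  proof
    fix x assume "x \<in> Xi M (Ust i)"
    then have x: "pu i x = x" using i by (simp add: mem_Xi)
    have "pi_u M x = (\<Sum>k\<in>IU M. pu k (pu i x))" by (simp add: pi_u_apply x)
    also have "\<dots> = pu i x" using i by (simp add: proj_proj if_distrib sum.delta cong: if_cong)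
    finally show "x \<in> Xu M" by (simp add: mem_Xu x)
  qed
qed

lemma norm_Xs_le: "x \<in> Xs M \<Longrightarrow> norm x \<le> (\<Sum>i\<in>IS M. norm (ps i x))"
  using norm_sum[of "\<lambda>i. ps i x" "IS M"] Xs_coords[of x] by simp
lemma norm_Xu_le: "x \<in> Xu M \<Longrightarrow> norm x \<le> (\<Sum>i\<in>IU M. norm (pu i x))"
  using norm_sum[of "\<lambda>i. pu i x" "IU M"] Xu_coords[of x] by simp

lemma closed_Xs: "closed (Xs M)"
proof -
  have "Xs M = {x. pi_s M x = x}" by (rule set_eqI) (simp add: mem_Xs)
  moreover have "closed {x. pi_s M x = x}" by (intro closed_Collect_eq continuous_intros)
  ultimately show ?thesis by simp
qed

section \<open>The box of initial data\<close>

lemma BsD: "x \<in> Bs M \<Longrightarrow> x \<in> Xs M" "x \<in> Bs M \<Longrightarrow> i \<in> IS M \<Longrightarrow> norm (ps i x) \<le> rho M i"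
  by (simp_all add: Bs_def)

lemma zero_Bs [simp]: "0 \<in> Bs M"
  using subspace_0[OF subspace_X(1)] rho_pos by (simp add: Bs_def less_imp_le)

lemma convex_Bs: "convex (Bs M)"
proof (rule convexI)
  fix x y and u v :: real assume *: "x \<in> Bs M" "y \<in> Bs M" "0 \<le> u" "0 \<le> v" "u + v = 1"
  have "norm (ps i (u *\<^sub>R x + v *\<^sub>R y)) \<le> rho M i" if i: "i \<in> IS M" for i
  proof -
    have "norm (ps i (u *\<^sub>R x + v *\<^sub>R y)) \<le> u * norm (ps i x) + v * norm (ps i y)"
      using norm_triangle_ineq[of "u *\<^sub>R ps i x" "v *\<^sub>R ps i y"] * by (simp add: blinfun.add_right blinfun.scaleR_right)
    also have "\<dots> \<le> u * rho M i + v * rho M i"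
      using * i BsD by (intro add_mono mult_left_mono) auto
    finally show ?thesis using * by (simp add: distrib_right[symmetric])
  qed
  then show "u *\<^sub>R x + v *\<^sub>R y \<in> Bs M"
    using * subspace_X(1) by (auto simp: Bs_def intro!: subspace_add subspace_mul)
qed

lemma scale_Bs: "x \<in> Bs M \<Longrightarrow> 0 \<le> s \<Longrightarrow> s \<le> 1 \<Longrightarrow> s *\<^sub>R x \<in> Bs M"
  using convexD[OF convex_Bs _ zero_Bs, of x s "1 - s"] by simp

lemma closed_Bs: "closed (Bs M)"
proof -
  have "Bs M = Xs M \<inter> (\<Inter>i\<in>IS M. {x. norm (ps i x) \<le> rho M i})" by (auto simp: Bs_def)
  then show ?thesis
    by (auto intro!: closed_Int closed_INT closed_Xs closed_Collect_le continuous_intros)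
qed

lemma Bs_sum:
  assumes "\<And>i. i \<in> IS M \<Longrightarrow> z i \<in> Xi M (St i)" "\<And>i. i \<in> IS M \<Longrightarrow> norm (z i) \<le> rho M i"
  shows "(\<Sum>i\<in>IS M. z i) \<in> Bs M" "j \<in> IS M \<Longrightarrow> ps j (\<Sum>i\<in>IS M. z i) = z j"
proof -
  have p: "ps j (\<Sum>i\<in>IS M. z i) = z j" if "j \<in> IS M" for j
  proof -
    have "ps j (\<Sum>i\<in>IS M. z i) = (\<Sum>i\<in>IS M. ps j (ps i (z i)))"
      using assms(1) by (simp add: blinfun.sum_right mem_Xi)
    also have "\<dots> = ps j (z j)" using that by (simp add: proj_proj if_distrib sum.delta cong: if_cong)
    finally show ?thesis using assms(1)[OF that] that by (simp add: mem_Xi)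
  qed
  then show "j \<in> IS M \<Longrightarrow> ps j (\<Sum>i\<in>IS M. z i) = z j" .
  have "(\<Sum>i\<in>IS M. z i) \<in> Xs M"
    by (intro subspace_sum subspace_X) (use assms(1) Xi_sub in blast)
  then show "(\<Sum>i\<in>IS M. z i) \<in> Bs M" using p assms(2) by (simp add: Bs_def)
qed

text \<open>Passes from \<open>\<xi>\<close> to \<open>\<eta>\<close> by changing one coordinate at
  a time and adds up the increments.\<close>

lemma coordinatewise_bound:
  fixes f :: "'a \<Rightarrow> 'b::real_normed_vector"
  assumes step: "\<And>i \<xi> \<zeta>. i \<in> IS M \<Longrightarrow> \<xi> \<in> Bs M \<Longrightarrow> \<zeta> \<in> Xi M (St i) \<Longrightarrow> \<xi> + \<zeta> \<in> Bs M \<Longrightarrow>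
      norm (f (\<xi> + \<zeta>) - f \<xi>) \<le> c i * norm \<zeta>"
    and \<xi>: "\<xi> \<in> Bs M" and \<eta>: "\<eta> \<in> Bs M"
  shows "norm (f \<eta> - f \<xi>) \<le> (\<Sum>i\<in>IS M. c i * norm (ps i (\<eta> - \<xi>)))"
proof -
  \<comment> \<open>The intermediate points have the coordinates of \<open>\<eta>\<close> in
    \<open>A\<close> and those of \<open>\<xi>\<close> elsewhere; they stay in the box because it is
    a product of balls.\<close>
  define z where "z A = (\<Sum>i\<in>IS M. ps i (if i \<in> A then \<eta> else \<xi>))" for A
  have zB: "z A \<in> Bs M" for A
    unfolding z_def by (rule Bs_sum) (use \<xi> \<eta> proj_in_Xi in \<open>auto simp: BsD\<close>)
  have "norm (f (z A) - f \<xi>) \<le> (\<Sum>i\<in>A. c i * norm (ps i (\<eta> - \<xi>)))" if "finite A" "A \<subseteq> IS M" for A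
    using that
  proof (induction A)
    case empty
    have "z {} = \<xi>" using Xs_coords[OF BsD(1)[OF \<xi>]] by (simp add: z_def)
    then show ?case by simp
  next
    case (insert i A)
    have "z (insert i A) = z A + (\<Sum>k\<in>IS M. if k = i then ps i (\<eta> - \<xi>) else 0)"
      unfolding z_def sum.distrib[symmetric]
      by (rule sum.cong) (use insert in \<open>auto simp: blinfun.diff_right\<close>)
    also have "(\<Sum>k\<in>IS M. if k = i then ps i (\<eta> - \<xi>) else 0) = ps i (\<eta> - \<xi>)" using insert by simp
    finally have zi: "z (insert i A) = z A + ps i (\<eta> - \<xi>)" .
    have "norm (f (z A + ps i (\<eta> - \<xi>)) - f (z A)) \<le> c i * norm (ps i (\<eta> - \<xi>))"
      by (rule step) (use insert zB zi[symmetric] proj_in_Xi in auto)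
    then have "norm (f (z (insert i A)) - f \<xi>) \<le> c i * norm (ps i (\<eta> - \<xi>)) + norm (f (z A) - f \<xi>)"
      unfolding zi using norm_triangle_ineq[of "f (z A + ps i (\<eta> - \<xi>)) - f (z A)" "f (z A) - f \<xi>"] by simp
    then show ?case using insert by simp
  qed
  from this[of "IS M"] have "norm (f (z (IS M)) - f \<xi>) \<le> (\<Sum>i\<in>IS M. c i * norm (ps i (\<eta> - \<xi>)))" by simp
  moreover have "z (IS M) = \<eta>" using Xs_coords[OF BsD(1)[OF \<eta>]] by (simp add: z_def cong: sum.cong)
  ultimately show ?thesis by simp
qed

section \<open>Charts\<close>

lemma Lip_le:
  assumes "Lip M \<alpha> i' i \<le> ereal c" "\<xi> \<in> Bs M" "\<zeta> \<in> Xi M (St i)" "\<xi> + \<zeta> \<in> Bs M"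
  shows "norm (pu i' (\<alpha> (\<xi> + \<zeta>)) - pu i' (\<alpha> \<xi>)) \<le> c * norm \<zeta>"
proof (cases "\<zeta> = 0")
  case False
  have "ereal (norm (pu i' (\<alpha> (\<xi> + \<zeta>)) - pu i' (\<alpha> \<xi>)) / norm \<zeta>) \<le> ereal c"
    by (rule order_trans[OF _ assms(1)]) (use assms False in \<open>auto simp: Lip_def intro!: SUP_upper2[of "(\<xi>, \<zeta>)"]\<close>)
  then show ?thesis using False by (simp add: pos_divide_le_eq)
qed simp

text \<open>The conditions shared by \<open>B01 M\<close> and \<open>B11 M Pbar\<close>, so that the
  flow is constructed for both kinds of chart at once.\<close>

definition chart :: "('a \<Rightarrow> 'a) \<Rightarrow> bool" where
  "chart \<alpha> \<longleftrightarrow> \<alpha> ` Bs M \<subseteq> Xu M \<and> \<alpha> 0 = 0 \<and> (\<forall>i'\<in>IU M. \<forall>i\<in>IS M. Lip M \<alpha> i' i \<le> ereal (Pt M i' i))"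

lemma chart_lip:
  assumes "chart \<alpha>" "\<xi> \<in> Bs M" "\<eta> \<in> Bs M" "i' \<in> IU M"
  shows "norm (pu i' (\<alpha> \<eta> - \<alpha> \<xi>)) \<le> (\<Sum>i\<in>IS M. Pt M i' i * norm (ps i (\<eta> - \<xi>)))"
proof -
  have "norm (pu i' (\<alpha> \<eta>) - pu i' (\<alpha> \<xi>)) \<le> (\<Sum>i\<in>IS M. Pt M i' i * norm (ps i (\<eta> - \<xi>)))"
    by (rule coordinatewise_bound[where f = "\<lambda>x. pu i' (\<alpha> x)", OF _ assms(2,3)], rule Lip_le)
      (use assms in \<open>auto simp: chart_def\<close>)
  then show ?thesis by (simp add: blinfun.diff_right)
qed

lemma chart_Xu: "chart \<alpha> \<Longrightarrow> \<xi> \<in> Bs M \<Longrightarrow> \<alpha> \<xi> \<in> Xu M"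
  by (auto simp: chart_def)

lemma chart_Bu:
  assumes "chart \<alpha>" "\<xi> \<in> Bs M"
  shows "\<alpha> \<xi> \<in> Bu M"
proof -
  have "norm (pu i' (\<alpha> \<xi>)) \<le> r_u M i'" if i': "i' \<in> IU M" for i'
  proof -
    have "norm (pu i' (\<alpha> \<xi>)) \<le> (\<Sum>i\<in>IS M. Pt M i' i * norm (ps i \<xi>))"
      using chart_lip[OF assms(1) zero_Bs assms(2) i'] assms(1) by (simp add: chart_def)
    also have "\<dots> \<le> r_u M i'"
      unfolding r_u_def using assms(2) P_pos[OF i'] by (intro sum_mono mult_left_mono) (auto simp: BsD less_imp_le)
    finally show ?thesis .
  qed
  then show ?thesis using chart_Xu[OF assms] by (simp add: Bu_def)
qed

definition psum :: real where "psum = (\<Sum>i\<in>IX M. norm (proj M i))"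

lemma norm_proj_le: "i \<in> IX M \<Longrightarrow> norm (proj M i x) \<le> norm (proj M i) * norm x"
  by (rule norm_blinfun)

lemma norm_coord_le:
  assumes "i \<in> IX M" shows "norm (proj M i x) \<le> psum * norm x"
proof -
  have "norm (proj M i) \<le> psum" unfolding psum_def by (rule member_le_sum) (use assms in auto)
  then show ?thesis using norm_proj_le[OF assms, of x] by (meson mult_right_mono norm_ge_zero order_trans)
qed

lemma psum_nonneg: "0 \<le> psum" unfolding psum_def by (simp add: sum_nonneg)

text \<open>An inequality between coordinates gives one between norms, with a crude constant.\<close>

lemma norm_le_of_coords:
  assumes "finite J" "\<And>i. i \<in> J \<Longrightarrow> f i \<le> (\<Sum>n\<in>IS M. c i n * norm (ps n x))"
    "\<And>i n. i \<in> J \<Longrightarrow> n \<in> IS M \<Longrightarrow> 0 \<le> c i n"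
  shows "(\<Sum>i\<in>J. f i) \<le> (\<Sum>i\<in>J. \<Sum>n\<in>IS M. c i n) * psum * norm x"
proof -
  have "(\<Sum>i\<in>J. f i) \<le> (\<Sum>i\<in>J. \<Sum>n\<in>IS M. c i n * (psum * norm x))"
    using assms norm_coord_le by (intro sum_mono order_trans[OF assms(2)] mult_left_mono) auto
  then show ?thesis by (simp add: sum_distrib_right mult.assoc)
qed

lemma chart_lipschitz:
  assumes "chart \<alpha>" "\<xi> \<in> Bs M" "\<eta> \<in> Bs M"
  shows "norm (\<alpha> \<eta> - \<alpha> \<xi>) \<le> (\<Sum>i\<in>IU M. \<Sum>n\<in>IS M. Pt M i n) * psum * norm (\<eta> - \<xi>)"
proof -
  have "norm (\<alpha> \<eta> - \<alpha> \<xi>) \<le> (\<Sum>i\<in>IU M. norm (pu i (\<alpha> \<eta> - \<alpha> \<xi>)))"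
    by (intro norm_Xu_le subspace_diff subspace_X chart_Xu assms)
  also have "\<dots> \<le> (\<Sum>i\<in>IU M. \<Sum>n\<in>IS M. Pt M i n) * psum * norm (\<eta> - \<xi>)"
    by (rule norm_le_of_coords) (use chart_lip[OF assms] P_pos in \<open>auto simp: less_imp_le\<close>)
  finally show ?thesis .
qed

lemma chart_iff_B01: "chart \<alpha> \<longleftrightarrow> \<alpha> \<in> B01 M"
proof
  assume c: "chart \<alpha>"
  have "((\<Sum>i\<in>IU M. \<Sum>n\<in>IS M. Pt M i n) * psum)-lipschitz_on (Bs M) \<alpha>"
  proof (rule lipschitz_onI)
    show "0 \<le> (\<Sum>i\<in>IU M. \<Sum>n\<in>IS M. Pt M i n) * psum"
      using P_pos psum_nonneg by (intro mult_nonneg_nonneg sum_nonneg) (auto simp: less_imp_le)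
  qed (use chart_lipschitz[OF c] in \<open>auto simp: dist_norm\<close>)
  then show "\<alpha> \<in> B01 M" using c unfolding chart_def B01_def by blast
qed (auto simp: chart_def B01_def)

lemma chart_B11: "\<alpha> \<in> B11 M Pbar \<Longrightarrow> chart \<alpha>"
  by (auto simp: chart_def B11_def)

section \<open>The nonlinearity\<close>

lemma Nfull_eq: "Nfull M x = Ntilde M (htilde M + x) - Ntilde M (htilde M)"
  by (simp add: Nfull_def Nhat_def)

lemma Nfull_zero [simp]: "Nfull M 0 = 0" by (simp add: Nfull_eq)

lemma Nfull_deriv:
  "(Nfull M has_derivative blinfun_apply (Fderiv (Nfull M) x)) (at x)"
  "(Fderiv (Nfull M) has_derivative blinfun_apply (Fderiv (Fderiv (Nfull M)) x)) (at x)"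
proof -
  have sh: "((+) (htilde M) has_derivative (\<lambda>h. h)) (at x)" for x
    by (auto intro!: derivative_eq_intros)
  have 1: "(Ntilde M has_derivative blinfun_apply (Fderiv (Ntilde M) x)) (at x)" for x
    using Ntilde_C2 by (auto simp: C2_map_def intro: has_derivative_Fderiv)
  have N: "(Nfull M has_derivative blinfun_apply (Fderiv (Ntilde M) (htilde M + x))) (at x)" for x
    unfolding Nfull_eq[abs_def]
    using has_derivative_compose[OF sh 1] by (auto intro!: derivative_eq_intros)
  then have eq: "Fderiv (Nfull M) x = Fderiv (Ntilde M) (htilde M + x)" for x by (rule Fderiv_eq)
  show "(Nfull M has_derivative blinfun_apply (Fderiv (Nfull M) x)) (at x)" using N eq by simp
  have 2: "(Fderiv (Ntilde M) has_derivative blinfun_apply (Fderiv (Fderiv (Ntilde M)) x)) (at x)" for x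
    using Ntilde_C2 by (auto simp: C2_map_def intro: has_derivative_Fderiv)
  have "(Fderiv (Nfull M) has_derivative blinfun_apply (Fderiv (Fderiv (Ntilde M)) (htilde M + x))) (at x)"
    unfolding eq[abs_def] by (rule has_derivative_compose[OF sh 2])
  moreover from Fderiv_eq[OF this] have "Fderiv (Fderiv (Nfull M)) x = Fderiv (Fderiv (Ntilde M)) (htilde M + x)" .
  ultimately show "(Fderiv (Nfull M) has_derivative blinfun_apply (Fderiv (Fderiv (Nfull M)) x)) (at x)" by simp
qed

definition BB :: "'a set" where "BB = {x + y |x y. x \<in> Bs M \<and> y \<in> Bu M}"

lemma convex_BB: "convex BB"
proof -
  have "convex (Bu M)"
  proof (rule convexI)
    fix x y and u v :: real assume *: "x \<in> Bu M" "y \<in> Bu M" "0 \<le> u" "0 \<le> v" "u + v = 1"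
    have "norm (pu i (u *\<^sub>R x + v *\<^sub>R y)) \<le> r_u M i" if i: "i \<in> IU M" for i
    proof -
      have "norm (pu i (u *\<^sub>R x + v *\<^sub>R y)) \<le> u * norm (pu i x) + v * norm (pu i y)"
        using norm_triangle_ineq[of "u *\<^sub>R pu i x" "v *\<^sub>R pu i y"] * by (simp add: blinfun.add_right blinfun.scaleR_right)
      also have "\<dots> \<le> u * r_u M i + v * r_u M i"
        using * i by (intro add_mono mult_left_mono) (auto simp: Bu_def)
      finally show ?thesis using * by (simp add: distrib_right[symmetric])
    qed
    then show "u *\<^sub>R x + v *\<^sub>R y \<in> Bu M"
      using * subspace_X(2) by (auto simp: Bu_def intro!: subspace_add subspace_mul)
  qed
  from convex_sums[OF convex_Bs this] show ?thesis
    unfolding BB_def by (rule back_subst[of convex]) auto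
qed

lemma DN_coord:
  assumes p: "p \<in> BB" and j: "j \<in> IX M"
  shows "norm (proj M j (Fderiv (Nfull M) p v)) \<le> (\<Sum>i\<in>IX M. Cbd1 M j i * norm (proj M i v))"
proof -
  obtain x y where xy: "p = x + y" "x \<in> Bs M" "y \<in> Bu M" using p by (auto simp: BB_def)
  have "proj M j (Fderiv (Nfull M) p v) = (\<Sum>i\<in>IX M. proj M j (Fderiv (Nfull M) p (proj M i v)))"
    by (subst proj_sum[symmetric, of v]) (simp add: blinfun.sum_right)
  also have "norm \<dots> \<le> (\<Sum>i\<in>IX M. norm (proj M j (Fderiv (Nfull M) p (proj M i v))))" by (rule norm_sum)
  also have "\<dots> \<le> (\<Sum>i\<in>IX M. Cbd1 M j i * norm (proj M i v))"
    by (rule sum_mono, rule op_norm_onD[OF DN_bound[OF j _ xy(2,3), folded xy(1)] proj_in_Xi])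
      (auto simp: blinfun.zero_right)
  finally show ?thesis .
qed

lemma bilin_norm_onD:
  assumes "bilin_norm_on Y Z (\<lambda>v w. blinfun_apply P (blinfun_apply (blinfun_apply f v) w)) \<le> ereal c" "v \<in> Y" "w \<in> Z"
  shows "norm (blinfun_apply P (blinfun_apply (blinfun_apply f v) w)) \<le> c * (norm v * norm w)"
proof (cases "v = 0 \<or> w = 0")
  case False
  have "norm (P (f v w)) / (norm v * norm w) \<le> c"
    using assms unfolding bilin_norm_on_def SUP_le_iff ereal_less_eq by blast
  then show ?thesis using False by (simp add: pos_divide_le_eq)
qed (auto simp: blinfun.zero_right blinfun.zero_left)

lemma D2N_coord:
  assumes p: "p \<in> BB" and j: "j \<in> IX M"
  shows "norm (proj M j (Fderiv (Fderiv (Nfull M)) p v w))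
    \<le> (\<Sum>i\<in>IX M. \<Sum>k\<in>IX M. Cbd2 M j i k * (norm (proj M i v) * norm (proj M k w)))"
proof -
  let ?D = "Fderiv (Fderiv (Nfull M)) p"
  obtain x y where xy: "p = x + y" "x \<in> Bs M" "y \<in> Bu M" using p by (auto simp: BB_def)
  have "proj M j (?D v w) = proj M j (?D (\<Sum>i\<in>IX M. proj M i v) (\<Sum>k\<in>IX M. proj M k w))"
    by (simp add: proj_sum)
  also have "\<dots> = (\<Sum>i\<in>IX M. \<Sum>k\<in>IX M. proj M j (?D (proj M i v) (proj M k w)))"
    by (simp only: blinfun.sum_right blinfun.sum_left) (rule sum.swap)
  also have "norm \<dots> \<le> (\<Sum>i\<in>IX M. \<Sum>k\<in>IX M. norm (proj M j (?D (proj M i v) (proj M k w))))"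
    by (rule order_trans[OF norm_sum]) (intro sum_mono norm_sum)
  also have "\<dots> \<le> (\<Sum>i\<in>IX M. \<Sum>k\<in>IX M. Cbd2 M j i k * (norm (proj M i v) * norm (proj M k w)))"
    by (intro sum_mono bilin_norm_onD[OF D2N_bound[OF j _ _ xy(2,3), folded xy(1)] proj_in_Xi proj_in_Xi])
  finally show ?thesis .
qed

lemma N_diff_coord:
  assumes p: "p \<in> BB" "q \<in> BB" and j: "j \<in> IX M"
  shows "norm (proj M j (Nfull M p - Nfull M q)) \<le> (\<Sum>i\<in>IX M. Cbd1 M j i * norm (proj M i (p - q)))"
proof -
  have "norm (proj M j (Nfull M p) - proj M j (Nfull M q)) \<le> (\<Sum>i\<in>IX M. Cbd1 M j i * norm (proj M i (p - q)))"
  proof (rule mean_value_bound[OF convex_BB p(2,1)])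
    show "((\<lambda>p. proj M j (Nfull M p)) has_derivative (\<lambda>h. proj M j (Fderiv (Nfull M) z h))) (at z within BB)" for z
      by (rule bounded_linear.has_derivative[OF blinfun.bounded_linear_right has_derivative_at_withinI[OF Nfull_deriv(1)]])
  qed (rule DN_coord[OF _ j])
  then show ?thesis by (simp add: blinfun.diff_right)
qed

text \<open>The symmetry of the second derivative enters here: \<open>Cbd2\<close> bounds it with the direction of
  differentiation as first argument, whereas below \<open>w\<close> is the argument of the first derivative.\<close>

lemma DN_diff_coord:
  assumes p: "p \<in> BB" "q \<in> BB" and j: "j \<in> IX M"
  shows "norm (proj M j (Fderiv (Nfull M) p w - Fderiv (Nfull M) q w))
    \<le> (\<Sum>i\<in>IX M. \<Sum>k\<in>IX M. Cbd2 M j i k * (norm (proj M i w) * norm (proj M k (p - q))))"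
proof -
  have "norm (proj M j (Fderiv (Nfull M) p w) - proj M j (Fderiv (Nfull M) q w))
    \<le> (\<Sum>i\<in>IX M. \<Sum>k\<in>IX M. Cbd2 M j i k * (norm (proj M i w) * norm (proj M k (p - q))))"
  proof (rule mean_value_bound[OF convex_BB p(2,1)])
    fix z assume z: "z \<in> BB"
    have bl: "bounded_linear (\<lambda>D. proj M j (blinfun_apply D w))"
      by (intro bounded_linear_compose[OF blinfun.bounded_linear_right blinfun.bounded_linear_left])
    show "((\<lambda>p. proj M j (Fderiv (Nfull M) p w)) has_derivative (\<lambda>h. proj M j (Fderiv (Fderiv (Nfull M)) z h w))) (at z within BB)"
      by (rule bounded_linear.has_derivative[OF bl has_derivative_at_withinI[OF Nfull_deriv(2)]])
    have "Fderiv (Fderiv (Nfull M)) z (p - q) w = Fderiv (Fderiv (Nfull M)) z w (p - q)"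
      by (rule symmetric_second_derivative[OF Nfull_deriv(1) Nfull_deriv(2)])
    then show "norm (proj M j (Fderiv (Fderiv (Nfull M)) z (p - q) w))
      \<le> (\<Sum>i\<in>IX M. \<Sum>k\<in>IX M. Cbd2 M j i k * (norm (proj M i w) * norm (proj M k (p - q))))"
      using D2N_coord[OF z j, of w "p - q"] by simp
  qed
  then show ?thesis by (simp add: blinfun.diff_right)
qed

section \<open>The vector field on a chart\<close>

definition on_chart :: "('a \<Rightarrow> 'a) \<Rightarrow> 'a \<Rightarrow> 'a" where "on_chart \<alpha> x = Nfull M (x + \<alpha> x)"

lemma chart_BB: "chart \<alpha> \<Longrightarrow> x \<in> Bs M \<Longrightarrow> x + \<alpha> x \<in> BB"
  using chart_Bu by (auto simp: BB_def)

lemma graph_coords: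
  assumes "chart \<alpha>" "x \<in> Bs M" "y \<in> Bs M"
  shows "i \<in> IS M \<Longrightarrow> ps i ((y + \<alpha> y) - (x + \<alpha> x)) = ps i (y - x)"
    and "i \<in> IU M \<Longrightarrow> pu i ((y + \<alpha> y) - (x + \<alpha> x)) = pu i (\<alpha> y - \<alpha> x)"
  using assms ps_Xu[OF chart_Xu[OF assms(1)]] pu_Xs[OF BsD(1)]
  by (auto simp: blinfun.diff_right blinfun.add_right)

lemma sum_Pt_swap:
  "(\<Sum>i'\<in>IU M. c i' * (\<Sum>n\<in>IS M. Pt M i' n * d n)) = (\<Sum>n\<in>IS M. (\<Sum>i'\<in>IU M. c i' * Pt M i' n) * d n)"
proof -
  have "(\<Sum>i'\<in>IU M. c i' * (\<Sum>n\<in>IS M. Pt M i' n * d n)) = (\<Sum>i'\<in>IU M. \<Sum>n\<in>IS M. c i' * Pt M i' n * d n)"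
    by (simp add: sum_distrib_left mult.assoc)
  also have "\<dots> = (\<Sum>n\<in>IS M. \<Sum>i'\<in>IU M. c i' * Pt M i' n * d n)" by (rule sum.swap)
  finally show ?thesis by (simp add: sum_distrib_right)
qed

text \<open>The two parts of \<open>Hc\<close> are the direct dependence on the stable coordinates
  and the dependence through the chart, whose slopes are bounded by \<open>Pt\<close>.\<close>

lemma on_chart_lip:
  assumes a: "chart \<alpha>" "x \<in> Bs M" "y \<in> Bs M" and j: "j \<in> IX M"
  shows "norm (proj M j (on_chart \<alpha> y - on_chart \<alpha> x)) \<le> (\<Sum>n\<in>IS M. Hc M j n * norm (ps n (y - x)))"
proof -
  have "norm (proj M j (on_chart \<alpha> y - on_chart \<alpha> x))
      \<le> (\<Sum>i\<in>IX M. Cbd1 M j i * norm (proj M i ((y + \<alpha> y) - (x + \<alpha> x))))"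
    unfolding on_chart_def by (rule N_diff_coord) (use a j chart_BB in auto)
  also have "\<dots> = (\<Sum>n\<in>IS M. Cbd1 M j (St n) * norm (ps n (y - x)))
      + (\<Sum>i'\<in>IU M. Cbd1 M j (Ust i') * norm (pu i' (\<alpha> y - \<alpha> x)))"
    unfolding sum_IX by (simp add: graph_coords[OF a])
  also have "(\<Sum>i'\<in>IU M. Cbd1 M j (Ust i') * norm (pu i' (\<alpha> y - \<alpha> x)))
      \<le> (\<Sum>i'\<in>IU M. Cbd1 M j (Ust i') * (\<Sum>n\<in>IS M. Pt M i' n * norm (ps n (y - x))))"
    by (intro sum_mono mult_left_mono chart_lip a Cbd1_nonneg) (use j in auto)
  also have "\<dots> = (\<Sum>n\<in>IS M. (\<Sum>i'\<in>IU M. Cbd1 M j (Ust i') * Pt M i' n) * norm (ps n (y - x)))"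
    by (rule sum_Pt_swap)
  finally show ?thesis by (simp add: Hc_def distrib_right sum.distrib)
qed

lemma on_chart_zero: "chart \<alpha> \<Longrightarrow> on_chart \<alpha> 0 = 0"
  by (simp add: on_chart_def chart_def)

definition lipN :: real where "lipN = (\<Sum>j\<in>IX M. \<Sum>n\<in>IS M. Hc M j n) * psum"

lemma lipN_nonneg: "0 \<le> lipN"
  unfolding lipN_def by (intro mult_nonneg_nonneg sum_nonneg Hc_nonneg psum_nonneg)

lemma norm_le_sum_coords: "norm x \<le> (\<Sum>i\<in>IX M. norm (proj M i x))"
  using norm_sum[of "\<lambda>i. proj M i x" "IX M"] by (simp add: proj_sum)

lemma on_chart_lipschitz:
  assumes "chart \<alpha>" "x \<in> Bs M" "y \<in> Bs M"
  shows "norm (on_chart \<alpha> y - on_chart \<alpha> x) \<le> lipN * norm (y - x)"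
  unfolding lipN_def
  by (rule order_trans[OF norm_le_sum_coords norm_le_of_coords]) (use on_chart_lip[OF assms] Hc_nonneg in auto)

text \<open>\<open>Hhat\<close> is defined by \<open>real_of_ereal\<close>, which would turn an
  infinite supremum into 0. A Lipschitz bound uniform over all charts shows that the supremum is
  finite, and only then does it bound each chart. The map in question is the nonlinearity on the
  chart minus the block of the linearisation that acts on the stable part.\<close>

lemma Hhat_bound:
  assumes \<alpha>: "chart \<alpha>"
  shows "0 \<le> Hhat M"
    and "x \<in> Bs M \<Longrightarrow> y \<in> Bs M \<Longrightarrow>
      norm (pi_s M (on_chart \<alpha> y - Lop M y) - pi_s M (on_chart \<alpha> x - Lop M x)) \<le> Hhat M * norm (y - x)"
proof -
  define g where "g \<alpha> x = pi_s M (Lop M (\<alpha> x)) + pi_s M (Nhat M (x + \<alpha> x))" for \<alpha> x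
  have g: "g \<alpha> x = pi_s M (on_chart \<alpha> x - Lop M x)" for \<alpha> x
    by (simp add: g_def on_chart_def Nfull_def blinfun.add_right blinfun.diff_right)
  define K where "K = norm (pi_s M) * (lipN + norm (Lop M))"
  have K0: "0 \<le> K" unfolding K_def using lipN_nonneg by (intro mult_nonneg_nonneg add_nonneg_nonneg) auto
  have gK: "norm (g \<beta> x - g \<beta> y) \<le> K * norm (x - y)" if "chart \<beta>" "x \<in> Bs M" "y \<in> Bs M" for \<beta> x y
  proof -
    have "g \<beta> x - g \<beta> y = pi_s M ((on_chart \<beta> x - on_chart \<beta> y) - Lop M (x - y))"
      by (simp add: g blinfun.diff_right blinfun.add_right algebra_simps)
    also have "norm \<dots> \<le> norm (pi_s M) * norm ((on_chart \<beta> x - on_chart \<beta> y) - Lop M (x - y))"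
      by (rule norm_blinfun)
    also have "\<dots> \<le> norm (pi_s M) * (lipN * norm (x - y) + norm (Lop M) * norm (x - y))"
      by (intro mult_left_mono order_trans[OF norm_triangle_ineq4] add_mono on_chart_lipschitz norm_blinfun that) auto
    finally show ?thesis by (simp add: K_def algebra_simps)
  qed
  let ?H = "SUP \<beta>\<in>B01 M. lip_const (Bs M) (g \<beta>)"
  have le: "?H \<le> ereal K"
    unfolding lip_const_def SUP_le_iff ereal_less_eq
  proof (intro ballI)
    fix \<beta> x y assume "\<beta> \<in> B01 M" "x \<in> Bs M" "y \<in> Bs M"
    then show "norm (g \<beta> x - g \<beta> y) / norm (x - y) \<le> K"
      using gK[of \<beta> x y] K0 by (cases "x = y") (auto simp: chart_iff_B01 pos_divide_le_eq)
  qed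
  have ge: "ereal (norm (g \<alpha> x - g \<alpha> y) / norm (x - y)) \<le> ?H" if "x \<in> Bs M" "y \<in> Bs M" for x y
  proof -
    have "ereal (norm (g \<alpha> x - g \<alpha> y) / norm (x - y)) \<le> lip_const (Bs M) (g \<alpha>)"
      unfolding lip_const_def by (rule SUP_upper2[OF that(1)], rule SUP_upper2[OF that(2)]) simp
    also have "\<dots> \<le> ?H" by (rule SUP_upper) (use \<alpha> chart_iff_B01 in auto)
    finally show ?thesis .
  qed
  \<comment> \<open>At equal points the quotient is \<open>0 / 0 = 0\<close>, so the supremum lies
    between 0 and \<open>K\<close>.\<close>
  have H0: "0 \<le> ?H" using ge[of 0 0] by (simp add: zero_ereal_def)
  then have H: "?H = ereal (Hhat M)"
    unfolding Hhat_def g_def[symmetric] using le by (subst ereal_real) auto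
  show "0 \<le> Hhat M" using H0 H by simp
  show "norm (pi_s M (on_chart \<alpha> y - Lop M y) - pi_s M (on_chart \<alpha> x - Lop M x)) \<le> Hhat M * norm (y - x)"
    if "x \<in> Bs M" "y \<in> Bs M"
  proof (cases "x = y")
    case False
    have "norm (g \<alpha> y - g \<alpha> x) / norm (y - x) \<le> Hhat M" using ge[OF that(2,1)] H by simp
    then show ?thesis using False by (simp add: g pos_divide_le_eq)
  qed simp
qed

end

section \<open>Decomposition of a semigroup into blocks\<close>

lemma generates_op_exp: "generator_on Y D A \<Longrightarrow> generates Y D A (op_exp Y D A)"
  unfolding generator_on_def op_exp_def by (elim exE) (rule someI[where P = "generates Y D A"])

text \<open>The block semigroups are given independently of the one on \<open>Y\<close> and are
  linked to it only through their generators: \<open>semigroup_restrict\<close> identifies each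
  block with the restriction. The local bound required there is inherited from the perturbed
  semigroup \<open>S\<close>.\<close>

lemma decomposed_semigroup:
  fixes p :: "'i \<Rightarrow> 'a::banach \<Rightarrow>\<^sub>L 'a"
  assumes fin: "finite I"
    and T: "projected_semigroup Y D A T \<pi>"
    and S: "projected_semigroup Y D A' S \<pi>"
    and SB: "\<And>t x. 0 \<le> t \<Longrightarrow> x \<in> Y \<Longrightarrow> norm (S t x) \<le> C * norm x" "0 \<le> C"
    and AA: "\<And>y. y \<in> D \<Longrightarrow> A y - A' y = G y"
    and G: "bounded_linear G" "G ` Y \<subseteq> Y" "\<And>x. norm (G x) \<le> K * norm x" "0 \<le> K"
    and Ti: "\<And>i. i \<in> I \<Longrightarrow> projected_semigroup (X i) (D \<inter> X i) A (Ti i) (blinfun_apply (p i))"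
    and XY: "\<And>i. i \<in> I \<Longrightarrow> X i \<subseteq> Y"
    and sum: "\<And>x. x \<in> Y \<Longrightarrow> (\<Sum>i\<in>I. p i x) = x"
    and orth: "\<And>i j x. i \<in> I \<Longrightarrow> j \<in> I \<Longrightarrow> p i (p j x) = (if i = j then p j x else 0)"
    and t: "0 \<le> t" and x: "x \<in> Y" and j: "j \<in> I"
  shows "p j (T t x) = Ti j t (p j x)"
proof -
  interpret T: projected_semigroup Y D A T \<pi> by fact
  have TB: "norm (T s x) \<le> (C * exp (C * K * t)) * norm x" if "0 \<le> s" "s \<le> t" "x \<in> Y" for s x
  proof -
    have "norm (T s x) \<le> C * exp (C * K * s) * norm x"
      by (rule perturbed_semigroup_bound(1)[OF T S SB AA G that(1,3)])
    also have "\<dots> \<le> C * exp (C * K * t) * norm x"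
      using that SB(2) G(4) by (intro mult_right_mono mult_left_mono) (auto intro!: mult_left_mono)
    finally show ?thesis .
  qed
  have TiT: "T t (p i x) = Ti i t (p i x)" "p i (Ti i t (p i x)) = Ti i t (p i x)" if i: "i \<in> I" for i
  proof -
    interpret i: projected_semigroup "X i" "D \<inter> X i" A "Ti i" "blinfun_apply (p i)" by (rule Ti[OF i])
    show "T t (p i x) = Ti i t (p i x)"
      by (rule semigroup_restrict[OF T i.projected_semigroup_axioms XY[OF i] _ _ TB t, symmetric])
        (use i.piY in auto)
    show "p i (Ti i t (p i x)) = Ti i t (p i x)" by (intro i.idem i.inY t i.piY)
  qed
  have pY: "p i x \<in> Y" if "i \<in> I" for i
  proof -
    interpret i: projected_semigroup "X i" "D \<inter> X i" A "Ti i" "blinfun_apply (p i)" by (rule Ti[OF that])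
    show ?thesis using i.piY XY[OF that] by blast
  qed
  have lin: "linear (\<lambda>x. T t (\<pi> x))" by (rule bounded_linear.linear[OF T.bounded_linear_T[OF t]])
  have "T t x = T t (\<pi> (\<Sum>i\<in>I. p i x))" using sum[OF x] T.idem[OF x] by simp
  also have "\<dots> = (\<Sum>i\<in>I. T t (\<pi> (p i x)))" by (rule linear_sum[OF lin])
  also have "\<dots> = (\<Sum>i\<in>I. p i (Ti i t (p i x)))"
    by (rule sum.cong) (simp_all add: T.idem pY TiT)
  finally have "p j (T t x) = (\<Sum>i\<in>I. p j (p i (Ti i t (p i x))))" by (simp add: blinfun.sum_right)
  also have "\<dots> = (\<Sum>i\<in>I. if i = j then p j (Ti j t (p j x)) else 0)"
    by (rule sum.cong) (use orth j in auto)
  also have "\<dots> = p j (Ti j t (p j x))" using fin j by simp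
  finally show ?thesis using TiT(2)[OF j] by simp
qed

context lyapunov_perron_setting
begin

section \<open>The linear semigroups\<close>

abbreviation Ts :: "real \<Rightarrow> 'a \<Rightarrow> 'a" where "Ts \<equiv> op_exp (Xs M) (dom_Lam M \<inter> Xs M) (Lam M)"
abbreviation Tu :: "real \<Rightarrow> 'a \<Rightarrow> 'a" where "Tu \<equiv> op_exp (Xu M) (dom_Lam M \<inter> Xu M) (\<lambda>x. - Lam M x)"
abbreviation TLs :: "real \<Rightarrow> 'a \<Rightarrow> 'a" where
  "TLs \<equiv> op_exp (Xs M) (dom_Lam M \<inter> Xs M) (\<lambda>x. Lam M x + pi_s M (Lop M x))"
abbreviation TLu :: "real \<Rightarrow> 'a \<Rightarrow> 'a" where
  "TLu \<equiv> op_exp (Xu M) (dom_Lam M \<inter> Xu M) (\<lambda>x. - (Lam M x + pi_u M (Lop M x)))"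

lemma projected_semigroups:
  "projected_semigroup (Xs M) (dom_Lam M \<inter> Xs M) (Lam M) Ts (pi_s M)"
  "projected_semigroup (Xs M) (dom_Lam M \<inter> Xs M) (\<lambda>x. Lam M x + pi_s M (Lop M x)) TLs (pi_s M)"
  "projected_semigroup (Xu M) (dom_Lam M \<inter> Xu M) (\<lambda>x. - Lam M x) Tu (pi_u M)"
  "projected_semigroup (Xu M) (dom_Lam M \<inter> Xu M) (\<lambda>x. - (Lam M x + pi_u M (Lop M x))) TLu (pi_u M)"
  by (intro projected_semigroup.intro generates_op_exp gen_s gen_Ls gen_u gen_Lu blinfun.bounded_linear_right;
      auto simp: Xs_def Xu_def)+

sublocale s: projected_semigroup "Xs M" "dom_Lam M \<inter> Xs M" "Lam M" Ts "blinfun_apply (pi_s M)"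
  by (rule projected_semigroups)
sublocale u: projected_semigroup "Xu M" "dom_Lam M \<inter> Xu M" "\<lambda>x. - Lam M x" Tu "blinfun_apply (pi_u M)"
  by (rule projected_semigroups)

lemma projected_semigroup_i:
  assumes i: "i \<in> IS M"
  shows "projected_semigroup (Xi M (St i)) ((dom_Lam M \<inter> Xs M) \<inter> Xi M (St i)) (Lam M)
    (op_exp (Xi M (St i)) (dom_Lam M \<inter> Xi M (St i)) (Lam M)) (proj M (St i))"
proof -
  have eq: "(dom_Lam M \<inter> Xs M) \<inter> Xi M (St i) = dom_Lam M \<inter> Xi M (St i)" using Xi_sub(1)[OF i] by auto
  show ?thesis unfolding eq
    by (rule projected_semigroup.intro[OF generates_op_exp[OF gen_i[OF i]] blinfun.bounded_linear_right])
      (use i in \<open>auto simp: Xi_def[symmetric] mem_Xi\<close>)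
qed

lemma projected_semigroup_i':
  assumes i: "i \<in> IU M"
  shows "projected_semigroup (Xi M (Ust i)) ((dom_Lam M \<inter> Xu M) \<inter> Xi M (Ust i)) (\<lambda>x. - Lam M x)
    (op_exp (Xi M (Ust i)) (dom_Lam M \<inter> Xi M (Ust i)) (\<lambda>x. - Lam M x)) (proj M (Ust i))"
proof -
  have eq: "(dom_Lam M \<inter> Xu M) \<inter> Xi M (Ust i) = dom_Lam M \<inter> Xi M (Ust i)" using Xi_sub(2)[OF i] by auto
  show ?thesis unfolding eq
    by (rule projected_semigroup.intro[OF generates_op_exp[OF gen_i'[OF i]] blinfun.bounded_linear_right])
      (use i in \<open>auto simp: Xi_def[symmetric] mem_Xi\<close>)
qed

lemma TLs_bound: "0 \<le> t \<Longrightarrow> x \<in> Xs M \<Longrightarrow> norm (TLs t x) \<le> max 0 (Cs M) * norm x"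
proof -
  assume t: "0 \<le> t" and x: "x \<in> Xs M"
  have "norm (TLs t x) \<le> Cs M * exp (lam_s M * t) * norm x" by (rule exp_Ls[OF t x])
  also have "\<dots> \<le> (max 0 (Cs M) * 1) * norm x"
    using lam_sign(1) t by (intro mult_right_mono mult_mono) (auto simp: mult_nonpos_nonneg)
  finally show ?thesis by simp
qed

lemma TLu_bound: "0 \<le> t \<Longrightarrow> x \<in> Xu M \<Longrightarrow> norm (TLu t x) \<le> max 0 (Cu M) * norm x"
proof -
  assume t: "0 \<le> t" and x: "x \<in> Xu M"
  have "norm (TLu t x) \<le> Cu M * exp (lam_u M * - t) * norm x" using exp_Lu[of "- t" x] t x by simp
  also have "\<dots> \<le> (max 0 (Cu M) * 1) * norm x"
    using lam_sign(2) t by (intro mult_right_mono mult_mono) auto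
  finally show ?thesis by simp
qed

lemma norm_piL_le:
  "norm (pi_s M (Lop M x)) \<le> (norm (pi_s M) * norm (Lop M)) * norm x"
  "norm (pi_u M (Lop M x)) \<le> (norm (pi_u M) * norm (Lop M)) * norm x"
proof -
  have "norm (blinfun_apply P (Lop M x)) \<le> norm P * norm (Lop M) * norm x" for P :: "'a \<Rightarrow>\<^sub>L 'a"
    by (rule order_trans[OF norm_blinfun]) (simp add: mult.assoc mult_left_mono norm_blinfun)
  then show "norm (pi_s M (Lop M x)) \<le> (norm (pi_s M) * norm (Lop M)) * norm x"
    "norm (pi_u M (Lop M x)) \<le> (norm (pi_u M) * norm (Lop M)) * norm x" by blast+
qed

lemma bounded_linear_piL: "bounded_linear (\<lambda>x. pi_s M (Lop M x))" "bounded_linear (\<lambda>x. pi_u M (Lop M x))"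
  by (rule bounded_linear_compose[OF blinfun.bounded_linear_right blinfun.bounded_linear_right])+

text \<open>Turns the rates of the blocks into componentwise rates for the semigroup on
  \<open>Xs M\<close>. Here \<open>Lam\<close> counts as the perturbation of the operator with
  linearisation, whence the sign in \<open>- pi_s M (Lop M x)\<close>.\<close>

lemma ps_Ts:
  assumes "0 \<le> t" "x \<in> Xs M" "j \<in> IS M"
  shows "norm (ps j (Ts t x)) \<le> exp (rate M (St j) * t) * norm (ps j x)"
proof -
  have "ps j (Ts t x) = op_exp (Xi M (St j)) (dom_Lam M \<inter> Xi M (St j)) (Lam M) t (ps j x)"
  proof (rule decomposed_semigroup[where p = "\<lambda>i. proj M (St i)" and X = "\<lambda>i. Xi M (St i)",
        OF finite_index(1) projected_semigroups(1) projected_semigroups(2) TLs_bound _ _ _ _ _ _ projected_semigroup_i Xi_sub(1) _ _ assms])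
    show "bounded_linear (\<lambda>x. - pi_s M (Lop M x))" by (intro bounded_linear_minus bounded_linear_piL)
    show "norm (- pi_s M (Lop M x)) \<le> (norm (pi_s M) * norm (Lop M)) * norm x" for x
      using norm_piL_le by simp
  qed (use Xs_coords in \<open>auto simp: proj_proj intro!: subspace_neg[OF subspace_X(1)]\<close>)
  then show ?thesis using exp_i[OF assms(3,1) proj_in_Xi] by simp
qed

lemma pu_Tu:
  assumes "0 \<le> t" "x \<in> Xu M" "j \<in> IU M"
  shows "norm (pu j (Tu t x)) \<le> exp (- rate M (Ust j) * t) * norm (pu j x)"
proof -
  have "pu j (Tu t x) = op_exp (Xi M (Ust j)) (dom_Lam M \<inter> Xi M (Ust j)) (\<lambda>x. - Lam M x) t (pu j x)"
  proof (rule decomposed_semigroup[where p = "\<lambda>i. proj M (Ust i)" and X = "\<lambda>i. Xi M (Ust i)",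
        OF finite_index(2) projected_semigroups(3) projected_semigroups(4) TLu_bound _ _ _ _ _ _ projected_semigroup_i' Xi_sub(2) _ _ assms])
    show "bounded_linear (\<lambda>x. pi_u M (Lop M x))" by (rule bounded_linear_piL)
    show "norm (pi_u M (Lop M x)) \<le> (norm (pi_u M) * norm (Lop M)) * norm x" for x
      by (rule norm_piL_le)
  qed (use Xu_coords in \<open>auto simp: proj_proj\<close>)
  then show ?thesis using exp_i'[OF assms(3) _ proj_in_Xi, of "- t" x] assms(1) by simp
qed

definition Es :: "real \<Rightarrow> 'a \<Rightarrow> 'a" where "Es t x = Ts t (pi_s M x)"
definition Eu :: "real \<Rightarrow> 'a \<Rightarrow> 'a" where "Eu t x = Tu t (pi_u M x)"
definition ELs :: "real \<Rightarrow> 'a \<Rightarrow> 'a" where "ELs t x = TLs t (pi_s M x)"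

lemma ps_Es: "0 \<le> t \<Longrightarrow> j \<in> IS M \<Longrightarrow> norm (ps j (Es t x)) \<le> exp (rate M (St j) * t) * norm (ps j x)"
  unfolding Es_def using ps_Ts[of t "pi_s M x" j] by simp

lemma pu_Eu: "0 \<le> t \<Longrightarrow> j \<in> IU M \<Longrightarrow> norm (pu j (Eu t x)) \<le> exp (- rate M (Ust j) * t) * norm (pu j x)"
  unfolding Eu_def using pu_Tu[of t "pi_u M x" j] by simp

lemma sum_norm_proj_le: "(\<Sum>i\<in>J. norm (proj M i x)) \<le> psum * norm x" if "J \<subseteq> IX M"
proof -
  have "(\<Sum>i\<in>J. norm (proj M i x)) \<le> (\<Sum>i\<in>IX M. norm (proj M i x))"
    by (rule sum_mono2) (use that in auto)
  also have "\<dots> \<le> (\<Sum>i\<in>IX M. norm (proj M i) * norm x)" by (intro sum_mono norm_proj_le)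
  finally show ?thesis by (simp add: psum_def sum_distrib_right)
qed

lemma sum_St_le: "(\<Sum>i\<in>IS M. norm (ps i x)) \<le> psum * norm x"
  and sum_Ust_le: "(\<Sum>i\<in>IU M. norm (pu i x)) \<le> psum * norm x"
  using sum_norm_proj_le[of "St ` IS M" x] sum_norm_proj_le[of "Ust ` IU M" x]
  by (auto simp: IX_def sum.reindex inj_on_def)

text \<open>Now that the blocks are available, their negative rates replace the exponentially
  growing perturbation bound by one uniform in time.\<close>

lemma Ts_bound: "0 \<le> t \<Longrightarrow> x \<in> Xs M \<Longrightarrow> norm (Ts t x) \<le> psum * norm x"
proof -
  assume t: "0 \<le> t" and x: "x \<in> Xs M"
  have "norm (Ts t x) \<le> (\<Sum>i\<in>IS M. norm (ps i (Ts t x)))" by (rule norm_Xs_le[OF s.inY[OF t x]])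
  also have "\<dots> \<le> (\<Sum>i\<in>IS M. norm (ps i x))"
  proof (rule sum_mono)
    fix i assume i: "i \<in> IS M"
    have "norm (ps i (Ts t x)) \<le> exp (rate M (St i) * t) * norm (ps i x)" by (rule ps_Ts[OF t x i])
    also have "\<dots> \<le> 1 * norm (ps i x)"
      using rate_sign(1)[OF i] t by (intro mult_right_mono) (auto simp: mult_nonpos_nonneg)
    finally show "norm (ps i (Ts t x)) \<le> norm (ps i x)" by simp
  qed
  also have "\<dots> \<le> psum * norm x" by (rule sum_St_le)
  finally show ?thesis .
qed

lemma Tu_bound: "0 \<le> t \<Longrightarrow> x \<in> Xu M \<Longrightarrow> norm (Tu t x) \<le> psum * norm x"
proof -
  assume t: "0 \<le> t" and x: "x \<in> Xu M"
  have "norm (Tu t x) \<le> (\<Sum>i\<in>IU M. norm (pu i (Tu t x)))" by (rule norm_Xu_le[OF u.inY[OF t x]])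
  also have "\<dots> \<le> (\<Sum>i\<in>IU M. norm (pu i x))"
  proof (rule sum_mono)
    fix i assume i: "i \<in> IU M"
    have "norm (pu i (Tu t x)) \<le> exp (- rate M (Ust i) * t) * norm (pu i x)" by (rule pu_Tu[OF t x i])
    also have "\<dots> \<le> 1 * norm (pu i x)"
      using rate_sign(2)[OF i] t by (intro mult_right_mono) auto
    finally show "norm (pu i (Tu t x)) \<le> norm (pu i x)" by simp
  qed
  also have "\<dots> \<le> psum * norm x" by (rule sum_Ust_le)
  finally show ?thesis .
qed

sublocale Es: bounded_semigroup Es "psum * norm (pi_s M)"
  unfolding Es_def[abs_def]
  by (rule s.bounded_semigroup) (use Ts_bound psum_nonneg norm_blinfun in auto)

sublocale Eu: bounded_semigroup Eu "psum * norm (pi_u M)"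
  unfolding Eu_def[abs_def]
  by (rule u.bounded_semigroup) (use Tu_bound psum_nonneg norm_blinfun in auto)

sublocale ELs: bounded_semigroup ELs "max 0 (Cs M) * norm (pi_s M)"
  unfolding ELs_def[abs_def]
  by (rule projected_semigroup.bounded_semigroup[OF projected_semigroups(2)])
    (use TLs_bound norm_blinfun in auto)

lemma Es_in_Xs: "0 \<le> t \<Longrightarrow> Es t x \<in> Xs M" by (simp add: Es_def s.inY)
lemma Eu_in_Xu: "0 \<le> t \<Longrightarrow> Eu t x \<in> Xu M" by (simp add: Eu_def u.inY)
lemma Es_pi [simp]: "Es t (pi_s M x) = Es t x" by (simp add: Es_def)
lemma Es_0: "Es 0 x = pi_s M x" by (simp add: Es_def s.at0)

lemma conv_in_Xs:
  assumes "continuous_on {0..t} g"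
  shows "mild_conv Es g t \<in> Xs M"
proof -
  have "pi_s M (mild_conv Es g t) = integral {0..t} (\<lambda>s. pi_s M (Es (t - s) (g s)))"
    unfolding mild_conv_def
    by (rule Henstock_Kurzweil_Integration.integral_linear[OF Es.integrable[OF assms order_refl] blinfun.bounded_linear_right, unfolded o_def, symmetric])
  also have "\<dots> = mild_conv Es g t" unfolding mild_conv_def
    by (rule Henstock_Kurzweil_Integration.integral_cong) (use Es_in_Xs mem_Xs in auto)
  finally show ?thesis by (simp add: mem_Xs)
qed

lemma ps_conv_le:
  assumes g: "continuous_on {0..t} g" and j: "j \<in> IS M"
    and \<phi>: "continuous_on {0..t} \<phi>" "\<And>s. 0 \<le> s \<Longrightarrow> s \<le> t \<Longrightarrow> norm (ps j (g s)) \<le> \<phi> s"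
  shows "norm (ps j (mild_conv Es g t)) \<le> integral {0..t} (\<lambda>s. exp (rate M (St j) * (t - s)) * \<phi> s)"
proof -
  have "ps j (mild_conv Es g t) = integral {0..t} (\<lambda>s. ps j (Es (t - s) (g s)))"
    unfolding mild_conv_def
    by (rule Henstock_Kurzweil_Integration.integral_linear[OF Es.integrable[OF g order_refl] blinfun.bounded_linear_right, unfolded o_def, symmetric])
  also have "norm \<dots> \<le> integral {0..t} (\<lambda>s. exp (rate M (St j) * (t - s)) * \<phi> s)"
  proof (rule Henstock_Kurzweil_Integration.integral_norm_bound_integral)
    show "(\<lambda>s. ps j (Es (t - s) (g s))) integrable_on {0..t}"
      by (rule integrable_linear[OF Es.integrable[OF g order_refl] blinfun.bounded_linear_right, unfolded o_def])
    fix s assume s: "s \<in> {0..t}"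
    have "norm (ps j (Es (t - s) (g s))) \<le> exp (rate M (St j) * (t - s)) * norm (ps j (g s))"
      by (rule ps_Es) (use s j in auto)
    also have "\<dots> \<le> exp (rate M (St j) * (t - s)) * \<phi> s" using \<phi>(2) s by (intro mult_left_mono) auto
    finally show "norm (ps j (Es (t - s) (g s))) \<le> exp (rate M (St j) * (t - s)) * \<phi> s" .
  qed (intro integrable_continuous_real continuous_intros \<phi>)
  finally show ?thesis .
qed

section \<open>Solutions on a chart\<close>

text \<open>A version of \<open>mild_solution\<close> on a bounded time interval: the estimates are
  needed up to a time at which it is not yet known that the solution stays in the box.\<close>

definition sol :: "('a \<Rightarrow> 'a) \<Rightarrow> 'a \<Rightarrow> real \<Rightarrow> (real \<Rightarrow> 'a) \<Rightarrow> bool" where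
  "sol \<alpha> \<xi> b x \<longleftrightarrow> continuous_on {0..b} x \<and>
     (\<forall>t\<in>{0..b}. x t \<in> Bs M \<and> x t = Es t \<xi> + mild_conv Es (\<lambda>s. on_chart \<alpha> (x s)) t)"

lemma sol_in_Bs: "sol \<alpha> \<xi> b x \<Longrightarrow> 0 \<le> t \<Longrightarrow> t \<le> b \<Longrightarrow> x t \<in> Bs M"
  and sol_eq: "sol \<alpha> \<xi> b x \<Longrightarrow> 0 \<le> t \<Longrightarrow> t \<le> b \<Longrightarrow> x t = Es t \<xi> + mild_conv Es (\<lambda>s. on_chart \<alpha> (x s)) t"
  unfolding sol_def by (metis atLeastAtMost_iff)+

lemma on_chart_continuous: "chart \<alpha> \<Longrightarrow> continuous_on (Bs M) (on_chart \<alpha>)"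
proof -
  assume "chart \<alpha>"
  then have "lipN-lipschitz_on (Bs M) (on_chart \<alpha>)"
    by (intro lipschitz_onI lipN_nonneg) (simp add: on_chart_lipschitz dist_norm)
  then show ?thesis by (rule lipschitz_on_continuous_on)
qed

lemma mild_solution_iff:
  assumes \<alpha>: "chart \<alpha>" and \<xi>: "\<xi> \<in> Bs M"
  shows "mild_solution M \<alpha> \<xi> x \<longleftrightarrow> continuous_on {0..} x \<and>
    (\<forall>t\<ge>0. x t \<in> Bs M \<and> x t = Es t \<xi> + mild_conv Es (\<lambda>s. on_chart \<alpha> (x s)) t)"
proof -
  have "((\<lambda>\<tau>. Ts (t - \<tau>) (pi_s M (Nfull M (x \<tau> + \<alpha> (x \<tau>))))) has_integral (x t - Ts t \<xi>)) {0..t} \<longleftrightarrow>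
      x t = Es t \<xi> + mild_conv Es (\<lambda>s. on_chart \<alpha> (x s)) t"
    if "continuous_on {0..} x" "\<forall>t\<ge>0. x t \<in> Bs M" "0 \<le> t" for t
  proof -
    have "continuous_on {0..t} (\<lambda>s. on_chart \<alpha> (x s))"
      by (rule continuous_on_compose2[OF on_chart_continuous[OF \<alpha>] continuous_on_subset[OF that(1)]])
        (use that in auto)
    from Es.conv_has_integral[OF this]
    have 1: "((\<lambda>\<tau>. Ts (t - \<tau>) (pi_s M (Nfull M (x \<tau> + \<alpha> (x \<tau>))))) has_integral mild_conv Es (\<lambda>s. on_chart \<alpha> (x s)) t) {0..t}"
      by (simp add: Es_def on_chart_def)
    have "Es t \<xi> = Ts t \<xi>" using BsD(1)[OF \<xi>] by (simp add: Es_def mem_Xs)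
    with 1 show ?thesis
      by (auto dest: has_integral_unique simp: algebra_simps)
  qed
  then show ?thesis unfolding mild_solution_def by blast
qed

lemma mild_solution_sol:
  assumes "chart \<alpha>" "\<xi> \<in> Bs M" "mild_solution M \<alpha> \<xi> x"
  shows "sol \<alpha> \<xi> b x"
  using assms unfolding sol_def mild_solution_iff[OF assms(1,2)]
  by (auto intro: continuous_on_subset)

lemma sol_field_continuous:
  assumes "chart \<alpha>" "sol \<alpha> \<xi> b x" "t \<le> b"
  shows "continuous_on {0..t} x" "continuous_on {0..t} (\<lambda>s. on_chart \<alpha> (x s))"
proof -
  show c: "continuous_on {0..t} x" using assms unfolding sol_def by (auto intro: continuous_on_subset)
  show "continuous_on {0..t} (\<lambda>s. on_chart \<alpha> (x s))"
    by (rule continuous_on_compose2[OF on_chart_continuous[OF assms(1)] c]) (use assms in \<open>auto intro: sol_in_Bs\<close>)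
qed

text \<open>The difference of two solutions is estimated in two ways: with the block rates of
  \<open>Lam\<close> and the full nonlinearity, which couples the components through
  \<open>Hc\<close>, and with the decay of \<open>Lam\<close> plus the linearisation and the
  remaining nonlinearity, which gives the starting bound of the bootstrap.\<close>

lemma comparison_sol:
  assumes \<alpha>: "chart \<alpha>" and x: "sol \<alpha> \<xi> b x" and y: "sol \<alpha> \<zeta> b y"
    and \<xi>: "\<xi> \<in> Bs M" and \<zeta>: "\<zeta> \<in> Bs M" and Cs: "0 \<le> Cs M"
  shows "comparison_system M b (\<lambda>j t. norm (ps j (x t - y t))) (\<lambda>n. norm (ps n (\<xi> - \<zeta>)))"
proof -
  define g where "g s = on_chart \<alpha> (x s) - on_chart \<alpha> (y s)" for s
  define w where "w s = x s - y s" for s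
  have cont: "continuous_on {0..t} x" "continuous_on {0..t} y" "continuous_on {0..t} g" if "t \<le> b" for t
    unfolding g_def using sol_field_continuous[OF \<alpha> x that] sol_field_continuous[OF \<alpha> y that]
    by (auto intro: continuous_intros)
  have w: "w t = Es t (\<xi> - \<zeta>) + mild_conv Es g t" if "0 \<le> t" "t \<le> b" for t
  proof -
    have "x t = Es t \<xi> + mild_conv Es (\<lambda>s. on_chart \<alpha> (x s)) t" "y t = Es t \<zeta> + mild_conv Es (\<lambda>s. on_chart \<alpha> (y s)) t"
      using x y that by (blast intro: sol_eq)+
    then show ?thesis
      unfolding g_def w_def using that sol_field_continuous[OF \<alpha> x] sol_field_continuous[OF \<alpha> y]
      by (simp add: Es.diff Es.conv_diff)
  qed
  have inB: "x t \<in> Bs M" "y t \<in> Bs M" if "0 \<le> t" "t \<le> b" for t using x y that by (blast intro: sol_in_Bs)+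
  have ineq: "norm (ps j (w t)) \<le> exp (rate M (St j) * t) * norm (ps j (\<xi> - \<zeta>))
      + integral {0..t} (\<lambda>s. exp (rate M (St j) * (t - s)) * (\<Sum>i\<in>IS M. Hc M (St j) i * norm (ps i (w s))))"
    if j: "j \<in> IS M" and t: "0 \<le> t" "t \<le> b" for j t
  proof -
    have "norm (ps j (w t)) \<le> norm (ps j (Es t (\<xi> - \<zeta>))) + norm (ps j (mild_conv Es g t))"
      unfolding w[OF t] blinfun.add_right by (rule norm_triangle_ineq)
    also have "norm (ps j (Es t (\<xi> - \<zeta>))) \<le> exp (rate M (St j) * t) * norm (ps j (\<xi> - \<zeta>))"
      by (rule ps_Es[OF t(1) j])
    also have "norm (ps j (mild_conv Es g t))
      \<le> integral {0..t} (\<lambda>s. exp (rate M (St j) * (t - s)) * (\<Sum>i\<in>IS M. Hc M (St j) i * norm (ps i (w s))))"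
    proof (rule ps_conv_le[OF cont(3)[OF t(2)] j])
      show "continuous_on {0..t} (\<lambda>s. \<Sum>i\<in>IS M. Hc M (St j) i * norm (ps i (w s)))"
        unfolding w_def using cont t by (auto intro!: continuous_intros)
      show "norm (ps j (g s)) \<le> (\<Sum>i\<in>IS M. Hc M (St j) i * norm (ps i (w s)))" if "0 \<le> s" "s \<le> t" for s
        unfolding g_def w_def by (rule on_chart_lip[OF \<alpha>]) (use inB that t j in auto)
    qed
    finally show ?thesis by simp
  qed
  \<comment> \<open>The estimate \<open>exp_Ls\<close> concerns \<open>ELs\<close>, so the
    difference is rewritten as a mild solution for that semigroup. Gronwall with coupling
    \<open>Cs M * Hhat M\<close> then yields the rate \<open>gam M 0\<close>.\<close>
  have norm_w: "norm (w t) \<le> Cs M * norm (\<xi> - \<zeta>) * exp (gam M 0 * t)" if t: "0 \<le> t" "t \<le> b" for t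
  proof (rule gronwall_comparison[where u = "\<lambda>s. norm (w s)" and \<phi> = "\<lambda>_. 0" and b = b and l = "lam_s M"
        and h = "Cs M * Hhat M" and a = "Cs M * norm (\<xi> - \<zeta>)" and g = "\<lambda>s. Cs M * norm (\<xi> - \<zeta>) * exp (gam M 0 * s)"])
    show "continuous_on {0..b} (\<lambda>s. norm (w s))" unfolding w_def using cont by (auto intro!: continuous_intros)
    show "((\<lambda>s. Cs M * norm (\<xi> - \<zeta>) * exp (gam M 0 * s)) has_real_derivative
        (lam_s M + Cs M * Hhat M) * (Cs M * norm (\<xi> - \<zeta>) * exp (gam M 0 * s)) + 0) (at s)" for s
      by (auto intro!: derivative_eq_intros simp: gam_def)
    fix s assume s: "0 \<le> s" "s \<le> b"
    \<comment> \<open>The forcing that remains once the linear part is moved into the semigroup; its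
      Lipschitz constant is \<open>Hhat M\<close> by \<open>Hhat_bound\<close>.\<close>
    define q where "q r = pi_s M (g r) - pi_s M (Lop M (w r))" for r
    have wX: "w r \<in> Xs M" if "0 \<le> r" "r \<le> b" for r
      unfolding w_def by (intro subspace_diff subspace_X BsD inB that)
    have qc: "continuous_on {0..s} q"
      unfolding q_def w_def using cont s by (auto intro!: continuous_intros)
    have ws: "w s = ELs s (\<xi> - \<zeta>) + mild_conv ELs q s"
      unfolding q_def
    proof (rule mild_perturb[OF Es.bounded_semigroup_axioms ELs.bounded_semigroup_axioms _ bounded_linear_piL(1)])
      show "Es 0 = ELs 0"
        using projected_semigroup.at0[OF projected_semigroups(2)] by (simp add: Es_def ELs_def s.at0 fun_eq_iff)
      fix y assume y: "Es 0 y = y"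
      then have yX: "y \<in> Xs M" by (simp add: Es_0 mem_Xs)
      have "((\<lambda>h. (Ts h y - TLs h y) /\<^sub>R h) \<longlongrightarrow> - pi_s M (Lop M y)) (at_right 0)"
      proof (rule perturbed_semigroup_derivative[OF projected_semigroups(1,2) TLs_bound _ _ _ _ _ _ yX])
        show "bounded_linear (\<lambda>x. - pi_s M (Lop M x))" by (intro bounded_linear_minus bounded_linear_piL)
        show "norm (- pi_s M (Lop M x)) \<le> (norm (pi_s M) * norm (Lop M)) * norm x" for x
          using norm_piL_le by simp
      qed (auto intro!: subspace_neg[OF subspace_X(1)])
      then show "((\<lambda>h. (Es h y - ELs h y) /\<^sub>R h) \<longlongrightarrow> - pi_s M (Lop M y)) (at_right 0)"
        using yX by (simp add: Es_def ELs_def mem_Xs)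
    next
      show "continuous_on {0..b} w" unfolding w_def using cont by (auto intro!: continuous_intros)
      show "continuous_on {0..b} (\<lambda>t. pi_s M (g t))" using cont by (auto intro!: continuous_intros)
      show "w t = Es t (\<xi> - \<zeta>) + mild_conv Es (\<lambda>t. pi_s M (g t)) t" if "0 \<le> t" "t \<le> b" for t
        unfolding w[OF that] by (simp add: mild_conv_def)
    qed (use s wX in \<open>auto simp: Es_0 mem_Xs\<close>)
    have q: "norm (q r) \<le> Hhat M * norm (w r)" if "0 \<le> r" "r \<le> s" for r
    proof -
      have "q r = pi_s M (on_chart \<alpha> (x r) - Lop M (x r)) - pi_s M (on_chart \<alpha> (y r) - Lop M (y r))"
        by (simp add: q_def g_def w_def blinfun.diff_right)
      then show ?thesis
        using Hhat_bound(2)[OF \<alpha>, of "y r" "x r"] inB that s by (simp add: w_def)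
    qed
    have qX: "q r \<in> Xs M" for r unfolding q_def by (intro subspace_diff subspace_X pi_in)
    have "norm (w s) \<le> norm (ELs s (\<xi> - \<zeta>)) + norm (mild_conv ELs q s)"
      unfolding ws by (rule norm_triangle_ineq)
    also have "norm (ELs s (\<xi> - \<zeta>)) \<le> exp (lam_s M * s) * (Cs M * norm (\<xi> - \<zeta>))"
    proof -
      have "\<xi> - \<zeta> \<in> Xs M" by (intro subspace_diff subspace_X BsD \<xi> \<zeta>)
      then show ?thesis using exp_Ls[OF s(1), of "\<xi> - \<zeta>"] by (simp add: ELs_def mem_Xs mult_ac)
    qed
    also have "norm (mild_conv ELs q s) \<le> integral {0..s} (\<lambda>r. exp (lam_s M * (s - r)) * (Cs M * Hhat M * norm (w r) + 0))"
    proof (rule ELs.norm_conv_le[OF qc])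
      fix r assume r: "0 \<le> r" "r \<le> s"
      have "norm (ELs (s - r) (q r)) \<le> Cs M * exp (lam_s M * (s - r)) * norm (q r)"
        using exp_Ls[of "s - r" "q r"] r qX[of r] by (simp add: ELs_def mem_Xs)
      also have "\<dots> \<le> Cs M * exp (lam_s M * (s - r)) * (Hhat M * norm (w r))"
        by (intro mult_left_mono q r) (use Cs in auto)
      finally show "norm (ELs (s - r) (q r)) \<le> exp (lam_s M * (s - r)) * (Cs M * Hhat M * norm (w r) + 0)"
        by (simp add: mult_ac)
    next
      show "(\<lambda>r. exp (lam_s M * (s - r)) * (Cs M * Hhat M * norm (w r) + 0)) integrable_on {0..s}"
        unfolding w_def using cont s by (auto intro!: integrable_continuous_real continuous_intros)
    qed
    finally show "norm (w s) \<le> exp (lam_s M * s) * (Cs M * norm (\<xi> - \<zeta>))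
        + integral {0..s} (\<lambda>r. exp (lam_s M * (s - r)) * (Cs M * Hhat M * norm (w r) + 0))" by simp
  qed (use t Cs Hhat_bound(1)[OF \<alpha>] in auto)
  have "norm (ps j (w t)) \<le> pbd M (St j) * Cs M * exp (gam M 0 * t) * (\<Sum>n\<in>IS M. norm (ps n (\<xi> - \<zeta>)))"
    if j: "j \<in> IS M" and t: "0 \<le> t" "t \<le> b" for j t
  proof -
    have pb: "norm (proj M (St j)) \<le> pbd M (St j)" "0 \<le> pbd M (St j)"
      using proj_bound[of "St j"] j norm_ge_zero[of "proj M (St j)"] by (auto simp del: norm_ge_zero intro: order_trans)
    have "norm (ps j (w t)) \<le> pbd M (St j) * norm (w t)"
      by (rule order_trans[OF norm_blinfun]) (use pb in \<open>auto intro: mult_right_mono\<close>)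
    also have "\<dots> \<le> pbd M (St j) * (Cs M * (\<Sum>n\<in>IS M. norm (ps n (\<xi> - \<zeta>))) * exp (gam M 0 * t))"
    proof (intro mult_left_mono pb order_trans[OF norm_w[OF t]] mult_right_mono Cs)
      show "norm (\<xi> - \<zeta>) \<le> (\<Sum>n\<in>IS M. norm (ps n (\<xi> - \<zeta>)))"
        by (intro norm_Xs_le subspace_diff subspace_X BsD \<xi> \<zeta>)
    qed auto
    finally show ?thesis by (simp add: mult_ac)
  qed
  then show ?thesis
    unfolding comparison_system_def using ineq cont by (auto simp: w_def intro!: continuous_intros)
qed

definition gr :: "nat \<Rightarrow> nat \<Rightarrow> real \<Rightarrow> real" where "gr = exp_combination M (G_boot M Nboot)"

text \<open>\<open>Cs M\<close> can only be negative if \<open>Xs M\<close> is the zero space.\<close>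

lemma Xs_trivial:
  assumes "\<not> 0 \<le> Cs M" "x \<in> Xs M"
  shows "x = 0"
proof -
  have "norm x \<le> Cs M * norm x"
    using exp_Ls[of 0 x] assms(2) projected_semigroup.at0[OF projected_semigroups(2)] by simp
  then show ?thesis using assms(1) by (smt (verit) mult_nonneg_nonneg norm_ge_zero zero_less_norm_iff mult_neg_pos)
qed

lemma sol_diff_bound:
  assumes "chart \<alpha>" "sol \<alpha> \<xi> b x" "sol \<alpha> \<zeta> b y" "\<xi> \<in> Bs M" "\<zeta> \<in> Bs M" "j \<in> IS M" "0 \<le> t" "t \<le> b"
  shows "norm (ps j (x t - y t)) \<le> (\<Sum>n\<in>IS M. gr j n t * norm (ps n (\<xi> - \<zeta>)))"
proof (cases "0 \<le> Cs M")
  case True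
  have "valid_bound (G_boot M Nboot)" by (rule valid_bound_boot[OF True])
  then show ?thesis
    using comparison_sol[OF assms(1-5) True] assms(6-) unfolding valid_bound_def gr_def by fastforce
next
  case False
  have "x t = 0" "y t = 0" "\<xi> = 0" "\<zeta> = 0"
    using assms by (auto intro!: Xs_trivial[OF False] BsD(1) intro: sol_in_Bs)
  then show ?thesis by simp
qed

lemma gr_rho:
  assumes "j \<in> IS M" "0 \<le> t"
  shows "(\<Sum>n\<in>IS M. gr j n t * rho M n) \<le> rho M j"
  using rho_invariant[OF assms] by (simp add: gr_def exp_combination_def sum_distrib_right)

lemma gr_nonneg: "0 \<le> Cs M \<Longrightarrow> j \<in> IS M \<Longrightarrow> n \<in> IS M \<Longrightarrow> 0 \<le> t \<Longrightarrow> 0 \<le> gr j n t"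
  using valid_bound_boot unfolding valid_bound_def gr_def by blast

end

section \<open>Existence of the flow\<close>

definition clip :: "real \<Rightarrow> 'a::real_normed_vector \<Rightarrow> 'a" where
  "clip r v = (r / max r (norm v)) *\<^sub>R v"

lemma norm_clip_le: "0 < r \<Longrightarrow> norm (clip r v) \<le> r"
  by (simp add: clip_def pos_divide_le_eq max_def mult_left_mono)

lemma clip_id: "0 < r \<Longrightarrow> norm v \<le> r \<Longrightarrow> clip r v = v"
  by (simp add: clip_def max_def)

text \<open>In a general normed space the radial retraction is not nonexpansive.\<close>

lemma clip_lipschitz:
  assumes r: "0 < r"
  shows "norm (clip r v - clip r w) \<le> 2 * norm (v - w)"
proof -
  define a b where "a = max r (norm v)" and "b = max r (norm w)"
  have ab: "0 < a" "0 < b" "r \<le> a" "norm w \<le> b" using r by (auto simp: a_def b_def)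
  have eq: "clip r v - clip r w = (r / a) *\<^sub>R (v - w) + ((r / a) * ((b - a) / b)) *\<^sub>R w"
  proof -
    have k: "(r / a) * ((b - a) / b) = r / a - r / b" using ab by (simp add: field_simps)
    show ?thesis
      unfolding k clip_def a_def[symmetric] b_def[symmetric] by (simp add: scaleR_diff_left scaleR_diff_right)
  qed
  have ra: "0 \<le> r / a" "r / a \<le> 1" using r ab by auto
  have "\<bar>b - a\<bar> \<le> norm (v - w)"
    using norm_triangle_ineq3[of v w] by (auto simp: a_def b_def max_def abs_if split: if_splits)
  moreover have "norm w / b \<le> 1" using ab by simp
  ultimately have "\<bar>b - a\<bar> * (norm w / b) \<le> norm (v - w) * 1"
    by (intro mult_mono) (use ab in auto)
  then have "(r / a) * (\<bar>b - a\<bar> * (norm w / b)) \<le> 1 * norm (v - w)"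
    using ra ab by (intro mult_mono) auto
  moreover have "norm (((r / a) * ((b - a) / b)) *\<^sub>R w) = (r / a) * (\<bar>b - a\<bar> * (norm w / b))"
    using ra ab r by (simp add: abs_mult)
  moreover have "norm ((r / a) *\<^sub>R (v - w)) \<le> 1 * norm (v - w)"
    unfolding norm_scaleR using ra by (intro mult_right_mono) auto
  ultimately show ?thesis unfolding eq by (intro order_trans[OF norm_triangle_ineq]) linarith
qed

context lyapunov_perron_setting
begin

definition retr :: "'a \<Rightarrow> 'a" where "retr x = (\<Sum>i\<in>IS M. clip (rho M i) (ps i x))"

lemma retr_Bs: "retr x \<in> Bs M"
  unfolding retr_def
proof (rule Bs_sum)
  show "clip (rho M i) (ps i x) \<in> Xi M (St i)" for i
    unfolding clip_def by (intro subspace_mul subspace_X proj_in_Xi)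
  show "norm (clip (rho M i) (ps i x)) \<le> rho M i" if "i \<in> IS M" for i
    by (rule norm_clip_le[OF rho_pos[OF that]])
qed

lemma retr_id: "x \<in> Bs M \<Longrightarrow> retr x = x"
  using Xs_coords[OF BsD(1)] by (simp add: retr_def clip_id rho_pos BsD cong: sum.cong)

lemma retr_lipschitz: "norm (retr x - retr y) \<le> 2 * psum * norm (x - y)"
proof -
  have "norm (retr x - retr y) \<le> (\<Sum>i\<in>IS M. norm (clip (rho M i) (ps i x) - clip (rho M i) (ps i y)))"
    unfolding retr_def sum_subtractf[symmetric] by (rule norm_sum)
  also have "\<dots> \<le> (\<Sum>i\<in>IS M. 2 * norm (ps i (x - y)))"
    using clip_lipschitz rho_pos by (intro sum_mono) (auto simp: blinfun.diff_right)
  also have "\<dots> \<le> 2 * (psum * norm (x - y))"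
    using sum_St_le by (simp add: sum_distrib_left[symmetric])
  finally show ?thesis by simp
qed

definition lext :: real where "lext = lipN * (2 * psum)"

lemma lext_nonneg: "0 \<le> lext" by (simp add: lext_def lipN_nonneg psum_nonneg)

lemma ext_lipschitz:
  assumes "chart \<alpha>"
  shows "norm (on_chart \<alpha> (retr x) - on_chart \<alpha> (retr y)) \<le> lext * norm (x - y)"
proof -
  have "norm (on_chart \<alpha> (retr x) - on_chart \<alpha> (retr y)) \<le> lipN * norm (retr x - retr y)"
    by (rule on_chart_lipschitz[OF assms retr_Bs retr_Bs])
  also have "\<dots> \<le> lipN * (2 * psum * norm (x - y))" by (intro mult_left_mono retr_lipschitz lipN_nonneg)
  finally show ?thesis by (simp add: lext_def mult.assoc)
qed

definition ext_sol :: "('a \<Rightarrow> 'a) \<Rightarrow> 'a \<Rightarrow> (real \<Rightarrow> 'a) \<Rightarrow> bool" where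
  "ext_sol \<alpha> \<xi> x \<longleftrightarrow> continuous_on {0..} x \<and>
     (\<forall>t\<ge>0. x t = Es t \<xi> + mild_conv Es (\<lambda>s. on_chart \<alpha> (retr (x s))) t)"

lemma ext_field_continuous:
  assumes "chart \<alpha>" "continuous_on S x"
  shows "continuous_on S (\<lambda>s. on_chart \<alpha> (retr (x s)))"
proof -
  have "lext-lipschitz_on UNIV (\<lambda>x. on_chart \<alpha> (retr x))"
    using ext_lipschitz[OF assms(1)] lext_nonneg by (intro lipschitz_onI) (auto simp: dist_norm)
  from continuous_on_compose2[OF lipschitz_on_continuous_on[OF this] assms(2)] show ?thesis by simp
qed

lemma ext_sol_exists:
  assumes \<alpha>: "chart \<alpha>"
  shows "\<exists>x. ext_sol \<alpha> \<xi> x"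
  unfolding ext_sol_def
proof (rule Es.mild_solution_exists[OF ext_field_continuous[OF \<alpha>] _ ext_lipschitz[OF \<alpha>] lext_nonneg])
  show "on_chart \<alpha> (retr 0) = 0" using retr_id[OF zero_Bs] on_chart_zero[OF \<alpha>] by simp
qed

lemma ext_sol_in_Xs:
  assumes \<alpha>: "chart \<alpha>" and x: "ext_sol \<alpha> \<xi> x" and t: "0 \<le> t"
  shows "x t \<in> Xs M"
proof -
  have "continuous_on {0..t} (\<lambda>s. on_chart \<alpha> (retr (x s)))"
    by (rule ext_field_continuous[OF \<alpha> continuous_on_subset]) (use x in \<open>auto simp: ext_sol_def\<close>)
  moreover have "x t = Es t \<xi> + mild_conv Es (\<lambda>s. on_chart \<alpha> (retr (x s))) t" using x t by (auto simp: ext_sol_def)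
  ultimately show ?thesis by (auto intro!: subspace_add subspace_X Es_in_Xs conv_in_Xs t)
qed

lemma ext_sol_sol:
  assumes \<alpha>: "chart \<alpha>" and x: "ext_sol \<alpha> \<xi> x" and B: "x ` {0..b} \<subseteq> Bs M"
  shows "sol \<alpha> \<xi> b x"
  unfolding sol_def
proof (intro conjI ballI)
  show "continuous_on {0..b} x" using x by (auto simp: ext_sol_def intro: continuous_on_subset)
  fix t assume t: "t \<in> {0..b}"
  show "x t \<in> Bs M" using B t by auto
  have "x t = Es t \<xi> + mild_conv Es (\<lambda>s. on_chart \<alpha> (retr (x s))) t" using x t by (auto simp: ext_sol_def)
  also have "mild_conv Es (\<lambda>s. on_chart \<alpha> (retr (x s))) t = mild_conv Es (\<lambda>s. on_chart \<alpha> (x s)) t"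
  proof (rule Es.conv_cong)
    fix s assume "0 \<le> s" "s \<le> t"
    then have "x s \<in> Bs M" using B t by (auto simp: image_subset_iff)
    then show "on_chart \<alpha> (retr (x s)) = on_chart \<alpha> (x s)" by (simp add: retr_id)
  qed
  finally show "x t = Es t \<xi> + mild_conv Es (\<lambda>s. on_chart \<alpha> (x s)) t" .
qed

lemma sol_zero: "chart \<alpha> \<Longrightarrow> sol \<alpha> 0 b (\<lambda>_. 0)"
proof -
  assume "chart \<alpha>"
  moreover have "mild_conv Es (\<lambda>_. 0) t = 0" for t
    unfolding mild_conv_def by (rule integral_unique, rule has_integral_is_0) (simp add: Es.zero)
  ultimately show ?thesis by (auto simp: sol_def on_chart_zero Es.zero)
qed

text \<open>Comparison with the zero solution and \<open>gr_rho\<close> give the coordinate bound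
  \<open>s * rho M j\<close>. The strict gap to \<open>rho M j\<close> is what allows continuation
  to the right; at \<open>s = 1\<close> the same estimate would leave no room.\<close>

lemma ext_sol_stays_scaled:
  assumes \<alpha>: "chart \<alpha>" and x: "ext_sol \<alpha> (s *\<^sub>R \<xi>) x" and \<xi>: "\<xi> \<in> Bs M" and s: "0 \<le> s" "s < 1" and b: "0 \<le> b"
  shows "x b \<in> Bs M"
proof -
  have cont: "continuous_on {0..} x" using x by (simp add: ext_sol_def)
  define K where "K = {t \<in> {0..b}. x t \<in> Bs M}"
  have s\<xi>: "s *\<^sub>R \<xi> \<in> Bs M" using scale_Bs[OF \<xi>] s by simp
  have strict: "norm (ps j (x c)) < rho M j" if c: "0 \<le> c" "{0..c} \<subseteq> K" and j: "j \<in> IS M" for c j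
  proof -
    have xs: "sol \<alpha> (s *\<^sub>R \<xi>) c x" by (rule ext_sol_sol[OF \<alpha> x]) (use c in \<open>auto simp: K_def\<close>)
    have "norm (ps j (x c)) \<le> s * rho M j"
    proof (cases "0 \<le> Cs M")
      case True
      have "norm (ps j (x c - 0)) \<le> (\<Sum>n\<in>IS M. gr j n c * norm (ps n (s *\<^sub>R \<xi> - 0)))"
        by (rule sol_diff_bound[OF \<alpha> xs sol_zero[OF \<alpha>]]) (use s\<xi> c j in auto)
      also have "\<dots> \<le> (\<Sum>n\<in>IS M. gr j n c * (s * rho M n))"
        using gr_nonneg[OF True j] c s \<xi>
        by (intro sum_mono mult_left_mono) (auto simp: blinfun.scaleR_right BsD intro!: mult_left_mono)
      also have "\<dots> = s * (\<Sum>n\<in>IS M. gr j n c * rho M n)" by (simp add: sum_distrib_left mult_ac)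
      also have "\<dots> \<le> s * rho M j" by (intro mult_left_mono gr_rho j c s)
      finally show ?thesis by simp
    next
      case False
      then have "x c = 0" using Xs_trivial ext_sol_in_Xs[OF \<alpha> x c(1)] by blast
      then show ?thesis using s rho_pos[OF j] by simp
    qed
    also have "\<dots> < rho M j" using s rho_pos[OF j] by simp
    finally show ?thesis .
  qed
  have "{0..b} \<subseteq> K"
  proof (rule interval_continuous_induction)
    have "closed ({0..b} \<inter> x -` Bs M)"
      by (rule continuous_closed_preimage) (use closed_Bs cont in \<open>auto intro: continuous_on_subset\<close>)
    then show "closed K" by (simp add: K_def vimage_def Int_def)
    have "x 0 = s *\<^sub>R \<xi>"
      using x BsD(1)[OF s\<xi>] by (simp add: ext_sol_def Es_0 mem_Xs)
    then show "0 \<in> K" using s\<xi> b by (simp add: K_def)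
    fix c assume c: "0 \<le> c" "c < b" "{0..c} \<subseteq> K"
    have "(x \<longlongrightarrow> x c) (at c within {c..b})"
      using continuous_on_subset[OF cont, of "{c..b}"] c by (auto simp: continuous_on_def)
    then have lim: "(x \<longlongrightarrow> x c) (at_right c)" using c by (simp add: at_within_Icc_at_right)
    have "eventually (\<lambda>t. \<forall>j\<in>IS M. norm (ps j (x t)) < rho M j) (at_right c)"
    proof (rule eventually_ball_finite[OF finite_index(1)], rule ballI)
      fix j assume j: "j \<in> IS M"
      have "((\<lambda>t. norm (ps j (x t))) \<longlongrightarrow> norm (ps j (x c))) (at_right c)"
        by (intro tendsto_norm blinfun.tendsto tendsto_const lim)
      then show "eventually (\<lambda>t. norm (ps j (x t)) < rho M j) (at_right c)"
        by (rule order_tendstoD(2)) (rule strict[OF c(1,3) j])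
    qed
    then obtain d where d: "d > c" "\<And>t. c < t \<Longrightarrow> t < d \<Longrightarrow> \<forall>j\<in>IS M. norm (ps j (x t)) < rho M j"
      unfolding eventually_at_right_field by auto
    define e where "e = min ((c + d) / 2) b"
    have "{c..e} \<subseteq> K"
    proof
      fix t assume t: "t \<in> {c..e}"
      show "t \<in> K"
      proof (cases "t = c")
        case False
        then have "\<forall>j\<in>IS M. norm (ps j (x t)) < rho M j" using d t by (intro d) (auto simp: e_def)
        then have "x t \<in> Bs M" using ext_sol_in_Xs[OF \<alpha> x, of t] t c by (auto simp: Bs_def less_imp_le)
        then show ?thesis using t c by (auto simp: K_def e_def)
      qed (use c in auto)
    qed
    moreover have "e > c" using d c by (auto simp: e_def)
    ultimately show "\<exists>d>c. {c..d} \<subseteq> K" by blast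
  qed
  then show ?thesis using b by (auto simp: K_def)
qed

lemma ext_sol_stays:
  assumes \<alpha>: "chart \<alpha>" and x: "ext_sol \<alpha> \<xi> x" and \<xi>: "\<xi> \<in> Bs M" and t: "0 \<le> t"
  shows "x t \<in> Bs M"
proof -
  define c where "c = psum * norm (pi_s M) * norm \<xi> * exp (psum * norm (pi_s M) * lext * t)"
  have c0: "0 \<le> c" by (simp add: c_def psum_nonneg)
  have "\<exists>y\<in>Bs M. dist y (x t) < e" if e: "0 < e" for e
  proof -
    \<comment> \<open>By Gronwall, shrinking the initial value to
      \<open>(1 - h) *\<^sub>R \<xi>\<close> moves the solution at time \<open>t\<close> by at most
      \<open>h * c\<close>, which this choice makes smaller than \<open>e\<close>.\<close>
    define h where "h = min 1 (e / (c + 1))"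
    have h: "0 < h" "h \<le> 1" using e c0 by (auto simp: h_def)
    have hc: "h * c < e"
    proof -
      have "h * c \<le> e / (c + 1) * c" using c0 by (intro mult_right_mono) (auto simp: h_def)
      also have "\<dots> < e" using e c0 by (simp add: field_simps)
      finally show ?thesis .
    qed
    obtain y where y: "ext_sol \<alpha> ((1 - h) *\<^sub>R \<xi>) y" using ext_sol_exists[OF \<alpha>] by blast
    have "y t \<in> Bs M" by (rule ext_sol_stays_scaled[OF \<alpha> y \<xi> _ _ t]) (use h in auto)
    moreover have "norm (x t - y t) \<le> (psum * norm (pi_s M) * norm (h *\<^sub>R \<xi>) + psum * norm (pi_s M) * 0 * t)
        * exp (psum * norm (pi_s M) * lext * t)"
    proof (rule Es.mild_gronwall[where w = "\<lambda>t. x t - y t" and q = "\<lambda>t. on_chart \<alpha> (retr (x t)) - on_chart \<alpha> (retr (y t))" and b = t])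
      have cxy: "continuous_on {0..b} x" "continuous_on {0..b} y" for b
        using x y by (auto simp: ext_sol_def intro: continuous_on_subset)
      then show "continuous_on {0..t} (\<lambda>t. x t - y t)"
        "continuous_on {0..t} (\<lambda>t. on_chart \<alpha> (retr (x t)) - on_chart \<alpha> (retr (y t)))"
        by (auto intro!: continuous_intros ext_field_continuous[OF \<alpha>])
      fix r assume r: "0 \<le> r" "r \<le> t"
      have "x r = Es r \<xi> + mild_conv Es (\<lambda>s. on_chart \<alpha> (retr (x s))) r"
        "y r = Es r ((1 - h) *\<^sub>R \<xi>) + mild_conv Es (\<lambda>s. on_chart \<alpha> (retr (y s))) r"
        using x y r by (auto simp: ext_sol_def)
      moreover have "\<xi> - (1 - h) *\<^sub>R \<xi> = h *\<^sub>R \<xi>" by (simp add: algebra_simps)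
      ultimately show "x r - y r = Es r (h *\<^sub>R \<xi>)
          + mild_conv Es (\<lambda>t. on_chart \<alpha> (retr (x t)) - on_chart \<alpha> (retr (y t))) r"
        using r cxy by (subst Es.conv_diff) (auto intro!: ext_field_continuous[OF \<alpha>] simp: Es.diff[symmetric])
      show "norm (on_chart \<alpha> (retr (x r)) - on_chart \<alpha> (retr (y r))) \<le> lext * norm (x r - y r) + 0"
        using ext_lipschitz[OF \<alpha>] by simp
    qed (use t lext_nonneg in auto)
    then have "norm (x t - y t) \<le> h * c" using h by (simp add: c_def mult_ac)
    ultimately show ?thesis using hc by (intro bexI[of _ "y t"]) (auto simp: dist_norm norm_minus_commute)
  qed
  then have "x t \<in> closure (Bs M)" by (simp add: closure_approachable)
  then show ?thesis using closed_Bs by simp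
qed

lemma mild_solution_exists:
  assumes \<alpha>: "chart \<alpha>" and \<xi>: "\<xi> \<in> Bs M"
  shows "\<exists>x. mild_solution M \<alpha> \<xi> x"
proof -
  obtain x where x: "ext_sol \<alpha> \<xi> x" using ext_sol_exists[OF \<alpha>] by blast
  have B: "x t \<in> Bs M" if "0 \<le> t" for t by (rule ext_sol_stays[OF \<alpha> x \<xi> that])
  have "x t = Es t \<xi> + mild_conv Es (\<lambda>s. on_chart \<alpha> (x s)) t" if "0 \<le> t" for t
    by (rule sol_eq[OF ext_sol_sol[OF \<alpha> x, of t]]) (use B that in auto)
  then show ?thesis
    unfolding mild_solution_iff[OF \<alpha> \<xi>] using B x by (auto simp: ext_sol_def)
qed

lemma mild_solution_diff_bound:
  assumes "chart \<alpha>" "\<xi> \<in> Bs M" "\<zeta> \<in> Bs M" "mild_solution M \<alpha> \<xi> x" "mild_solution M \<alpha> \<zeta> y" "j \<in> IS M" "0 \<le> t"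
  shows "norm (ps j (x t - y t)) \<le> (\<Sum>n\<in>IS M. gr j n t * norm (ps n (\<xi> - \<zeta>)))"
  by (rule sol_diff_bound[OF assms(1) mild_solution_sol mild_solution_sol]) (use assms in auto)

lemma mild_solution_in_Bs: "mild_solution M \<alpha> \<xi> x \<Longrightarrow> 0 \<le> t \<Longrightarrow> x t \<in> Bs M"
  by (simp add: mild_solution_def)

lemma mild_solution_unique:
  assumes "chart \<alpha>" "\<xi> \<in> Bs M" "mild_solution M \<alpha> \<xi> x" "mild_solution M \<alpha> \<xi> y" "0 \<le> t"
  shows "y t = x t"
proof -
  have "ps j (y t - x t) = 0" if "j \<in> IS M" for j
    using mild_solution_diff_bound[OF assms(1,2,2,4,3) that assms(5)] by (simp add: blinfun.zero_right)
  moreover have "y t - x t \<in> Xs M"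
    by (intro subspace_diff subspace_X BsD mild_solution_in_Bs[OF assms(4)] mild_solution_in_Bs[OF assms(3)] assms)
  ultimately have "y t - x t = 0" using Xs_coords by (metis (no_types, lifting) sum.neutral)
  then show ?thesis by simp
qed

lemma flow_mild:
  assumes "chart \<alpha>" "\<xi> \<in> Bs M"
  shows "mild_solution M \<alpha> \<xi> (\<lambda>t. flow M t \<xi> \<alpha>)"
  unfolding flow_def using someI_ex[OF mild_solution_exists[OF assms]] by (simp add: eta_contract_eq)

lemmas flow_in_Bs = mild_solution_in_Bs[OF flow_mild]
  and flow_bound = mild_solution_diff_bound[OF _ _ _ flow_mild flow_mild]

lemma flow_eq:
  assumes "chart \<alpha>" "\<xi> \<in> Bs M"
  shows "continuous_on {0..} (\<lambda>t. flow M t \<xi> \<alpha>)"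
    and "0 \<le> t \<Longrightarrow> flow M t \<xi> \<alpha> = Es t \<xi> + mild_conv Es (\<lambda>s. on_chart \<alpha> (flow M s \<xi> \<alpha>)) t"
  using flow_mild[OF assms] unfolding mild_solution_iff[OF assms] by blast+

end

text \<open>Serves both the flow at a fixed time and \<open>Psi\<close>, whose remainders are
  obtained as explicit quadratic bounds on the box.\<close>

lemma has_derivative_quadratic_remainder:
  assumes D: "bounded_linear D"
    and rem: "\<And>y. y \<in> S \<Longrightarrow> norm (f y - f x - D (y - x)) \<le> c * (norm (y - x))\<^sup>2"
  shows "(f has_derivative D) (at x within S)"
  unfolding has_derivative_within_alt
proof (intro conjI allI impI D)
  fix e :: real assume e: "e > 0"
  define d where "d = e / (\<bar>c\<bar> + 1)"
  have d: "d > 0" using e by (simp add: d_def add_nonneg_pos)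
  have "norm (f y - f x - D (y - x)) \<le> e * norm (y - x)" if "y \<in> S" "norm (y - x) < d" for y
  proof -
    have "norm (f y - f x - D (y - x)) \<le> c * (norm (y - x))\<^sup>2" by (rule rem[OF that(1)])
    also have "\<dots> \<le> (\<bar>c\<bar> + 1) * (norm (y - x))\<^sup>2" by (intro mult_right_mono) auto
    also have "\<dots> \<le> (\<bar>c\<bar> + 1) * (d * norm (y - x))"
      using that(2) by (intro mult_left_mono) (auto simp: power2_eq_square intro!: mult_right_mono)
    also have "\<dots> = e * norm (y - x)" by (simp add: d_def)
    finally show ?thesis .
  qed
  then show "\<exists>d>0. \<forall>y\<in>S. norm (y - x) < d \<longrightarrow> norm (f y - f x - D (y - x)) \<le> e * norm (y - x)"
    using d by blast
qed

context lyapunov_perron_setting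
begin

section \<open>Derivatives relative to the box\<close>

lemma small_multiple_in_Bs:
  assumes "v \<in> Xs M"
  shows "\<exists>s>0. s *\<^sub>R v \<in> Bs M"
proof -
  define c where "c = (\<Sum>i\<in>IS M. norm (ps i v) / rho M i)"
  have c0: "0 \<le> c" unfolding c_def using rho_pos by (intro sum_nonneg) (auto simp: less_imp_le)
  define s where "s = 1 / (1 + c)"
  have s: "0 < s" using c0 by (simp add: s_def)
  have "norm (ps i (s *\<^sub>R v)) \<le> rho M i" if i: "i \<in> IS M" for i
  proof -
    have "norm (ps i v) / rho M i \<le> c"
      unfolding c_def by (rule member_le_sum) (use i rho_pos in \<open>auto simp: less_imp_le\<close>)
    then have "norm (ps i v) \<le> (1 + c) * rho M i" using rho_pos[OF i] by (simp add: field_simps)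
    then show ?thesis using c0 by (simp add: s_def blinfun.scaleR_right field_simps)
  qed
  then have "s *\<^sub>R v \<in> Bs M" using assms subspace_X(1) by (auto simp: Bs_def intro: subspace_mul)
  with s show ?thesis by blast
qed

lemma derivative_along_segment:
  assumes "(f has_derivative D) (at \<xi> within Bs M)" "\<xi> \<in> Bs M" "\<eta> \<in> Bs M"
  shows "((\<lambda>t. f (\<xi> + t *\<^sub>R (\<eta> - \<xi>))) has_vector_derivative D (\<eta> - \<xi>)) (at 0 within {0..1})"
proof -
  have "\<xi> + t *\<^sub>R (\<eta> - \<xi>) \<in> Bs M" if "t \<in> {0..1}" for t
  proof -
    have "\<xi> + t *\<^sub>R (\<eta> - \<xi>) = (1 - t) *\<^sub>R \<xi> + t *\<^sub>R \<eta>" by (simp add: algebra_simps)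
    then show ?thesis using convexD[OF convex_Bs assms(2,3), of "1 - t" t] that by auto
  qed
  then have sub: "(\<lambda>t. \<xi> + t *\<^sub>R (\<eta> - \<xi>)) ` {0..1} \<subseteq> Bs M" by auto
  have 1: "((\<lambda>t. \<xi> + t *\<^sub>R (\<eta> - \<xi>)) has_derivative (\<lambda>h. h *\<^sub>R (\<eta> - \<xi>))) (at 0 within {0..1})"
    by (auto intro!: derivative_eq_intros)
  have 2: "(f has_derivative D) (at (\<xi> + 0 *\<^sub>R (\<eta> - \<xi>)) within (\<lambda>t. \<xi> + t *\<^sub>R (\<eta> - \<xi>)) ` {0..1})"
    using has_derivative_subset[OF assms(1) sub] by simp
  from diff_chain_within[OF 1 2]
  show ?thesis
    using has_derivative_linear[OF assms(1)] by (simp add: has_vector_derivative_def o_def linear_scale)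
qed

text \<open>The box need not be a neighbourhood of its points, so only directions towards other
  points of the box can be tested. Testing towards a small multiple of \<open>v\<close> and towards
  0 and subtracting removes the base point and leaves \<open>v\<close>.\<close>

lemma derivative_Bs_unique:
  assumes "(f has_derivative D) (at \<xi> within Bs M)" "(f has_derivative D') (at \<xi> within Bs M)"
    and \<xi>: "\<xi> \<in> Bs M" and v: "v \<in> Xs M"
  shows "D v = D' v"
proof -
  have seg: "D (\<eta> - \<xi>) = D' (\<eta> - \<xi>)" if "\<eta> \<in> Bs M" for \<eta>
    by (rule vector_derivative_unique_within[OF _ derivative_along_segment[OF assms(1) \<xi> that]
          derivative_along_segment[OF assms(2) \<xi> that]]) (simp add: at_within_Icc_at_right)
  obtain s where s: "s > 0" "s *\<^sub>R v \<in> Bs M" using small_multiple_in_Bs[OF v] by blast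
  have lin: "linear D" "linear D'" using assms by (auto intro: has_derivative_linear)
  have "D (s *\<^sub>R v) - D \<xi> = D' (s *\<^sub>R v) - D' \<xi>"
    using seg[OF s(2)] lin by (simp add: linear_diff)
  moreover have "D \<xi> = D' \<xi>" using seg[OF zero_Bs] lin by (simp add: linear_neg)
  ultimately show ?thesis using s(1) lin by (simp add: linear_scale)
qed

lemma DBs_eq:
  assumes "(f has_derivative D) (at \<xi> within Bs M)" "\<xi> \<in> Bs M" "v \<in> Xs M"
  shows "DBs M f \<xi> v = D v"
proof -
  have "(f has_derivative DBs M f \<xi>) (at \<xi> within Bs M)"
    unfolding DBs_def using assms(1) frechet_derivative_works differentiable_def by blast
  from derivative_Bs_unique[OF this assms] show ?thesis .
qed

lemma has_derivative_Bs_cong: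
  assumes "(f has_derivative D) (at \<xi> within Bs M)" "bounded_linear D'" "\<xi> \<in> Bs M"
    and eq: "\<And>v. v \<in> Xs M \<Longrightarrow> D' v = D v"
  shows "(f has_derivative D') (at \<xi> within Bs M)"
  using assms(1) unfolding has_derivative_within_alt
proof (elim conjE, intro conjI assms(2))
  assume *: "\<forall>e>0. \<exists>d>0. \<forall>y\<in>Bs M. norm (y - \<xi>) < d \<longrightarrow> norm (f y - f \<xi> - D (y - \<xi>)) \<le> e * norm (y - \<xi>)"
  have "D' (y - \<xi>) = D (y - \<xi>)" if "y \<in> Bs M" for y
    by (intro eq subspace_diff subspace_X BsD that assms(3))
  then show "\<forall>e>0. \<exists>d>0. \<forall>y\<in>Bs M. norm (y - \<xi>) < d \<longrightarrow> norm (f y - f \<xi> - D' (y - \<xi>)) \<le> e * norm (y - \<xi>)"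
    using * by simp
qed

text \<open>At a boundary point of the box it may be impossible to move in the direction \<open>v\<close> or \<open>-v\<close>, so
  the bound is first obtained at \<open>s *\<^sub>R \<xi>\<close> with \<open>s < 1\<close>.\<close>

lemma directional_bound:
  fixes f :: "'a \<Rightarrow> 'b::real_normed_vector"
  assumes D: "\<And>x. x \<in> Bs M \<Longrightarrow> (f has_derivative D x) (at x within Bs M)"
    and i: "i \<in> IS M" and v: "v \<in> Xi M (St i)" and \<xi>: "\<xi> \<in> Bs M"
    and lip: "\<And>x \<zeta>. x \<in> Bs M \<Longrightarrow> \<zeta> \<in> Xi M (St i) \<Longrightarrow> x + \<zeta> \<in> Bs M \<Longrightarrow> norm (f (x + \<zeta>) - f x) \<le> c * norm \<zeta>"
    and cont: "\<And>x. x \<in> Bs M \<Longrightarrow> norm (D x v - D \<xi> v) \<le> \<kappa> * norm (x - \<xi>)"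
  shows "norm (D \<xi> v) \<le> c * norm v"
proof -
  have inner: "norm (D (s *\<^sub>R \<xi>) v) \<le> c * norm v" if s: "0 \<le> s" "s < 1" for s
  proof -
    let ?x = "s *\<^sub>R \<xi>"
    have xB: "?x \<in> Bs M" using scale_Bs[OF \<xi>] s by simp
    obtain r where r: "r > 0" "r *\<^sub>R v \<in> Bs M" using small_multiple_in_Bs v Xi_sub(1)[OF i] by blast
    \<comment> \<open>With this step length the moved point is the convex combination of
      \<open>\<xi>\<close> and \<open>r *\<^sub>R v\<close> with weights \<open>s\<close> and
      \<open>1 - s\<close>, hence in the box.\<close>
    define \<delta> where "\<delta> = (1 - s) * r"
    have \<delta>: "\<delta> > 0" using s r by (simp add: \<delta>_def)
    have inB: "?x + \<delta> *\<^sub>R v \<in> Bs M"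
      using convexD[OF convex_Bs \<xi> r(2), of s "1 - s"] s by (simp add: \<delta>_def)
    let ?g = "\<lambda>t. f (?x + t *\<^sub>R (?x + \<delta> *\<^sub>R v - ?x))"
    have "(?g has_vector_derivative D ?x (?x + \<delta> *\<^sub>R v - ?x)) (at 0 within {0..1})"
      by (rule derivative_along_segment[OF D[OF xB] xB inB])
    then have lim: "((\<lambda>h. (?g (0 + h) - ?g 0) /\<^sub>R h) \<longlongrightarrow> D ?x (?x + \<delta> *\<^sub>R v - ?x)) (at_right 0)"
      by (rule vector_derivative_imp_right) auto
    have "norm (D ?x (?x + \<delta> *\<^sub>R v - ?x)) \<le> c * (\<delta> * norm v)"
    proof (rule tendsto_upperbound[OF tendsto_norm[OF lim]])
      have "eventually (\<lambda>h. 0 < h \<and> h < 1) (at_right (0::real))"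
        using eventually_at_right_real[of 0 1] by (auto elim: eventually_mono)
      then show "eventually (\<lambda>h. norm ((?g (0 + h) - ?g 0) /\<^sub>R h) \<le> c * (\<delta> * norm v)) (at_right 0)"
      proof eventually_elim
        case (elim h)
        have hB: "?x + h *\<^sub>R \<delta> *\<^sub>R v \<in> Bs M"
        proof -
          have "?x + h *\<^sub>R \<delta> *\<^sub>R v = (1 - h) *\<^sub>R ?x + h *\<^sub>R (?x + \<delta> *\<^sub>R v)" by (simp add: algebra_simps)
          then show ?thesis using convexD[OF convex_Bs xB inB, of "1 - h" h] elim by simp
        qed
        have "norm (f (?x + h *\<^sub>R \<delta> *\<^sub>R v) - f ?x) \<le> c * norm (h *\<^sub>R \<delta> *\<^sub>R v)"
          by (rule lip[OF xB _ hB]) (intro subspace_mul subspace_X v)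
        also have "\<dots> = h * (c * (\<delta> * norm v))" using elim \<delta> by (simp add: mult_ac)
        finally have "norm (f (?x + h *\<^sub>R \<delta> *\<^sub>R v) - f ?x) \<le> h * (c * (\<delta> * norm v))" .
        then have "inverse h * norm (f (?x + h *\<^sub>R \<delta> *\<^sub>R v) - f ?x) \<le> inverse h * (h * (c * (\<delta> * norm v)))"
          using elim by (intro mult_left_mono) auto
        then show ?case using elim by (simp add: mult.assoc[symmetric] del: scaleR_scaleR)
      qed
    qed simp
    then have "\<delta> * norm (D ?x v) \<le> \<delta> * (c * norm v)"
      using has_derivative_linear[OF D[OF xB]] \<delta> by (simp add: linear_scale mult_ac)
    then show ?thesis using \<delta> by simp
  qed
  show ?thesis
  proof (rule field_le_epsilon)
    fix e :: real assume e: "e > 0"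
    \<comment> \<open>The scaled point \<open>(1 - h) *\<^sub>R \<xi>\<close> is at distance
      \<open>h * norm \<xi>\<close>, so the Lipschitz continuity of the derivative costs at most
      \<open>e\<close>.\<close>
    define h where "h = min 1 (e / (\<bar>\<kappa>\<bar> * norm \<xi> + 1))"
    have pos: "\<bar>\<kappa>\<bar> * norm \<xi> + 1 > 0" by (simp add: add_nonneg_pos)
    have h: "0 < h" "h \<le> 1" using e pos by (auto simp: h_def)
    have "norm (D \<xi> v) \<le> norm (D ((1 - h) *\<^sub>R \<xi>) v) + norm (D ((1 - h) *\<^sub>R \<xi>) v - D \<xi> v)"
      by (metis norm_minus_commute norm_triangle_sub)
    also have "norm (D ((1 - h) *\<^sub>R \<xi>) v) \<le> c * norm v" by (rule inner) (use h in auto)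
    also have "norm (D ((1 - h) *\<^sub>R \<xi>) v - D \<xi> v) \<le> \<kappa> * norm ((1 - h) *\<^sub>R \<xi> - \<xi>)"
      by (rule cont, rule scale_Bs[OF \<xi>]) (use h in auto)
    also have "\<dots> = \<kappa> * (h * norm \<xi>)" using h by (simp add: algebra_simps)
    also have "\<dots> \<le> h * (\<bar>\<kappa>\<bar> * norm \<xi> + 1)"
    proof -
      have "\<kappa> * (h * norm \<xi>) \<le> \<bar>\<kappa>\<bar> * (h * norm \<xi>)" using h by (intro mult_right_mono) auto
      also have "\<dots> = h * (\<bar>\<kappa>\<bar> * norm \<xi>)" by simp
      also have "\<dots> \<le> h * (\<bar>\<kappa>\<bar> * norm \<xi> + 1)" using h by (intro mult_left_mono) auto
      finally show ?thesis .
    qed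
    also have "\<dots> \<le> e / (\<bar>\<kappa>\<bar> * norm \<xi> + 1) * (\<bar>\<kappa>\<bar> * norm \<xi> + 1)"
      using pos by (intro mult_right_mono) (auto simp: h_def)
    also have "\<dots> = e" using pos by simp
    finally show "norm (D \<xi> v) \<le> c * norm v + e" by simp
  qed
qed

lemma Sc_nonneg:
  assumes "\<And>i' i j. i' \<in> IU M \<Longrightarrow> i \<in> IS M \<Longrightarrow> j \<in> IS M \<Longrightarrow> 0 < Pbar i' i j"
    and "j \<in> IX M" "n \<in> IS M" "m \<in> IS M"
  shows "0 \<le> Sc M Pbar j n m"
  unfolding Sc_def
  by (intro add_nonneg_nonneg sum_nonneg mult_nonneg_nonneg Cbd1_nonneg Cbd2_nonneg less_imp_le[OF P_pos] less_imp_le[OF assms(1)])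
    (use assms in auto)

end

section \<open>Differentiable charts\<close>

locale smooth_chart = lyapunov_perron_setting M Nboot
  for M :: "'a::banach lp_data" and Nboot :: nat +
  fixes \<alpha> :: "'a \<Rightarrow> 'a" and Pbar :: "nat \<Rightarrow> nat \<Rightarrow> nat \<Rightarrow> real"
  assumes B11: "\<alpha> \<in> B11 M Pbar"
    and Pbar_pos: "\<And>i' i j. i' \<in> IU M \<Longrightarrow> i \<in> IS M \<Longrightarrow> j \<in> IS M \<Longrightarrow> 0 < Pbar i' i j"
begin

lemma chart: "chart \<alpha>" using chart_B11[OF B11] .

text \<open>The relative derivative is arbitrary off \<open>Xs M\<close>. Composing with
  \<open>pi_s\<close> fixes one representative on the whole space without changing it on
  \<open>Xs M\<close>.\<close>

definition Da :: "'a \<Rightarrow> 'a \<Rightarrow> 'a" where "Da \<xi> v = DBs M \<alpha> \<xi> (pi_s M v)"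

lemma DBs_alpha: "\<xi> \<in> Bs M \<Longrightarrow> (\<alpha> has_derivative DBs M \<alpha> \<xi>) (at \<xi> within Bs M)"
  unfolding DBs_def using B11 by (auto simp: B11_def frechet_derivative_works)

lemma bounded_linear_Da: "\<xi> \<in> Bs M \<Longrightarrow> bounded_linear (Da \<xi>)"
  unfolding Da_def[abs_def]
  by (rule bounded_linear_compose[OF has_derivative_bounded_linear[OF DBs_alpha] blinfun.bounded_linear_right])

lemma has_derivative_Da: "\<xi> \<in> Bs M \<Longrightarrow> (\<alpha> has_derivative Da \<xi>) (at \<xi> within Bs M)"
  by (rule has_derivative_Bs_cong[OF DBs_alpha bounded_linear_Da]) (auto simp: Da_def mem_Xs)

lemma Da_pi [simp]: "Da \<xi> (pi_s M v) = Da \<xi> v" by (simp add: Da_def)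

lemma Da_Xu:
  assumes \<xi>: "\<xi> \<in> Bs M"
  shows "Da \<xi> v \<in> Xu M"
proof -
  have "((\<lambda>x. pi_u M (\<alpha> x)) has_derivative (\<lambda>v. pi_u M (Da \<xi> v))) (at \<xi> within Bs M)"
    by (rule bounded_linear.has_derivative[OF blinfun.bounded_linear_right has_derivative_Da[OF \<xi>]])
  then have "(\<alpha> has_derivative (\<lambda>v. pi_u M (Da \<xi> v))) (at \<xi> within Bs M)"
    by (rule has_derivative_transform[OF \<xi>, rotated]) (use chart_Xu[OF chart] in \<open>simp add: mem_Xu\<close>)
  from derivative_Bs_unique[OF this has_derivative_Da[OF \<xi>] \<xi>, of "pi_s M v"]
  show ?thesis by (simp add: mem_Xu)
qed

lemma Da_lipschitz: "\<exists>L. \<forall>\<xi>\<in>Bs M. \<forall>\<eta>\<in>Bs M. \<forall>v. norm (Da \<xi> v - Da \<eta> v) \<le> L * norm (\<xi> - \<eta>) * norm (pi_s M v)"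
proof -
  obtain L where L: "\<And>\<xi> \<eta>. \<xi> \<in> Bs M \<Longrightarrow> \<eta> \<in> Bs M \<Longrightarrow>
      op_norm_on (Xs M) (\<lambda>v. DBs M \<alpha> \<xi> v - DBs M \<alpha> \<eta> v) \<le> ereal (L * norm (\<xi> - \<eta>))"
  proof -
    have "\<exists>L\<ge>0. \<forall>\<xi>\<in>Bs M. \<forall>\<eta>\<in>Bs M. op_norm_on (Xs M) (\<lambda>v. DBs M \<alpha> \<xi> v - DBs M \<alpha> \<eta> v) \<le> ereal (L * norm (\<xi> - \<eta>))"
      using B11 unfolding B11_def by blast
    then show ?thesis using that by blast
  qed
  have "norm (Da \<xi> v - Da \<eta> v) \<le> L * norm (\<xi> - \<eta>) * norm (pi_s M v)" if "\<xi> \<in> Bs M" "\<eta> \<in> Bs M" for \<xi> \<eta> v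
    unfolding Da_def
    by (rule op_norm_onD[OF L[OF that]])
      (use has_derivative_linear[OF DBs_alpha] that in \<open>auto simp: linear_0\<close>)
  then show ?thesis by blast
qed

lemma Da_split: "\<xi> \<in> Bs M \<Longrightarrow> Da \<xi> v = (\<Sum>n\<in>IS M. Da \<xi> (ps n v))"
  using linear_sum[OF bounded_linear.linear[OF bounded_linear_Da], of \<xi> "\<lambda>n. ps n v" "IS M"]
  by (metis Da_pi pi_s_apply)

text \<open>The Lipschitz constants of the chart bound its partial derivatives; at faces of the box
  this uses the continuity of the derivative through \<open>directional_bound\<close>. The
  coordinates of \<open>v\<close> are then summed.\<close>

lemma Da_coord:
  assumes \<xi>: "\<xi> \<in> Bs M" and i': "i' \<in> IU M"
  shows "norm (pu i' (Da \<xi> v)) \<le> (\<Sum>n\<in>IS M. Pt M i' n * norm (ps n v))"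
proof -
  obtain L where L: "\<And>\<xi> \<eta> v. \<xi> \<in> Bs M \<Longrightarrow> \<eta> \<in> Bs M \<Longrightarrow> norm (Da \<xi> v - Da \<eta> v) \<le> L * norm (\<xi> - \<eta>) * norm (pi_s M v)"
    using Da_lipschitz by blast
  have 1: "norm (pu i' (Da \<xi> (ps n v))) \<le> Pt M i' n * norm (ps n v)" if n: "n \<in> IS M" for n
  proof (rule directional_bound[where D = "\<lambda>x v. pu i' (Da x v)" and f = "\<lambda>x. pu i' (\<alpha> x)", OF _ n proj_in_Xi \<xi>])
    show "((\<lambda>x. pu i' (\<alpha> x)) has_derivative (\<lambda>v. pu i' (Da x v))) (at x within Bs M)" if "x \<in> Bs M" for x
      by (rule bounded_linear.has_derivative[OF blinfun.bounded_linear_right has_derivative_Da[OF that]])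
    show "norm (pu i' (\<alpha> (x + \<zeta>)) - pu i' (\<alpha> x)) \<le> Pt M i' n * norm \<zeta>"
      if "x \<in> Bs M" "\<zeta> \<in> Xi M (St n)" "x + \<zeta> \<in> Bs M" for x \<zeta>
      by (rule Lip_le) (use chart i' n that in \<open>auto simp: chart_def\<close>)
    fix x assume x: "x \<in> Bs M"
    have "norm (pu i' (Da x (ps n v)) - pu i' (Da \<xi> (ps n v))) \<le> norm (proj M (Ust i')) * norm (Da x (ps n v) - Da \<xi> (ps n v))"
      unfolding blinfun.diff_right[symmetric] by (rule norm_blinfun)
    also have "\<dots> \<le> norm (proj M (Ust i')) * (L * norm (x - \<xi>) * norm (pi_s M (ps n v)))"
      by (intro mult_left_mono L x \<xi>) auto
    finally show "norm (pu i' (Da x (ps n v)) - pu i' (Da \<xi> (ps n v)))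
        \<le> (norm (proj M (Ust i')) * L * norm (pi_s M (ps n v))) * norm (x - \<xi>)" by (simp add: mult_ac)
  qed
  have "norm (pu i' (Da \<xi> v)) \<le> (\<Sum>n\<in>IS M. norm (pu i' (Da \<xi> (ps n v))))"
    unfolding Da_split[OF \<xi>, of v] blinfun.sum_right by (rule norm_sum)
  also have "\<dots> \<le> (\<Sum>n\<in>IS M. Pt M i' n * norm (ps n v))" by (intro sum_mono 1)
  finally show ?thesis .
qed

lemma LipD_le:
  assumes "LipD M f i' i l \<le> ereal c" "i' \<in> IU M" "\<xi> \<in> Bs M" "\<zeta> \<in> Xi M (St l)" "\<xi> + \<zeta> \<in> Bs M" "v \<in> Xi M (St i)"
    and lin: "\<And>\<xi>. \<xi> \<in> Bs M \<Longrightarrow> linear (DBs M f \<xi>)"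
  shows "norm (pu i' (DBs M f (\<xi> + \<zeta>) v) - pu i' (DBs M f \<xi> v)) \<le> c * norm \<zeta> * norm v"
proof (cases "\<zeta> = 0")
  case False
  let ?o = "op_norm_on (Xi M (St i)) (\<lambda>v. pu i' (DBs M f (\<xi> + \<zeta>) v) - pu i' (DBs M f \<xi> v))"
  have "?o / ereal (norm \<zeta>) \<le> ereal c"
    by (rule order_trans[OF _ assms(1)]) (use assms False in \<open>auto simp: LipD_def intro!: SUP_upper2[of "(\<xi>, \<zeta>)"]\<close>)
  then have "?o \<le> ereal (norm \<zeta>) * ereal c" using False by (subst (asm) ereal_divide_le_pos) auto
  then have "?o \<le> ereal (c * norm \<zeta>)" by (simp add: mult.commute)
  then show ?thesis by (rule op_norm_onD[OF _ assms(6)]) (use lin assms in \<open>simp add: linear_0\<close>)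
qed simp

lemma Da_diff_coord:
  assumes \<xi>: "\<xi> \<in> Bs M" and \<eta>: "\<eta> \<in> Bs M" and i': "i' \<in> IU M"
  shows "norm (pu i' (Da \<eta> v - Da \<xi> v))
    \<le> (\<Sum>n\<in>IS M. \<Sum>m\<in>IS M. Pbar i' n m * (norm (ps n v) * norm (ps m (\<eta> - \<xi>))))"
proof -
  have 1: "norm (pu i' (Da \<eta> (ps n v)) - pu i' (Da \<xi> (ps n v)))
      \<le> (\<Sum>m\<in>IS M. (Pbar i' n m * norm (ps n v)) * norm (ps m (\<eta> - \<xi>)))" if n: "n \<in> IS M" for n
  proof (rule coordinatewise_bound[where f = "\<lambda>x. pu i' (Da x (ps n v))", OF _ \<xi> \<eta>])
    fix m x \<zeta> assume m: "m \<in> IS M" "x \<in> Bs M" "\<zeta> \<in> Xi M (St m)" "x + \<zeta> \<in> Bs M"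
    have "Da x (ps n v) = DBs M \<alpha> x (ps n v)" for x
      using Xi_sub(1)[OF n] proj_in_Xi by (simp add: Da_def mem_Xs[symmetric] subsetD)
         (metis mem_Xs subsetD)
    then show "norm (pu i' (Da (x + \<zeta>) (ps n v)) - pu i' (Da x (ps n v))) \<le> Pbar i' n m * norm (ps n v) * norm \<zeta>"
      using LipD_le[of \<alpha> i' n m "Pbar i' n m" x \<zeta> "ps n v"] B11 i' n m proj_in_Xi has_derivative_linear[OF DBs_alpha]
      by (auto simp: B11_def mult_ac)
  qed
  have "pu i' (Da \<eta> v - Da \<xi> v) = (\<Sum>n\<in>IS M. pu i' (Da \<eta> (ps n v)) - pu i' (Da \<xi> (ps n v)))"
    by (simp add: Da_split[OF \<eta>, of v] Da_split[OF \<xi>, of v] blinfun.sum_right blinfun.diff_right sum_subtractf)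
  also have "norm \<dots> \<le> (\<Sum>n\<in>IS M. norm (pu i' (Da \<eta> (ps n v)) - pu i' (Da \<xi> (ps n v))))" by (rule norm_sum)
  also have "\<dots> \<le> (\<Sum>n\<in>IS M. \<Sum>m\<in>IS M. (Pbar i' n m * norm (ps n v)) * norm (ps m (\<eta> - \<xi>)))"
    by (intro sum_mono 1)
  finally show ?thesis by (simp add: mult.assoc)
qed

definition DF :: "'a \<Rightarrow> 'a \<Rightarrow> 'a" where
  "DF y v = Fderiv (Nfull M) (y + \<alpha> y) (pi_s M v + Da y v)"

lemma bounded_linear_DF: "y \<in> Bs M \<Longrightarrow> bounded_linear (DF y)"
  unfolding DF_def[abs_def]
  by (intro bounded_linear_compose[OF blinfun.bounded_linear_right] bounded_linear_add
      blinfun.bounded_linear_right bounded_linear_Da)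

lemma has_derivative_DF:
  assumes y: "y \<in> Bs M"
  shows "(on_chart \<alpha> has_derivative DF y) (at y within Bs M)"
proof -
  have "((\<lambda>x. x + \<alpha> x) has_derivative (\<lambda>v. v + Da y v)) (at y within Bs M)"
    by (intro has_derivative_add has_derivative_ident has_derivative_Da y)
  from has_derivative_compose[OF this Nfull_deriv(1)]
  have "(on_chart \<alpha> has_derivative (\<lambda>v. Fderiv (Nfull M) (y + \<alpha> y) (v + Da y v))) (at y within Bs M)"
    by (simp add: on_chart_def[abs_def])
  then show ?thesis
    by (rule has_derivative_Bs_cong[OF _ bounded_linear_DF[OF y] y]) (simp add: DF_def mem_Xs)
qed

lemma tangent_coords:
  assumes "y \<in> Bs M"
  shows "n \<in> IS M \<Longrightarrow> ps n (pi_s M v + Da y v) = ps n v"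
    and "n \<in> IU M \<Longrightarrow> pu n (pi_s M v + Da y v) = pu n (Da y v)"
  using ps_Xu[OF Da_Xu[OF assms]] by (simp_all add: blinfun.add_right)

lemma DF_coord:
  assumes y: "y \<in> Bs M" and j: "j \<in> IX M"
  shows "norm (proj M j (DF y v)) \<le> (\<Sum>n\<in>IS M. Hc M j n * norm (ps n v))"
proof -
  have "norm (proj M j (DF y v)) \<le> (\<Sum>i\<in>IX M. Cbd1 M j i * norm (proj M i (pi_s M v + Da y v)))"
    unfolding DF_def by (rule DN_coord[OF chart_BB[OF chart y] j])
  also have "\<dots> = (\<Sum>n\<in>IS M. Cbd1 M j (St n) * norm (ps n v)) + (\<Sum>i'\<in>IU M. Cbd1 M j (Ust i') * norm (pu i' (Da y v)))"
    unfolding sum_IX by (simp add: tangent_coords[OF y])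
  also have "(\<Sum>i'\<in>IU M. Cbd1 M j (Ust i') * norm (pu i' (Da y v)))
      \<le> (\<Sum>i'\<in>IU M. Cbd1 M j (Ust i') * (\<Sum>n\<in>IS M. Pt M i' n * norm (ps n v)))"
    by (intro sum_mono mult_left_mono Da_coord y Cbd1_nonneg) (use j in auto)
  also have "\<dots> = (\<Sum>n\<in>IS M. (\<Sum>i'\<in>IU M. Cbd1 M j (Ust i') * Pt M i' n) * norm (ps n v))"
    by (rule sum_Pt_swap)
  finally show ?thesis by (simp add: Hc_def distrib_right sum.distrib)
qed

text \<open>This is where \<open>Sc\<close> comes from. The derivative on the chart changes because
  its base point moves, which costs second derivatives of the nonlinearity, and because the tangent
  direction of the chart moves, which costs first derivatives times \<open>Pbar\<close>.\<close>

lemma DF_diff_coord: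
  assumes y: "y \<in> Bs M" and z: "z \<in> Bs M" and j: "j \<in> IX M"
  shows "norm (proj M j (DF y v - DF z v))
    \<le> (\<Sum>n\<in>IS M. \<Sum>m\<in>IS M. Sc M Pbar j n m * (norm (ps n v) * norm (ps m (y - z))))"
proof -
  let ?p = "y + \<alpha> y" and ?q = "z + \<alpha> z" and ?w = "pi_s M v + Da y v"
  let ?a = "\<lambda>n. norm (ps n v)" and ?d = "\<lambda>m. norm (ps m (y - z))"
  \<comment> \<open>The effect of moving the stable coordinate \<open>m\<close> on the derivative in
    slot \<open>i\<close>, directly and through the slope of the chart. Stable slots
    \<open>i\<close> give the first group of terms in \<open>Sc\<close>, unstable ones, weighted by
    \<open>Pt\<close>, the third.\<close>
  define c where "c i m = Cbd2 M j i (St m) + (\<Sum>m'\<in>IU M. Cbd2 M j i (Ust m') * Pt M m' m)" for i m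
  define R where "R i = (\<Sum>m\<in>IS M. c i m * ?d m)" for i
  have c0: "0 \<le> c i m" if "i \<in> IX M" "m \<in> IS M" for i m
    unfolding c_def by (intro add_nonneg_nonneg sum_nonneg mult_nonneg_nonneg Cbd2_nonneg less_imp_le[OF P_pos])
      (use that j in auto)
  have R0: "0 \<le> R i" if "i \<in> IX M" for i unfolding R_def using c0 that by (intro sum_nonneg) auto
  have inner: "(\<Sum>k\<in>IX M. Cbd2 M j i k * norm (proj M k (?p - ?q))) \<le> R i" if i: "i \<in> IX M" for i
  proof -
    have "(\<Sum>k\<in>IX M. Cbd2 M j i k * norm (proj M k (?p - ?q)))
        = (\<Sum>m\<in>IS M. Cbd2 M j i (St m) * ?d m) + (\<Sum>m'\<in>IU M. Cbd2 M j i (Ust m') * norm (pu m' (\<alpha> y - \<alpha> z)))"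
      unfolding sum_IX by (simp add: graph_coords[OF chart z y])
    also have "(\<Sum>m'\<in>IU M. Cbd2 M j i (Ust m') * norm (pu m' (\<alpha> y - \<alpha> z)))
        \<le> (\<Sum>m'\<in>IU M. Cbd2 M j i (Ust m') * (\<Sum>m\<in>IS M. Pt M m' m * ?d m))"
      by (intro sum_mono mult_left_mono chart_lip chart y z Cbd2_nonneg) (use i j in auto)
    also have "\<dots> = (\<Sum>m\<in>IS M. (\<Sum>m'\<in>IU M. Cbd2 M j i (Ust m') * Pt M m' m) * ?d m)"
      by (rule sum_Pt_swap)
    finally show ?thesis by (simp add: R_def c_def distrib_right sum.distrib)
  qed
  have first: "norm (proj M j (Fderiv (Nfull M) ?p ?w - Fderiv (Nfull M) ?q ?w))
      \<le> (\<Sum>n\<in>IS M. (R (St n) + (\<Sum>n'\<in>IU M. R (Ust n') * Pt M n' n)) * ?a n)"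
  proof -
    have "norm (proj M j (Fderiv (Nfull M) ?p ?w - Fderiv (Nfull M) ?q ?w))
      \<le> (\<Sum>i\<in>IX M. \<Sum>k\<in>IX M. Cbd2 M j i k * (norm (proj M i ?w) * norm (proj M k (?p - ?q))))"
      by (rule DN_diff_coord) (use chart_BB[OF chart] y z j in auto)
    also have "\<dots> = (\<Sum>i\<in>IX M. (\<Sum>k\<in>IX M. Cbd2 M j i k * norm (proj M k (?p - ?q))) * norm (proj M i ?w))"
      by (simp add: sum_distrib_left sum_distrib_right mult_ac)
    also have "\<dots> \<le> (\<Sum>i\<in>IX M. R i * norm (proj M i ?w))"
      by (intro sum_mono mult_right_mono inner) auto
    also have "\<dots> = (\<Sum>n\<in>IS M. R (St n) * ?a n) + (\<Sum>n'\<in>IU M. R (Ust n') * norm (pu n' (Da y v)))"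
      unfolding sum_IX by (simp add: tangent_coords[OF y])
    also have "(\<Sum>n'\<in>IU M. R (Ust n') * norm (pu n' (Da y v))) \<le> (\<Sum>n'\<in>IU M. R (Ust n') * (\<Sum>n\<in>IS M. Pt M n' n * ?a n))"
      by (intro sum_mono mult_left_mono Da_coord y R0) auto
    also have "\<dots> = (\<Sum>n\<in>IS M. (\<Sum>n'\<in>IU M. R (Ust n') * Pt M n' n) * ?a n)" by (rule sum_Pt_swap)
    finally show ?thesis by (simp add: distrib_right sum.distrib)
  qed
  have second: "norm (proj M j (Fderiv (Nfull M) ?q (Da y v - Da z v)))
      \<le> (\<Sum>n\<in>IS M. \<Sum>m\<in>IS M. (\<Sum>n'\<in>IU M. Cbd1 M j (Ust n') * Pbar n' n m) * (?a n * ?d m))"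
  proof -
    have X: "Da y v - Da z v \<in> Xu M" by (intro subspace_diff subspace_X Da_Xu y z)
    have "norm (proj M j (Fderiv (Nfull M) ?q (Da y v - Da z v)))
        \<le> (\<Sum>i\<in>IX M. Cbd1 M j i * norm (proj M i (Da y v - Da z v)))"
      by (rule DN_coord[OF chart_BB[OF chart z] j])
    also have "\<dots> = (\<Sum>n'\<in>IU M. Cbd1 M j (Ust n') * norm (pu n' (Da y v - Da z v)))"
      unfolding sum_IX by (simp add: ps_Xu[OF X])
    also have "\<dots> \<le> (\<Sum>n'\<in>IU M. Cbd1 M j (Ust n') * (\<Sum>n\<in>IS M. \<Sum>m\<in>IS M. Pbar n' n m * (?a n * ?d m)))"
      by (intro sum_mono mult_left_mono Da_diff_coord y z Cbd1_nonneg) (use j in auto)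
    also have "\<dots> = (\<Sum>n'\<in>IU M. \<Sum>n\<in>IS M. \<Sum>m\<in>IS M. Cbd1 M j (Ust n') * Pbar n' n m * (?a n * ?d m))"
      by (simp add: sum_distrib_left mult.assoc)
    also have "\<dots> = (\<Sum>n\<in>IS M. \<Sum>n'\<in>IU M. \<Sum>m\<in>IS M. Cbd1 M j (Ust n') * Pbar n' n m * (?a n * ?d m))"
      by (rule sum.swap)
    also have "\<dots> = (\<Sum>n\<in>IS M. \<Sum>m\<in>IS M. \<Sum>n'\<in>IU M. Cbd1 M j (Ust n') * Pbar n' n m * (?a n * ?d m))"
      by (intro sum.cong refl sum.swap)
    finally show ?thesis by (simp add: sum_distrib_right)
  qed
  have R_eq: "(R (St n) + (\<Sum>n'\<in>IU M. R (Ust n') * Pt M n' n)) * ?a n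
      = (\<Sum>m\<in>IS M. (c (St n) m + (\<Sum>n'\<in>IU M. c (Ust n') m * Pt M n' n)) * (?a n * ?d m))" for n
  proof -
    have "(\<Sum>n'\<in>IU M. R (Ust n') * Pt M n' n) = (\<Sum>m\<in>IS M. (\<Sum>n'\<in>IU M. c (Ust n') m * Pt M n' n) * ?d m)"
    proof -
      have "(\<Sum>n'\<in>IU M. R (Ust n') * Pt M n' n) = (\<Sum>n'\<in>IU M. \<Sum>m\<in>IS M. c (Ust n') m * Pt M n' n * ?d m)"
        unfolding R_def sum_distrib_right by (intro sum.cong refl) (simp add: mult_ac)
      also have "\<dots> = (\<Sum>m\<in>IS M. \<Sum>n'\<in>IU M. c (Ust n') m * Pt M n' n * ?d m)" by (rule sum.swap)
      finally show ?thesis by (simp add: sum_distrib_right)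
    qed
    then have "R (St n) + (\<Sum>n'\<in>IU M. R (Ust n') * Pt M n' n)
        = (\<Sum>m\<in>IS M. (c (St n) m + (\<Sum>n'\<in>IU M. c (Ust n') m * Pt M n' n)) * ?d m)"
      by (simp add: R_def distrib_right sum.distrib)
    moreover have "(\<Sum>m\<in>IS M. X m * ?d m) * ?a n = (\<Sum>m\<in>IS M. X m * (?a n * ?d m))" for X
      unfolding sum_distrib_right by (intro sum.cong refl) (simp add: mult_ac)
    ultimately show ?thesis by simp
  qed
  have "DF y v - DF z v = (Fderiv (Nfull M) ?p ?w - Fderiv (Nfull M) ?q ?w) + Fderiv (Nfull M) ?q (Da y v - Da z v)"
    by (simp add: DF_def blinfun.add_right blinfun.diff_right)
  then have "norm (proj M j (DF y v - DF z v))
      \<le> norm (proj M j (Fderiv (Nfull M) ?p ?w - Fderiv (Nfull M) ?q ?w)) + norm (proj M j (Fderiv (Nfull M) ?q (Da y v - Da z v)))"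
    by (simp only: blinfun.add_right[of "proj M j"] norm_triangle_ineq)
  also have "\<dots> \<le> (\<Sum>n\<in>IS M. \<Sum>m\<in>IS M. (c (St n) m + (\<Sum>n'\<in>IU M. c (Ust n') m * Pt M n' n)) * (?a n * ?d m))
      + (\<Sum>n\<in>IS M. \<Sum>m\<in>IS M. (\<Sum>n'\<in>IU M. Cbd1 M j (Ust n') * Pbar n' n m) * (?a n * ?d m))"
    using first second unfolding R_eq by (rule add_mono)
  also have "\<dots> = (\<Sum>n\<in>IS M. \<Sum>m\<in>IS M. Sc M Pbar j n m * (?a n * ?d m))"
  proof -
    have "Sc M Pbar j n m = (c (St n) m + (\<Sum>n'\<in>IU M. c (Ust n') m * Pt M n' n))
        + (\<Sum>n'\<in>IU M. Cbd1 M j (Ust n') * Pbar n' n m)" for n m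
      by (simp add: Sc_def c_def)
    then show ?thesis by (simp only: distrib_right[of _ _ "_ * _"] sum.distrib)
  qed
  finally show ?thesis .
qed

lemma norm_DF_le: "y \<in> Bs M \<Longrightarrow> norm (DF y v) \<le> lipN * norm v"
  unfolding lipN_def
  by (rule order_trans[OF norm_le_sum_coords norm_le_of_coords]) (use DF_coord Hc_nonneg in auto)

definition lipDF :: real where
  "lipDF = (\<Sum>j\<in>IX M. \<Sum>n\<in>IS M. \<Sum>m\<in>IS M. Sc M Pbar j n m) * psum * psum"

lemma lipDF_nonneg: "0 \<le> lipDF"
  unfolding lipDF_def by (intro mult_nonneg_nonneg sum_nonneg psum_nonneg Sc_nonneg Pbar_pos)

lemma DF_lipschitz:
  assumes "y \<in> Bs M" "z \<in> Bs M"
  shows "norm (DF y v - DF z v) \<le> lipDF * norm v * norm (y - z)"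
proof -
  have "norm (DF y v - DF z v) \<le> (\<Sum>j\<in>IX M. norm (proj M j (DF y v - DF z v)))" by (rule norm_le_sum_coords)
  also have "\<dots> \<le> (\<Sum>j\<in>IX M. \<Sum>n\<in>IS M. \<Sum>m\<in>IS M. Sc M Pbar j n m * ((psum * norm v) * (psum * norm (y - z))))"
  proof (rule sum_mono)
    fix j assume j: "j \<in> IX M"
    have "norm (proj M j (DF y v - DF z v)) \<le> (\<Sum>n\<in>IS M. \<Sum>m\<in>IS M. Sc M Pbar j n m * (norm (ps n v) * norm (ps m (y - z))))"
      by (rule DF_diff_coord[OF assms j])
    also have "\<dots> \<le> (\<Sum>n\<in>IS M. \<Sum>m\<in>IS M. Sc M Pbar j n m * ((psum * norm v) * (psum * norm (y - z))))"
      by (intro sum_mono mult_left_mono mult_mono norm_coord_le Sc_nonneg Pbar_pos j mult_nonneg_nonneg psum_nonneg) auto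
    finally show "norm (proj M j (DF y v - DF z v)) \<le> \<dots>" .
  qed
  also have "\<dots> = (\<Sum>j\<in>IX M. \<Sum>n\<in>IS M. \<Sum>m\<in>IS M. Sc M Pbar j n m) * ((psum * norm v) * (psum * norm (y - z)))"
    by (simp only: sum_distrib_right)
  also have "\<dots> = lipDF * norm v * norm (y - z)" by (simp add: lipDF_def)
  finally show ?thesis .
qed

text \<open>The mean value bound is applied on the segment to the map minus its linearisation at
  \<open>z\<close>, whose derivative is controlled by \<open>DF_lipschitz\<close>.\<close>

lemma on_chart_taylor:
  assumes y: "y \<in> Bs M" and z: "z \<in> Bs M"
  shows "norm (on_chart \<alpha> y - on_chart \<alpha> z - DF z (y - z)) \<le> lipDF * (norm (y - z))\<^sup>2"
proof -
  let ?S = "closed_segment z y"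
  have sub: "?S \<subseteq> Bs M" by (rule closed_segment_subset[OF z y convex_Bs])
  have "norm ((on_chart \<alpha> y - DF z y) - (on_chart \<alpha> z - DF z z)) \<le> lipDF * (norm (y - z))\<^sup>2"
  proof (rule mean_value_bound[of ?S z y "\<lambda>x. on_chart \<alpha> x - DF z x" "\<lambda>x v. DF x v - DF z v"])
    fix x assume x: "x \<in> ?S"
    then have xB: "x \<in> Bs M" using sub by blast
    show "((\<lambda>x. on_chart \<alpha> x - DF z x) has_derivative (\<lambda>v. DF x v - DF z v)) (at x within ?S)"
      by (intro has_derivative_diff has_derivative_subset[OF has_derivative_DF[OF xB] sub]
          bounded_linear_imp_has_derivative bounded_linear_DF z)
    have "norm (DF x (y - z) - DF z (y - z)) \<le> lipDF * norm (y - z) * norm (x - z)"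
      by (rule DF_lipschitz[OF xB z])
    also have "\<dots> \<le> lipDF * norm (y - z) * norm (y - z)"
      using segment_bound(1)[OF x] lipDF_nonneg by (intro mult_left_mono) auto
    finally show "norm (DF x (y - z) - DF z (y - z)) \<le> lipDF * (norm (y - z))\<^sup>2"
      by (simp add: power2_eq_square mult.assoc)
  qed auto
  then show ?thesis
    using bounded_linear.linear[OF bounded_linear_DF[OF z]] by (simp add: linear_diff algebra_simps)
qed

lemma DF_continuous:
  assumes "continuous_on S y" "y ` S \<subseteq> Bs M" "continuous_on S x"
  shows "continuous_on S (\<lambda>t. DF (y t) (x t))"
  unfolding continuous_on_def
proof
  fix s assume s: "s \<in> S"
  have ys: "y s \<in> Bs M" using assms s by auto
  have lim: "(y \<longlongrightarrow> y s) (at s within S)" "(x \<longlongrightarrow> x s) (at s within S)"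
    using assms s by (auto simp: continuous_on_def)
  have "((\<lambda>t. DF (y t) (x t) - DF (y s) (x s)) \<longlongrightarrow> 0) (at s within S)"
  proof (rule Lim_null_comparison)
    have "eventually (\<lambda>t. t \<in> S) (at s within S)" by (simp add: eventually_at_filter)
    then show "eventually (\<lambda>t. norm (DF (y t) (x t) - DF (y s) (x s))
        \<le> lipN * norm (x t - x s) + lipDF * norm (x s) * norm (y t - y s)) (at s within S)"
    proof eventually_elim
      case (elim t)
      then have yt: "y t \<in> Bs M" using assms by auto
      have eq: "DF (y t) (x t) - DF (y s) (x s) = DF (y t) (x t - x s) + (DF (y t) (x s) - DF (y s) (x s))"
        using bounded_linear.linear[OF bounded_linear_DF[OF yt]] by (simp add: linear_diff)
      show ?case
        unfolding eq by (intro order_trans[OF norm_triangle_ineq] add_mono norm_DF_le[OF yt] DF_lipschitz[OF yt ys])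
    qed
    have "((\<lambda>t. lipN * norm (x t - x s) + lipDF * norm (x s) * norm (y t - y s)) \<longlongrightarrow>
        lipN * norm (x s - x s) + lipDF * norm (x s) * norm (y s - y s)) (at s within S)"
      by (intro tendsto_intros lim)
    then show "((\<lambda>t. lipN * norm (x t - x s) + lipDF * norm (x s) * norm (y t - y s)) \<longlongrightarrow> 0) (at s within S)"
      by simp
  qed
  then show "((\<lambda>t. DF (y t) (x t)) \<longlongrightarrow> DF (y s) (x s)) (at s within S)" by (rule LIM_zero_cancel)
qed

section \<open>Differentiability of the flow\<close>

abbreviation fl :: "real \<Rightarrow> 'a \<Rightarrow> 'a" where "fl t \<xi> \<equiv> flow M t \<xi> \<alpha>"

text \<open>The solution of the variational equation along the trajectory of \<open>\<xi>\<close>; the flow is only specified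
  at times \<open>s \<ge> 0\<close>, whence the \<open>max 0 s\<close>.\<close>

definition V :: "'a \<Rightarrow> 'a \<Rightarrow> real \<Rightarrow> 'a" where
  "V \<xi> v = (SOME x. continuous_on {0..} x \<and>
     (\<forall>t\<ge>0. x t = Es t v + mild_conv Es (\<lambda>s. DF (fl (max 0 s) \<xi>) (x s)) t))"

lemma fl_in_Bs: "\<xi> \<in> Bs M \<Longrightarrow> 0 \<le> t \<Longrightarrow> fl t \<xi> \<in> Bs M"
  using flow_in_Bs[OF chart] .

lemma V_props:
  assumes \<xi>: "\<xi> \<in> Bs M"
  shows "continuous_on {0..} (V \<xi> v)"
    and "0 \<le> t \<Longrightarrow> V \<xi> v t = Es t v + mild_conv Es (\<lambda>s. DF (fl s \<xi>) (V \<xi> v s)) t"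
proof -
  have "\<exists>x. continuous_on {0..} x \<and> (\<forall>t\<ge>0. x t = Es t v + mild_conv Es (\<lambda>s. DF (fl (max 0 s) \<xi>) (x s)) t)"
  proof (rule Es.mild_solution_exists)
    fix x :: "real \<Rightarrow> 'a" assume x: "continuous_on {0..} x"
    show "continuous_on {0..} (\<lambda>t. DF (fl (max 0 t) \<xi>) (x t))"
      by (intro DF_continuous x continuous_on_compose2[OF flow_eq(1)[OF chart \<xi>]] continuous_intros)
        (use fl_in_Bs[OF \<xi>] in auto)
  next
    show "DF (fl (max 0 t) \<xi>) 0 = 0" for t
      using bounded_linear.linear[OF bounded_linear_DF[OF fl_in_Bs[OF \<xi>, of "max 0 t"]]] by (simp add: linear_0)
    show "norm (DF (fl (max 0 t) \<xi>) x - DF (fl (max 0 t) \<xi>) y) \<le> lipN * norm (x - y)" for t x y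
      using norm_DF_le[OF fl_in_Bs[OF \<xi>, of "max 0 t"], of "x - y"]
        bounded_linear.linear[OF bounded_linear_DF[OF fl_in_Bs[OF \<xi>, of "max 0 t"]]]
      by (simp add: linear_diff)
  qed (rule lipN_nonneg)
  from someI_ex[OF this]
  have V: "continuous_on {0..} (V \<xi> v)"
    "\<forall>t\<ge>0. V \<xi> v t = Es t v + mild_conv Es (\<lambda>s. DF (fl (max 0 s) \<xi>) (V \<xi> v s)) t"
    unfolding V_def by blast+
  show "continuous_on {0..} (V \<xi> v)" by (rule V(1))
  assume t: "0 \<le> t"
  have "mild_conv Es (\<lambda>s. DF (fl (max 0 s) \<xi>) (V \<xi> v s)) t = mild_conv Es (\<lambda>s. DF (fl s \<xi>) (V \<xi> v s)) t"
    by (rule Es.conv_cong) simp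
  then show "V \<xi> v t = Es t v + mild_conv Es (\<lambda>s. DF (fl s \<xi>) (V \<xi> v s)) t" using V(2) t by simp
qed

lemma fl_continuous: "\<xi> \<in> Bs M \<Longrightarrow> S \<subseteq> {0..} \<Longrightarrow> continuous_on S (\<lambda>t. fl t \<xi>)"
  using flow_eq(1)[OF chart] by (blast intro: continuous_on_subset)

lemma V_continuous: "\<xi> \<in> Bs M \<Longrightarrow> S \<subseteq> {0..} \<Longrightarrow> continuous_on S (V \<xi> v)"
  using V_props(1) by (blast intro: continuous_on_subset)

lemma DFV_continuous:
  assumes "\<xi> \<in> Bs M" "S \<subseteq> {0..}"
  shows "continuous_on S (\<lambda>s. DF (fl s \<xi>) (V \<xi> v s))"
  by (rule DF_continuous) (use assms fl_in_Bs in \<open>auto intro!: fl_continuous V_continuous\<close>)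

lemma V_Xs:
  assumes "\<xi> \<in> Bs M" "0 \<le> t"
  shows "V \<xi> v t \<in> Xs M"
  unfolding V_props(2)[OF assms]
  by (intro subspace_add subspace_X Es_in_Xs conv_in_Xs DFV_continuous assms) auto

lemma variational_eq_zero:
  assumes \<xi>: "\<xi> \<in> Bs M" and w: "\<And>t. 0 \<le> t \<Longrightarrow> w t = Es t 0 + mild_conv Es (\<lambda>s. DF (fl s \<xi>) (w s)) t"
    and cont: "continuous_on {0..} w" and t: "0 \<le> t"
  shows "w t = 0"
proof -
  have c: "continuous_on {0..t} w" by (rule continuous_on_subset[OF cont]) auto
  have "norm (w t) \<le> (psum * norm (pi_s M) * norm (0::'a) + psum * norm (pi_s M) * 0 * t) * exp (psum * norm (pi_s M) * lipN * t)"
  proof (rule Es.mild_gronwall[where q = "\<lambda>s. DF (fl s \<xi>) (w s)" and b = t])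
    show "continuous_on {0..t} (\<lambda>s. DF (fl s \<xi>) (w s))"
      by (rule DF_continuous) (use fl_in_Bs \<xi> c in \<open>auto intro!: fl_continuous\<close>)
    show "norm (DF (fl s \<xi>) (w s)) \<le> lipN * norm (w s) + 0" if "0 \<le> s" for s
      using norm_DF_le[OF fl_in_Bs[OF \<xi> that]] by simp
  qed (use w c t lipN_nonneg in auto)
  then show ?thesis by simp
qed

text \<open>\<open>V\<close> is chosen separately for each initial direction, so linearity comes
  from uniqueness: the defect solves the variational equation with initial value 0.\<close>

lemma V_linear:
  assumes \<xi>: "\<xi> \<in> Bs M" and t: "0 \<le> t"
  shows "V \<xi> (v + w) t = V \<xi> v t + V \<xi> w t" "V \<xi> (c *\<^sub>R v) t = c *\<^sub>R V \<xi> v t"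
proof -
  have lin: "linear (DF (fl s \<xi>))" if "0 \<le> s" for s
    by (rule bounded_linear.linear[OF bounded_linear_DF[OF fl_in_Bs[OF \<xi> that]]])
  have "V \<xi> (v + w) t - V \<xi> v t - V \<xi> w t = 0"
  proof (rule variational_eq_zero[OF \<xi> _ _ t])
    fix t :: real assume t: "0 \<le> t"
    have "mild_conv Es (\<lambda>s. DF (fl s \<xi>) (V \<xi> (v + w) s - V \<xi> v s - V \<xi> w s)) t
        = mild_conv Es (\<lambda>s. (DF (fl s \<xi>) (V \<xi> (v + w) s) - DF (fl s \<xi>) (V \<xi> v s)) - DF (fl s \<xi>) (V \<xi> w s)) t"
      by (rule Es.conv_cong) (simp add: lin linear_diff)
    also have "\<dots> = mild_conv Es (\<lambda>s. DF (fl s \<xi>) (V \<xi> (v + w) s)) t - mild_conv Es (\<lambda>s. DF (fl s \<xi>) (V \<xi> v s)) t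
        - mild_conv Es (\<lambda>s. DF (fl s \<xi>) (V \<xi> w s)) t"
      by (subst Es.conv_diff, (auto intro!: continuous_intros DFV_continuous \<xi>)[2])+ simp
    finally show "V \<xi> (v + w) t - V \<xi> v t - V \<xi> w t
        = Es t 0 + mild_conv Es (\<lambda>s. DF (fl s \<xi>) (V \<xi> (v + w) s - V \<xi> v s - V \<xi> w s)) t"
      using V_props(2)[OF \<xi> t, of "v + w"] V_props(2)[OF \<xi> t, of v] V_props(2)[OF \<xi> t, of w] t
      by (simp add: Es.zero Es.add)
  qed (intro continuous_intros V_continuous \<xi>; simp)+
  then show "V \<xi> (v + w) t = V \<xi> v t + V \<xi> w t" by (simp add: algebra_simps)
  have "V \<xi> (c *\<^sub>R v) t - c *\<^sub>R V \<xi> v t = 0"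
  proof (rule variational_eq_zero[OF \<xi> _ _ t])
    fix t :: real assume t: "0 \<le> t"
    have "mild_conv Es (\<lambda>s. DF (fl s \<xi>) (V \<xi> (c *\<^sub>R v) s - c *\<^sub>R V \<xi> v s)) t
        = mild_conv Es (\<lambda>s. DF (fl s \<xi>) (V \<xi> (c *\<^sub>R v) s) - c *\<^sub>R DF (fl s \<xi>) (V \<xi> v s)) t"
      by (rule Es.conv_cong) (simp add: lin linear_diff linear_scale)
    also have "\<dots> = mild_conv Es (\<lambda>s. DF (fl s \<xi>) (V \<xi> (c *\<^sub>R v) s)) t - mild_conv Es (\<lambda>s. c *\<^sub>R DF (fl s \<xi>) (V \<xi> v s)) t"
      by (rule Es.conv_diff) (auto intro!: continuous_intros DFV_continuous \<xi>)
    also have "mild_conv Es (\<lambda>s. c *\<^sub>R DF (fl s \<xi>) (V \<xi> v s)) t = c *\<^sub>R mild_conv Es (\<lambda>s. DF (fl s \<xi>) (V \<xi> v s)) t"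
      unfolding mild_conv_def Henstock_Kurzweil_Integration.integral_cmul[symmetric]
      by (rule Henstock_Kurzweil_Integration.integral_cong) (simp add: Es.scale)
    finally show "V \<xi> (c *\<^sub>R v) t - c *\<^sub>R V \<xi> v t
        = Es t 0 + mild_conv Es (\<lambda>s. DF (fl s \<xi>) (V \<xi> (c *\<^sub>R v) s - c *\<^sub>R V \<xi> v s)) t"
      using V_props(2)[OF \<xi> t, of "c *\<^sub>R v"] V_props(2)[OF \<xi> t, of v] t
      by (simp add: Es.zero Es.scale scaleR_add_right)
  qed (intro continuous_intros V_continuous \<xi>; simp)+
  then show "V \<xi> (c *\<^sub>R v) t = c *\<^sub>R V \<xi> v t" by simp
qed

lemma bounded_linear_V:
  assumes \<xi>: "\<xi> \<in> Bs M" and t: "0 \<le> t"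
  shows "bounded_linear (\<lambda>v. V \<xi> v t)"
proof (rule bounded_linear_intro[of _ "psum * norm (pi_s M) * exp (psum * norm (pi_s M) * lipN * t)"])
  fix v
  have "norm (V \<xi> v t) \<le> (psum * norm (pi_s M) * norm v + psum * norm (pi_s M) * 0 * t) * exp (psum * norm (pi_s M) * lipN * t)"
  proof (rule Es.mild_gronwall[where q = "\<lambda>s. DF (fl s \<xi>) (V \<xi> v s)" and b = t])
    show "continuous_on {0..t} (\<lambda>s. DF (fl s \<xi>) (V \<xi> v s))" by (rule DFV_continuous[OF \<xi>]) auto
    show "norm (DF (fl s \<xi>) (V \<xi> v s)) \<le> lipN * norm (V \<xi> v s) + 0" if "0 \<le> s" for s
      using norm_DF_le[OF fl_in_Bs[OF \<xi> that]] by simp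
  qed (use V_props(2) V_continuous \<xi> t lipN_nonneg in auto)
  then show "norm (V \<xi> v t) \<le> norm v * (psum * norm (pi_s M) * exp (psum * norm (pi_s M) * lipN * t))"
    by (simp add: mult_ac)
qed (use V_linear[OF assms] in auto)

text \<open>Only for use at a fixed time: the constant grows exponentially, unlike in
  \<open>norm_fl_diff_le\<close>.\<close>

lemma fl_diff_crude:
  assumes \<xi>: "\<xi> \<in> Bs M" and \<eta>: "\<eta> \<in> Bs M" and t: "0 \<le> t"
  shows "norm (fl t \<eta> - fl t \<xi>) \<le> (psum * norm (pi_s M) * exp (psum * norm (pi_s M) * lipN * t)) * norm (\<eta> - \<xi>)"
proof -
  have c: "continuous_on {0..r} (\<lambda>s. on_chart \<alpha> (fl s x))" if "x \<in> Bs M" for r x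
    by (rule continuous_on_compose2[OF on_chart_continuous[OF chart] fl_continuous[OF that]])
      (use fl_in_Bs that in auto)
  have "norm (fl t \<eta> - fl t \<xi>) \<le> (psum * norm (pi_s M) * norm (\<eta> - \<xi>) + psum * norm (pi_s M) * 0 * t) * exp (psum * norm (pi_s M) * lipN * t)"
  proof (rule Es.mild_gronwall[where w = "\<lambda>t. fl t \<eta> - fl t \<xi>" and q = "\<lambda>s. on_chart \<alpha> (fl s \<eta>) - on_chart \<alpha> (fl s \<xi>)" and b = t])
    show "fl r \<eta> - fl r \<xi> = Es r (\<eta> - \<xi>) + mild_conv Es (\<lambda>s. on_chart \<alpha> (fl s \<eta>) - on_chart \<alpha> (fl s \<xi>)) r"
      if r: "0 \<le> r" for r
      using flow_eq(2)[OF chart \<xi> r] flow_eq(2)[OF chart \<eta> r] r c[OF \<xi>] c[OF \<eta>]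
      by (simp add: Es.conv_diff Es.diff)
    show "norm (on_chart \<alpha> (fl r \<eta>) - on_chart \<alpha> (fl r \<xi>)) \<le> lipN * norm (fl r \<eta> - fl r \<xi>) + 0" if "0 \<le> r" for r
      using on_chart_lipschitz[OF chart fl_in_Bs[OF \<xi> that] fl_in_Bs[OF \<eta> that]] by simp
  qed (use t lipN_nonneg c \<xi> \<eta> in \<open>auto intro!: continuous_intros fl_continuous\<close>)
  then show ?thesis by (simp add: mult_ac)
qed

text \<open>The error of the linear prediction solves the variational equation with a quadratically
  small forcing and initial value 0, so Gronwall keeps it quadratic. The constant depends on
  \<open>t\<close>, which is harmless here but not under the integral defining
  \<open>Psi\<close>.\<close>

lemma flow_has_derivative:
  assumes \<xi>: "\<xi> \<in> Bs M" and t: "0 \<le> t"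
  shows "(fl t has_derivative (\<lambda>v. V \<xi> v t)) (at \<xi> within Bs M)"
proof -
  define C where "C = psum * norm (pi_s M)"
  define K where "K = C * exp (C * lipN * t)"
  have C0: "0 \<le> C" by (simp add: C_def psum_nonneg)
  show ?thesis
  proof (rule has_derivative_quadratic_remainder[OF bounded_linear_V[OF assms]])
    fix \<eta> assume \<eta>: "\<eta> \<in> Bs M"
    define w where "w s = fl s \<eta> - fl s \<xi> - V \<xi> (\<eta> - \<xi>) s" for s
    define q where "q s = on_chart \<alpha> (fl s \<eta>) - on_chart \<alpha> (fl s \<xi>) - DF (fl s \<xi>) (V \<xi> (\<eta> - \<xi>) s)" for s
    have c: "continuous_on {0..r} (\<lambda>s. on_chart \<alpha> (fl s x))" if "x \<in> Bs M" for r x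
      by (rule continuous_on_compose2[OF on_chart_continuous[OF chart] fl_continuous[OF that]])
        (use fl_in_Bs that in auto)
    have cD: "continuous_on {0..r} (\<lambda>s. DF (fl s \<xi>) (V \<xi> (\<eta> - \<xi>) s))" for r
      by (rule DFV_continuous[OF \<xi>]) auto
    have "norm (w t) \<le> (C * norm (0::'a) + C * (lipDF * (K * norm (\<eta> - \<xi>))\<^sup>2) * t) * exp (C * lipN * t)"
      unfolding C_def
    proof (rule Es.mild_gronwall[where q = q and b = t])
      show "continuous_on {0..t} w" unfolding w_def
        by (intro continuous_intros fl_continuous V_continuous \<xi> \<eta>) auto
      show "continuous_on {0..t} q" unfolding q_def by (intro continuous_intros c cD \<xi> \<eta>)
      fix r assume r: "0 \<le> r" "r \<le> t"
      show "w r = Es r 0 + mild_conv Es q r"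
      proof -
        have "mild_conv Es q r = mild_conv Es (\<lambda>s. on_chart \<alpha> (fl s \<eta>)) r - mild_conv Es (\<lambda>s. on_chart \<alpha> (fl s \<xi>)) r
            - mild_conv Es (\<lambda>s. DF (fl s \<xi>) (V \<xi> (\<eta> - \<xi>) s)) r"
        proof -
          have 1: "mild_conv Es (\<lambda>s. on_chart \<alpha> (fl s \<eta>) - on_chart \<alpha> (fl s \<xi>)) r
              = mild_conv Es (\<lambda>s. on_chart \<alpha> (fl s \<eta>)) r - mild_conv Es (\<lambda>s. on_chart \<alpha> (fl s \<xi>)) r"
            by (rule Es.conv_diff) (intro c \<xi> \<eta>)+
          have 2: "mild_conv Es q r = mild_conv Es (\<lambda>s. on_chart \<alpha> (fl s \<eta>) - on_chart \<alpha> (fl s \<xi>)) r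
              - mild_conv Es (\<lambda>s. DF (fl s \<xi>) (V \<xi> (\<eta> - \<xi>) s)) r"
            unfolding q_def by (rule Es.conv_diff) (intro continuous_intros c cD \<xi> \<eta>)+
          show ?thesis using 1 2 by simp
        qed
        then show ?thesis
          unfolding w_def flow_eq(2)[OF chart \<xi> r(1)] flow_eq(2)[OF chart \<eta> r(1)] V_props(2)[OF \<xi> r(1), of "\<eta> - \<xi>"]
          using r by (simp add: Es.zero Es.diff)
      qed
      have B: "fl r \<xi> \<in> Bs M" "fl r \<eta> \<in> Bs M" using fl_in_Bs \<xi> \<eta> r by auto
      \<comment> \<open>The Taylor remainder of the vector field, quadratic by
        \<open>fl_diff_crude\<close>, plus the linear feedback of the error
        \<open>w\<close>.\<close>
      have "q r = (on_chart \<alpha> (fl r \<eta>) - on_chart \<alpha> (fl r \<xi>) - DF (fl r \<xi>) (fl r \<eta> - fl r \<xi>)) + DF (fl r \<xi>) (w r)"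
        unfolding q_def w_def using bounded_linear.linear[OF bounded_linear_DF[OF B(1)]] by (simp add: linear_diff)
      then have "norm (q r) \<le> lipDF * (norm (fl r \<eta> - fl r \<xi>))\<^sup>2 + lipN * norm (w r)"
        using norm_triangle_le[OF add_mono[OF on_chart_taylor[OF B(2,1)] norm_DF_le[OF B(1), of "w r"]]] by simp
      moreover have "norm (fl r \<eta> - fl r \<xi>) \<le> K * norm (\<eta> - \<xi>)"
      proof -
        have "norm (fl r \<eta> - fl r \<xi>) \<le> C * exp (C * lipN * r) * norm (\<eta> - \<xi>)"
          using fl_diff_crude[OF \<xi> \<eta> r(1)] by (simp add: C_def)
        also have "\<dots> \<le> K * norm (\<eta> - \<xi>)"
          unfolding K_def using r C0 lipN_nonneg by (intro mult_right_mono mult_left_mono) (auto intro!: mult_left_mono)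
        finally show ?thesis .
      qed
      then have "lipDF * (norm (fl r \<eta> - fl r \<xi>))\<^sup>2 \<le> lipDF * (K * norm (\<eta> - \<xi>))\<^sup>2"
        by (intro mult_left_mono power_mono lipDF_nonneg) auto
      ultimately show "norm (q r) \<le> lipN * norm (w r) + lipDF * (K * norm (\<eta> - \<xi>))\<^sup>2" by simp
    qed (use t lipN_nonneg lipDF_nonneg in auto)
    then show "norm (fl t \<eta> - fl t \<xi> - V \<xi> (\<eta> - \<xi>) t) \<le> (C * lipDF * K\<^sup>2 * t * exp (C * lipN * t)) * (norm (\<eta> - \<xi>))\<^sup>2"
      by (simp add: w_def power_mult_distrib mult_ac)
  qed
qed

end

section \<open>The derivative of the Lyapunov--Perron operator\<close>

lemma sum_swap4:
  "(\<Sum>a\<in>A. \<Sum>b\<in>B. \<Sum>c\<in>C. \<Sum>d\<in>D. f a b c d) = (\<Sum>c\<in>C. \<Sum>d\<in>D. \<Sum>a\<in>A. \<Sum>b\<in>B. f a b c d)"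
proof -
  have "(\<Sum>a\<in>A. \<Sum>b\<in>B. \<Sum>c\<in>C. \<Sum>d\<in>D. f a b c d) = (\<Sum>a\<in>A. \<Sum>c\<in>C. \<Sum>b\<in>B. \<Sum>d\<in>D. f a b c d)"
    by (intro sum.cong refl sum.swap)
  also have "\<dots> = (\<Sum>c\<in>C. \<Sum>a\<in>A. \<Sum>d\<in>D. \<Sum>b\<in>B. f a b c d)"
    by (subst sum.swap) (intro sum.cong refl sum.swap)
  also have "\<dots> = (\<Sum>c\<in>C. \<Sum>d\<in>D. \<Sum>a\<in>A. \<Sum>b\<in>B. f a b c d)"
    by (intro sum.cong refl sum.swap)
  finally show ?thesis .
qed

lemma has_integral_exp_Ici:
  assumes "b < (0::real)"
  shows "((\<lambda>t. exp (b * t) * a) has_integral inverse (- b) * a) {0..}"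
  using has_integral_exp_sum[of "{()}" "\<lambda>_. b" "\<lambda>_. a"] assms by simp

context lyapunov_perron_setting
begin

lemma norm_Eu_le:
  assumes "0 \<le> t"
  shows "norm (Eu t x) \<le> (\<Sum>i\<in>IU M. exp (- rate M (Ust i) * t) * (psum * norm x))"
proof -
  have "norm (Eu t x) \<le> (\<Sum>i\<in>IU M. norm (pu i (Eu t x)))" by (rule norm_Xu_le[OF Eu_in_Xu[OF assms]])
  also have "\<dots> \<le> (\<Sum>i\<in>IU M. exp (- rate M (Ust i) * t) * (psum * norm x))"
  proof (rule sum_mono)
    fix i assume i: "i \<in> IU M"
    have "norm (pu i (Eu t x)) \<le> exp (- rate M (Ust i) * t) * norm (pu i x)" by (rule pu_Eu[OF assms i])
    also have "\<dots> \<le> exp (- rate M (Ust i) * t) * (psum * norm x)"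
      using norm_coord_le[of "Ust i" x] i by (intro mult_left_mono) auto
    finally show "norm (pu i (Eu t x)) \<le> exp (- rate M (Ust i) * t) * (psum * norm x)" .
  qed
  finally show ?thesis .
qed

definition cu :: real where "cu = (\<Sum>i\<in>IU M. inverse (rate M (Ust i))) * psum"

text \<open>The positive unstable rates alone make the integral converge, so a bounded integrand
  suffices; \<open>cu\<close> collects their reciprocals.\<close>

lemma Eu_integral:
  assumes cont: "continuous_on {0..} f" and bound: "\<And>t. 0 \<le> t \<Longrightarrow> norm (f t) \<le> c"
  shows "(\<lambda>t. Eu t (f t)) integrable_on {0..}" "norm (integral {0..} (\<lambda>t. Eu t (f t))) \<le> cu * c"
proof -
  have c: "continuous_on {0..} (\<lambda>t. Eu t (f t))" by (rule Eu.cont_orbit) (use cont in auto)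
  have I: "((\<lambda>t. \<Sum>i\<in>IU M. exp (- rate M (Ust i) * t) * (psum * c)) has_integral
      (\<Sum>i\<in>IU M. inverse (- (- rate M (Ust i))) * (psum * c))) {0..}"
    by (rule has_integral_exp_sum) (use rate_sign in auto)
  have le: "norm (Eu t (f t)) \<le> (\<Sum>i\<in>IU M. exp (- rate M (Ust i) * t) * (psum * c))" if t: "0 \<le> t" for t
  proof -
    have "norm (Eu t (f t)) \<le> (\<Sum>i\<in>IU M. exp (- rate M (Ust i) * t) * (psum * norm (f t)))" by (rule norm_Eu_le[OF t])
    also have "\<dots> \<le> (\<Sum>i\<in>IU M. exp (- rate M (Ust i) * t) * (psum * c))"
      by (intro sum_mono mult_left_mono bound t psum_nonneg) auto
    finally show ?thesis .
  qed
  show "(\<lambda>t. Eu t (f t)) integrable_on {0..}" by (rule integrable_on_Ici_dominated(1)[OF c I le])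
  have "norm (integral {0..} (\<lambda>t. Eu t (f t))) \<le> (\<Sum>i\<in>IU M. inverse (- (- rate M (Ust i))) * (psum * c))"
    by (rule integrable_on_Ici_dominated(2)[OF c I le])
  also have "\<dots> = cu * c" by (simp add: cu_def sum_distrib_right mult.assoc)
  finally show "norm (integral {0..} (\<lambda>t. Eu t (f t))) \<le> cu * c" .
qed

definition Gsum :: real where
  "Gsum = (\<Sum>j\<in>IS M. \<Sum>n\<in>IS M. \<Sum>k=0..mS M. \<bar>G_boot M Nboot j k n\<bar>)"

lemma sum_abs_gr_le:
  assumes t: "0 \<le> t"
  shows "(\<Sum>j\<in>IS M. \<Sum>n\<in>IS M. \<bar>gr j n t\<bar>) \<le> Gsum"
  unfolding Gsum_def
proof (intro sum_mono)
  fix j n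
  have "\<bar>gr j n t\<bar> \<le> (\<Sum>k=0..mS M. \<bar>exp (gam M k * t) * G_boot M Nboot j k n\<bar>)"
    unfolding gr_def exp_combination_def by (rule sum_abs)
  also have "\<dots> \<le> (\<Sum>k=0..mS M. \<bar>G_boot M Nboot j k n\<bar>)"
  proof (rule sum_mono)
    fix k assume "k \<in> {0..mS M}"
    then have "exp (gam M k * t) \<le> 1" using gam_neg[of k] t by (auto simp: mult_nonpos_nonneg)
    then show "\<bar>exp (gam M k * t) * G_boot M Nboot j k n\<bar> \<le> \<bar>G_boot M Nboot j k n\<bar>"
      by (simp add: abs_mult mult_left_le_one_le)
  qed
  finally show "\<bar>gr j n t\<bar> \<le> (\<Sum>k=0..mS M. \<bar>G_boot M Nboot j k n\<bar>)" .
qed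

text \<open>All rates are negative, so each exponential sum is at most the sum of the absolute
  values of its coefficients: crude, but uniform in time.\<close>

lemma sum_gr_le:
  assumes t: "0 \<le> t"
  shows "(\<Sum>j\<in>IS M. \<Sum>n\<in>IS M. gr j n t * norm (ps n v)) \<le> Gsum * psum * norm v"
proof -
  have "(\<Sum>j\<in>IS M. \<Sum>n\<in>IS M. gr j n t * norm (ps n v)) \<le> (\<Sum>j\<in>IS M. \<Sum>n\<in>IS M. \<bar>gr j n t\<bar> * (psum * norm v))"
    by (intro sum_mono mult_mono norm_coord_le) auto
  also have "\<dots> = (\<Sum>j\<in>IS M. \<Sum>n\<in>IS M. \<bar>gr j n t\<bar>) * (psum * norm v)"
    by (simp only: sum_distrib_right)
  also have "\<dots> \<le> Gsum * (psum * norm v)"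
    by (intro mult_right_mono sum_abs_gr_le t mult_nonneg_nonneg psum_nonneg) auto
  finally show ?thesis by simp
qed

lemma norm_Bs_le: "x \<in> Bs M \<Longrightarrow> norm x \<le> (\<Sum>i\<in>IS M. rho M i)"
  by (rule order_trans[OF norm_Xs_le]) (auto intro: BsD sum_mono)

lemma LP_integrand_eq: "LP_integrand M \<beta> \<xi> = (\<lambda>t. Eu t (on_chart \<beta> (flow M t \<xi> \<beta>)))"
  by (simp add: LP_integrand_def Eu_def on_chart_def fun_eq_iff)

lemma Psi_eq: "Psi M \<beta> \<xi> = - integral {0..} (\<lambda>t. Eu t (on_chart \<beta> (flow M t \<xi> \<beta>)))"
  unfolding Psi_def LP_integrand_eq ..

lemma integrand_integrable:
  assumes \<beta>: "chart \<beta>" and \<xi>: "\<xi> \<in> Bs M"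
  shows "(\<lambda>t. Eu t (on_chart \<beta> (flow M t \<xi> \<beta>))) integrable_on {0..}"
proof (rule Eu_integral)
  show "continuous_on {0..} (\<lambda>t. on_chart \<beta> (flow M t \<xi> \<beta>))"
    by (rule continuous_on_compose2[OF on_chart_continuous[OF \<beta>] flow_eq(1)[OF \<beta> \<xi>]])
      (use flow_in_Bs[OF \<beta> \<xi>] in auto)
  fix t :: real assume t: "0 \<le> t"
  have B: "flow M t \<xi> \<beta> \<in> Bs M" by (rule flow_in_Bs[OF \<beta> \<xi> t])
  have "norm (on_chart \<beta> (flow M t \<xi> \<beta>)) \<le> lipN * norm (flow M t \<xi> \<beta>)"
    using on_chart_lipschitz[OF \<beta> zero_Bs B] on_chart_zero[OF \<beta>] by simp
  also have "\<dots> \<le> lipN * (\<Sum>i\<in>IS M. rho M i)" by (intro mult_left_mono norm_Bs_le B lipN_nonneg)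
  finally show "norm (on_chart \<beta> (flow M t \<xi> \<beta>)) \<le> lipN * (\<Sum>i\<in>IS M. rho M i)" .
qed

lemma Psi_well_definedI:
  assumes \<beta>: "chart \<beta>"
  shows "Psi_well_defined M \<beta>"
  unfolding Psi_well_defined_def
proof (intro ballI conjI)
  fix \<xi> assume \<xi>: "\<xi> \<in> Bs M"
  show "\<exists>x. mild_solution M \<beta> \<xi> x \<and> (\<forall>y. mild_solution M \<beta> \<xi> y \<longrightarrow> (\<forall>t\<ge>0. y t = x t))"
    using flow_mild[OF \<beta> \<xi>] mild_solution_unique[OF \<beta> \<xi>] by blast
  show "LP_integrand M \<beta> \<xi> integrable_on {0..}"
    unfolding LP_integrand_eq by (rule integrand_integrable[OF \<beta> \<xi>])
qed

end

locale variation_bound = smooth_chart M Nboot \<alpha> Pbar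
  for M :: "'a::banach lp_data" and Nboot \<alpha> Pbar +
  fixes Nmu :: nat and \<mu> :: "nat \<Rightarrow> real" and K :: "nat \<Rightarrow> nat \<Rightarrow> nat \<Rightarrow> nat \<Rightarrow> real"
  assumes mu: "\<mu> ` {1..Nmu} = gam M ` {0..mS M} \<union> {gam M k1 + gam M k2 | k1 k2. k1 \<le> mS M \<and> k2 \<le> mS M}"
    and K_bound: "\<And>t \<eta> \<zeta> i j. 0 \<le> t \<Longrightarrow> \<eta> \<in> Bs M \<Longrightarrow> \<zeta> \<in> Bs M \<Longrightarrow> i \<in> IS M \<Longrightarrow> j \<in> IS M \<Longrightarrow>
          op_norm_on (Xi M (St i))
            (\<lambda>v. DBs M (\<lambda>\<xi>. proj M (St j) (flow M t \<xi> \<alpha>)) \<eta> v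
               - DBs M (\<lambda>\<xi>. proj M (St j) (flow M t \<xi> \<alpha>)) \<zeta> v)
          \<le> ereal (\<Sum>k=1..Nmu. \<Sum>l\<in>IS M. exp (\<mu> k * t) * K j k i l * norm (proj M (St l) (\<eta> - \<zeta>)))"
begin

lemma mu_neg: "k \<in> {1..Nmu} \<Longrightarrow> \<mu> k < 0"
proof -
  assume "k \<in> {1..Nmu}"
  then have "\<mu> k \<in> gam M ` {0..mS M} \<union> {gam M k1 + gam M k2 | k1 k2. k1 \<le> mS M \<and> k2 \<le> mS M}"
    unfolding mu[symmetric] by blast
  then show ?thesis using gam_neg by (auto intro!: add_neg_neg)
qed

definition kr :: "nat \<Rightarrow> nat \<Rightarrow> nat \<Rightarrow> real \<Rightarrow> real" where
  "kr j i l t = (\<Sum>k=1..Nmu. exp (\<mu> k * t) * K j k i l)"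

definition Ksum :: real where
  "Ksum = (\<Sum>j\<in>IS M. \<Sum>i\<in>IS M. \<Sum>l\<in>IS M. \<Sum>k=1..Nmu. \<bar>K j k i l\<bar>)"

lemma abs_kr_le:
  assumes "0 \<le> t"
  shows "\<bar>kr j i l t\<bar> \<le> (\<Sum>k=1..Nmu. \<bar>K j k i l\<bar>)"
proof -
  have "\<bar>kr j i l t\<bar> \<le> (\<Sum>k=1..Nmu. \<bar>exp (\<mu> k * t) * K j k i l\<bar>)" unfolding kr_def by (rule sum_abs)
  also have "\<dots> \<le> (\<Sum>k=1..Nmu. \<bar>K j k i l\<bar>)"
  proof (rule sum_mono)
    fix k assume "k \<in> {1..Nmu}"
    then have "exp (\<mu> k * t) \<le> 1" using mu_neg[of k] assms by (auto simp: mult_nonpos_nonneg)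
    then show "\<bar>exp (\<mu> k * t) * K j k i l\<bar> \<le> \<bar>K j k i l\<bar>" by (simp add: abs_mult mult_left_le_one_le)
  qed
  finally show ?thesis .
qed

lemma K_sum_eq:
  "(\<Sum>k=1..Nmu. \<Sum>l\<in>IS M. exp (\<mu> k * t) * K j k i l * d l) = (\<Sum>l\<in>IS M. kr j i l t * d l)"
  unfolding kr_def by (subst sum.swap) (simp only: sum_distrib_right)

text \<open>Connects the hypothesis on \<open>K\<close>, stated for derivatives relative to the box,
  with solutions of the variational equation.\<close>

lemma DBs_flow:
  assumes "\<xi> \<in> Bs M" "0 \<le> t" "v \<in> Xs M"
  shows "DBs M (\<lambda>\<xi>. ps j (fl t \<xi>)) \<xi> v = ps j (V \<xi> v t)"
  by (rule DBs_eq[OF bounded_linear.has_derivative[OF blinfun.bounded_linear_right flow_has_derivative]])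
    (use assms in auto)

lemma V_zero: "\<xi> \<in> Bs M \<Longrightarrow> 0 \<le> t \<Longrightarrow> V \<xi> 0 t = 0"
  using V_linear(2)[of \<xi> t 0 0] by simp

lemma V_diff_coord:
  assumes \<eta>: "\<eta> \<in> Bs M" and \<xi>: "\<xi> \<in> Bs M" and t: "0 \<le> t" and i: "i \<in> IS M" and j: "j \<in> IS M" and v: "v \<in> Xi M (St i)"
  shows "norm (ps j (V \<eta> v t - V \<xi> v t)) \<le> (\<Sum>l\<in>IS M. kr j i l t * norm (ps l (\<eta> - \<xi>))) * norm v"
proof -
  have vX: "v \<in> Xs M" using v Xi_sub(1)[OF i] by blast
  have 0: "0 \<in> Xs M" by (rule subspace_0[OF subspace_X(1)])
  have "norm (DBs M (\<lambda>\<xi>. ps j (fl t \<xi>)) \<eta> v - DBs M (\<lambda>\<xi>. ps j (fl t \<xi>)) \<xi> v)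
      \<le> (\<Sum>k=1..Nmu. \<Sum>l\<in>IS M. exp (\<mu> k * t) * K j k i l * norm (ps l (\<eta> - \<xi>))) * norm v"
    by (rule op_norm_onD[OF K_bound[OF t \<eta> \<xi> i j] v])
      (simp add: DBs_flow \<eta> \<xi> t 0 V_zero)
  then show ?thesis
    unfolding K_sum_eq by (simp add: DBs_flow \<eta> \<xi> t vX blinfun.diff_right)
qed

text \<open>The Lipschitz bound of the flow in the single coordinate \<open>i\<close> becomes a
  bound on the derivative by \<open>directional_bound\<close>. The continuity in the base point
  required there is supplied by \<open>K\<close>, whose entries may have any sign, hence the
  absolute values.\<close>

lemma V_coord:
  assumes \<xi>: "\<xi> \<in> Bs M" and t: "0 \<le> t" and i: "i \<in> IS M" and j: "j \<in> IS M" and v: "v \<in> Xi M (St i)"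
  shows "norm (ps j (V \<xi> v t)) \<le> gr j i t * norm v"
proof (rule directional_bound[where D = "\<lambda>x v. ps j (V x v t)" and f = "\<lambda>x. ps j (fl t x)", OF _ i v \<xi>])
  show "((\<lambda>x. ps j (fl t x)) has_derivative (\<lambda>v. ps j (V x v t))) (at x within Bs M)" if "x \<in> Bs M" for x
    by (rule bounded_linear.has_derivative[OF blinfun.bounded_linear_right flow_has_derivative[OF that t]])
  fix x \<zeta> assume x: "x \<in> Bs M" "\<zeta> \<in> Xi M (St i)" "x + \<zeta> \<in> Bs M"
  have "norm (ps j (fl t (x + \<zeta>) - fl t x)) \<le> (\<Sum>n\<in>IS M. gr j n t * norm (ps n (x + \<zeta> - x)))"
    by (rule flow_bound[OF chart]) (use x chart j t in auto)
  also have "\<dots> = (\<Sum>n\<in>IS M. if n = i then gr j i t * norm \<zeta> else 0)"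
  proof (rule sum.cong[OF refl])
    fix n assume n: "n \<in> IS M"
    have "ps i \<zeta> = \<zeta>" using x(2) i by (simp add: mem_Xi)
    then have "ps n \<zeta> = (if n = i then \<zeta> else 0)" using proj_proj[of "St n" "St i" \<zeta>] n i by auto
    then show "gr j n t * norm (ps n (x + \<zeta> - x)) = (if n = i then gr j i t * norm \<zeta> else 0)" by simp
  qed
  also have "\<dots> = gr j i t * norm \<zeta>" using i by simp
  finally show "norm (ps j (fl t (x + \<zeta>)) - ps j (fl t x)) \<le> gr j i t * norm \<zeta>" by (simp add: blinfun.diff_right)
next
  fix x assume x: "x \<in> Bs M"
  have "norm (ps j (V x v t) - ps j (V \<xi> v t)) \<le> (\<Sum>l\<in>IS M. kr j i l t * norm (ps l (x - \<xi>))) * norm v"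
    using V_diff_coord[OF x \<xi> t i j v] by (simp add: blinfun.diff_right)
  also have "\<dots> \<le> (\<Sum>l\<in>IS M. \<bar>kr j i l t\<bar> * (psum * norm (x - \<xi>))) * norm v"
    by (intro mult_right_mono sum_mono mult_mono norm_coord_le) auto
  also have "\<dots> = ((\<Sum>l\<in>IS M. \<bar>kr j i l t\<bar>) * psum * norm v) * norm (x - \<xi>)"
    unfolding sum_distrib_right[symmetric] by (simp only: mult_ac)
  finally show "norm (ps j (V x v t) - ps j (V \<xi> v t)) \<le> ((\<Sum>l\<in>IS M. \<bar>kr j i l t\<bar>) * psum * norm v) * norm (x - \<xi>)" .
qed

lemma V_split: "\<xi> \<in> Bs M \<Longrightarrow> 0 \<le> t \<Longrightarrow> V \<xi> (pi_s M v) t = (\<Sum>i\<in>IS M. V \<xi> (ps i v) t)"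
  unfolding pi_s_apply by (rule linear_sum[OF bounded_linear.linear[OF bounded_linear_V]])

lemma norm_V_le:
  assumes \<xi>: "\<xi> \<in> Bs M" and t: "0 \<le> t"
  shows "norm (V \<xi> (pi_s M v) t) \<le> Gsum * psum * norm v"
proof -
  have "norm (V \<xi> (pi_s M v) t) \<le> (\<Sum>j\<in>IS M. norm (ps j (V \<xi> (pi_s M v) t)))"
    by (rule norm_Xs_le[OF V_Xs[OF assms]])
  also have "\<dots> \<le> (\<Sum>j\<in>IS M. \<Sum>n\<in>IS M. gr j n t * norm (ps n v))"
  proof (rule sum_mono)
    fix j assume j: "j \<in> IS M"
    show "norm (ps j (V \<xi> (pi_s M v) t)) \<le> (\<Sum>n\<in>IS M. gr j n t * norm (ps n v))"
      unfolding V_split[OF assms] blinfun.sum_right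
      by (intro order_trans[OF norm_sum] sum_mono V_coord \<xi> t j proj_in_Xi)
  qed
  also have "\<dots> \<le> Gsum * psum * norm v" by (rule sum_gr_le[OF t])
  finally show ?thesis .
qed

text \<open>The bootstrap bounds make the constant independent of time, as is needed for integration
  over the half-line.\<close>

lemma norm_fl_diff_le:
  assumes \<xi>: "\<xi> \<in> Bs M" and \<eta>: "\<eta> \<in> Bs M" and t: "0 \<le> t"
  shows "norm (fl t \<eta> - fl t \<xi>) \<le> Gsum * psum * norm (\<eta> - \<xi>)"
proof -
  have "norm (fl t \<eta> - fl t \<xi>) \<le> (\<Sum>j\<in>IS M. norm (ps j (fl t \<eta> - fl t \<xi>)))"
    by (intro norm_Xs_le subspace_diff subspace_X BsD fl_in_Bs \<xi> \<eta> t)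
  also have "\<dots> \<le> (\<Sum>j\<in>IS M. \<Sum>n\<in>IS M. gr j n t * norm (ps n (\<eta> - \<xi>)))"
    by (intro sum_mono flow_bound chart \<xi> \<eta> t)
  also have "\<dots> \<le> Gsum * psum * norm (\<eta> - \<xi>)" by (rule sum_gr_le[OF t])
  finally show ?thesis .
qed

lemma norm_V_diff_le:
  assumes \<xi>: "\<xi> \<in> Bs M" and \<eta>: "\<eta> \<in> Bs M" and t: "0 \<le> t"
  shows "norm (V \<eta> (pi_s M v) t - V \<xi> (pi_s M v) t) \<le> Ksum * psum * psum * norm v * norm (\<eta> - \<xi>)"
proof -
  have "norm (V \<eta> (pi_s M v) t - V \<xi> (pi_s M v) t) \<le> (\<Sum>j\<in>IS M. norm (ps j (V \<eta> (pi_s M v) t - V \<xi> (pi_s M v) t)))"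
    by (intro norm_Xs_le subspace_diff subspace_X V_Xs \<xi> \<eta> t)
  also have "\<dots> \<le> (\<Sum>j\<in>IS M. \<Sum>i\<in>IS M. \<Sum>l\<in>IS M. (\<Sum>k=1..Nmu. \<bar>K j k i l\<bar>) * ((psum * norm v) * (psum * norm (\<eta> - \<xi>))))"
  proof (rule sum_mono)
    fix j assume j: "j \<in> IS M"
    have "ps j (V \<eta> (pi_s M v) t - V \<xi> (pi_s M v) t) = (\<Sum>i\<in>IS M. ps j (V \<eta> (ps i v) t - V \<xi> (ps i v) t))"
      by (simp add: V_split \<xi> \<eta> t blinfun.diff_right blinfun.sum_right sum_subtractf)
    also have "norm \<dots> \<le> (\<Sum>i\<in>IS M. norm (ps j (V \<eta> (ps i v) t - V \<xi> (ps i v) t)))" by (rule norm_sum)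
    also have "\<dots> \<le> (\<Sum>i\<in>IS M. (\<Sum>l\<in>IS M. kr j i l t * norm (ps l (\<eta> - \<xi>))) * norm (ps i v))"
      by (intro sum_mono V_diff_coord \<xi> \<eta> t j proj_in_Xi)
    also have "\<dots> \<le> (\<Sum>i\<in>IS M. (\<Sum>l\<in>IS M. (\<Sum>k=1..Nmu. \<bar>K j k i l\<bar>) * (psum * norm (\<eta> - \<xi>))) * (psum * norm v))"
      by (intro sum_mono mult_mono norm_coord_le order_trans[OF abs_ge_self abs_kr_le[OF t]] sum_nonneg mult_nonneg_nonneg psum_nonneg)
        auto
    also have "\<dots> = (\<Sum>i\<in>IS M. \<Sum>l\<in>IS M. (\<Sum>k=1..Nmu. \<bar>K j k i l\<bar>) * ((psum * norm v) * (psum * norm (\<eta> - \<xi>))))"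
      unfolding sum_distrib_right[of _ "IS M"] by (intro sum.cong refl) (simp only: mult_ac)
    finally show "norm (ps j (V \<eta> (pi_s M v) t - V \<xi> (pi_s M v) t))
      \<le> (\<Sum>i\<in>IS M. \<Sum>l\<in>IS M. (\<Sum>k=1..Nmu. \<bar>K j k i l\<bar>) * ((psum * norm v) * (psum * norm (\<eta> - \<xi>))))" .
  qed
  also have "\<dots> = Ksum * ((psum * norm v) * (psum * norm (\<eta> - \<xi>)))"
    unfolding Ksum_def by (simp only: sum_distrib_right)
  finally show ?thesis by (simp add: mult_ac)
qed

lemma Ksum_nonneg: "0 \<le> Ksum" unfolding Ksum_def by (intro sum_nonneg) auto

lemma pi_s_diff: "\<xi> \<in> Bs M \<Longrightarrow> \<eta> \<in> Bs M \<Longrightarrow> pi_s M (\<eta> - \<xi>) = \<eta> - \<xi>"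
  by (simp add: mem_Xs[symmetric] subspace_diff[OF subspace_X(1)] BsD)

lemma flow_taylor:
  assumes \<xi>: "\<xi> \<in> Bs M" and \<eta>: "\<eta> \<in> Bs M" and t: "0 \<le> t"
  shows "norm (fl t \<eta> - fl t \<xi> - V \<xi> (\<eta> - \<xi>) t) \<le> Ksum * psum * psum * (norm (\<eta> - \<xi>))\<^sup>2"
proof -
  let ?S = "closed_segment \<xi> \<eta>"
  have sub: "?S \<subseteq> Bs M" by (rule closed_segment_subset[OF \<xi> \<eta> convex_Bs])
  have "norm ((fl t \<eta> - V \<xi> \<eta> t) - (fl t \<xi> - V \<xi> \<xi> t)) \<le> Ksum * psum * psum * (norm (\<eta> - \<xi>))\<^sup>2"
  proof (rule mean_value_bound[of ?S \<xi> \<eta> "\<lambda>x. fl t x - V \<xi> x t" "\<lambda>x v. V x v t - V \<xi> v t"])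
    fix x assume x: "x \<in> ?S"
    then have xB: "x \<in> Bs M" using sub by blast
    show "((\<lambda>x. fl t x - V \<xi> x t) has_derivative (\<lambda>v. V x v t - V \<xi> v t)) (at x within ?S)"
      by (intro has_derivative_diff has_derivative_subset[OF flow_has_derivative[OF xB t] sub]
          bounded_linear_imp_has_derivative bounded_linear_V \<xi> t)
    have "norm (V x (\<eta> - \<xi>) t - V \<xi> (\<eta> - \<xi>) t) \<le> Ksum * psum * psum * norm (\<eta> - \<xi>) * norm (x - \<xi>)"
      using norm_V_diff_le[OF \<xi> xB t, of "\<eta> - \<xi>"] pi_s_diff[OF \<xi> \<eta>] by simp
    also have "\<dots> \<le> Ksum * psum * psum * norm (\<eta> - \<xi>) * norm (\<eta> - \<xi>)"
      using segment_bound(1)[OF x] Ksum_nonneg psum_nonneg by (intro mult_left_mono) auto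
    finally show "norm (V x (\<eta> - \<xi>) t - V \<xi> (\<eta> - \<xi>) t) \<le> Ksum * psum * psum * (norm (\<eta> - \<xi>))\<^sup>2"
      by (simp add: power2_eq_square mult.assoc)
  qed auto
  moreover have "V \<xi> (\<eta> - \<xi>) t = V \<xi> \<eta> t - V \<xi> \<xi> t"
    by (rule linear_diff[OF bounded_linear.linear[OF bounded_linear_V[OF \<xi> t]]])
  then have "fl t \<eta> - fl t \<xi> - V \<xi> (\<eta> - \<xi>) t = (fl t \<eta> - V \<xi> \<eta> t) - (fl t \<xi> - V \<xi> \<xi> t)"
    by simp
  ultimately show ?thesis by (simp only:)
qed

definition DPsi :: "'a \<Rightarrow> 'a \<Rightarrow> 'a" where
  "DPsi \<xi> v = - integral {0..} (\<lambda>t. Eu t (DF (fl t \<xi>) (V \<xi> (pi_s M v) t)))"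

lemma DPsi_integrable:
  assumes \<xi>: "\<xi> \<in> Bs M"
  shows "(\<lambda>t. Eu t (DF (fl t \<xi>) (V \<xi> (pi_s M v) t))) integrable_on {0..}"
    and "norm (DPsi \<xi> v) \<le> cu * (lipN * (Gsum * psum * norm v))"
proof -
  have c: "continuous_on {0..} (\<lambda>t. DF (fl t \<xi>) (V \<xi> (pi_s M v) t))" by (rule DFV_continuous[OF \<xi>]) simp
  have b: "norm (DF (fl t \<xi>) (V \<xi> (pi_s M v) t)) \<le> lipN * (Gsum * psum * norm v)" if t: "0 \<le> t" for t
    by (rule order_trans[OF norm_DF_le[OF fl_in_Bs[OF \<xi> t]]]) (intro mult_left_mono norm_V_le \<xi> t lipN_nonneg)
  show "(\<lambda>t. Eu t (DF (fl t \<xi>) (V \<xi> (pi_s M v) t))) integrable_on {0..}" by (rule Eu_integral(1)[OF c b])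
  show "norm (DPsi \<xi> v) \<le> cu * (lipN * (Gsum * psum * norm v))"
    unfolding DPsi_def norm_minus_cancel by (rule Eu_integral(2)[OF c b])
qed

lemma bounded_linear_DPsi:
  assumes \<xi>: "\<xi> \<in> Bs M"
  shows "bounded_linear (DPsi \<xi>)"
proof (rule bounded_linear_intro[of _ "cu * (lipN * (Gsum * psum))"])
  let ?h = "\<lambda>v t. Eu t (DF (fl t \<xi>) (V \<xi> (pi_s M v) t))"
  have lin: "linear (DF (fl t \<xi>))" if "0 \<le> t" for t
    by (rule bounded_linear.linear[OF bounded_linear_DF[OF fl_in_Bs[OF \<xi> that]]])
  show "DPsi \<xi> (v + w) = DPsi \<xi> v + DPsi \<xi> w" for v w
  proof -
    have "integral {0..} (?h (v + w)) = integral {0..} (\<lambda>t. ?h v t + ?h w t)"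
      by (rule Henstock_Kurzweil_Integration.integral_cong)
        (simp add: blinfun.add_right V_linear \<xi> lin linear_add Eu.add)
    also have "\<dots> = integral {0..} (?h v) + integral {0..} (?h w)"
      by (intro Henstock_Kurzweil_Integration.integral_add DPsi_integrable \<xi>)
    finally show ?thesis by (simp add: DPsi_def)
  qed
  show "DPsi \<xi> (c *\<^sub>R v) = c *\<^sub>R DPsi \<xi> v" for c v
  proof -
    have "integral {0..} (?h (c *\<^sub>R v)) = integral {0..} (\<lambda>t. c *\<^sub>R ?h v t)"
      by (rule Henstock_Kurzweil_Integration.integral_cong)
        (simp add: blinfun.scaleR_right V_linear \<xi> lin linear_scale Eu.scale)
    then show ?thesis by (simp add: DPsi_def)
  qed
  show "norm (DPsi \<xi> v) \<le> norm v * (cu * (lipN * (Gsum * psum)))" for v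
    using DPsi_integrable(2)[OF \<xi>, of v] by (simp add: mult_ac)
qed

lemma Psi_has_derivative:
  assumes \<xi>: "\<xi> \<in> Bs M"
  shows "(Psi M \<alpha> has_derivative DPsi \<xi>) (at \<xi> within Bs M)"
proof (rule has_derivative_quadratic_remainder[OF bounded_linear_DPsi[OF \<xi>]])
  fix \<eta> assume \<eta>: "\<eta> \<in> Bs M"
  let ?d = "norm (\<eta> - \<xi>)"
  define r where "r t = on_chart \<alpha> (fl t \<eta>) - on_chart \<alpha> (fl t \<xi>) - DF (fl t \<xi>) (V \<xi> (\<eta> - \<xi>) t)" for t
  \<comment> \<open>Two sources of error, both uniform in time: the Taylor remainder of the vector
    field at the displaced flow, and the linearised field applied to the Taylor remainder of the
    flow.\<close>
  define c where "c = lipDF * (Gsum * psum)\<^sup>2 + lipN * (Ksum * psum * psum)"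
  have "Psi M \<alpha> \<eta> - Psi M \<alpha> \<xi> - DPsi \<xi> (\<eta> - \<xi>) = - integral {0..} (\<lambda>t. Eu t (r t))"
  proof -
    have "integral {0..} (\<lambda>t. Eu t (r t)) = integral {0..} (\<lambda>t. Eu t (on_chart \<alpha> (fl t \<eta>)) - Eu t (on_chart \<alpha> (fl t \<xi>))
        - Eu t (DF (fl t \<xi>) (V \<xi> (pi_s M (\<eta> - \<xi>)) t)))"
      by (rule Henstock_Kurzweil_Integration.integral_cong) (simp add: r_def Eu.diff pi_s_diff \<xi> \<eta>)
    also have "\<dots> = integral {0..} (\<lambda>t. Eu t (on_chart \<alpha> (fl t \<eta>))) - integral {0..} (\<lambda>t. Eu t (on_chart \<alpha> (fl t \<xi>)))
        - integral {0..} (\<lambda>t. Eu t (DF (fl t \<xi>) (V \<xi> (pi_s M (\<eta> - \<xi>)) t)))"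
      using integrand_integrable[OF chart \<xi>] integrand_integrable[OF chart \<eta>] DPsi_integrable(1)[OF \<xi>]
      by (simp add: Henstock_Kurzweil_Integration.integral_diff Henstock_Kurzweil_Integration.integrable_diff)
    finally show ?thesis by (simp add: Psi_eq DPsi_def)
  qed
  moreover have "norm (integral {0..} (\<lambda>t. Eu t (r t))) \<le> cu * (c * ?d\<^sup>2)"
  proof (rule Eu_integral(2))
    have c: "continuous_on {0..} (\<lambda>t. on_chart \<alpha> (fl t x))" if "x \<in> Bs M" for x
      by (rule continuous_on_compose2[OF on_chart_continuous[OF chart] fl_continuous[OF that]])
        (use fl_in_Bs that in auto)
    show "continuous_on {0..} r" unfolding r_def
      by (intro continuous_intros c \<xi> \<eta> DFV_continuous) auto
    fix t :: real assume t: "0 \<le> t"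
    have B: "fl t \<xi> \<in> Bs M" "fl t \<eta> \<in> Bs M" using fl_in_Bs \<xi> \<eta> t by auto
    let ?w = "fl t \<eta> - fl t \<xi> - V \<xi> (\<eta> - \<xi>) t"
    have eq: "r t = (on_chart \<alpha> (fl t \<eta>) - on_chart \<alpha> (fl t \<xi>) - DF (fl t \<xi>) (fl t \<eta> - fl t \<xi>)) + DF (fl t \<xi>) ?w"
      unfolding r_def using bounded_linear.linear[OF bounded_linear_DF[OF B(1)]] by (simp add: linear_diff)
    have "norm (r t) \<le> lipDF * (norm (fl t \<eta> - fl t \<xi>))\<^sup>2 + lipN * norm ?w"
      unfolding eq by (intro order_trans[OF norm_triangle_ineq] add_mono on_chart_taylor norm_DF_le B)
    also have "\<dots> \<le> lipDF * (Gsum * psum * ?d)\<^sup>2 + lipN * (Ksum * psum * psum * ?d\<^sup>2)"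
      by (intro add_mono mult_left_mono power_mono norm_fl_diff_le flow_taylor \<xi> \<eta> t lipDF_nonneg lipN_nonneg) auto
    also have "\<dots> = c * ?d\<^sup>2" by (simp add: c_def power_mult_distrib algebra_simps)
    finally show "norm (r t) \<le> c * ?d\<^sup>2" .
  qed
  ultimately show "norm (Psi M \<alpha> \<eta> - Psi M \<alpha> \<xi> - DPsi \<xi> (\<eta> - \<xi>)) \<le> (cu * c) * ?d\<^sup>2"
    by (simp add: mult.assoc)
qed

section \<open>The Lipschitz constant of the derivative\<close>

abbreviation Pt' :: "nat \<Rightarrow> nat \<Rightarrow> nat \<Rightarrow> real" where "Pt' \<equiv> Ptilde M Nboot Pbar Nmu \<mu> K"

text \<open>The bound at time \<open>t\<close> for the \<open>j'\<close> component of the integrand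
  of \<open>DPsi\<close>: the effect of a change in coordinate \<open>l\<close> on the partial
  derivative in coordinate \<open>i\<close>. Its integral over the half-line is
  \<open>Ptilde\<close>.\<close>

definition pt_integrand :: "nat \<Rightarrow> nat \<Rightarrow> nat \<Rightarrow> real \<Rightarrow> real" where
  "pt_integrand j' i l t = exp (- rate M (Ust j') * t) *
     ((\<Sum>n\<in>IS M. \<Sum>m\<in>IS M. Sc M Pbar (Ust j') n m * (gr n i t * gr m l t))
       + (\<Sum>n\<in>IS M. Hc M (Ust j') n * kr n i l t))"

text \<open>Expanding the exponential sums gives single exponentials with exponents
  \<open>gam M k1 + gam M k2 - ?r\<close> and \<open>\<mu> k - ?r\<close>, all negative; integrating
  each yields one of the inverse factors in \<open>Ptilde\<close>.\<close>

lemma pt_has_integral: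
  assumes j': "j' \<in> IU M"
  shows "(pt_integrand j' i l has_integral Pt' j' i l) {0..}"
proof -
  let ?r = "rate M (Ust j')"
  have g: "((\<lambda>t. \<Sum>k1=0..mS M. \<Sum>k2=0..mS M. \<Sum>n\<in>IS M. \<Sum>m\<in>IS M.
        exp ((gam M k1 + gam M k2 - ?r) * t) * (Sc M Pbar (Ust j') n m * G_boot M Nboot m k1 l * G_boot M Nboot n k2 i))
      has_integral (\<Sum>k1=0..mS M. \<Sum>k2=0..mS M. \<Sum>n\<in>IS M. \<Sum>m\<in>IS M.
        inverse (- (gam M k1 + gam M k2 - ?r)) * (Sc M Pbar (Ust j') n m * G_boot M Nboot m k1 l * G_boot M Nboot n k2 i))) {0..}"
    (is "(?g has_integral ?G) _")
  proof (intro has_integral_sum has_integral_exp_Ici finite_atLeastAtMost finite_index)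
    fix k1 k2 assume "k1 \<in> {0..mS M}" "k2 \<in> {0..mS M}"
    then have "gam M k1 < 0" "gam M k2 < 0" using gam_neg by auto
    then show "gam M k1 + gam M k2 - ?r < 0" using rate_sign(2)[OF j'] by linarith
  qed
  have h: "((\<lambda>t. \<Sum>k=1..Nmu. \<Sum>n\<in>IS M. exp ((\<mu> k - ?r) * t) * (Hc M (Ust j') n * K n k i l))
      has_integral (\<Sum>k=1..Nmu. \<Sum>n\<in>IS M. inverse (- (\<mu> k - ?r)) * (Hc M (Ust j') n * K n k i l))) {0..}"
    (is "(?h has_integral ?H) _")
  proof (intro has_integral_sum has_integral_exp_Ici finite_atLeastAtMost finite_index)
    fix k assume "k \<in> {1..Nmu}"
    then have "\<mu> k < 0" by (rule mu_neg)
    then show "\<mu> k - ?r < 0" using rate_sign(2)[OF j'] by linarith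
  qed
  have "?g t + ?h t = pt_integrand j' i l t" for t
  proof -
    have "?g t = (\<Sum>n\<in>IS M. \<Sum>m\<in>IS M. \<Sum>k1=0..mS M. \<Sum>k2=0..mS M.
        exp ((gam M k1 + gam M k2 - ?r) * t) * (Sc M Pbar (Ust j') n m * G_boot M Nboot m k1 l * G_boot M Nboot n k2 i))"
      by (rule sum_swap4)
    also have "\<dots> = (\<Sum>n\<in>IS M. \<Sum>m\<in>IS M. exp (- ?r * t) * (Sc M Pbar (Ust j') n m * (gr n i t * gr m l t)))"
    proof (intro sum.cong refl)
      fix n m
      have "exp (- ?r * t) * (Sc M Pbar (Ust j') n m * (gr m l t * gr n i t))
          = (\<Sum>k1=0..mS M. \<Sum>k2=0..mS M. exp (- ?r * t) * (Sc M Pbar (Ust j') n m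
              * ((exp (gam M k1 * t) * G_boot M Nboot m k1 l) * (exp (gam M k2 * t) * G_boot M Nboot n k2 i))))"
        unfolding gr_def exp_combination_def sum_product by (simp only: sum_distrib_left)
      also have "\<dots> = (\<Sum>k1=0..mS M. \<Sum>k2=0..mS M.
          exp ((gam M k1 + gam M k2 - ?r) * t) * (Sc M Pbar (Ust j') n m * G_boot M Nboot m k1 l * G_boot M Nboot n k2 i))"
      proof (intro sum.cong refl)
        fix k1 k2
        have "exp ((gam M k1 + gam M k2 - ?r) * t) = exp (- ?r * t) * exp (gam M k1 * t) * exp (gam M k2 * t)"
          by (simp add: exp_add[symmetric] algebra_simps)
        then show "exp (- ?r * t) * (Sc M Pbar (Ust j') n m
              * ((exp (gam M k1 * t) * G_boot M Nboot m k1 l) * (exp (gam M k2 * t) * G_boot M Nboot n k2 i)))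
            = exp ((gam M k1 + gam M k2 - ?r) * t) * (Sc M Pbar (Ust j') n m * G_boot M Nboot m k1 l * G_boot M Nboot n k2 i)"
          by (simp only: mult_ac)
      qed
      finally show "(\<Sum>k1=0..mS M. \<Sum>k2=0..mS M.
          exp ((gam M k1 + gam M k2 - ?r) * t) * (Sc M Pbar (Ust j') n m * G_boot M Nboot m k1 l * G_boot M Nboot n k2 i))
          = exp (- ?r * t) * (Sc M Pbar (Ust j') n m * (gr n i t * gr m l t))"
        by (simp only: mult.commute[of "gr m l t"])
    qed
    also have "\<dots> = exp (- ?r * t) * (\<Sum>n\<in>IS M. \<Sum>m\<in>IS M. Sc M Pbar (Ust j') n m * (gr n i t * gr m l t))"
      by (simp only: sum_distrib_left)
    finally have 1: "?g t = exp (- ?r * t) * (\<Sum>n\<in>IS M. \<Sum>m\<in>IS M. Sc M Pbar (Ust j') n m * (gr n i t * gr m l t))" .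
    have "?h t = (\<Sum>n\<in>IS M. \<Sum>k=1..Nmu. exp ((\<mu> k - ?r) * t) * (Hc M (Ust j') n * K n k i l))"
      by (rule sum.swap)
    also have "\<dots> = (\<Sum>n\<in>IS M. exp (- ?r * t) * (Hc M (Ust j') n * kr n i l t))"
      unfolding kr_def sum_distrib_left
      by (intro sum.cong refl) (simp add: exp_add[symmetric] algebra_simps exp_diff exp_minus divide_inverse)
    also have "\<dots> = exp (- ?r * t) * (\<Sum>n\<in>IS M. Hc M (Ust j') n * kr n i l t)"
      by (simp only: sum_distrib_left)
    finally show ?thesis using 1 by (simp only: pt_integrand_def distrib_left)
  qed
  moreover have "?G + ?H = Pt' j' i l"
    unfolding Ptilde_def by (intro arg_cong2[of _ _ _ _ "(+)"] sum.cong refl) (simp_all add: algebra_simps)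
  ultimately show ?thesis using has_integral_add[OF g h] by (simp only: fun_eq_iff[symmetric] eta_contract_eq)
qed

lemma DPsi_diff_coord:
  assumes \<eta>: "\<eta> \<in> Bs M" and \<xi>: "\<xi> \<in> Bs M" and j': "j' \<in> IU M" and i: "i \<in> IS M" and v: "v \<in> Xi M (St i)"
  shows "norm (pu j' (DPsi \<eta> v - DPsi \<xi> v)) \<le> (\<Sum>l\<in>IS M. Pt' j' i l * norm (ps l (\<eta> - \<xi>))) * norm v"
proof -
  let ?d = "\<lambda>l. norm (ps l (\<eta> - \<xi>))"
  have vX: "pi_s M v = v" using v Xi_sub(1)[OF i] mem_Xs by blast
  define a where "a x t = DF (fl t x) (V x v t)" for x t
  have ac: "continuous_on {0..} (a x)" if "x \<in> Bs M" for x
    unfolding a_def[abs_def] by (rule DFV_continuous[OF that]) simp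
  have ai: "(\<lambda>t. Eu t (a x t)) integrable_on {0..}" if "x \<in> Bs M" for x
    using DPsi_integrable(1)[OF that, of v] by (simp add: a_def vX)
  \<comment> \<open>The order of \<open>\<xi>\<close> and \<open>\<eta>\<close> is reversed in order
    to absorb the minus sign in \<open>DPsi\<close>.\<close>
  let ?f = "\<lambda>t. pu j' (Eu t (a \<xi> t - a \<eta> t))"
  have eq: "pu j' (DPsi \<eta> v - DPsi \<xi> v) = integral {0..} ?f"
  proof -
    have "integral {0..} ?f = integral {0..} (\<lambda>t. pu j' (Eu t (a \<xi> t) - Eu t (a \<eta> t)))"
      by (rule Henstock_Kurzweil_Integration.integral_cong) (simp add: Eu.diff)
    also have "\<dots> = pu j' (integral {0..} (\<lambda>t. Eu t (a \<xi> t) - Eu t (a \<eta> t)))"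
      by (rule Henstock_Kurzweil_Integration.integral_linear[OF _ blinfun.bounded_linear_right, unfolded o_def])
        (intro Henstock_Kurzweil_Integration.integrable_diff ai \<xi> \<eta>)
    also have "integral {0..} (\<lambda>t. Eu t (a \<xi> t) - Eu t (a \<eta> t)) = DPsi \<eta> v - DPsi \<xi> v"
      using ai \<xi> \<eta> by (simp add: DPsi_def vX a_def Henstock_Kurzweil_Integration.integral_diff)
    finally show ?thesis by simp
  qed
  have bound: "norm (?f t) \<le> (\<Sum>l\<in>IS M. pt_integrand j' i l t * ?d l) * norm v" if t: "0 \<le> t" for t
  proof -
    have B: "fl t \<xi> \<in> Bs M" "fl t \<eta> \<in> Bs M" using fl_in_Bs \<xi> \<eta> t by auto
    have lin: "linear (DF (fl t \<xi>))" by (rule bounded_linear.linear[OF bounded_linear_DF[OF B(1)]])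
    \<comment> \<open>Product rule for differences: the first term pairs \<open>Sc\<close> with the
      derivative of the flow and the displacement of the flow, giving two factors \<open>gr\<close>;
      the second pairs \<open>Hc\<close> with the Lipschitz bound \<open>kr\<close> of the
      derivative of the flow.\<close>
    have split: "a \<eta> t - a \<xi> t = (DF (fl t \<eta>) (V \<eta> v t) - DF (fl t \<xi>) (V \<eta> v t)) + DF (fl t \<xi>) (V \<eta> v t - V \<xi> v t)"
      by (simp add: a_def lin linear_diff)
    have Vn: "norm (ps n (V \<eta> v t)) \<le> gr n i t * norm v" if "n \<in> IS M" for n
      by (rule V_coord[OF \<eta> t i that v])
    have F: "norm (ps m (fl t \<eta> - fl t \<xi>)) \<le> (\<Sum>l\<in>IS M. gr m l t * ?d l)" if "m \<in> IS M" for m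
      by (rule flow_bound[OF chart \<eta> \<xi> chart \<eta> chart \<xi> that t])
    have 1: "norm (pu j' (DF (fl t \<eta>) (V \<eta> v t) - DF (fl t \<xi>) (V \<eta> v t)))
        \<le> (\<Sum>n\<in>IS M. \<Sum>m\<in>IS M. Sc M Pbar (Ust j') n m * ((gr n i t * norm v) * (\<Sum>l\<in>IS M. gr m l t * ?d l)))"
    proof (rule order_trans[OF DF_diff_coord[OF B(2,1)]], goal_cases)
      case 2
      show ?case
        by (intro sum_mono mult_left_mono mult_mono Vn F Sc_nonneg Pbar_pos order_trans[OF norm_ge_zero Vn]) (use j' in auto)
    qed (use j' in simp)
    have 2: "norm (pu j' (DF (fl t \<xi>) (V \<eta> v t - V \<xi> v t)))
        \<le> (\<Sum>n\<in>IS M. Hc M (Ust j') n * ((\<Sum>l\<in>IS M. kr n i l t * ?d l) * norm v))"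
    proof (rule order_trans[OF DF_coord[OF B(1)]], goal_cases)
      case 2
      show ?case
        by (intro sum_mono mult_left_mono V_diff_coord \<xi> \<eta> t i v Hc_nonneg) (use j' in auto)
    qed (use j' in simp)
    have s1: "(\<Sum>n\<in>IS M. \<Sum>m\<in>IS M. Sc M Pbar (Ust j') n m * ((gr n i t * norm v) * (\<Sum>l\<in>IS M. gr m l t * ?d l)))
        = (\<Sum>l\<in>IS M. (\<Sum>n\<in>IS M. \<Sum>m\<in>IS M. Sc M Pbar (Ust j') n m * (gr n i t * gr m l t)) * ?d l) * norm v"
    proof -
      have "(\<Sum>n\<in>IS M. \<Sum>m\<in>IS M. Sc M Pbar (Ust j') n m * ((gr n i t * norm v) * (\<Sum>l\<in>IS M. gr m l t * ?d l)))
          = (\<Sum>n\<in>IS M. \<Sum>m\<in>IS M. \<Sum>l\<in>IS M. Sc M Pbar (Ust j') n m * (gr n i t * gr m l t) * ?d l * norm v)"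
        unfolding sum_distrib_left by (intro sum.cong refl) (simp only: mult_ac)
      also have "\<dots> = (\<Sum>n\<in>IS M. \<Sum>l\<in>IS M. \<Sum>m\<in>IS M. Sc M Pbar (Ust j') n m * (gr n i t * gr m l t) * ?d l * norm v)"
        by (intro sum.cong refl sum.swap)
      also have "\<dots> = (\<Sum>l\<in>IS M. \<Sum>n\<in>IS M. \<Sum>m\<in>IS M. Sc M Pbar (Ust j') n m * (gr n i t * gr m l t) * ?d l * norm v)"
        by (rule sum.swap)
      finally show ?thesis by (simp only: sum_distrib_right)
    qed
    have s2: "(\<Sum>n\<in>IS M. Hc M (Ust j') n * ((\<Sum>l\<in>IS M. kr n i l t * ?d l) * norm v))
        = (\<Sum>l\<in>IS M. (\<Sum>n\<in>IS M. Hc M (Ust j') n * kr n i l t) * ?d l) * norm v"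
    proof -
      have "(\<Sum>n\<in>IS M. Hc M (Ust j') n * ((\<Sum>l\<in>IS M. kr n i l t * ?d l) * norm v))
          = (\<Sum>n\<in>IS M. \<Sum>l\<in>IS M. Hc M (Ust j') n * kr n i l t * ?d l * norm v)"
        unfolding sum_distrib_left sum_distrib_right by (intro sum.cong refl) (simp only: mult_ac)
      also have "\<dots> = (\<Sum>l\<in>IS M. \<Sum>n\<in>IS M. Hc M (Ust j') n * kr n i l t * ?d l * norm v)" by (rule sum.swap)
      finally show ?thesis by (simp only: sum_distrib_right)
    qed
    have gen: "e * ((\<Sum>l\<in>IS M. A l * ?d l) * x + (\<Sum>l\<in>IS M. A' l * ?d l) * x)
        = (\<Sum>l\<in>IS M. (e * (A l + A' l)) * ?d l) * x" for e x and A A' :: "nat \<Rightarrow> real"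
    proof -
      have "(\<Sum>l\<in>IS M. (e * (A l + A' l)) * ?d l) = (\<Sum>l\<in>IS M. e * (A l * ?d l) + e * (A' l * ?d l))"
        by (intro sum.cong refl) (simp add: algebra_simps)
      then show ?thesis by (simp add: sum.distrib sum_distrib_left[symmetric] algebra_simps)
    qed
    have "norm (?f t) \<le> exp (- rate M (Ust j') * t) * norm (pu j' (a \<xi> t - a \<eta> t))" by (rule pu_Eu[OF t j'])
    also have "norm (pu j' (a \<xi> t - a \<eta> t)) = norm (pu j' (a \<eta> t - a \<xi> t))"
      by (simp only: blinfun.diff_right norm_minus_commute)
    also have "exp (- rate M (Ust j') * t) * norm (pu j' (a \<eta> t - a \<xi> t)) \<le> exp (- rate M (Ust j') * t) *
        ((\<Sum>l\<in>IS M. (\<Sum>n\<in>IS M. \<Sum>m\<in>IS M. Sc M Pbar (Ust j') n m * (gr n i t * gr m l t)) * ?d l) * norm v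
          + (\<Sum>l\<in>IS M. (\<Sum>n\<in>IS M. Hc M (Ust j') n * kr n i l t) * ?d l) * norm v)"
      unfolding split blinfun.add_right
      by (intro mult_left_mono order_trans[OF norm_triangle_ineq] add_mono 1[unfolded s1] 2[unfolded s2]) auto
    also have "\<dots> = (\<Sum>l\<in>IS M. pt_integrand j' i l t * ?d l) * norm v"
      unfolding pt_integrand_def by (rule gen)
    finally show ?thesis .
  qed
  have I: "((\<lambda>t. (\<Sum>l\<in>IS M. pt_integrand j' i l t * ?d l) * norm v) has_integral
      (\<Sum>l\<in>IS M. Pt' j' i l * ?d l) * norm v) {0..}"
    by (intro has_integral_mult_left has_integral_sum finite_index pt_has_integral j')
  have "continuous_on {0..} ?f"
    by (intro continuous_intros Eu.cont_orbit ac \<xi> \<eta>) auto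
  from integrable_on_Ici_dominated(2)[OF this I bound] show ?thesis unfolding eq .
qed

text \<open>Not implied by the estimate of \<open>DPsi\<close> when \<open>Xi M (St i)\<close> is the zero space, where the operator
  norm is \<open>0\<close>.\<close>

lemma Pt'_nonneg:
  assumes j': "j' \<in> IU M" and i: "i \<in> IS M" and l: "l \<in> IS M" and \<zeta>: "\<zeta> \<in> Xi M (St l)" "\<zeta> \<noteq> 0"
  shows "0 \<le> Pt' j' i l"
proof (rule has_integral_nonneg[OF pt_has_integral[OF j']])
  fix t :: real assume "t \<in> {0..}"
  then have t: "0 \<le> t" by simp
  have \<zeta>X: "\<zeta> \<in> Xs M" using \<zeta> Xi_sub(1)[OF l] by blast
  then have Cs: "0 \<le> Cs M" using Xs_trivial \<zeta>(2) by blast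
  obtain s where s: "s > 0" "s *\<^sub>R \<zeta> \<in> Bs M" using small_multiple_in_Bs[OF \<zeta>X] by blast
  \<comment> \<open>An operator norm is nonnegative. Comparing the base points
    \<open>s *\<^sub>R \<zeta>\<close> and 0, which differ in coordinate \<open>l\<close> only,
    isolates the single term \<open>kr n i l t\<close> in \<open>K_bound\<close>.\<close>
  have kr: "0 \<le> kr n i l t" if n: "n \<in> IS M" for n
  proof -
    have "0 \<le> op_norm_on (Xi M (St i)) (\<lambda>v. DBs M (\<lambda>\<xi>. ps n (fl t \<xi>)) (s *\<^sub>R \<zeta>) v - DBs M (\<lambda>\<xi>. ps n (fl t \<xi>)) 0 v)"
      unfolding op_norm_on_def
      by (rule SUP_upper2[of 0]) (use subspace_0[OF subspace_X(3)] in \<open>auto simp: zero_ereal_def\<close>)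
    also have "\<dots> \<le> ereal (\<Sum>k=1..Nmu. \<Sum>l\<in>IS M. exp (\<mu> k * t) * K n k i l * norm (ps l (s *\<^sub>R \<zeta> - 0)))"
      by (rule K_bound[OF t s(2) zero_Bs i n])
    finally have "0 \<le> (\<Sum>m\<in>IS M. kr n i m t * norm (ps m (s *\<^sub>R \<zeta> - 0)))"
      unfolding K_sum_eq by simp
    also have "\<dots> = (\<Sum>m\<in>IS M. if m = l then kr n i l t * (s * norm \<zeta>) else 0)"
    proof (rule sum.cong[OF refl])
      fix m assume m: "m \<in> IS M"
      have "ps l \<zeta> = \<zeta>" using \<zeta> l by (simp add: mem_Xi)
      then have "ps m \<zeta> = (if m = l then \<zeta> else 0)" using proj_proj[of "St m" "St l" \<zeta>] m l by auto
      then show "kr n i m t * norm (ps m (s *\<^sub>R \<zeta> - 0)) = (if m = l then kr n i l t * (s * norm \<zeta>) else 0)"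
        using s by (simp add: blinfun.scaleR_right)
    qed
    also have "\<dots> = kr n i l t * (s * norm \<zeta>)" using l by simp
    finally have "0 \<le> kr n i l t * (s * norm \<zeta>)" .
    moreover have "0 < s * norm \<zeta>" using s(1) \<zeta>(2) by simp
    ultimately show ?thesis using mult_neg_pos not_less by blast
  qed
  show "0 \<le> pt_integrand j' i l t"
    unfolding pt_integrand_def
    by (intro mult_nonneg_nonneg add_nonneg_nonneg sum_nonneg Sc_nonneg Pbar_pos gr_nonneg[OF Cs] Hc_nonneg kr)
      (use j' i l t in auto)
qed

lemma DBs_Psi: "\<xi> \<in> Bs M \<Longrightarrow> v \<in> Xs M \<Longrightarrow> DBs M (Psi M \<alpha>) \<xi> v = DPsi \<xi> v"
  by (rule DBs_eq[OF Psi_has_derivative])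

text \<open>The increment moves coordinate \<open>l\<close> alone, so a single term of the sum in
  \<open>DPsi_diff_coord\<close> survives.\<close>

lemma LipD_Psi_le:
  assumes i: "i \<in> IS M" and l: "l \<in> IS M" and j': "j' \<in> IU M"
  shows "LipD M (Psi M \<alpha>) j' i l \<le> ereal (Pt' j' i l)"
  unfolding LipD_def
proof (rule SUP_least, clarify)
  fix \<xi> \<zeta> assume *: "\<xi> \<in> Bs M" "\<zeta> \<in> Xi M (St l)" "\<zeta> \<noteq> 0" "\<xi> + \<zeta> \<in> Bs M"
  let ?o = "op_norm_on (Xi M (St i)) (\<lambda>v. pu j' (DBs M (Psi M \<alpha>) (\<xi> + \<zeta>) v) - pu j' (DBs M (Psi M \<alpha>) \<xi> v))"
  have "?o \<le> ereal (Pt' j' i l * norm \<zeta>)"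
  proof (rule op_norm_onI)
    show "0 \<le> Pt' j' i l * norm \<zeta>" using Pt'_nonneg[OF j' i l *(2,3)] by simp
    fix v assume v: "v \<in> Xi M (St i)"
    then have vX: "v \<in> Xs M" using Xi_sub(1)[OF i] by blast
    have "norm (pu j' (DPsi (\<xi> + \<zeta>) v - DPsi \<xi> v)) \<le> (\<Sum>m\<in>IS M. Pt' j' i m * norm (ps m (\<xi> + \<zeta> - \<xi>))) * norm v"
      by (rule DPsi_diff_coord[OF *(4,1) j' i v])
    also have "(\<Sum>m\<in>IS M. Pt' j' i m * norm (ps m (\<xi> + \<zeta> - \<xi>))) = (\<Sum>m\<in>IS M. if m = l then Pt' j' i l * norm \<zeta> else 0)"
    proof (rule sum.cong[OF refl])
      fix m assume m: "m \<in> IS M"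
      have "ps l \<zeta> = \<zeta>" using * l by (simp add: mem_Xi)
      then have "ps m \<zeta> = (if m = l then \<zeta> else 0)" using proj_proj[of "St m" "St l" \<zeta>] m l by auto
      then show "Pt' j' i m * norm (ps m (\<xi> + \<zeta> - \<xi>)) = (if m = l then Pt' j' i l * norm \<zeta> else 0)" by simp
    qed
    also have "\<dots> = Pt' j' i l * norm \<zeta>" using l by simp
    finally show "norm (pu j' (DBs M (Psi M \<alpha>) (\<xi> + \<zeta>) v) - pu j' (DBs M (Psi M \<alpha>) \<xi> v)) \<le> Pt' j' i l * norm \<zeta> * norm v"
      using * vX by (simp add: DBs_Psi blinfun.diff_right)
  qed
  then have "?o \<le> ereal (norm \<zeta>) * ereal (Pt' j' i l)" by (simp add: mult.commute)
  then show "?o / ereal (norm \<zeta>) \<le> ereal (Pt' j' i l)" using *(3) by (subst ereal_divide_le_pos) auto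
qed

lemma DPsi_Xu:
  assumes \<xi>: "\<xi> \<in> Bs M"
  shows "DPsi \<xi> v \<in> Xu M"
proof -
  have "pi_u M (integral {0..} (\<lambda>t. Eu t (DF (fl t \<xi>) (V \<xi> (pi_s M v) t))))
      = integral {0..} (\<lambda>t. pi_u M (Eu t (DF (fl t \<xi>) (V \<xi> (pi_s M v) t))))"
    by (rule Henstock_Kurzweil_Integration.integral_linear[OF DPsi_integrable(1)[OF \<xi>] blinfun.bounded_linear_right, unfolded o_def, symmetric])
  also have "\<dots> = integral {0..} (\<lambda>t. Eu t (DF (fl t \<xi>) (V \<xi> (pi_s M v) t)))"
    by (rule Henstock_Kurzweil_Integration.integral_cong) (use Eu_in_Xu mem_Xu in auto)
  finally show ?thesis by (simp add: mem_Xu DPsi_def blinfun.minus_right)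
qed

lemma DPsi_lipschitz:
  assumes \<eta>: "\<eta> \<in> Bs M" and \<xi>: "\<xi> \<in> Bs M" and v: "v \<in> Xs M"
  shows "norm (DPsi \<eta> v - DPsi \<xi> v)
    \<le> ((\<Sum>j'\<in>IU M. \<Sum>i\<in>IS M. \<Sum>l\<in>IS M. \<bar>Pt' j' i l\<bar>) * psum * psum) * norm (\<eta> - \<xi>) * norm v"
proof -
  have "norm (DPsi \<eta> v - DPsi \<xi> v) \<le> (\<Sum>j'\<in>IU M. norm (pu j' (DPsi \<eta> v - DPsi \<xi> v)))"
    by (intro norm_Xu_le subspace_diff subspace_X DPsi_Xu \<xi> \<eta>)
  also have "\<dots> \<le> (\<Sum>j'\<in>IU M. \<Sum>i\<in>IS M. \<Sum>l\<in>IS M. \<bar>Pt' j' i l\<bar> * ((psum * norm (\<eta> - \<xi>)) * (psum * norm v)))"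
  proof (rule sum_mono)
    fix j' assume j': "j' \<in> IU M"
    have lin: "DPsi x v = (\<Sum>i\<in>IS M. DPsi x (ps i v))" if "x \<in> Bs M" for x
      using linear_sum[OF bounded_linear.linear[OF bounded_linear_DPsi[OF that]], of "\<lambda>i. ps i v" "IS M"] Xs_coords[OF v]
      by simp
    have "pu j' (DPsi \<eta> v - DPsi \<xi> v) = (\<Sum>i\<in>IS M. pu j' (DPsi \<eta> (ps i v) - DPsi \<xi> (ps i v)))"
      by (simp add: lin[OF \<xi>] lin[OF \<eta>] blinfun.diff_right blinfun.sum_right sum_subtractf)
    also have "norm \<dots> \<le> (\<Sum>i\<in>IS M. norm (pu j' (DPsi \<eta> (ps i v) - DPsi \<xi> (ps i v))))" by (rule norm_sum)
    also have "\<dots> \<le> (\<Sum>i\<in>IS M. (\<Sum>l\<in>IS M. Pt' j' i l * norm (ps l (\<eta> - \<xi>))) * norm (ps i v))"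
      by (intro sum_mono DPsi_diff_coord \<xi> \<eta> j' proj_in_Xi)
    also have "\<dots> \<le> (\<Sum>i\<in>IS M. (\<Sum>l\<in>IS M. \<bar>Pt' j' i l\<bar> * (psum * norm (\<eta> - \<xi>))) * (psum * norm v))"
      by (intro sum_mono mult_mono norm_coord_le sum_nonneg mult_nonneg_nonneg psum_nonneg) auto
    also have "\<dots> = (\<Sum>i\<in>IS M. \<Sum>l\<in>IS M. \<bar>Pt' j' i l\<bar> * ((psum * norm (\<eta> - \<xi>)) * (psum * norm v)))"
      unfolding sum_distrib_right by (simp only: mult.assoc)
    finally show "norm (pu j' (DPsi \<eta> v - DPsi \<xi> v)) \<le> \<dots>" .
  qed
  also have "\<dots> = (\<Sum>j'\<in>IU M. \<Sum>i\<in>IS M. \<Sum>l\<in>IS M. \<bar>Pt' j' i l\<bar>) * ((psum * norm (\<eta> - \<xi>)) * (psum * norm v))"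
    by (simp only: sum_distrib_right)
  finally show ?thesis by (simp add: mult_ac)
qed

lemma Psi_differentiable: "\<xi> \<in> Bs M \<Longrightarrow> Psi M \<alpha> differentiable (at \<xi> within Bs M)"
  using Psi_has_derivative differentiable_def by blast

lemma Psi_B11:
  assumes le: "\<And>i l j'. i \<in> IS M \<Longrightarrow> l \<in> IS M \<Longrightarrow> j' \<in> IU M \<Longrightarrow> Pt' j' i l \<le> Pbar j' i l"
  shows "Psi M \<alpha> \<in> B11 M Pbar"
proof -
  \<comment> \<open>The conditions on the values of \<open>Psi M \<alpha>\<close> come from the
    standing assumption that \<open>Psi\<close> preserves \<open>B01 M\<close>; only those on its
    derivative are new.\<close>
  have "chart (Psi M \<alpha>)" using chart chart_iff_B01 Psi_B01 by blast
  moreover have "LipD M (Psi M \<alpha>) j' i l \<le> ereal (Pbar j' i l)" if "i \<in> IS M" "l \<in> IS M" "j' \<in> IU M" for i l j'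
    by (rule order_trans[OF LipD_Psi_le[OF that]]) (use le that in simp)
  moreover have "\<exists>L\<ge>0. \<forall>\<xi>\<in>Bs M. \<forall>\<eta>\<in>Bs M.
      op_norm_on (Xs M) (\<lambda>v. DBs M (Psi M \<alpha>) \<xi> v - DBs M (Psi M \<alpha>) \<eta> v) \<le> ereal (L * norm (\<xi> - \<eta>))"
  proof (intro exI conjI ballI)
    show L0: "0 \<le> (\<Sum>j'\<in>IU M. \<Sum>i\<in>IS M. \<Sum>l\<in>IS M. \<bar>Pt' j' i l\<bar>) * psum * psum"
      by (intro mult_nonneg_nonneg sum_nonneg psum_nonneg) auto
    fix \<xi> \<eta> assume "\<xi> \<in> Bs M" "\<eta> \<in> Bs M"
    then show "op_norm_on (Xs M) (\<lambda>v. DBs M (Psi M \<alpha>) \<xi> v - DBs M (Psi M \<alpha>) \<eta> v)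
        \<le> ereal ((\<Sum>j'\<in>IU M. \<Sum>i\<in>IS M. \<Sum>l\<in>IS M. \<bar>Pt' j' i l\<bar>) * psum * psum * norm (\<xi> - \<eta>))"
      using DPsi_lipschitz L0 by (intro op_norm_onI) (auto simp: DBs_Psi)
  qed
  ultimately show ?thesis
    unfolding B11_def chart_def using Psi_differentiable by simp
qed

end

theorem theorem4p11:
  fixes M :: "'a::banach lp_data"
    and Nboot Nmu :: nat
    and \<mu> :: "nat \<Rightarrow> real"
    and Pbar :: "nat \<Rightarrow> nat \<Rightarrow> nat \<Rightarrow> real"
    and K :: "nat \<Rightarrow> nat \<Rightarrow> nat \<Rightarrow> nat \<Rightarrow> real"
  assumes setting: "lyapunov_perron_setting M Nboot"
    and Pbar_pos: "\<And>i' i j. i' \<in> IU M \<Longrightarrow> i \<in> IS M \<Longrightarrow> j \<in> IS M \<Longrightarrow> 0 < Pbar i' i j"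
    and mu: "\<mu> ` {1..Nmu} = gam M ` {0..mS M} \<union> {gam M k1 + gam M k2 | k1 k2. k1 \<le> mS M \<and> k2 \<le> mS M}"
    and K_bound: "\<And>t \<alpha> \<eta> \<zeta> i j. 0 \<le> t \<Longrightarrow> \<alpha> \<in> B11 M Pbar \<Longrightarrow> \<eta> \<in> Bs M \<Longrightarrow> \<zeta> \<in> Bs M \<Longrightarrow>
          i \<in> IS M \<Longrightarrow> j \<in> IS M \<Longrightarrow>
          op_norm_on (Xi M (St i))
            (\<lambda>v. DBs M (\<lambda>\<xi>. proj M (St j) (flow M t \<xi> \<alpha>)) \<eta> v
               - DBs M (\<lambda>\<xi>. proj M (St j) (flow M t \<xi> \<alpha>)) \<zeta> v)
          \<le> ereal (\<Sum>k=1..Nmu. \<Sum>l\<in>IS M. exp (\<mu> k * t) * K j k i l * norm (proj M (St l) (\<eta> - \<zeta>)))"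
  shows "(\<forall>\<alpha>\<in>B11 M Pbar.
            (\<forall>\<xi>\<in>Bs M. Psi M \<alpha> differentiable (at \<xi> within Bs M)) \<and>
            (\<forall>i\<in>IS M. \<forall>l\<in>IS M. \<forall>j'\<in>IU M.
               LipD M (Psi M \<alpha>) j' i l \<le> ereal (Ptilde M Nboot Pbar Nmu \<mu> K j' i l))) \<and>
         ((\<forall>i\<in>IS M. \<forall>l\<in>IS M. \<forall>j'\<in>IU M. Ptilde M Nboot Pbar Nmu \<mu> K j' i l \<le> Pbar j' i l) \<longrightarrow>
            (\<forall>\<alpha>\<in>B11 M Pbar. Psi_well_defined M \<alpha> \<and> Psi M \<alpha> \<in> B11 M Pbar))"
proof -
  have vb: "variation_bound M Nboot \<alpha> Pbar Nmu \<mu> K" if "\<alpha> \<in> B11 M Pbar" for \<alpha>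
    by (intro variation_bound.intro smooth_chart.intro smooth_chart_axioms.intro variation_bound_axioms.intro
        setting Pbar_pos mu K_bound that)
  show ?thesis
    using variation_bound.Psi_differentiable[OF vb] variation_bound.LipD_Psi_le[OF vb]
      variation_bound.Psi_B11[OF vb]
      lyapunov_perron_setting.Psi_well_definedI[OF setting lyapunov_perron_setting.chart_B11[OF setting]]
    by blast
qed

end
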